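(* Let $\rho>1$, $R>0$, $p>1$, $q>1$, $s>1/p$. Suppose the random filter $Y$ satisfies the following condition (condition $C_{up}$): $Y_l\neq0$ almost surely for all $l\in\mathbb{Z}$, and there exist $\nu\ge0$, $c>0$, $\alpha>0$ and a constant $C>0$ such that for all $j\in\mathbb{N}$ and all $t\ge0$, $$P\big(U^Y_j\ge t\,2^{2\nu j}\big)\le C e^{-ct^\alpha},\qquad U^Y_j=\frac1{2^j}\sum_{l=0}^{2^{j+1}-1}|Y_l|^{-2}.$$ Set $\epsilon=\frac{2s+2\nu+1}{\rho}-\frac{2\nu+1}{p}$ and let $R_n$ be the minimax $L^\rho$-risk over $M(s,p,q,R)$ defined in the context. Then there exists a constant $C_0>0$, independent of $n$, such that for all integers $n\ge2$: (i) if $\epsilon>0$ (regular case), $$R_n\le C_0\left(\frac1n\right)^{\frac{s}{2s+2\nu+1}};$$ (ii) if $\epsilon<0$ (sparse case), $$R_n\le C_0\left(\frac{\log n}{n}\right)^{\frac{s-1/p+1/\rho}{2s+2\nu+1-2/p}};$$ (iii) if $\epsilon=0$ (critical case), $$R_n\le C_0\left(\frac{\log n}{n}\right)^{\frac{s-1/p+1/\rho}{2s+2\nu+1-2/p}}(\log n)^{\left(1-\frac{p}{\rho q}\right)_+},$$ where $x_+=\max(x,0)$.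
   Context: Model. Let $W$ be a standard Wiener process on a probability space, and let $Y$ be a real random process on $[0,1]$ with values in $L^2([0,1])$, independent of $W$, whose distribution depends neither on $n$ nor on $f$. For $n\in\mathbb{N}^*$ one observes $(X_n(t),Y(t))_{t\in[0,1]}$ with $$dX_n(t)=(f\star Y)(t)\,dt+\sigma n^{-1/2}\,dW(t),\quad t\in[0,1],\qquad X_n(0)=x_0,$$ where $f\star Y(t)=\int_0^1 f(t-s)Y(s)\,ds$, $f:\mathbb{R}\to\mathbb{R}$ is an unknown $1$-periodic function, $x_0$ is deterministic and $\sigma>0$ is a known constant. $E_f$ denotes expectation when the target is $f$. $Y_l=\int_0^1 Y(t)e^{-2\pi i l t}dt$, $l\in\mathbb{Z}$, are the Fourier coefficients of $Y$. Function classes. $L^\rho([0,1])$ is the space of $1$-periodic $f:\mathbb{R}\to\mathbb{R}$ with $\|f\|_\rho=(\int_0^1|f|^\rho)^{1/\rho}<\infty$. Let $\varphi,\psi$ be the Meyer scaling function and Meyer wavelet, $\varphi_{j,k}(x)=2^{j/2}\varphi(2^jx-k)$, $\psi_{j,k}(x)=2^{j/2}\psi(2^jx-k)$, with periodizations $\Phi_{j,k}(x)=\sum_{l\in\mathbb{Z}}\varphi_{j,k}(x+l)$, $\Psi_{j,k}(x)=\sum_{l\in\mathbb{Z}}\psi_{j,k}(x+l)$ for $j\ge0$. Put $R_j=\{0,\dots,2^j-1\}$ for $j\ge 0$, $R_{-1}=\{0\}$, and $\Psi_{-1,0}=\Phi_{0,0}$. For $f\in L^p([0,1])$ let $\beta_{j,k}=\int_0^1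 f\Psi_{j,k}$ ($j\ge-1$, $k\in R_j$) and $$\|f\|_{s,p,q}=\Big(\sum_{j\ge -1}2^{j(s+1/2-1/p)q}\Big(\sum_{k\in R_j}|\beta_{j,k}|^p\Big)^{q/p}\Big)^{1/q}.$$ The periodic Besov space $B^s_{p,q}([0,1])$ is $\{f\in L^p([0,1]):\|f\|_{s,p,q}<\infty\}$, and $M(s,p,q,R)=\{f\in B^s_{p,q}([0,1]):\|f\|_{s,p,q}\le R\}$. For $s>1/p$ its elements are continuous (identify $f$ with its continuous representative). Minimax risk. $R_n=\inf_{\hat f_n}\sup_{f\in M(s,p,q,R)}E_f(\|\hat f_n-f\|_\rho)$, where the infimum is over all estimators measurable with respect to $\sigma((X_n(t),Y(t))_{t\in[0,1]})$. *)

theory Defs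
  imports "HOL-Probability.Probability"
begin

text \<open>The norm takes values in \<open>[0, \<infinity>]\<close>; it is infinite outside the space, so that no default
  value of the Bochner integral can make a loss artificially small.\<close>

definition Lnorm :: "real \<Rightarrow> (real \<Rightarrow> real) \<Rightarrow> ennreal" where
  "Lnorm \<rho> f =
     (if set_integrable lborel {0..1} (\<lambda>x. \<bar>f x\<bar> powr \<rho>)
      then ennreal ((LBINT x:{0..1}. \<bar>f x\<bar> powr \<rho>) powr (1 / \<rho>))
      else \<infinity>)"

definition Lper :: "real \<Rightarrow> (real \<Rightarrow> real) set" where
  "Lper \<rho> = {f. f \<in> borel_measurable borel \<and> (\<forall>x. f (x + 1) = f x) \<and> Lnorm \<rho> f < \<infinity>}"

text \<open>A Meyer pair is determined by a smooth transition function \<open>h\<close> from \<open>0\<close> to \<open>1\<close>.\<close>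

definition meyer_aux :: "(real \<Rightarrow> real) \<Rightarrow> bool" where
  "meyer_aux h \<longleftrightarrow>
     (\<forall>k x. (deriv ^^ k) h differentiable (at x)) \<and>
     (\<forall>x\<le>0. h x = 0) \<and> (\<forall>x\<ge>1. h x = 1) \<and>
     (\<forall>x. 0 \<le> h x \<and> h x \<le> 1) \<and>
     (\<forall>x. h x + h (1 - x) = 1)"

definition meyer_scaling_ft :: "(real \<Rightarrow> real) \<Rightarrow> real \<Rightarrow> complex" where
  "meyer_scaling_ft h \<xi> =
     (if \<bar>\<xi>\<bar> \<le> 2 * pi / 3 then 1
      else if \<bar>\<xi>\<bar> \<le> 4 * pi / 3 then of_real (cos (pi / 2 * h (3 * \<bar>\<xi>\<bar> / (2 * pi) - 1)))
      else 0)"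

definition meyer_wavelet_ft :: "(real \<Rightarrow> real) \<Rightarrow> real \<Rightarrow> complex" where
  "meyer_wavelet_ft h \<xi> =
     (if \<bar>\<xi>\<bar> < 2 * pi / 3 then 0
      else if \<bar>\<xi>\<bar> \<le> 4 * pi / 3
        then exp (\<i> * of_real \<xi> / 2) * of_real (sin (pi / 2 * h (3 * \<bar>\<xi>\<bar> / (2 * pi) - 1)))
      else if \<bar>\<xi>\<bar> \<le> 8 * pi / 3
        then exp (\<i> * of_real \<xi> / 2) * of_real (cos (pi / 2 * h (3 * \<bar>\<xi>\<bar> / (4 * pi) - 1)))
      else 0)"

text \<open>Inverse Fourier transform. For the two functions above the integral is already real, because
  they are Hermitian (\<open>F (- \<xi>) = cnj (F \<xi>)\<close>); taking the real part only adjusts the type.\<close>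

definition inv_fourier :: "(real \<Rightarrow> complex) \<Rightarrow> real \<Rightarrow> real" where
  "inv_fourier F x =
     Re (1 / (2 * of_real pi) * (LINT \<xi>|lborel. F \<xi> * exp (\<i> * of_real \<xi> * of_real x)))"

definition meyer_scaling :: "(real \<Rightarrow> real) \<Rightarrow> real \<Rightarrow> real" where
  "meyer_scaling h = inv_fourier (meyer_scaling_ft h)"

definition meyer_wavelet :: "(real \<Rightarrow> real) \<Rightarrow> real \<Rightarrow> real" where
  "meyer_wavelet h = inv_fourier (meyer_wavelet_ft h)"

definition dilate :: "(real \<Rightarrow> real) \<Rightarrow> nat \<Rightarrow> nat \<Rightarrow> real \<Rightarrow> real" where
  "dilate g j k x = 2 powr (real j / 2) * g (2 ^ j * x - real k)"

definition periodize :: "(real \<Rightarrow> real) \<Rightarrow> real \<Rightarrow> real" where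
  "periodize g x = (\<Sum>\<^sub>\<infinity>l::int. g (x + of_int l))"

definition per_wavelet :: "(real \<Rightarrow> real) \<Rightarrow> int \<Rightarrow> nat \<Rightarrow> real \<Rightarrow> real" where
  "per_wavelet h j k =
     (if j = -1 then periodize (dilate (meyer_scaling h) 0 0)
      else periodize (dilate (meyer_wavelet h) (nat j) k))"

definition wavelet_index :: "int \<Rightarrow> nat set" where
  "wavelet_index j = (if j = -1 then {0} else {0..<2 ^ nat j})"

definition wavelet_coeff :: "(real \<Rightarrow> real) \<Rightarrow> (real \<Rightarrow> real) \<Rightarrow> int \<Rightarrow> nat \<Rightarrow> real" where
  "wavelet_coeff h f j k = (LBINT x:{0..1}. f x * per_wavelet h j k x)"

definition besov_term ::
    "(real \<Rightarrow> real) \<Rightarrow> real \<Rightarrow> real \<Rightarrow> real \<Rightarrow> (real \<Rightarrow> real) \<Rightarrow> int \<Rightarrow> real" where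
  "besov_term h s p q f j =
     2 powr (of_int j * (s + 1 / 2 - 1 / p) * q) *
     (\<Sum>k\<in>wavelet_index j. \<bar>wavelet_coeff h f j k\<bar> powr p) powr (q / p)"

text \<open>The real-valued norm is meaningful only if the series converges, so membership in the space
  records convergence explicitly.\<close>

definition besov_norm ::
    "(real \<Rightarrow> real) \<Rightarrow> real \<Rightarrow> real \<Rightarrow> real \<Rightarrow> (real \<Rightarrow> real) \<Rightarrow> real" where
  "besov_norm h s p q f = (\<Sum>\<^sub>\<infinity>j\<in>{-1..}. besov_term h s p q f j) powr (1 / q)"

definition besov_space ::
    "(real \<Rightarrow> real) \<Rightarrow> real \<Rightarrow> real \<Rightarrow> real \<Rightarrow> (real \<Rightarrow> real) set" where
  "besov_space h s p q = {f \<in> Lper p. besov_term h s p q f summable_on {-1..}}"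

definition besov_ball ::
    "(real \<Rightarrow> real) \<Rightarrow> real \<Rightarrow> real \<Rightarrow> real \<Rightarrow> real \<Rightarrow> (real \<Rightarrow> real) set" where
  "besov_ball h s p q R = {f \<in> besov_space h s p q. besov_norm h s p q f \<le> R}"

definition wiener_process :: "'a measure \<Rightarrow> (real \<Rightarrow> 'a \<Rightarrow> real) \<Rightarrow> bool" where
  "wiener_process M W \<longleftrightarrow>
     prob_space M \<and>
     (\<forall>t\<ge>0. W t \<in> borel_measurable M) \<and>
     (AE \<omega> in M. W 0 \<omega> = 0) \<and>
     (AE \<omega> in M. continuous_on {0..} (\<lambda>t. W t \<omega>)) \<and>
     (\<forall>u v. 0 \<le> u \<and> u < v \<longrightarrow>
        distributed M lborel (\<lambda>\<omega>. W v \<omega> - W u \<omega>) (normal_density 0 (sqrt (v - u)))) \<and>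
     (\<forall>(m::nat) \<tau>. 0 \<le> \<tau> 0 \<and> (\<forall>i<m. \<tau> i < \<tau> (Suc i)) \<longrightarrow>
        prob_space.indep_vars M (\<lambda>_. borel) (\<lambda>i \<omega>. W (\<tau> (Suc i)) \<omega> - W (\<tau> i) \<omega>) {..<m})"

definition L2_process :: "'a measure \<Rightarrow> (real \<Rightarrow> 'a \<Rightarrow> real) \<Rightarrow> bool" where
  "L2_process M Y \<longleftrightarrow>
     (\<lambda>(\<omega>, t). Y t \<omega>) \<in> borel_measurable (M \<Otimes>\<^sub>M restrict_space borel {0..1}) \<and>
     (\<forall>\<omega>\<in>space M. set_integrable lborel {0..1} (\<lambda>t. (Y t \<omega>)\<^sup>2))"

definition indep_processes ::
    "'a measure \<Rightarrow> (real \<Rightarrow> 'a \<Rightarrow> real) \<Rightarrow> (real \<Rightarrow> 'a \<Rightarrow> real) \<Rightarrow> bool" where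
  "indep_processes M W Y \<longleftrightarrow>
     prob_space.indep_var M
       (Pi\<^sub>M {0..} (\<lambda>_. borel)) (\<lambda>\<omega>. \<lambda>t\<in>{0..}. W t \<omega>)
       (Pi\<^sub>M {0..1} (\<lambda>_. borel)) (\<lambda>\<omega>. \<lambda>t\<in>{0..1}. Y t \<omega>)"

definition conv01 :: "(real \<Rightarrow> real) \<Rightarrow> (real \<Rightarrow> real) \<Rightarrow> real \<Rightarrow> real" where
  "conv01 f y t = (LBINT u:{0..1}. f (t - u) * y u)"

definition obs_X ::
    "(real \<Rightarrow> 'a \<Rightarrow> real) \<Rightarrow> (real \<Rightarrow> 'a \<Rightarrow> real) \<Rightarrow> real \<Rightarrow> real \<Rightarrow> nat \<Rightarrow> (real \<Rightarrow> real) \<Rightarrow>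
     real \<Rightarrow> 'a \<Rightarrow> real" where
  "obs_X W Y x0 \<sigma> n f t \<omega> =
     x0 + (LBINT u:{0..t}. conv01 f (\<lambda>v. Y v \<omega>) u) + \<sigma> * real n powr (-1/2) * W t \<omega>"

definition obs_path ::
    "(real \<Rightarrow> 'a \<Rightarrow> real) \<Rightarrow> (real \<Rightarrow> 'a \<Rightarrow> real) \<Rightarrow> real \<Rightarrow> real \<Rightarrow> nat \<Rightarrow> (real \<Rightarrow> real) \<Rightarrow>
     'a \<Rightarrow> real \<Rightarrow> real \<times> real" where
  "obs_path W Y x0 \<sigma> n f \<omega> = (\<lambda>t\<in>{0..1}. (obs_X W Y x0 \<sigma> n f t \<omega>, Y t \<omega>))"

text \<open>An estimator must not depend on the unknown target, whereas the observation on the underlying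
  probability space does. Estimators are therefore functions of the observed path, measurable
  for the product sigma-algebra on path space: its pullback under the observation is the
  sigma-algebra generated by the observed process.\<close>

definition estimators :: "((real \<Rightarrow> real \<times> real) \<Rightarrow> real \<Rightarrow> real) set" where
  "estimators =
     {F. (\<lambda>(z, x). F z x)
           \<in> borel_measurable (Pi\<^sub>M {0..1} (\<lambda>_. borel) \<Otimes>\<^sub>M restrict_space borel {0..1})}"

definition risk ::
    "'a measure \<Rightarrow> (real \<Rightarrow> 'a \<Rightarrow> real) \<Rightarrow> (real \<Rightarrow> 'a \<Rightarrow> real) \<Rightarrow> real \<Rightarrow> real \<Rightarrow> real \<Rightarrow> nat \<Rightarrow>
     ((real \<Rightarrow> real \<times> real) \<Rightarrow> real \<Rightarrow> real) \<Rightarrow> (real \<Rightarrow> real) \<Rightarrow> ennreal" where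
  "risk M W Y x0 \<sigma> \<rho> n F f =
     (\<integral>\<^sup>+\<omega>. Lnorm \<rho> (\<lambda>x. F (obs_path W Y x0 \<sigma> n f \<omega>) x - f x) \<partial>M)"

definition minimax_risk ::
    "'a measure \<Rightarrow> (real \<Rightarrow> 'a \<Rightarrow> real) \<Rightarrow> (real \<Rightarrow> 'a \<Rightarrow> real) \<Rightarrow> real \<Rightarrow> real \<Rightarrow> real \<Rightarrow>
     (real \<Rightarrow> real) set \<Rightarrow> nat \<Rightarrow> ennreal" where
  "minimax_risk M W Y x0 \<sigma> \<rho> \<F> n =
     (INF F\<in>estimators. SUP f\<in>\<F>. risk M W Y x0 \<sigma> \<rho> n F f)"

definition fourier_coeff :: "(real \<Rightarrow> real) \<Rightarrow> int \<Rightarrow> complex" where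
  "fourier_coeff y l =
     (CLBINT t:{0..1}. of_real (y t) * exp (- 2 * of_real pi * \<i> * of_int l * of_real t))"

definition U_filter :: "(real \<Rightarrow> real) \<Rightarrow> nat \<Rightarrow> real" where
  "U_filter y j = 1 / 2 ^ j * (\<Sum>l<2 ^ (j + 1). 1 / (cmod (fourier_coeff y (int l)))\<^sup>2)"

definition cond_Cup :: "'a measure \<Rightarrow> (real \<Rightarrow> 'a \<Rightarrow> real) \<Rightarrow> real \<Rightarrow> bool" where
  "cond_Cup M Y \<nu> \<longleftrightarrow>
     (\<forall>l. AE \<omega> in M. fourier_coeff (\<lambda>t. Y t \<omega>) l \<noteq> 0) \<and>
     \<nu> \<ge> 0 \<and>
     (\<exists>c>0. \<exists>\<alpha>>0. \<exists>C>0. \<forall>j. \<forall>t\<ge>0.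
        measure M {\<omega> \<in> space M. U_filter (\<lambda>u. Y u \<omega>) j \<ge> t * 2 powr (2 * \<nu> * real j)}
          \<le> C * exp (- c * t powr \<alpha>))"

end

theory Submission
  imports Defs "HOL-Real_Asymp.Real_Asymp"
begin

text \<open>
  The periodized Meyer wavelets are trigonometric polynomials, so dividing the Fourier coefficients
  of the observed path by those of the filter gives an unbiased estimate of every wavelet
  coefficient. Given the filter, its noise is sub-Gaussian with variance at most
  \<open>4 \<sigma>\<^sup>2 U_filter y i / n\<close>, whose moments are of order \<open>2\<close> to the power \<open>2 \<nu> i\<close>. Up to a level \<open>i0\<close> the
  estimates are kept; above it they are hard-thresholded at the conditional standard deviation
  times a constant times the square root of \<open>i - i0\<close>, so that the noise contributions decay
  geometrically on both sides of \<open>i0\<close> and no logarithm is lost in the regular case, where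
  \<open>i0\<close> balances bias and noise. In the sparse and the critical case \<open>i0 = 0\<close>. The losses of the
  levels are added up by the triangle inequality; in the critical case all levels up to \<open>log n\<close>
  contribute equally, and Hoelder's inequality for the outer Besov sum gives the logarithmic factor.
\<close>


section \<open>Fourier coefficients on the unit interval\<close>

text \<open>An estimator may use the observation only through countably many coordinates, so the
  Fourier coefficients of the noisy path and of the filter both have to be limits of finite sums.
  For the path, summation by parts against a smooth character makes these limits exist for every
  continuous path; they play the part of Wiener integrals. The threshold contains the variance
  computed from the observed filter itself instead of a moment bound: given the filter, threshold
  and standard deviation then have a deterministic ratio, and the random filter enters only through
  moments of \<open>U_filter\<close>, which the tail condition supplies in every order. Beyond
  \<open>i0\<close> the exceedance probability decays faster than the noise grows, so the number of
  levels may be as large as the bias requires. The target is fixed only up to its wavelet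
  coefficients, hence almost everywhere; it is replaced by its uniformly convergent wavelet series,
  a change that neither convolution nor norm notices. For p > \<rho> the level norms with exponent
  \<rho> are dominated by those with exponent p, hence \<open>pm\<close>.\<close>

definition I01 :: "real measure" where "I01 = restrict_space lborel {0..1}"

lemma space_I01 [simp]: "space I01 = {0..1}"
  by (simp add: I01_def space_restrict_space)

lemma sets_I01: "sets I01 = sets (restrict_space borel {0..1::real})"
  by (simp add: I01_def sets_restrict_space)

lemma measurable_I01 [measurable (raw)]: "f \<in> borel_measurable borel \<Longrightarrow> f \<in> borel_measurable I01"
  unfolding I01_def by (simp add: measurable_restrict_space1)

lemma prob_space_I01: "prob_space I01"
  unfolding I01_def by (rule prob_spaceI) (simp add: space_restrict_space emeasure_restrict_space)

interpretation I01: prob_space I01 by (rule prob_space_I01)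

lemma set_integral_I01:
  fixes f :: "real \<Rightarrow> 'b::{banach, second_countable_topology}"
  shows "set_lebesgue_integral lborel {0..1} f = (LINT x|I01. f x)"
  unfolding I01_def set_lebesgue_integral_def by (subst integral_restrict_space) auto

lemma set_integrable_I01:
  fixes f :: "real \<Rightarrow> 'b::{banach, second_countable_topology}"
  shows "set_integrable lborel {0..1} f \<longleftrightarrow> integrable I01 f"
  unfolding I01_def set_integrable_def by (subst integrable_restrict_space) auto

lemma AE_I01: "(AE x in I01. P x) \<longleftrightarrow> (AE x in lborel. x \<in> {0..1} \<longrightarrow> P x)"
  unfolding I01_def by (subst AE_restrict_space_iff) auto

definition fexp :: "int \<Rightarrow> real \<Rightarrow> complex" where "fexp l x = cis (2 * pi * of_int l * x)"

lemma ee_add: "fexp (k + l) x = fexp k x * fexp l x"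
  by (simp add: fexp_def cis_mult algebra_simps)

lemma norm_ee [simp]: "norm (fexp l x) = 1" by (simp add: fexp_def)

lemma measurable_of_real: "(of_real :: real \<Rightarrow> complex) \<in> borel_measurable borel"
  by (intro borel_measurable_continuous_onI continuous_intros)

lemma ee_0 [simp]: "fexp 0 x = 1" by (simp add: fexp_def)

lemma cnj_ee: "cnj (fexp l x) = fexp (-l) x"
  by (simp add: fexp_def cis_cnj)

lemma ee_int: "fexp l (of_int m) = 1"
  using cis_multiple_2pi[of "of_int (l * m)"] by (simp add: fexp_def mult_ac)

lemma ee_plus_int: "fexp l (x + of_int m) = fexp l x"
proof -
  have "fexp l (x + of_int m) = fexp l x * fexp l (of_int m)"
    by (simp add: fexp_def cis_mult algebra_simps)
  then show ?thesis by (simp add: ee_int)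
qed

lemma ee_continuous [continuous_intros]: "continuous_on A (fexp l)"
  unfolding fexp_def by (intro continuous_intros)

lemma ee_measurable [measurable]: "fexp l \<in> borel_measurable borel"
  by (intro borel_measurable_continuous_onI continuous_intros)

lemma ee_has_vector_derivative:
  "(fexp l has_vector_derivative (2 * pi * of_int l * \<i> * fexp l x)) (at x within S)"
proof -
  have "((\<lambda>x. exp (\<i> * (2 * pi * of_int l) * of_real x)) has_vector_derivative
          (\<i> * (2 * pi * of_int l)) * exp (\<i> * (2 * pi * of_int l) * of_real x)) (at x within S)"
    by (rule has_vector_derivative_real_field[where f="\<lambda>z. exp (\<i> * (2 * pi * of_int l) * z)"])
       (auto intro!: derivative_eq_intros)
  moreover have eq: "exp (\<i> * (2 * pi * of_int l) * of_real x) = fexp l x" for x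
    by (simp add: fexp_def cis_conv_exp mult_ac)
  ultimately show ?thesis unfolding eq by (simp add: mult_ac)
qed

lemma integrable_mult_bounded_I01:
  fixes u g :: "real \<Rightarrow> complex"
  assumes "u \<in> borel_measurable I01" "\<And>x. x \<in> {0..1} \<Longrightarrow> norm (u x) \<le> (B::real)"
    "integrable I01 g"
  shows "integrable I01 (\<lambda>x. g x * u x :: complex)"
proof (rule Bochner_Integration.integrable_bound[of _ "\<lambda>x. B * norm (g x)"])
  show "integrable I01 (\<lambda>x. B * norm (g x))" using assms by auto
  show "(\<lambda>x. g x * u x) \<in> borel_measurable I01"
    using assms(1) borel_measurable_integrable[OF assms(3)] by measurable
  show "AE x in I01. norm (g x * u x) \<le> norm (B * norm (g x))"
  proof (rule AE_I2)
    fix x assume "x \<in> space I01"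
    then have "norm (u x) \<le> B" using assms(2) by simp
    then have "norm (g x) * norm (u x) \<le> norm (g x) * \<bar>B\<bar>" by (intro mult_left_mono) auto
    then show "norm (g x * u x) \<le> norm (B * norm (g x))"
      by (simp add: norm_mult abs_mult mult.commute)
  qed
qed

section \<open>Uniqueness of Fourier coefficients of integrable functions\<close>

context
  fixes f :: "real \<Rightarrow> complex"
  assumes f_int: "integrable I01 f"
    and f_coeff: "\<And>l. (LINT x|I01. f x * fexp l x) = 0"
begin

text \<open>Orthogonality to all characters is demanded at once, so that the property survives
  multiplication of \<open>u\<close> by a character.\<close>

definition annihilates :: "(real \<Rightarrow> complex) \<Rightarrow> bool" where
  "annihilates u \<longleftrightarrow> (\<forall>l. integrable I01 (\<lambda>x. f x * u x * fexp l x) \<and> (LINT x|I01. f x * u x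
      * fexp l x) = 0)"

lemma annih_one: "annihilates (\<lambda>_. 1)"
  unfolding annihilates_def using f_coeff
  by (auto intro!: integrable_mult_bounded_I01[where B=1] f_int)

lemma annih_const_mult: "annihilates u \<Longrightarrow> annihilates (\<lambda>x. c * u x)"
  unfolding annihilates_def
proof safe
  fix l assume "\<forall>l. integrable I01 (\<lambda>x. f x * u x * fexp l x) \<and> (LINT x|I01. f x * u x * fexp l x) = 0"
  then have 1: "integrable I01 (\<lambda>x. f x * u x * fexp l x)" "(LINT x|I01. f x * u x * fexp l x) = 0"
      by auto
  have eq: "f x * (c * u x) * fexp l x = c * (f x * u x * fexp l x)" for x by simp
  show "integrable I01 (\<lambda>x. f x * (c * u x) * fexp l x)" "(LINT x|I01. f x * (c * u x) * fexp l x) = 0"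
    unfolding eq using 1 by auto
qed

lemma annih_add: "annihilates u \<Longrightarrow> annihilates v \<Longrightarrow> annihilates (\<lambda>x. u x + v x)"
  unfolding annihilates_def by (simp add: distrib_left distrib_right)

lemma annih_ee: "annihilates u \<Longrightarrow> annihilates (\<lambda>x. fexp k x * u x)"
  unfolding annihilates_def
proof safe
  fix l assume *: "\<forall>l. integrable I01 (\<lambda>x. f x * u x * fexp l x) \<and> (LINT x|I01. f x * u x
      * fexp l x) = 0"
  have eq: "f x * (fexp k x * u x) * fexp l x = f x * u x * fexp (k + l) x" for x by (simp add: ee_add)
  show "integrable I01 (\<lambda>x. f x * (fexp k x * u x) * fexp l x)" "(LINT x|I01. f x * (fexp k x * u x)
      * fexp l x) = 0"
    unfolding eq using * by auto
qed

text \<open>On the circle a real linear form is a combination of z and its conjugate, that is of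
  \<open>fexp 1\<close> and \<open>fexp (-1)\<close>, under which \<open>annihilates\<close> is
  closed. The factor \<open>u\<close> is arbitrary in the induction, since the product case applies
  one hypothesis to the other polynomial times \<open>u\<close>.\<close>

lemma annih_polynomial:
  fixes p :: "complex \<Rightarrow> real"
  assumes "real_polynomial_function p" "annihilates u"
  shows "annihilates (\<lambda>x. of_real (p (fexp 1 x)) * u x)"
  using assms
proof (induction p arbitrary: u)
  case (linear g)
  have "of_real (g (fexp 1 x)) * u x =
     (complex_of_real (g 1) / 2 + complex_of_real (g \<i>) / (2 * \<i>)) * (fexp 1 x * u x) +
     (complex_of_real (g 1) / 2 - complex_of_real (g \<i>) / (2 * \<i>)) * (fexp (-1) x * u x)" for x
  proof -
    interpret bounded_linear g by fact
    have "fexp 1 x = Re (fexp 1 x) *\<^sub>R 1 + Im (fexp 1 x) *\<^sub>R \<i>" by (simp add: complex_eq_iff)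
    then have "g (fexp 1 x) = Re (fexp 1 x) * g 1 + Im (fexp 1 x) * g \<i>"
        by (metis add scaleR real_scaleR_def)
    moreover have "complex_of_real (Re z) = (z + cnj z) / 2" "complex_of_real (Im z)
        = (z - cnj z) / (2 * \<i>)" for z
      by (auto simp: complex_eq_iff)
    ultimately have "complex_of_real (g (fexp 1 x)) = (fexp 1 x + fexp (-1) x) / 2 * g 1
        + (fexp 1 x - fexp (-1) x) / (2 * \<i>) * g \<i>"
      by (simp add: cnj_ee)
    then have "complex_of_real (g (fexp 1 x)) * u x = ((fexp 1 x + fexp (-1) x) / 2 * g 1
        + (fexp 1 x - fexp (-1) x) / (2 * \<i>) * g \<i>) * u x"
      by simp
    then show ?thesis by (simp add: algebra_simps add_divide_distrib diff_divide_distrib)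
  qed
  then show ?case using linear by (simp add: annih_add annih_const_mult annih_ee)
next
  case (const c)
  then show ?case by (simp add: annih_const_mult)
next
  case (add p q)
  then show ?case by (simp add: distrib_right annih_add)
next
  case (mult p q)
  then have "annihilates (\<lambda>x. of_real (p (fexp 1 x)) * (of_real (q (fexp 1 x)) * u x))" by blast
  then show ?case by (simp add: mult.assoc)
qed

text \<open>Stone-Weierstrass on the circle: a polynomial within \<open>e\<close> of
  \<open>V\<close> changes the integral by at most \<open>e\<close> times the L1 norm of
  \<open>f\<close>, and its own integral vanishes.\<close>

lemma integral_continuous_circle_zero:
  fixes V :: "complex \<Rightarrow> real"
  assumes V: "continuous_on UNIV V"
  shows "(LINT x|I01. f x * of_real (V (fexp 1 x))) = 0"
proof -
  have Vm[measurable]: "(\<lambda>x. V (fexp 1 x)) \<in> borel_measurable I01"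
    using V by (intro measurable_I01 borel_measurable_continuous_onI continuous_intros
        continuous_on_compose2[OF V]) auto
  have bnd: "\<bar>LINT x|I01. norm (f x)\<bar> * e \<ge> norm (LINT x|I01. f x * of_real (V (fexp 1 x)))"
      if "e > 0" for e
  proof -
    obtain p where p: "real_polynomial_function p" "\<And>z. z \<in> sphere 0 1 \<Longrightarrow> \<bar>V z - p z\<bar> < e"
      using Stone_Weierstrass_real_polynomial_function[of "sphere 0 1" V e] V \<open>e > 0\<close>
      by (metis compact_sphere continuous_on_subset subset_UNIV)
    have pm[measurable]: "(\<lambda>x. p (fexp 1 x)) \<in> borel_measurable I01"
      using continuous_on_polymonial_function[of p UNIV] p(1)
      by (intro measurable_I01 borel_measurable_continuous_onI)
         (auto simp: real_polynomial_function_eq intro!: continuous_intros intro: continuous_on_compose2)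
    have *: "integrable I01 (\<lambda>x. f x * of_real (p (fexp 1 x)))" "(LINT x|I01. f x
        * of_real (p (fexp 1 x))) = 0"
      using annih_polynomial[OF p(1) annih_one] unfolding annihilates_def
      by (auto dest: spec[where x=0])
    have d: "\<bar>V (fexp 1 x) - p (fexp 1 x)\<bar> \<le> e" for x
      using p(2)[of "fexp 1 x"] by simp
    have i: "integrable I01 (\<lambda>x. f x * of_real (V (fexp 1 x) - p (fexp 1 x)))"
      using d by (intro integrable_mult_bounded_I01[where B=e] f_int) (auto simp flip: of_real_diff)
    have "(LINT x|I01. f x * of_real (V (fexp 1 x))) =
        (LINT x|I01. f x * of_real (V (fexp 1 x) - p (fexp 1 x)) + f x * of_real (p (fexp 1 x)))"
      by (simp add: algebra_simps)
    also have "\<dots> = (LINT x|I01. f x * of_real (V (fexp 1 x) - p (fexp 1 x)))"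
      using i * by (subst Bochner_Integration.integral_add) auto
    also have "norm \<dots> \<le> (LINT x|I01. norm (f x * of_real (V (fexp 1 x) - p (fexp 1 x))))"
      by (rule integral_norm_bound)
    also have "\<dots> \<le> (LINT x|I01. norm (f x) * e)"
      using integrable_norm[OF i] f_int d by (intro integral_mono) (auto simp: norm_mult intro!:
          mult_left_mono simp flip: of_real_diff)
    also have "\<dots> = (LINT x|I01. norm (f x)) * e" by simp
    also have "\<dots> \<le> \<bar>LINT x|I01. norm (f x)\<bar> * e" using that by (intro mult_right_mono) auto
    finally show ?thesis .
  qed
  define c where "c = \<bar>LINT x|I01. norm (f x)\<bar>"
  have "norm (LINT x|I01. f x * of_real (V (fexp 1 x))) \<le> 0"
  proof (rule field_le_epsilon)
    fix e :: real assume "e > 0"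
    have "c \<ge> 0" by (simp add: c_def)
    have "norm (LINT x|I01. f x * of_real (V (fexp 1 x))) \<le> c * (e / (c + 1))"
      using bnd[of "e / (c+1)"] \<open>e > 0\<close> \<open>c \<ge> 0\<close> unfolding c_def[symmetric] by simp
    also have "\<dots> \<le> e" using \<open>e > 0\<close> \<open>c \<ge> 0\<close> by (simp add: field_simps)
    finally show "norm (LINT x|I01. f x * of_real (V (fexp 1 x))) \<le> 0 + e" by simp
  qed
  then show ?thesis by simp
qed

text \<open>The indicator of a closed set is the limit of the continuous functions
  \<open>V n\<close>, which are 1 on the set and fall with slope n in the distance from it;
  closedness makes this distance positive off the set.\<close>

lemma integral_closed_circle_zero:
  assumes A: "closed A" "A \<noteq> {}"
  shows "(LINT x|I01. f x * of_real (indicator A (fexp 1 x))) = 0"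
proof -
  define V where "V n z = max 0 (1 - real n * infdist z A)" for n z
  have Vc: "continuous_on UNIV (V n)" for n
    unfolding V_def by (intro continuous_intros)
  have Vm[measurable]: "(\<lambda>x. V n (fexp 1 x)) \<in> borel_measurable I01" for n
    by (intro measurable_I01 borel_measurable_continuous_onI continuous_intros
        continuous_on_compose2[OF Vc]) auto
  have Vlim: "(\<lambda>n. V n z) \<longlonglongrightarrow> indicator A z" for z
  proof (cases "z \<in> A")
    case True
    then show ?thesis by (simp add: V_def)
  next
    case False
    then have "infdist z A > 0" using A by (metis in_closed_iff_infdist_zero infdist_nonneg
        less_eq_real_def)
    then obtain N where N: "real N * infdist z A > 1"
      using reals_Archimedean3 by blast
    have "\<forall>\<^sub>F n in sequentially. V n z = 0"
      using eventually_ge_at_top[of N]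
    proof eventually_elim
      case (elim n)
      then have "real n * infdist z A \<ge> real N * infdist z A"
          by (intro mult_right_mono) (auto simp: infdist_nonneg)
      then show ?case using N by (simp add: V_def)
    qed
    then show ?thesis using False by (simp add: tendsto_eventually)
  qed
  have Am[measurable]: "(\<lambda>x. indicator A (fexp 1 x) :: real) \<in> borel_measurable I01"
  proof -
    have "A \<in> sets borel" using A by auto
    then show ?thesis by measurable
  qed
  have "(\<lambda>n. LINT x|I01. f x * of_real (V n (fexp 1 x))) \<longlonglongrightarrow> (LINT x|I01. f x
      * of_real (indicator A (fexp 1 x)))"
  proof (rule integral_dominated_convergence[where w="\<lambda>x. norm (f x)"])
    show "AE x in I01. (\<lambda>n. f x * of_real (V n (fexp 1 x))) \<longlonglongrightarrow> f x * of_real (indicator A (fexp 1 x))"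
      by (intro AE_I2 tendsto_intros Vlim)
    have "\<bar>V n z\<bar> \<le> 1" for n z by (auto simp: V_def infdist_nonneg)
    then show "\<And>n. AE x in I01. norm (f x * of_real (V n (fexp 1 x))) \<le> norm (f x)"
      by (auto simp: norm_mult mult_left_le intro!: AE_I2)
    show "(\<lambda>x. f x * of_real (indicator A (fexp 1 x))) \<in> borel_measurable I01"
      "\<And>n. (\<lambda>x. f x * of_real (V n (fexp 1 x))) \<in> borel_measurable I01"
      by (rule borel_measurable_times[OF borel_measurable_integrable[OF f_int] measurable_compose[OF
          Am measurable_of_real]]
               borel_measurable_times[OF borel_measurable_integrable[OF f_int] measurable_compose[OF
                   Vm measurable_of_real]])+
  qed (use f_int in auto)
  then show ?thesis
    unfolding integral_continuous_circle_zero[OF Vc] by (simp add: LIMSEQ_const_iff)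
qed

lemma ee1_inj:
  assumes "x \<in> {0<..<1}" "y \<in> {0..1}" "fexp 1 x = fexp 1 y"
  shows "x = y"
proof -
  have "sin (2*pi*x) = sin (2*pi*y) \<and> cos (2*pi*x) = cos (2*pi*y)"
    using assms(3) by (auto simp: fexp_def complex_eq_iff)
  then obtain n :: int where n: "2*pi*x = 2*pi*y + 2*pi*n"
    using sin_cos_eq_iff[of "2*pi*x" "2*pi*y"] by auto
  then have "2 * pi * (x - y - n) = 0" by (simp add: algebra_simps)
  then have "x - y = n" by simp
  moreover have "\<bar>x - y\<bar> < 1" using assms by auto
  ultimately have "n = 0" by linarith
  then show ?thesis using \<open>x - y = n\<close> by simp
qed

lemma AE_I01_interior: "AE x in I01. x \<in> {0<..<1}"
  unfolding AE_I01
  using AE_lborel_singleton[of 0] AE_lborel_singleton[of 1]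
  by eventually_elim auto

text \<open>The arc over [0, a] is closed, and its preimage under \<open>fexp 1\<close> is [0, a]
  except for the endpoint 1, which \<open>fexp 1\<close> identifies with 0; such points form a null
  set.\<close>

lemma fourier_unique_interval: "(LINT x|I01. f x * of_real (indicator {..a} x)) = 0"
proof -
  consider "a \<le> 0" | "a \<ge> 1" | "0 < a" "a < 1" by linarith
  then show ?thesis
  proof cases
    case 1
    have "(LINT x|I01. f x * of_real (indicator {..a} x)) = (LINT x|I01. 0)"
      using borel_measurable_integrable[OF f_int] AE_I01_interior 1
      by (intro integral_cong_AE) (auto elim!: eventually_mono)
    then show ?thesis by simp
  next
    case 2
    have "(LINT x|I01. f x * of_real (indicator {..a} x)) = (LINT x|I01. f x)"
      using 2 by (intro Bochner_Integration.integral_cong) auto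
    then show ?thesis using f_coeff[of 0] by simp
  next
    case 3
    define A where "A = fexp 1 ` {0..a}"
    have A: "closed A" "A \<noteq> {}"
      using 3 unfolding A_def by (auto intro!: compact_imp_closed compact_continuous_image
          continuous_intros)
    have "A \<in> sets borel" using A by auto
    then have [measurable]: "(\<lambda>x. indicator A (fexp 1 x) :: real) \<in> borel_measurable I01" by measurable
    have "(LINT x|I01. f x * of_real (indicator {..a} x)) = (LINT x|I01. f x
        * of_real (indicator A (fexp 1 x)))"
    proof (rule integral_cong_AE)
      show "AE x in I01. f x * of_real (indicator {..a} x) = f x * of_real (indicator A (fexp 1 x))"
        using AE_I01_interior
      proof eventually_elim
        case (elim x)
        have "fexp 1 x \<in> A \<longleftrightarrow> x \<in> {..a}"
          using elim 3 ee1_inj[OF elim] by (force simp: A_def)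
        then show ?case by (simp add: indicator_def)
      qed
    qed (use borel_measurable_integrable[OF f_int] in measurable)
    then show ?thesis using integral_closed_circle_zero[OF A] by simp
  qed
qed

text \<open>Dynkin's argument: the half-lines are a generator stable under intersection, and the
  vanishing of the integral passes to complements and to disjoint countable unions.\<close>

lemma fourier_unique_borel: 
  assumes "A \<in> sets (borel :: real measure)"
  shows "(LINT x|I01. f x * of_real (indicator A x)) = 0"
proof -
  have im: "integrable I01 (\<lambda>x. f x * of_real (indicator A x))" if "A \<in> sets borel" for A
    using that by (intro integrable_mult_bounded_I01[where B=1] f_int) (auto simp: indicator_def)
  have "Int_stable (range (atMost :: real \<Rightarrow> _))" by (auto simp: Int_stable_def)
  moreover have "range (atMost :: real \<Rightarrow> _) \<subseteq> Pow UNIV" by auto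
  moreover have "A \<in> sigma_sets UNIV (range (atMost :: real \<Rightarrow> _))"
    using assms by (simp add: borel_eq_atMost)
  ultimately show ?thesis
  proof (induction rule: sigma_sets_induct_disjoint)
    case (basic A)
    then show ?case using fourier_unique_interval by auto
  next
    case empty
    then show ?case by simp
  next
    case (compl A)
    then have "A \<in> sets borel" by (simp add: borel_eq_atMost)
    then have "integrable I01 (\<lambda>x. f x * of_real (indicator A x))" by (rule im)
    have "(LINT x|I01. f x * of_real (indicator (UNIV - A) x)) =
        (LINT x|I01. f x * fexp 0 x - f x * of_real (indicator A x))"
      by (intro Bochner_Integration.integral_cong) (auto simp: indicator_def)
    also have "\<dots> = 0"
      using f_int compl f_coeff[of 0] \<open>integrable I01 (\<lambda>x. f x * of_real (indicator A x))\<close> 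
      by (subst Bochner_Integration.integral_diff) auto
    finally show ?case .
  next
    case (union B)
    then have B: "B i \<in> sets borel" for i by (auto simp: borel_eq_atMost)
    have "(\<lambda>n. LINT x|I01. f x * of_real (indicator (\<Union>i<n. B i) x)) \<longlonglongrightarrow>
        (LINT x|I01. f x * of_real (indicator (\<Union>i. B i) x))"
    proof (rule integral_dominated_convergence[where w="\<lambda>x. norm (f x)"])
      show "AE x in I01. (\<lambda>n. f x * of_real (indicator (\<Union>i<n. B i) x)) \<longlonglongrightarrow> f x
          * of_real (indicator (\<Union>i. B i) x)"
        by (intro AE_I2 tendsto_intros LIMSEQ_indicator_UN)
      show "\<And>n. AE x in I01. norm (f x * of_real (indicator (\<Union>i<n. B i) x)) \<le> norm (f x)"
        by (auto simp: norm_mult mult_left_le indicator_def intro!: AE_I2)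
      show "(\<lambda>x. f x * of_real (indicator (\<Union>i. B i) x)) \<in> borel_measurable I01"
        "\<And>n. (\<lambda>x. f x * of_real (indicator (\<Union>i<n. B i) x)) \<in> borel_measurable I01"
        by (intro borel_measurable_integrable[OF im] sets.countable_UN sets.finite_UN; use B in auto)+
    qed (use f_int in auto)
    moreover have "(LINT x|I01. f x * of_real (indicator (\<Union>i<n. B i) x)) = 0" for n
    proof -
      have "(LINT x|I01. f x * of_real (indicator (\<Union>i<n. B i) x)) =
          (LINT x|I01. (\<Sum>i<n. f x * of_real (indicator (B i) x)))"
        using union(1) by (subst indicator_UN_disjoint)
          (auto simp: sum_distrib_left disjoint_family_on_def)
      also have "\<dots> = 0" using union im[OF B] by (subst Bochner_Integration.integral_sum) auto
      finally show ?thesis .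
    qed
    ultimately show ?case by (simp add: LIMSEQ_const_iff)
  qed
qed

lemma fourier_unique: "AE x in I01. f x = 0"
proof (rule I01.density_zero[OF f_int])
  fix A assume "A \<in> sets I01"
  then obtain B where B: "B \<in> sets borel" "A = B \<inter> {0..1}"
    by (auto simp: sets_I01 sets_restrict_space)
  have "set_lebesgue_integral I01 A f = (LINT x|I01. f x * of_real (indicator B x))"
    unfolding set_lebesgue_integral_def 
    by (intro Bochner_Integration.integral_cong) (auto simp: B(2) indicator_def)
  then show "set_lebesgue_integral I01 A f = 0" using fourier_unique_borel[OF B(1)] by simp
qed

end

section \<open>Poisson summation\<close>

lemma integrable_I01_continuous:
  fixes f :: "real \<Rightarrow> 'a::{banach, second_countable_topology}"
  assumes "continuous_on {0..1} f" shows "integrable I01 f"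
  using borel_integrable_compact[of "{0..1}" f] assms
  unfolding set_integrable_I01[symmetric] set_integrable_def by (simp add: indicator_scaleR_eq_if)

lemma measure_I01 [simp]: "measure I01 {0..1} = 1"
  using I01.prob_space by simp

lemma integral_ee: "(LINT x|I01. fexp l x) = (if l = 0 then 1 else 0)"
proof (cases "l = 0")
  case True
  then show ?thesis by (simp add: I01.prob_space)
next
  case False
  have "(\<integral>x. indicator {0..1} x *\<^sub>R (2 * pi * of_int l * \<i> * fexp l x) \<partial>lborel) = fexp l 1 - fexp l 0"
    by (rule integral_FTC_atLeastAtMost) (simp, rule ee_has_vector_derivative, intro continuous_intros)
  also have "\<dots> = 0" using ee_int[of l 1] by (simp add: fexp_def)
  finally have "set_lebesgue_integral lborel {0..1} (\<lambda>x. (2 * pi * of_int l * \<i>) * fexp l x) = 0"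
    unfolding set_lebesgue_integral_def .
  then have "(LINT x|I01. (2 * pi * of_int l * \<i>) * fexp l x) = 0"
    by (simp only: set_integral_I01)
  then show ?thesis using False by simp
qed

text \<open>The filter is general because the statement serves both sequences and unordered sums,
  which are limits along finite subsets.\<close>

lemma integral_I01_uniform_limit:
  fixes f :: "'i \<Rightarrow> real \<Rightarrow> complex"
  assumes u: "uniform_limit {0..1} f g F" and F: "F \<noteq> bot"
    and i: "\<And>n. integrable I01 (f n)" and g: "integrable I01 g"
  shows "((\<lambda>n. LINT x|I01. f n x) \<longlongrightarrow> (LINT x|I01. g x)) F"
proof (rule tendstoI)
  fix e :: real assume "e > 0"
  have "\<forall>\<^sub>F n in F. \<forall>x\<in>{0..1}. dist (f n x) (g x) < e / 2"
    using u \<open>e > 0\<close> half_gt_zero unfolding uniform_limit_iff by blast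
  then show "\<forall>\<^sub>F n in F. dist (LINT x|I01. f n x) (LINT x|I01. g x) < e"
  proof eventually_elim
    case (elim n)
    have "dist (LINT x|I01. f n x) (LINT x|I01. g x) = norm (LINT x|I01. f n x - g x)"
      using i g by (simp add: dist_norm)
    also have "\<dots> \<le> (LINT x|I01. norm (f n x - g x))" by (rule integral_norm_bound)
    also have "\<dots> \<le> (LINT x|I01. e / 2)"
      using i g elim by (intro integral_mono) (auto simp: dist_norm intro: less_imp_le)
    also have "\<dots> < e" using \<open>e > 0\<close> by (simp add: I01.prob_space)
    finally show ?case .
  qed
qed

text \<open>The interior points where \<open>d\<close> differs from 0 form an open null set, hence
  there are none; continuity then reaches the endpoints.\<close>

lemma AE_I01_continuous_zero:
  fixes d :: "real \<Rightarrow> complex"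
  assumes d: "continuous_on {0..1} d" and AE: "AE x in I01. d x = 0" and x: "x \<in> {0..1}"
  shows "d x = 0"
proof -
  define S where "S = {x\<in>{0<..<1}. d x \<noteq> 0}"
  have "open S"
  proof -
    have "continuous_on {0<..<1} d" using d by (rule continuous_on_subset) auto
    then have "open (d -` (-{0}) \<inter> {0<..<1})"
      using continuous_on_open_vimage[of "{0<..<1::real}" d]
          by (metis open_Compl closed_singleton open_greaterThanLessThan)
    moreover have "d -` (-{0}) \<inter> {0<..<1} = S" by (auto simp: S_def)
    ultimately show ?thesis by simp
  qed
  have "negligible S"
  proof -
    have "S \<in> null_sets lborel"
      using AE \<open>open S\<close> unfolding AE_I01
      by (subst AE_iff_null_sets) (auto simp: S_def elim!: eventually_mono)
    then show ?thesis by (simp add: negligible_iff_null_sets null_sets_completionI)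
  qed
  then have "S = {}" using \<open>open S\<close> open_not_negligible by blast
  have cl: "closure {0<..<1} = {0..1::real}" by (simp add: closure_greaterThanLessThan)
  show ?thesis
    by (rule continuous_constant_on_closure[of "{0<..<1}" d]) (use d x \<open>S = {}\<close> in \<open>auto simp: S_def cl\<close>)
qed

section \<open>Twice continuously differentiable functions on the line\<close>

definition C2 :: "(real \<Rightarrow> 'a::real_normed_vector) \<Rightarrow> bool" where
  "C2 f \<longleftrightarrow> (\<exists>f' f''. (\<forall>x. (f has_vector_derivative f' x) (at x)) \<and>
     (\<forall>x. (f' has_vector_derivative f'' x) (at x)) \<and> continuous_on UNIV f'')"

lemma has_vector_derivative_imp_continuous:
  "(\<And>x. (f has_vector_derivative f' x) (at x)) \<Longrightarrow> continuous_on A f"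
  by (rule continuous_at_imp_continuous_on) (auto intro: has_vector_derivative_continuous)

lemma C2_continuous: "C2 f \<Longrightarrow> continuous_on A f"
  unfolding C2_def by (elim exE conjE) (rule has_vector_derivative_imp_continuous, auto)

lemma C2_const: "C2 (\<lambda>_. c)"
  unfolding C2_def by (intro exI[of _ "\<lambda>_. 0"]) auto

lemma C2_ident: "C2 (\<lambda>x::real. x)"
  unfolding C2_def by (intro exI[of _ "\<lambda>_. 1"] exI[of _ "\<lambda>_. 0"]) auto

lemma C2_add: assumes "C2 f" "C2 g" shows "C2 (\<lambda>x. f x + g x)"
proof -
  obtain f' f'' g' g'' where
    "\<And>x. (f has_vector_derivative f' x) (at x)" "\<And>x. (f' has_vector_derivative f'' x) (at x)"
        "continuous_on UNIV f''"
    "\<And>x. (g has_vector_derivative g' x) (at x)" "\<And>x. (g' has_vector_derivative g'' x) (at x)"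
        "continuous_on UNIV g''"
    using assms unfolding C2_def by metis
  then show ?thesis unfolding C2_def
    by (intro exI[of _ "\<lambda>x. f' x + g' x"] exI[of _ "\<lambda>x. f'' x + g'' x"])
       (auto intro!: has_vector_derivative_add continuous_intros)
qed

lemma C2_mult: 
  fixes f g :: "real \<Rightarrow> 'a::real_normed_algebra"
  assumes "C2 f" "C2 g" shows "C2 (\<lambda>x. f x * g x)"
proof -
  obtain f' f'' g' g'' where *:
    "\<And>x. (f has_vector_derivative f' x) (at x)" "\<And>x. (f' has_vector_derivative f'' x) (at x)"
        "continuous_on UNIV f''"
    "\<And>x. (g has_vector_derivative g' x) (at x)" "\<And>x. (g' has_vector_derivative g'' x) (at x)"
        "continuous_on UNIV g''"
    using assms unfolding C2_def by metis
  have c: "continuous_on UNIV f" "continuous_on UNIV f'" "continuous_on UNIV g" "continuous_on UNIV g'"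
    by (rule has_vector_derivative_imp_continuous, rule *)+
  show ?thesis unfolding C2_def
    by (intro exI[of _ "\<lambda>x. f x * g' x + f' x * g x"]
        exI[of _ "\<lambda>x. (f x * g'' x + f' x * g' x) + (f' x * g' x + f'' x * g x)"] conjI allI)
       (auto intro!: has_vector_derivative_add has_vector_derivative_mult * continuous_intros c)
qed

lemma C2_affine: assumes "C2 f" shows "C2 (\<lambda>x. f (a * x + b))"
proof -
  obtain f' f'' where *:
    "\<And>x. (f has_vector_derivative f' x) (at x)" "\<And>x. (f' has_vector_derivative f'' x) (at x)"
        "continuous_on UNIV f''"
    using assms unfolding C2_def by metis
  have l: "((\<lambda>x. a * x + b) has_vector_derivative a) (at x)" for x
    by (auto simp: has_real_derivative_iff_has_vector_derivative[symmetric] intro!: derivative_eq_intros)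
  have 1: "((\<lambda>x. f (a * x + b)) has_vector_derivative a *\<^sub>R f' (a * x + b)) (at x)" for x
    using vector_diff_chain_at[OF l, of f "f' (a * x + b)"] *(1) by (simp add: o_def)
  have 2: "((\<lambda>x. a *\<^sub>R f' (a * x + b)) has_vector_derivative a *\<^sub>R (a *\<^sub>R f'' (a * x + b))) (at x)" for x
    using bounded_linear.has_vector_derivative[OF bounded_linear_scaleR_right
        vector_diff_chain_at[OF l, of f' "f'' (a * x + b)"]] *(2) 
    by (simp add: o_def)
  have 3: "continuous_on UNIV (\<lambda>x. a *\<^sub>R (a *\<^sub>R f'' (a * x + b)))"
    by (intro continuous_intros continuous_on_compose2[OF *(3)]) auto
  show ?thesis unfolding C2_def
    by (intro exI[of _ "\<lambda>x. a *\<^sub>R f' (a * x + b)"] exI[of _ "\<lambda>x. a *\<^sub>R (a *\<^sub>R f'' (a * x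
        + b))"] conjI allI 1 2 3)
qed

lemma C2_of_real: assumes "C2 f" shows "C2 (\<lambda>x. of_real (f x) :: 'a::real_normed_algebra_1)"
proof -
  obtain f' f'' where *:
    "\<And>x. (f has_vector_derivative f' x) (at x)" "\<And>x. (f' has_vector_derivative f'' x) (at x)"
        "continuous_on UNIV f''"
    using assms unfolding C2_def by metis
  show ?thesis unfolding C2_def
    by (intro exI[of _ "\<lambda>x. of_real (f' x)"] exI[of _ "\<lambda>x. of_real (f'' x)"] conjI allI
        bounded_linear.has_vector_derivative[OF bounded_linear_of_real] * continuous_intros)
qed

lemma C2_sin_cos: assumes "C2 f" shows "C2 (\<lambda>x. sin (f x :: real))" "C2 (\<lambda>x. cos (f x))"
proof -
  obtain f' f'' where *:
    "\<And>x. (f has_real_derivative f' x) (at x)" "\<And>x. (f' has_real_derivative f'' x) (at x)"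
        "continuous_on UNIV f''"
    using assms unfolding C2_def has_real_derivative_iff_has_vector_derivative by metis
  have c: "continuous_on UNIV f" "continuous_on UNIV f'"
    by (rule has_vector_derivative_imp_continuous, rule *[unfolded
        has_real_derivative_iff_has_vector_derivative])+
  show "C2 (\<lambda>x. sin (f x))"
    unfolding C2_def has_real_derivative_iff_has_vector_derivative[symmetric]
    by (intro exI[of _ "\<lambda>x. cos (f x) * f' x"] exI[of _ "\<lambda>x. - sin (f x) * f' x * f' x + cos (f x)
        * f'' x"] conjI allI)
      (auto intro!: derivative_eq_intros * continuous_intros c simp: algebra_simps)
  show "C2 (\<lambda>x. cos (f x))"
    unfolding C2_def has_real_derivative_iff_has_vector_derivative[symmetric]
    by (intro exI[of _ "\<lambda>x. - sin (f x) * f' x"] exI[of _ "\<lambda>x. - cos (f x) * f' x * f' x - sin (f x)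
        * f'' x"] conjI allI)
      (auto intro!: derivative_eq_intros * continuous_intros c simp: algebra_simps)
qed

lemma C2_cis: assumes "C2 f" shows "C2 (\<lambda>x. cis (f x))"
proof -
  have eq: "(\<lambda>x. cis (f x)) = (\<lambda>x. of_real (cos (f x)) + \<i> * of_real (sin (f x)))"
    by (simp add: complex_eq_iff fun_eq_iff)
  show ?thesis
    unfolding eq by (intro C2_add C2_mult C2_of_real C2_sin_cos C2_const assms)
qed

text \<open>The inverse Fourier integral without its factor 1 / (2 pi), which reappears in
  \<open>poisson_summation\<close>.\<close>

definition fourier_int :: "(real \<Rightarrow> complex) \<Rightarrow> real \<Rightarrow> complex" where
  "fourier_int F x = (LINT \<xi>|lborel. F \<xi> * cis (\<xi> * x))"

lemma compact_support_integral:
  fixes F :: "real \<Rightarrow> complex"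
  assumes "continuous_on UNIV F" "\<And>\<xi>. \<bar>\<xi>\<bar> \<ge> A \<Longrightarrow> F \<xi> = 0" "B \<ge> A"
  shows "integrable lborel F" "(LINT \<xi>|lborel. F \<xi>) = (\<integral>\<xi>. indicator {-B..B} \<xi> *\<^sub>R F \<xi> \<partial>lborel)"
proof -
  have eq: "(\<lambda>\<xi>. indicator {-B..B} \<xi> *\<^sub>R F \<xi>) = F"
    using assms(2,3) by (auto simp: indicator_def fun_eq_iff not_le)
  then show "(LINT \<xi>|lborel. F \<xi>) = (\<integral>\<xi>. indicator {-B..B} \<xi> *\<^sub>R F \<xi> \<partial>lborel)" by simp
  have "integrable lborel (\<lambda>\<xi>. indicator {-B..B} \<xi> *\<^sub>R F \<xi>)"
    using borel_integrable_compact[of "{-B..B}" F] assms(1) continuous_on_subset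
    by (auto simp: indicator_scaleR_eq_if)
  then show "integrable lborel F" unfolding eq .
qed

text \<open>Two integrations by parts bound \<open>x\<^sup>2 * norm (fourier_int F x)\<close> by the
  L1 norm of the second derivative; with the trivial bound by the L1 norm of \<open>F\<close> this
  gives the quadratic decay that sums over integer translates ask for.\<close>

lemma ftint_decay:
  assumes "C2 F" and supp: "\<And>\<xi>. \<bar>\<xi>\<bar> \<ge> A \<Longrightarrow> F \<xi> = 0"
  shows "\<exists>K\<ge>0. \<forall>x. norm (fourier_int F x) \<le> K / (1 + x\<^sup>2)"
proof -
  obtain F' F'' where *:
    "\<And>x. (F has_vector_derivative F' x) (at x)" "\<And>x. (F' has_vector_derivative F'' x) (at x)"
        "continuous_on UNIV F''"
    using assms unfolding C2_def by metis
  have c: "continuous_on UNIV F" "continuous_on UNIV F'"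
    by (rule has_vector_derivative_imp_continuous, rule *)+
  have z: "g' x = 0" if "\<And>\<xi>. \<bar>\<xi>\<bar> > A \<Longrightarrow> g \<xi> = 0" "(g has_vector_derivative g' x) (at x)" "\<bar>x\<bar> > A"
    for g g' :: "real \<Rightarrow> complex" and x
  proof -
    have o: "open {\<xi>::real. A < \<bar>\<xi>\<bar>}" by (intro open_Collect_less continuous_intros)
    have "((\<lambda>_. 0) has_vector_derivative g' x) (at x)"
      using has_vector_derivative_transform_within_open[OF that(2) o, of "\<lambda>_. 0"] that by auto
    then show ?thesis by (rule vector_derivative_unique_at) (rule has_vector_derivative_const)
  qed
  have F'0: "F' \<xi> = 0" if "\<bar>\<xi>\<bar> > A" for \<xi> using z[of F F'] *(1) supp that by auto
  have F''0: "F'' \<xi> = 0" if "\<bar>\<xi>\<bar> > A" for \<xi> using z[of F' F''] *(2) F'0 that by auto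
  define K0 where "K0 = (LINT \<xi>|lborel. norm (F \<xi>))"
  define K2 where "K2 = (LINT \<xi>|lborel. norm (F'' \<xi>))"
  \<comment> \<open>The derivatives are shown to vanish only where the absolute value exceeds
    \<open>A\<close> strictly, and \<open>A\<close> may be negative; hence the absolute value and
    the added 1.\<close>
  define B where "B = \<bar>A\<bar> + 1"
  have nn: "K0 \<ge> 0" "K2 \<ge> 0" unfolding K0_def K2_def by auto
  have b0: "norm (fourier_int F x) \<le> K0" for x
    unfolding fourier_int_def K0_def
    using integral_norm_bound[of lborel "\<lambda>\<xi>. F \<xi> * cis (\<xi> * x)"] by (simp add: norm_mult)
  have b2: "x\<^sup>2 * norm (fourier_int F x) \<le> K2" for x
  proof -
    have cd: "((\<lambda>\<xi>. cis (\<xi> * x)) has_vector_derivative (\<i> * x * cis (\<xi> * x))) (at \<xi> within S)" for \<xi> S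
    proof -
      have "((\<lambda>\<xi>. exp (\<i> * x * of_real \<xi>)) has_vector_derivative (\<i> * x) * exp (\<i> * x
          * of_real \<xi>)) (at \<xi> within S)"
        by (rule has_vector_derivative_real_field[where f="\<lambda>z. exp (\<i> * x * z)"])
           (auto intro!: derivative_eq_intros)
      moreover have eq: "exp (\<i> * x * of_real \<xi>) = cis (\<xi> * x)" for \<xi>
        by (simp add: cis_conv_exp mult_ac)
      ultimately show ?thesis unfolding eq by (simp add: mult_ac)
    qed
    \<comment> \<open>Lagrange's identity: the derivative of \<open>h\<close> is \<open>F\<close>
      times the second derivative of the character minus \<open>F''\<close> times the character, so
      one use of the fundamental theorem performs both integrations by parts.\<close>
    define h where "h \<xi> = F \<xi> * (\<i> * x * cis (\<xi> * x)) - F' \<xi> * cis (\<xi> * x)" for \<xi>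
    define h' where "h' \<xi> = - (x^2) * (F \<xi> * cis (\<xi> * x)) - F'' \<xi> * cis (\<xi> * x)" for \<xi>
    have "(h has_vector_derivative h' \<xi>) (at \<xi> within {-B..B})" for \<xi>
    proof -
      have "(h has_vector_derivative (F \<xi> * (\<i> * x * (\<i> * x * cis (\<xi> * x))) + F' \<xi> * (\<i> * x * cis (\<xi>
          * x)))
          - (F' \<xi> * (\<i> * x * cis (\<xi> * x)) + F'' \<xi> * cis (\<xi> * x))) (at \<xi> within {-B..B})"
        unfolding h_def
        by (intro has_vector_derivative_diff has_vector_derivative_mult[OF
            has_vector_derivative_at_within[OF *(1)]]
              has_vector_derivative_mult[OF has_vector_derivative_at_within[OF *(2)]] cd
              has_vector_derivative_mult_right[OF cd])
      then show ?thesis by (rule has_vector_derivative_eq_rhs) (simp add: h'_def power2_eq_square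
          algebra_simps)
    qed
    moreover have cc: "continuous_on UNIV (\<lambda>\<xi>. cis (\<xi> * x))" by (intro continuous_intros)
    have c'': "continuous_on UNIV h'" unfolding h'_def by (intro continuous_intros c *(3))
    moreover have "-B \<le> B" by (simp add: B_def)
    ultimately have "(\<integral>\<xi>. indicator {-B..B} \<xi> *\<^sub>R h' \<xi> \<partial>lborel) = h B - h (-B)"
      by (intro integral_FTC_atLeastAtMost) (auto intro: continuous_on_subset)
    also have "\<dots> = 0" using supp[of B] supp[of "-B"] F'0[of B] F'0[of "-B"] by (simp add: h_def B_def)
    finally have "(LINT \<xi>|lborel. h' \<xi>) = 0"
      using compact_support_integral(2)[OF c'', of B B] supp F''0 by (auto simp: h'_def B_def)
    moreover have i: "integrable lborel (\<lambda>\<xi>. F \<xi> * cis (\<xi> * x))" "integrable lborel (\<lambda>\<xi>. F'' \<xi>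
        * cis (\<xi> * x))"
      using supp F''0 by (auto intro!: compact_support_integral(1)[of _ B] continuous_intros c *(3)
          simp: B_def)
    ultimately have "-(x^2) * fourier_int F x = (LINT \<xi>|lborel. F'' \<xi> * cis (\<xi> * x))"
      unfolding h'_def fourier_int_def by simp
    then have "norm (-(x^2) * fourier_int F x) = norm (LINT \<xi>|lborel. F'' \<xi> * cis (\<xi> * x))" by simp
    then have "x\<^sup>2 * norm (fourier_int F x) = norm (LINT \<xi>|lborel. F'' \<xi> * cis (\<xi> * x))"
      by (simp add: norm_mult norm_power)
    also have "\<dots> \<le> K2" unfolding K2_def
      using integral_norm_bound[of lborel "\<lambda>\<xi>. F'' \<xi> * cis (\<xi> * x)"] by (simp add: norm_mult)
    finally show ?thesis .
  qed
  have "norm (fourier_int F x) \<le> (K0 + K2) / (1 + x\<^sup>2)" for x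
  proof -
    have "(1 + x\<^sup>2) * norm (fourier_int F x) \<le> K0 + K2" using b0[of x] b2[of x]
        by (simp add: algebra_simps)
    moreover have "1 + x\<^sup>2 > 0" by (simp add: add_pos_nonneg)
    ultimately show ?thesis by (simp add: pos_le_divide_eq mult.commute)
  qed
  then show ?thesis using nn by (intro exI[of _ "K0 + K2"]) auto
qed

lemma summable_on_int_square: "(\<lambda>l::int. 1 / (1 + (real_of_int l)\<^sup>2)) summable_on UNIV"
proof -
  have s: "summable (\<lambda>n. 1 / (1 + (real n)\<^sup>2))"
  proof (rule summable_comparison_test')
    show "summable (\<lambda>n. 2 * inverse ((real (Suc n))\<^sup>2))"
      using summable_Suc_iff[of "\<lambda>n. inverse ((real n)\<^sup>2)"] inverse_power_summable[of 2, where 'a=real]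
      by (auto intro!: summable_mult)
    fix n :: nat assume "n \<ge> 0"
    have "(real (Suc n))\<^sup>2 \<le> 2 * (1 + (real n)\<^sup>2)"
      using sum_squares_ge_zero[of "real n - 1" 0] by (simp add: power2_eq_square algebra_simps)
    moreover have "1 + (real n)\<^sup>2 > 0" by (simp add: add_pos_nonneg)
    ultimately show "norm (1 / (1 + (real n)\<^sup>2)) \<le> 2 * inverse ((real (Suc n))\<^sup>2)"
      by (simp add: field_simps)
  qed
  then have n: "(\<lambda>n. 1 / (1 + (real n)\<^sup>2)) summable_on UNIV"
    by (intro summable_nonneg_imp_summable_on) auto
  have "(\<lambda>l::int. 1 / (1 + (real_of_int l)\<^sup>2)) summable_on (range int)"
    using n by (subst summable_on_reindex) (auto simp: o_def)
  moreover have "(\<lambda>l::int. 1 / (1 + (real_of_int l)\<^sup>2)) summable_on (range (\<lambda>n. - int n))"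
    using n by (subst summable_on_reindex) (auto simp: o_def inj_def)
  ultimately have "(\<lambda>l::int. 1 / (1 + (real_of_int l)\<^sup>2)) summable_on (range int \<union> range (\<lambda>n. - int n))"
    by (rule summable_on_union)
  moreover have "range int \<union> range (\<lambda>n. - int n) = UNIV"
  proof -
    have "x \<in> range int \<union> range (\<lambda>n. - int n)" for x
      by (cases x rule: int_cases2) auto
    then show ?thesis by blast
  qed
  ultimately show ?thesis by simp
qed

text \<open>Peetre's inequality for the exponent 2, from (y - x)^2 \<le> 2 x^2 + 2 y^2 with y = x +
  l. It moves the shift \<open>x\<close> out of the summable factor.\<close>

lemma decay_shift: "1 / (1 + (x + l)\<^sup>2) \<le> 2 * (1 + x\<^sup>2) * (1 / (1 + (l::real)\<^sup>2))"
proof -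
  define y where "y = x + l"
  have "(y - x)\<^sup>2 \<le> 2 * x\<^sup>2 + 2 * y\<^sup>2"
    using zero_le_power2[of "y + x"] by (simp add: power2_eq_square algebra_simps)
  then have "l\<^sup>2 \<le> 2 * x\<^sup>2 + 2 * y\<^sup>2" by (simp add: y_def)
  moreover have "0 \<le> x\<^sup>2 * y\<^sup>2" by simp
  moreover have "2 * (1 + x\<^sup>2) * (1 + y\<^sup>2) = 2 + 2 * x\<^sup>2 + 2 * y\<^sup>2 + 2 * (x\<^sup>2 * y\<^sup>2)"
      by (simp add: algebra_simps)
  ultimately have "1 + l\<^sup>2 \<le> 2 * (1 + x\<^sup>2) * (1 + (x + l)\<^sup>2)" unfolding y_def[symmetric] by linarith
  moreover have "1 + l\<^sup>2 > 0" "1 + (x+l)\<^sup>2 > 0" by (simp_all add: add_pos_nonneg)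
  ultimately show ?thesis by (simp add: field_simps)
qed

lemma summable_on_int_decay:
  fixes x :: real
  shows "(\<lambda>l::int. 1 / (1 + (x + of_int l)\<^sup>2)) summable_on UNIV"
proof (rule summable_on_comparison_test)
  show "(\<lambda>l::int. 2 * (1 + x\<^sup>2) * (1 / (1 + (real_of_int l)\<^sup>2))) summable_on UNIV"
    by (rule summable_on_cmult_right[OF summable_on_int_square])
qed (rule decay_shift, simp)

text \<open>Each translate contributes the integral over one cell [m, m + 1]; the cells overlap only
  in integers, a null set, and those with -N \<le> m \<le> N cover the support.\<close>

lemma integral_unit_translates:
  fixes H :: "real \<Rightarrow> complex"
  assumes H: "integrable lborel H" and supp: "\<And>t. \<bar>t\<bar> \<ge> real N \<Longrightarrow> H t = 0"
  shows "(\<Sum>m\<in>{-int N..int N}. LINT t|I01. H (t + of_int m)) = (LINT t|lborel. H t)"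
proof -
  have i: "integrable lborel (\<lambda>t. indicator {of_int m..of_int m+1} t *\<^sub>R H t)" for m :: int
    by (intro integrable_mult_indicator H) auto
  have "(LINT t|I01. H (t + of_int m)) = (LINT t|lborel. indicator {of_int m..of_int m+1} t *\<^sub>R H
      t)" for m :: int
  proof -
    have "(LINT t|I01. H (t + of_int m)) = (LINT t|lborel. indicator {0..1} t *\<^sub>R H (of_int m + 1 * t))"
      by (simp add: set_integral_I01[symmetric] set_lebesgue_integral_def add.commute)
    also have "\<dots> = (LINT t|lborel. indicator {of_int m..of_int m+1} (of_int m + 1
        * t) *\<^sub>R H (of_int m + 1 * t))"
      by (intro Bochner_Integration.integral_cong) (auto simp: indicator_def)
    also have "\<dots> = (LINT t|lborel. indicator {of_int m..of_int m+1} t *\<^sub>R H t)"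
      using lborel_integral_real_affine[of 1 "\<lambda>t. indicator {of_int m..of_int m+1} t *\<^sub>R H t"
          "of_int m"] by simp
    finally show ?thesis .
  qed
  then have "(\<Sum>m\<in>{-int N..int N}. LINT t|I01. H (t + of_int m)) =
      (LINT t|lborel. (\<Sum>m\<in>{-int N..int N}. indicator {of_int m..of_int m+1} t *\<^sub>R H t))"
    using i by (subst Bochner_Integration.integral_sum) auto
  also have "\<dots> = (LINT t|lborel. H t)"
  proof (rule integral_cong_AE)
    have cnt: "countable (range (of_int :: int \<Rightarrow> real))" by auto
    have "AE t in lborel. t \<notin> range (of_int :: int \<Rightarrow> real)"
      by (rule AE_not_in) (simp add: countable_imp_null_set_lborel)
    then show "AE t in lborel. (\<Sum>m\<in>{-int N..int N}. indicator {of_int m..of_int m+1} t *\<^sub>R H t) = H t"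
    proof eventually_elim
      case (elim t)
      have ind: "indicat_real {of_int m..of_int m+1} t = (if m = \<lfloor>t\<rfloor> then 1 else 0)" for m
      proof -
        have "t \<noteq> of_int m" "t \<noteq> of_int m + 1" using elim by (auto intro: rangeI)
           (metis of_int_1 of_int_add rangeI)
        then have "t \<in> {of_int m..of_int m+1} \<longleftrightarrow> m = \<lfloor>t\<rfloor>"
          by (auto simp: eq_commute[of m] floor_eq_iff)
        then show ?thesis by (simp add: indicator_def)
      qed
      have "(\<Sum>m\<in>{-int N..int N}. indicator {of_int m..of_int m+1} t *\<^sub>R H t) =
          (\<Sum>m\<in>{-int N..int N}. if m = \<lfloor>t\<rfloor> then H t else 0)"
        unfolding ind by (intro sum.cong) auto
      also have "\<dots> = (if \<lfloor>t\<rfloor> \<in> {-int N..int N} then H t else 0)" by (simp add: sum.delta)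
      also have "\<dots> = H t"
      proof -
        have "\<bar>t\<bar> \<ge> real N" if "\<lfloor>t\<rfloor> \<notin> {-int N..int N}"
          using that by (auto simp: floor_less_iff less_floor_iff not_le)
        then show ?thesis using supp by auto
      qed
      finally show ?case .
    qed
    show "(\<lambda>t. \<Sum>m\<in>{-int N..int N}. indicator {of_int m..of_int m+1} t *\<^sub>R H t) \<in> borel_measurable lborel"
      by (intro borel_measurable_sum borel_measurable_integrable[OF i])
  qed (rule borel_measurable_integrable[OF H])
  finally show ?thesis .
qed

text \<open>By the M-test the series converges uniformly, so its sum \<open>S\<close> is continuous
  and has the coefficients \<open>a\<close>; uniqueness gives S = G almost everywhere, continuity
  everywhere on the interval. The series runs over \<open>fexp (-l)\<close> because the coefficients
  are taken against \<open>fexp l\<close>.\<close>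

lemma fourier_series_pointwise:
  fixes G :: "real \<Rightarrow> complex"
  assumes G: "continuous_on {0..1} G" 
    and a: "\<And>l. (LINT t|I01. G t * fexp l t) = a l"
    and M: "\<And>l. norm (a l) \<le> M l" "M summable_on UNIV" and t: "t \<in> {0..1}"
  shows "((\<lambda>l. a l * fexp (-l) t) has_sum G t) UNIV"
proof -
  define S where "S t = (\<Sum>\<^sub>\<infinity>l. a l * fexp (-l) t)" for t
  have u: "uniform_limit UNIV (\<lambda>X t. \<Sum>l\<in>X. a l * fexp (-l) t) S (finite_subsets_at_top UNIV)"
    unfolding S_def
  proof (rule Weierstrass_m_test_general)
    show "norm (a l * fexp (-l) t) \<le> M l" for l t using M(1)[of l] by (simp add: norm_mult)
    show "M summable_on UNIV" by (rule M(2))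
  qed
  have Sc: "continuous_on UNIV S"
  proof (rule uniform_limit_theorem[OF _ u])
    show "\<forall>\<^sub>F X in finite_subsets_at_top UNIV. continuous_on UNIV (\<lambda>t. \<Sum>l\<in>X. a l * fexp (-l) t)"
      by (intro always_eventually allI continuous_intros)
  qed simp
  have Scoeff: "(LINT t|I01. S t * fexp k t) = a k" for k
  proof (rule tendsto_unique)
    show "finite_subsets_at_top (UNIV :: int set) \<noteq> bot" by simp
    have "uniform_limit {0..1} (\<lambda>X t. (\<Sum>l\<in>X. a l * fexp (-l) t) * fexp k t) (\<lambda>t. S t
        * fexp k t) (finite_subsets_at_top UNIV)"
      unfolding uniform_limit_iff
    proof safe
      fix e :: real assume "e > 0"
      then have "\<forall>\<^sub>F X in finite_subsets_at_top UNIV. \<forall>t\<in>UNIV. dist (\<Sum>l\<in>X. a l * fexp (-l) t) (S t) < e"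
        using u unfolding uniform_limit_iff by blast
      then show "\<forall>\<^sub>F X in finite_subsets_at_top UNIV. \<forall>t\<in>{0..1}. dist ((\<Sum>l\<in>X. a l * fexp (-l) t)
          * fexp k t) (S t * fexp k t) < e"
        by (rule eventually_mono) (simp add: dist_norm norm_mult left_diff_distrib[symmetric])
    qed
    then show "((\<lambda>X. LINT t|I01. (\<Sum>l\<in>X. a l * fexp (-l) t) * fexp k t) \<longlongrightarrow> (LINT t|I01. S t
        * fexp k t)) (finite_subsets_at_top UNIV)"
    proof (rule integral_I01_uniform_limit)
      show "integrable I01 (\<lambda>t. (\<Sum>l\<in>X. a l * fexp (-l) t) * fexp k t)" for X
        by (intro integrable_I01_continuous continuous_intros)
      show "integrable I01 (\<lambda>t. S t * fexp k t)"
        by (intro integrable_I01_continuous continuous_intros continuous_on_subset[OF Sc]) simp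
    qed simp
    have "\<forall>\<^sub>F X in finite_subsets_at_top UNIV. (LINT t|I01. (\<Sum>l\<in>X. a l * fexp (-l) t) * fexp k t) = a k"
    proof -
      have "\<forall>\<^sub>F X in finite_subsets_at_top UNIV. finite X \<and> {k} \<subseteq> X \<and> X \<subseteq> UNIV"
        by (auto simp: eventually_finite_subsets_at_top)
      then show ?thesis
      proof eventually_elim
        case (elim X)
        have "(LINT t|I01. (\<Sum>l\<in>X. a l * fexp (-l) t) * fexp k t) = (LINT t|I01. (\<Sum>l\<in>X. a l
            * fexp (k-l) t))"
          by (simp add: sum_distrib_right mult.assoc ee_add[symmetric])
        also have "\<dots> = (\<Sum>l\<in>X. a l * (LINT t|I01. fexp (k-l) t))"
          by (subst Bochner_Integration.integral_sum) (auto intro!: integrable_I01_continuous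
              continuous_intros)
        also have "\<dots> = (\<Sum>l\<in>X. if l = k then a l else 0)"
          by (intro sum.cong) (auto simp: integral_ee)
        also have "\<dots> = a k" using elim by (simp add: sum.delta)
        finally show ?case .
      qed
    qed
    then show "((\<lambda>X. LINT t|I01. (\<Sum>l\<in>X. a l * fexp (-l) t)
        * fexp k t) \<longlongrightarrow> a k) (finite_subsets_at_top UNIV)"
      by (rule tendsto_eventually)
  qed
  have Sc': "continuous_on {0..1} S" by (rule continuous_on_subset[OF Sc]) simp
  have "AE t in I01. G t - S t = 0"
  proof (rule fourier_unique)
    show "integrable I01 (\<lambda>t. G t - S t)" by (intro integrable_I01_continuous continuous_intros G Sc')
    fix l
    have "(LINT t|I01. (G t - S t) * fexp l t) = (LINT t|I01. G t * fexp l t - S t * fexp l t)"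
      by (simp add: algebra_simps)
    also have "\<dots> = (LINT t|I01. G t * fexp l t) - (LINT t|I01. S t * fexp l t)"
      by (intro Bochner_Integration.integral_diff integrable_I01_continuous continuous_intros G Sc')
    also have "\<dots> = 0" using a Scoeff by simp
    finally show "(LINT t|I01. (G t - S t) * fexp l t) = 0" .
  qed
  then have "G t - S t = 0"
    by (intro AE_I01_continuous_zero[of "\<lambda>t. G t - S t"] t continuous_intros G Sc')
  moreover have "(\<lambda>l. a l * fexp (-l) t) summable_on UNIV"
    by (rule abs_summable_summable, rule summable_on_comparison_test[OF M(2)]) (auto simp: norm_mult M)
  ultimately show ?thesis unfolding S_def by (simp add: has_sum_iff)
qed

text \<open>The compactly supported side is the frequency side here, so the sum over all translates
  of a band-limited function becomes a finite trigonometric sum.\<close>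

lemma poisson_summation:
  assumes F: "C2 F" and supp: "\<And>\<xi>. \<bar>\<xi>\<bar> \<ge> 2 * pi * real N \<Longrightarrow> F \<xi> = 0"
  shows "((\<lambda>l::int. fourier_int F (x + of_int l) / (2 * pi)) has_sum (\<Sum>m\<in>{-int N..int N}. F (2 * pi
      * of_int m) * fexp m x)) UNIV"
proof -
  have Fc: "continuous_on A F" for A by (rule C2_continuous[OF F])
  obtain K where K: "K \<ge> 0" "\<And>x. norm (fourier_int F x) \<le> K / (1 + x\<^sup>2)"
      using ftint_decay[OF F supp] by auto
  \<comment> \<open>The phase with \<open>x\<close> is built into the periodized function: its
    coefficient at \<open>l\<close> is then the Fourier integral at \<open>x + of_int l\<close>, and
    its series has to be evaluated only at 0.\<close>
  define G where "G t = (\<Sum>m\<in>{-int N..int N}. F (2 * pi * (t + of_int m)) * cis (2 * pi * (t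
      + of_int m) * x))" for t
  have Gc: "continuous_on {0..1} G"
    unfolding G_def by (intro continuous_intros continuous_on_compose2[OF Fc[of UNIV]]) auto
  have coeff: "(LINT t|I01. G t * fexp l t) = fourier_int F (x + of_int l) / (2 * pi)" for l
  proof -
    define H where "H t = F (2 * pi * t) * cis (2 * pi * t * (x + of_int l))" for t
    have Hc: "continuous_on UNIV H"
      unfolding H_def by (intro continuous_intros continuous_on_compose2[OF Fc[of UNIV]]) auto
    have Hs: "H t = 0" if "\<bar>t\<bar> \<ge> real N" for t
      using supp[of "2*pi*t"] that by (simp add: H_def abs_mult)
    have Hi: "integrable lborel H" by (rule compact_support_integral(1)[OF Hc Hs, of "real N"]) auto
    have "G t * fexp l t = (\<Sum>m\<in>{-int N..int N}. H (t + of_int m))" for t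
    proof -
      have "cis (2 * pi * (t + of_int m) * x) * fexp l t = cis (2 * pi * (t + of_int m) * (x
          + of_int l))" for m :: int
      proof -
        have "fexp l t = fexp l (t + of_int m)" by (simp add: ee_plus_int)
        then show ?thesis by (simp only: fexp_def cis_mult) (simp add: algebra_simps)
      qed
      then show ?thesis by (simp add: G_def H_def sum_distrib_right mult.assoc)
    qed
    then have "(LINT t|I01. G t * fexp l t) = (\<Sum>m\<in>{-int N..int N}. LINT t|I01. H (t + of_int m))"
      by (simp, subst Bochner_Integration.integral_sum)
         (auto intro!: integrable_I01_continuous continuous_intros continuous_on_compose2[OF Hc])
    also have "\<dots> = (LINT t|lborel. H t)" by (rule integral_unit_translates[OF Hi Hs])
    also have "\<dots> = fourier_int F (x + of_int l) / (2 * pi)"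
      using lborel_integral_real_affine[of "2*pi" "\<lambda>\<xi>. F \<xi> * cis (\<xi> * (x + of_int l))" 0]
      by (simp add: fourier_int_def H_def scaleR_conv_of_real field_simps)
    finally show ?thesis .
  qed
  have Ms: "(\<lambda>l::int. K / (2*pi) * (1 / (1 + (x + of_int l)\<^sup>2))) summable_on UNIV"
    by (intro summable_on_cmult_right summable_on_int_decay)
  have Mb: "norm (fourier_int F (x + of_int l) / (2 * pi)) \<le> K / (2*pi) * (1 / (1 + (x
      + of_int l)\<^sup>2))" for l :: int
    using divide_right_mono[OF K(2)[of "x + of_int l"], of "2*pi"]
        by (simp add: norm_divide norm_mult mult.commute)
  have "((\<lambda>l. fourier_int F (x + of_int l) / (2 * pi) * fexp (-l) 0) has_sum G 0) UNIV"
    by (rule fourier_series_pointwise[OF Gc coeff Mb Ms]) auto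
  then show ?thesis by (simp add: G_def fexp_def)
qed


lemma sum_roots_of_unity:
  assumes "n > 0"
  shows "(\<Sum>k<n. fexp d (real k / real n)) = (if int n dvd d then of_nat n else 0)"
proof -
  define z where "z = fexp d (1 / real n)"
  have pow: "fexp d (real k / real n) = z ^ k" for k
  proof -
    have "z ^ k = cis (real k * (2 * pi * of_int d * (1 / real n)))"
      unfolding z_def fexp_def by (rule Complex.DeMoivre)
    then show ?thesis by (simp add: fexp_def mult_ac)
  qed
  show ?thesis
  proof (cases "int n dvd d")
    case True
    then obtain c where "d = int n * c" by auto
    then have "2 * pi * of_int d * (1 / real n) = 2 * pi * of_int c" using assms by simp
    then have "z = cis (2 * pi * of_int c)" unfolding z_def fexp_def by (rule arg_cong)
    also have "\<dots> = 1" by (rule cis_multiple_2pi) simp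
    finally have "z = 1" .
    then show ?thesis using True by (simp add: pow)
  next
    case False
    have "z \<noteq> 1"
    proof
      assume "z = 1"
      then have "cos (2 * pi * of_int d * (1 / real n)) = 1" by (simp add: z_def fexp_def complex_eq_iff)
      then obtain c :: int where "2 * pi * of_int d * (1 / real n) = of_int c * 2 * pi"
        using cos_one_2pi_int by auto
      then have "real_of_int d = of_int (c * int n)" using assms by (simp add: field_simps)
      then have "d = c * int n" by linarith
      then show False using False by simp
    qed
    moreover have "z ^ n = 1"
      using pow[of n] ee_int[of d 1] assms by simp
    ultimately show ?thesis using False by (simp add: pow geometric_sum)
  qed
qed

section \<open>Periodized Meyer wavelets\<close>

text \<open>At most one of the two summands is nonzero; unlike the equivalent \<open>h (3 * \<bar>u\<bar> - 1)\<close>, this form is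
  visibly smooth at \<open>0\<close>. The argument \<open>u\<close> is the frequency divided by \<open>2 * pi\<close>.\<close>

definition meyer_angle :: "(real \<Rightarrow> real) \<Rightarrow> real \<Rightarrow> real" where
  "meyer_angle h u = pi / 2 * (h (3 * u + (-1)) + h (-3 * u + (-1)))"

definition meyer_low :: "(real \<Rightarrow> real) \<Rightarrow> real \<Rightarrow> real" where
  "meyer_low h u = cos (meyer_angle h u)"

text \<open>The transform of the wavelet without its phase \<open>cis (pi * u)\<close>: as the
  absolute value of \<open>u\<close> grows, the sine switches it on between 1/3 and 2/3 and the
  cosine switches it off between 2/3 and 4/3.\<close>

definition meyer_high :: "(real \<Rightarrow> real) \<Rightarrow> real \<Rightarrow> real" where
  "meyer_high h u = sin (meyer_angle h u) * cos (meyer_angle h (u / 2))"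

text \<open>Levels are shifted by one to be natural numbers: level \<open>i\<close> is the level \<open>j = i - 1\<close> of the
  Besov norm, and \<open>i = 0\<close> is the scaling function, which is the constant \<open>1\<close>.\<close>

definition freqs :: "nat \<Rightarrow> int set" where "freqs i = {l. \<bar>l\<bar> < 2 ^ i}"

lemma finite_freqs [simp]: "finite (freqs i)"
proof -
  have "freqs i \<subseteq> {- (2 ^ i)..2 ^ i}" by (auto simp: freqs_def)
  then show ?thesis by (rule finite_subset) simp
qed

text \<open>The Fourier coefficients of the periodized wavelets, as \<open>wav_series\<close> shows.
  The first phase is the factor exp(i \<xi> / 2) of the Meyer wavelet, the second one the
  translation by \<open>k\<close>.\<close>

definition wav_ft :: "(real \<Rightarrow> real) \<Rightarrow> nat \<Rightarrow> nat \<Rightarrow> int \<Rightarrow> complex" where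
  "wav_ft h i k l = (if i = 0 then (if l = 0 then 1 else 0)
     else of_real (2 powr (- real (i - 1) / 2) * meyer_high h (of_int l / 2 ^ (i - 1))) *
        cis (pi * (of_int l / 2 ^ (i - 1))) * cis (- 2 * pi * (of_int l / 2 ^ (i - 1)) * real k))"

definition wav :: "(real \<Rightarrow> real) \<Rightarrow> nat \<Rightarrow> nat \<Rightarrow> real \<Rightarrow> real" where
  "wav h i k = per_wavelet h (int i - 1) k"

definition widx :: "nat \<Rightarrow> nat set" where
  "widx i = wavelet_index (int i - 1)"

lemma widx_0: "widx 0 = {0}" by (simp add: widx_def wavelet_index_def)

lemma widx_Suc: "widx (Suc j) = {..<2 ^ j}"
  by (auto simp: widx_def wavelet_index_def)

lemma finite_widx [simp]: "finite (widx i)"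
  by (cases i) (auto simp: widx_0 widx_Suc)

lemma card_widx: "card (widx i) \<le> 2 ^ i" "card (widx i) > 0"
  by (cases i; simp add: widx_0 widx_Suc)+

section \<open>Meyer identities and the trigonometric form of the wavelets\<close>

context
  fixes h :: "real \<Rightarrow> real"
  assumes h: "meyer_aux h"
begin

lemma meyer_aux_le_0: "x \<le> 0 \<Longrightarrow> h x = 0" and meyer_aux_ge_1: "x \<ge> 1 \<Longrightarrow> h x = 1"
    and meyer_aux_compl: "h x + h (1 - x) = 1"
  using h unfolding meyer_aux_def by auto

lemma C2_meyer_aux: "C2 h"
proof -
  have d: "((deriv ^^ k) h has_real_derivative (deriv ^^ Suc k) h x) (at x)" for k x
    using h unfolding meyer_aux_def by (auto simp: DERIV_deriv_iff_real_differentiable)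
  have "continuous_on UNIV ((deriv ^^ 2) h)"
    using d[of 2] by (intro continuous_at_imp_continuous_on) (auto intro: DERIV_isCont)
  then show ?thesis unfolding C2_def has_real_derivative_iff_has_vector_derivative[symmetric]
    using d[of 0] d[of 1]
    by (intro exI[of _ "deriv h"] exI[of _ "(deriv ^^ 2) h"]) (auto simp: numeral_2_eq_2)
qed

lemma mang_abs: "meyer_angle h u = pi / 2 * h (3 * \<bar>u\<bar> - 1)"
  by (cases "u \<ge> 0") (auto simp: meyer_angle_def meyer_aux_le_0 abs_if)

lemma mang_minus: "meyer_angle h (-u) = meyer_angle h u" by (simp add: meyer_angle_def add.commute)

lemma mang_small: "\<bar>u\<bar> \<le> 1/3 \<Longrightarrow> meyer_angle h u = 0"
  by (simp add: mang_abs meyer_aux_le_0)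

lemma mang_large: "\<bar>u\<bar> \<ge> 2/3 \<Longrightarrow> meyer_angle h u = pi / 2"
  by (simp add: mang_abs meyer_aux_ge_1)

text \<open>This is where the symmetry of \<open>h\<close> about 1/2 enters; it makes sine and
  cosine trade places in \<open>psis_odd\<close>.\<close>

lemma mang_compl: "\<bar>u\<bar> + \<bar>v\<bar> = 1 \<Longrightarrow> meyer_angle h v = pi / 2 - meyer_angle h u"
proof -
  assume "\<bar>u\<bar> + \<bar>v\<bar> = 1"
  then have "3 * \<bar>v\<bar> - 1 = 1 - (3 * \<bar>u\<bar> - 1)" by linarith
  then have "h (3 * \<bar>v\<bar> - 1) = 1 - h (3 * \<bar>u\<bar> - 1)" using meyer_aux_compl[of "3 * \<bar>u\<bar> - 1"] by simp
  then show ?thesis unfolding mang_abs by (simp only: right_diff_distrib)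
qed

lemma phis_small: "\<bar>u\<bar> \<le> 1/3 \<Longrightarrow> meyer_low h u = 1"
  and phis_large: "\<bar>u\<bar> \<ge> 2/3 \<Longrightarrow> meyer_low h u = 0"
  by (simp_all add: meyer_low_def mang_small mang_large)

lemma psis_small: "\<bar>u\<bar> \<le> 1/3 \<Longrightarrow> meyer_high h u = 0"
  and psis_large: "\<bar>u\<bar> \<ge> 4/3 \<Longrightarrow> meyer_high h u = 0"
  by (simp_all add: meyer_high_def mang_small mang_large)

lemma psis_le_1: "\<bar>meyer_high h u\<bar> \<le> 1"
  using mult_mono[of "\<bar>sin (meyer_angle h u)\<bar>" 1 "\<bar>cos (meyer_angle h (u / 2))\<bar>" 1]
  by (simp add: meyer_high_def abs_mult)

lemma psis_minus: "meyer_high h (-u) = meyer_high h u"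
  using mang_minus[of u] mang_minus[of "u/2"] by (simp add: meyer_high_def)

text \<open>Two regimes meet at 2/3: above it the sine is 1 and \<open>meyer_low h u\<close> is 0;
  below it the cosine and \<open>meyer_low h (u/2)\<close> are 1, and the claim is sin^2 = 1 -
  cos^2.\<close>

lemma psis_sq: "meyer_high h u * meyer_high h u = meyer_low h (u/2)
    * meyer_low h (u/2) - meyer_low h u * meyer_low h u"
proof (cases "\<bar>u\<bar> \<ge> 2/3")
  case True
  then show ?thesis by (simp add: meyer_high_def meyer_low_def mang_large)
next
  case False
  then have "meyer_angle h (u / 2) = 0" by (intro mang_small) simp
  then show ?thesis
    using sin_squared_eq[of "meyer_angle h u"] by (simp add: meyer_high_def meyer_low_def
        power2_eq_square)
qed

text \<open>The supports leave only a difference of absolute value 1. If one point lies on the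
  plateau around 0, the other is beyond 2/3 and both sides vanish; otherwise the absolute values add
  up to 1 and the angles are complementary.\<close>

lemma psis_odd:
  assumes "odd d" "v - u = of_int d"
  shows "meyer_high h u * meyer_high h v = meyer_low h u * meyer_low h v"
proof (cases "\<bar>u\<bar> \<ge> 4/3 \<or> \<bar>v\<bar> \<ge> 4/3")
  case True
  then show ?thesis by (auto simp: psis_large phis_large)
next
  case False
  have "\<bar>d\<bar> = 1"
  proof -
    have "\<bar>real_of_int d\<bar> < 3" using False assms(2) by linarith
    then have "\<bar>d\<bar> < 3" by linarith
    then show ?thesis using assms(1) by presburger
  qed
  then have uv: "\<bar>v - u\<bar> = 1" using assms(2) by simp
  show ?thesis
  proof (cases "\<bar>u\<bar> \<le> 1/3 \<or> \<bar>v\<bar> \<le> 1/3")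
    case True
    then show ?thesis
    proof
      assume "\<bar>u\<bar> \<le> 1/3"
      moreover then have "\<bar>v\<bar> \<ge> 2/3" using uv by linarith
      ultimately show ?thesis by (simp add: psis_small phis_large)
    next
      assume "\<bar>v\<bar> \<le> 1/3"
      moreover then have "\<bar>u\<bar> \<ge> 2/3" using uv by linarith
      ultimately show ?thesis by (simp add: psis_small phis_large)
    qed
  next
    case f2: False
    have s: "\<bar>u\<bar> + \<bar>v\<bar> = 1" using uv False f2 by linarith
    then have "meyer_angle h v = pi / 2 - meyer_angle h u" by (rule mang_compl)
    moreover have "meyer_angle h (u/2) = 0" "meyer_angle h (v/2) = 0" using s f2
        by (auto intro!: mang_small)
    ultimately show ?thesis
      by (simp add: meyer_high_def meyer_low_def sin_diff cos_diff)
  qed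
qed

text \<open>A nonzero even difference has absolute value at least 2, so one point is beyond 2/3,
  which kills the last product. Either both points are, where \<open>meyer_high\<close> is
  \<open>meyer_low\<close> at half the argument, or one of them is beyond 4/3 and everything
  vanishes.\<close>

lemma psis_even:
  assumes "even d" "d \<noteq> 0" "v - u = of_int d"
  shows "meyer_high h u * meyer_high h v = meyer_low h (u/2) * meyer_low h (v/2) - meyer_low h u
      * meyer_low h v"
proof -
  have "\<bar>d\<bar> \<ge> 2" using assms(1,2) by (auto elim!: evenE)
  then have "\<bar>real_of_int d\<bar> \<ge> 2" by linarith
  then have uv: "\<bar>v - u\<bar> \<ge> 2" using assms(3) by simp
  then have "meyer_low h u * meyer_low h v = 0"
    by (cases "\<bar>u\<bar> \<ge> 2/3") (auto simp: phis_large)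
  moreover have "meyer_high h u * meyer_high h v = meyer_low h (u/2) * meyer_low h (v/2)"
  proof (cases "\<bar>u\<bar> \<ge> 2/3 \<and> \<bar>v\<bar> \<ge> 2/3")
    case True
    then show ?thesis by (simp add: meyer_high_def meyer_low_def mang_large)
  next
    case False
    then have "\<bar>u\<bar> \<ge> 4/3 \<or> \<bar>v\<bar> \<ge> 4/3" using uv by linarith
    then show ?thesis by (auto simp: psis_large phis_large)
  qed
  ultimately show ?thesis by simp
qed

lemma wc_cnj: "cnj (wav_ft h i k l) = wav_ft h i k (-l)"
  by (simp add: wav_ft_def cis_cnj psis_minus)

lemma wc_0: "l \<notin> freqs i \<Longrightarrow> wav_ft h i k l = 0"
proof (cases i)
  case (Suc j)
  assume "l \<notin> freqs i"
  then have "\<bar>l\<bar> \<ge> 2 ^ Suc j" by (simp add: freqs_def Suc)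
  then have "\<bar>real_of_int l\<bar> \<ge> 2 ^ Suc j"
    by (metis of_int_abs of_int_le_iff of_int_numeral of_int_power)
  then have "\<bar>of_int l / 2 ^ j\<bar> \<ge> (4/3::real)" by (simp add: abs_divide field_simps)
  then show ?thesis by (simp add: wav_ft_def psis_large Suc)
qed (simp add: wav_ft_def freqs_def)

text \<open>The factor 2 stems from the shift of levels: the squared normalization is 2 to the power
  -(i - 1). The bound does not depend on position or frequency, so one variance will serve a whole
  level.\<close>

lemma norm_wc: "(norm (wav_ft h i k l))\<^sup>2 \<le> 2 * 2 powr (- real i)"
proof (cases i)
  case 0
  then show ?thesis by (simp add: wav_ft_def)
next
  case (Suc j)
  have "(norm (wav_ft h i k l))\<^sup>2 = (2 powr (- real j / 2))\<^sup>2 * (meyer_high h (of_int l / 2 ^ j))\<^sup>2"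
    by (simp add: wav_ft_def Suc norm_mult power_mult_distrib)
  also have "\<dots> \<le> (2 powr (- real j / 2))\<^sup>2 * 1"
    using psis_le_1[of "of_int l / 2 ^ j"] by (intro mult_left_mono) (auto simp: abs_square_le_1)
  also have "\<dots> = 2 * 2 powr (- real i)"
    using powr_add[of 2 1 "- real i"] by (simp add: Suc powr_power)
  finally show ?thesis .
qed

text \<open>Summing over the positions is summing over roots of unity, which leaves only pairs of
  frequencies congruent modulo \<open>2 ^ j\<close>.\<close>

lemma level_kernel:
  "(\<Sum>k\<in>widx (Suc j). wav_ft h (Suc j) k l * cnj (wav_ft h (Suc j) k m)) =
   (if 2 ^ j dvd m - l then of_real (meyer_high h (of_int l / 2 ^ j)
       * meyer_high h (of_int m / 2 ^ j)) * cis (pi * of_int (l - m) / 2 ^ j) else 0)"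
proof -
  define u v where "u = real_of_int l / 2 ^ j" and "v = real_of_int m / 2 ^ j"
  have p: "2 powr (- real j / 2) * 2 powr (- real j / 2) = 1 / (2 ^ j :: real)"
    by (simp add: powr_add[symmetric] powr_minus powr_realpow field_simps)
  have "wav_ft h (Suc j) k l * cnj (wav_ft h (Suc j) k m) =
     of_real (1 / 2 ^ j * (meyer_high h u * meyer_high h v)) * cis (pi * of_int (l - m) / 2 ^ j)
         * fexp (m - l) (real k / real (2 ^ j))" for k
  proof -
    have "wav_ft h (Suc j) k l * cnj (wav_ft h (Suc j) k m) =
      of_real ((2 powr (- real j / 2) * 2 powr (- real j / 2)) * (meyer_high h u * meyer_high h v)) *
        (cis (pi * u) * cis (- 2 * pi * u * real k) * cis (- (pi * v)) * cis (2 * pi * v * real k))"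
      by (simp add: wav_ft_def u_def v_def cis_cnj mult_ac)
    also have "cis (pi * u) * cis (- 2 * pi * u * real k) * cis (- (pi * v)) * cis (2 * pi * v
        * real k) =
       cis (pi * of_int (l - m) / 2 ^ j) * fexp (m - l) (real k / real (2 ^ j))"
      by (simp only: cis_mult fexp_def) (simp add: u_def v_def field_simps)
    finally show ?thesis unfolding p by (simp only: mult.assoc)
  qed
  then have "(\<Sum>k\<in>widx (Suc j). wav_ft h (Suc j) k l * cnj (wav_ft h (Suc j) k m)) =
    of_real (1 / 2 ^ j * (meyer_high h u * meyer_high h v)) * cis (pi * of_int (l - m) / 2 ^ j)
        * (\<Sum>k<2^j. fexp (m - l) (real k / real (2 ^ j)))"
    by (simp add: widx_Suc sum_distrib_left)
  also have "(\<Sum>k<2^j. fexp (m - l) (real k / real (2 ^ j))) = (if 2 ^ j dvd m - l then 2 ^ j else 0)"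
    using sum_roots_of_unity[of "2 ^ j" "m - l"] by simp
  finally show ?thesis by (simp add: u_def v_def)
qed

text \<open>Level \<open>j + 1\<close> contributes exactly the difference of the kernels on the right-hand side for
  \<open>j + 1\<close> and \<open>j\<close>, so the sum telescopes.\<close>

lemma kernel_sum:
  "(\<Sum>i\<le>J. \<Sum>k\<in>widx i. wav_ft h i k l * cnj (wav_ft h i k m)) =
   (if 2 ^ J dvd m - l then of_real (meyer_low h (of_int l / 2 ^ J)
       * meyer_low h (of_int m / 2 ^ J)) else 0)"
proof (induction J)
  case 0
  have p: "meyer_low h (of_int l) = (if l = 0 then 1 else 0)" for l
  proof (cases "l = 0")
    case False
    then have "\<bar>l\<bar> \<ge> 1" by simp
    then have "\<bar>real_of_int l\<bar> \<ge> 1" by (metis of_int_1_le_iff of_int_abs)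
    then show ?thesis using False by (simp add: phis_large)
  qed (simp add: phis_small)
  show ?case by (simp add: widx_0 wav_ft_def p)
next
  case (Suc j)
  define u v where "u = real_of_int l / 2 ^ j" and "v = real_of_int m / 2 ^ j"
  have eq: "(\<Sum>i\<le>Suc j. \<Sum>k\<in>widx i. wav_ft h i k l * cnj (wav_ft h i k m)) =
    (if 2 ^ j dvd m - l then of_real (meyer_low h u * meyer_low h v) + of_real (meyer_high h u
        * meyer_high h v) * cis (pi * of_int (l - m) / 2 ^ j) else 0)"
    by (simp add: Suc.IH level_kernel u_def v_def)
  have half: "real_of_int l / 2 ^ Suc j = u / 2" "real_of_int m / 2 ^ Suc j = v / 2"
      by (simp_all add: u_def v_def)
  show ?case
  proof (cases "2 ^ j dvd m - l")
    case False
    then have "\<not> 2 ^ Suc j dvd m - l" by (metis dvd_mult_left mult.commute power_Suc)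
    then show ?thesis using False eq by simp
  next
    case True
    then obtain d where d: "m - l = 2 ^ j * d" by auto
    then have mj: "real_of_int m - real_of_int l = 2 ^ j * of_int d"
      by (metis of_int_diff of_int_mult of_int_numeral of_int_power)
    then have uv: "v - u = of_int d" by (simp add: u_def v_def field_simps)
    \<comment> \<open>The half-step phase becomes the sign given by the parity of \<open>d\<close>.
      For odd \<open>d\<close> the new level cancels the old kernel; for even \<open>d\<close> it
      turns it into the kernel at half the argument.\<close>
    have c: "cis (pi * of_int (l - m) / 2 ^ j) = (if even d then 1 else -1)"
    proof -
      have "pi * of_int (l - m) / 2 ^ j = - (pi * of_int d)"
        using mj by (simp add: field_simps)
      then have "cis (pi * of_int (l - m) / 2 ^ j) = cis (- (pi * of_int d))" by simp
      also have "\<dots> = (if even d then 1 else -1)"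
        by (auto simp: complex_eq_iff elim!: evenE oddE)
      finally show ?thesis .
    qed
    have dv: "2 ^ Suc j dvd m - l \<longleftrightarrow> even d" unfolding d by simp
    consider "d = 0" | "even d" "d \<noteq> 0" | "odd d" by blast
    then show ?thesis
    proof cases
      case 1
      then have "v = u" using uv by simp
      then show ?thesis unfolding eq half dv c using 1 True psis_sq[of u]
          by (simp flip: of_real_add of_real_mult)
    next
      case 2
      then show ?thesis unfolding eq half dv c using True psis_even[OF 2 uv]
          by (simp flip: of_real_add of_real_mult)
    next
      case 3
      then show ?thesis unfolding eq half dv c using True psis_odd[OF 3 uv] by simp
    qed
  qed
qed

text \<open>\<open>l\<close> lies on the plateau where \<open>meyer_low\<close> is 1, and any other
  \<open>m\<close> congruent to \<open>l\<close> is at least \<open>2 ^ J\<close> away from it,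
  hence beyond 2/3 of \<open>2 ^ J\<close>, where \<open>meyer_low\<close> vanishes.\<close>

lemma kernel_complete:
  assumes "3 * \<bar>l\<bar> \<le> 2 ^ J"
  shows "(\<Sum>i\<le>J. \<Sum>k\<in>widx i. wav_ft h i k l * cnj (wav_ft h i k m)) = (if l = m then 1 else 0)"
proof -
  have "real_of_int (3 * \<bar>l\<bar>) \<le> 2 ^ J" using assms by (metis of_int_le_iff of_int_numeral of_int_power)
  then have l: "3 * \<bar>real_of_int l\<bar> \<le> 2 ^ J" by simp
  then have pl: "meyer_low h (of_int l / 2 ^ J) = 1" by (intro phis_small) (simp add: abs_divide
      field_simps)
  show ?thesis
  proof (cases "l = m")
    case True
    then show ?thesis using pl by (simp add: kernel_sum)
  next
    case False
    have "meyer_low h (of_int m / 2 ^ J) = 0" if "2 ^ J dvd m - l"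
    proof (rule phis_large)
      have "2 ^ J \<le> \<bar>m - l\<bar>" using that False by (intro dvd_imp_le_int[of "m-l" "2^J", simplified]) auto
      then have "real_of_int (2 ^ J) \<le> of_int \<bar>m - l\<bar>" by (simp only: of_int_le_iff)
      then have "2 ^ J \<le> \<bar>real_of_int m\<bar> + \<bar>real_of_int l\<bar>" by simp
      then have "3 * \<bar>real_of_int m\<bar> \<ge> 2 * 2 ^ J" using l by simp
      then show "2/3 \<le> \<bar>of_int m / 2 ^ J :: real\<bar>" by (simp add: abs_divide field_simps)
    qed
    then show ?thesis using False by (simp add: kernel_sum)
  qed
qed


lemma C2_scale: "C2 f \<Longrightarrow> C2 (\<lambda>x. f (a * x))"
  using C2_affine[of f a 0] by simp

lemma C2_mang: "C2 (meyer_angle h)"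
proof -
  have "C2 (\<lambda>u. pi / 2 * (h (3 * u + (-1)) + h (-3 * u + (-1))))"
    by (intro C2_mult C2_const C2_add C2_affine C2_meyer_aux)
  then show ?thesis by (simp add: meyer_angle_def[abs_def])
qed

lemma C2_phis: "C2 (meyer_low h)"
  unfolding meyer_low_def[abs_def] by (intro C2_sin_cos C2_mang)

lemma C2_psis: "C2 (meyer_high h)"
proof -
  have "C2 (\<lambda>u. meyer_angle h (1/2 * u))" by (rule C2_scale[OF C2_mang])
  then have "C2 (\<lambda>u. sin (meyer_angle h u) * cos (meyer_angle h (1/2 * u)))"
    by (intro C2_mult C2_sin_cos C2_mang)
  then show ?thesis by (simp add: meyer_high_def[abs_def])
qed

lemma scaling_ft: "meyer_scaling_ft h \<xi> = of_real (meyer_low h (\<xi> / (2 * pi)))"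
proof -
  have m: "meyer_angle h (\<xi> / (2 * pi)) = pi / 2 * h (3 * \<bar>\<xi>\<bar> / (2 * pi) - 1)"
    by (simp add: mang_abs abs_divide)
  have "\<bar>\<xi>\<bar> \<le> 2 * pi / 3 \<Longrightarrow> meyer_low h (\<xi> / (2 * pi)) = 1"
    by (rule phis_small) (simp add: abs_divide field_simps)
  moreover have "\<bar>\<xi>\<bar> > 4 * pi / 3 \<Longrightarrow> meyer_low h (\<xi> / (2 * pi)) = 0"
    by (rule phis_large) (simp add: abs_divide field_simps)
  ultimately show ?thesis
    by (auto simp: meyer_scaling_ft_def meyer_low_def m not_le)
qed

text \<open>On each of the four ranges one factor of \<open>meyer_high\<close> is constantly 0 or 1,
  and what remains is the branch of the case definition. The product form makes the smoothness
  across the breakpoints visible.\<close>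

lemma wavelet_ft: "meyer_wavelet_ft h \<xi> = of_real (meyer_high h (\<xi> / (2 * pi))) * cis (\<xi> / 2)"
proof -
  have m: "meyer_angle h (\<xi> / (2 * pi)) = pi / 2 * h (3 * \<bar>\<xi>\<bar> / (2 * pi) - 1)"
    "meyer_angle h (\<xi> / (2 * pi) / 2) = pi / 2 * h (3 * \<bar>\<xi>\<bar> / (4 * pi) - 1)"
    by (simp_all add: mang_abs abs_divide mult.commute)
  have m2: "meyer_angle h (\<xi> / (4 * pi)) = pi / 2 * h (3 * \<bar>\<xi>\<bar> / (4 * pi) - 1)"
    by (simp add: mang_abs abs_divide)
  have e: "exp (\<i> * of_real \<xi> / 2) = cis (\<xi> / 2)" by (simp add: cis_conv_exp)
  consider "\<bar>\<xi>\<bar> < 2 * pi / 3" | "2 * pi / 3 \<le> \<bar>\<xi>\<bar>" "\<bar>\<xi>\<bar> \<le> 4 * pi / 3" 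
    | "4 * pi / 3 < \<bar>\<xi>\<bar>" "\<bar>\<xi>\<bar> \<le> 8 * pi / 3" | "8 * pi / 3 < \<bar>\<xi>\<bar>" by linarith
  then show ?thesis
  proof cases
    case 1
    then have "meyer_high h (\<xi> / (2 * pi)) = 0" by (intro psis_small) (simp add: abs_divide field_simps)
    then show ?thesis using 1 by (simp add: meyer_wavelet_ft_def)
  next
    case 2
    have "meyer_angle h (\<xi> / (2 * pi) / 2) = 0" using 2
        by (intro mang_small) (simp add: abs_divide field_simps)
    then show ?thesis using 2 by (simp add: meyer_wavelet_ft_def e meyer_high_def m(1))
  next
    case 3
    have ang: "meyer_angle h (\<xi> / (2 * pi)) = pi / 2" using 3
        by (intro mang_large) (simp add: abs_divide field_simps)
    have "sin (meyer_angle h (\<xi> / (2 * pi))) = 1" unfolding ang by (rule sin_pi_half)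
    moreover have "\<not> \<bar>\<xi>\<bar> < 2 * pi / 3" "\<not> \<bar>\<xi>\<bar> \<le> 4 * pi / 3" using 3 pi_gt_zero by linarith+
    ultimately show ?thesis using 3 by (simp add: meyer_wavelet_ft_def e meyer_high_def m2)
  next
    case 4
    then have "meyer_high h (\<xi> / (2 * pi)) = 0" by (intro psis_large) (simp add: abs_divide field_simps)
    moreover have "\<not> \<bar>\<xi>\<bar> < 2 * pi / 3" "\<not> \<bar>\<xi>\<bar> \<le> 4 * pi / 3" "\<not> \<bar>\<xi>\<bar> \<le> 8 * pi / 3" using 4 pi_gt_zero
        by linarith+
    ultimately show ?thesis by (simp add: meyer_wavelet_ft_def)
  qed
qed

lemma inv_fourier_ftint: "inv_fourier F x = Re (fourier_int F x / (2 * pi))"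
proof -
  have "exp (\<i> * of_real \<xi> * of_real x) = cis (\<xi> * x)" for \<xi> by (simp add: cis_conv_exp mult_ac)
  then show ?thesis by (simp add: inv_fourier_def fourier_int_def)
qed

text \<open>Hermitian symmetry makes the finite sum equal to its conjugate, so that taking real
  parts in the definition of the inverse transform loses nothing.\<close>

lemma periodize_series:
  assumes F: "C2 F" and supp: "\<And>\<xi>. \<bar>\<xi>\<bar> \<ge> 2 * pi * real N \<Longrightarrow> F \<xi> = 0"
    and herm: "\<And>\<xi>. F (- \<xi>) = cnj (F \<xi>)" and g: "\<And>y. g y = Re (fourier_int F y / (2 * pi))"
  shows "of_real (periodize g x) = (\<Sum>m\<in>{-int N..int N}. F (2 * pi * of_int m) * fexp m x)"
    (is "_ = ?S")
proof -
  have "((\<lambda>l::int. g (x + of_int l)) has_sum Re ?S) UNIV"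
    unfolding g by (rule has_sum_Re[OF poisson_summation[OF F supp]])
  then have p: "periodize g x = Re ?S" unfolding periodize_def by (rule infsumI)
  have "cnj ?S = (\<Sum>m\<in>{-int N..int N}. F (2 * pi * of_int (-m)) * fexp (-m) x)"
    using herm by (simp add: cnj_ee)
  also have "\<dots> = ?S"
    by (rule sum.reindex_bij_witness[of _ uminus uminus]) auto
  finally have "cnj ?S = ?S" .
  then have "of_real (Re ?S) = ?S" by (intro of_real_Re) (simp only: Reals_cnj_iff)
  then show ?thesis unfolding p .
qed

text \<open>The transform of the dilated and translated wavelet, with every argument in the form
  constant times \<eta> that the closure rules of \<open>C2\<close> accept.\<close>

definition dilated_ft :: "nat \<Rightarrow> nat \<Rightarrow> real \<Rightarrow> complex" where
  "dilated_ft j k \<eta> = of_real (2 powr (- real j / 2) * meyer_high h (1 / (2 * pi * 2 ^ j) * \<eta>)) *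
     cis (1 / (2 * 2 ^ j) * \<eta>) * cis (- (real k / 2 ^ j) * \<eta>)"

lemma C2_dilft: "C2 (dilated_ft j k)"
  unfolding dilated_ft_def[abs_def]
  by (intro C2_mult C2_of_real C2_const C2_scale[OF C2_psis] C2_cis C2_ident)

lemma dilft_supp: "\<bar>\<eta>\<bar> \<ge> 2 * pi * real (2 ^ Suc j) \<Longrightarrow> dilated_ft j k \<eta> = 0"
proof -
  assume "\<bar>\<eta>\<bar> \<ge> 2 * pi * real (2 ^ Suc j)"
  then have "\<bar>1 / (2 * pi * 2 ^ j) * \<eta>\<bar> \<ge> 4/3" by (simp add: abs_mult field_simps)
  then show ?thesis by (simp add: dilated_ft_def psis_large)
qed

lemma dilft_herm: "dilated_ft j k (- \<eta>) = cnj (dilated_ft j k \<eta>)"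
  using psis_minus by (simp add: dilated_ft_def cis_cnj)

lemma dilft_wc: "dilated_ft j k (2 * pi * of_int m) = wav_ft h (Suc j) k m"
  by (simp add: dilated_ft_def wav_ft_def mult_ac)

text \<open>The substitution of 2^j \<xi> for \<eta>. The second part concerns the modulus of the
  whole integral, to which the decay from \<open>ftint_decay\<close> applies.\<close>

lemma dilate_wavelet:
  "dilate (meyer_wavelet h) j k y = Re (fourier_int (dilated_ft j k) y / (2 * pi))"
  "norm (fourier_int (dilated_ft j k) y) = 2 powr (real j / 2)
      * norm (fourier_int (meyer_wavelet_ft h) (2 ^ j * y - real k))"
proof -
  have p: "2 ^ j * 2 powr (- real j / 2) = 2 powr (real j / 2)"
    by (simp add: powr_realpow[symmetric] powr_add[symmetric])
  have "fourier_int (dilated_ft j k) y = of_real (2 ^ j) * (LINT \<xi>|lborel. dilated_ft j k (2 ^ j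
      * \<xi>) * cis (2 ^ j * \<xi> * y))"
    unfolding fourier_int_def
    using lborel_integral_real_affine[of "2^j" "\<lambda>\<eta>. dilated_ft j k \<eta> * cis (\<eta> * y)" 0]
        by (simp add: scaleR_conv_of_real)
  also have "(\<lambda>\<xi>. dilated_ft j k (2 ^ j * \<xi>) * cis (2 ^ j * \<xi> * y)) =
      (\<lambda>\<xi>. of_real (2 powr (- real j / 2)) * (meyer_wavelet_ft h \<xi> * cis (\<xi> * (2 ^ j * y - real k))))"
  proof
    fix \<xi>
    have 1: "dilated_ft j k (2 ^ j * \<xi>) = of_real (2 powr (- real j / 2) * meyer_high h (\<xi> / (2
        * pi))) * (cis (\<xi> / 2) * cis (- (real k * \<xi>)))"
      by (simp add: dilated_ft_def)
    have 2: "cis (- (real k * \<xi>)) * cis (2 ^ j * \<xi> * y) = cis (\<xi> * (2 ^ j * y - real k))"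
      unfolding cis_mult by (simp add: algebra_simps)
    show "dilated_ft j k (2 ^ j * \<xi>) * cis (2 ^ j * \<xi> * y) =
      of_real (2 powr (- real j / 2)) * (meyer_wavelet_ft h \<xi> * cis (\<xi> * (2 ^ j * y - real k)))"
      unfolding 1 wavelet_ft 2[symmetric] by (simp add: mult_ac)
  qed
  also have "of_real (2 ^ j) * (LINT \<xi>|lborel. of_real (2 powr (- real j / 2))
      * (meyer_wavelet_ft h \<xi> * cis (\<xi> * (2 ^ j * y - real k)))) =
     of_real (2 ^ j * 2 powr (- real j / 2)) * fourier_int (meyer_wavelet_ft h) (2 ^ j * y - real k)"
    unfolding fourier_int_def by (simp only: integral_mult_right_zero of_real_mult mult.assoc)
  finally have eq: "fourier_int (dilated_ft j k) y = of_real (2 powr (real j / 2))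
      * fourier_int (meyer_wavelet_ft h) (2 ^ j * y - real k)"
    unfolding p .
  show "dilate (meyer_wavelet h) j k y = Re (fourier_int (dilated_ft j k) y / (2 * pi))"
    unfolding dilate_def meyer_wavelet_def inv_fourier_ftint eq
        by (simp add: Re_divide_of_real[of _ "2*pi", simplified])
  show "norm (fourier_int (dilated_ft j k) y) = 2 powr (real j / 2)
      * norm (fourier_int (meyer_wavelet_ft h) (2 ^ j * y - real k))"
    unfolding eq by (simp add: norm_mult)
qed

text \<open>Poisson summation with the frequency bound taken from the support: 1 for the scaling
  function, where only the frequency 0 survives, and \<open>2 ^ Suc j\<close> for the
  wavelets.\<close>

lemma wav_series:
  assumes "k \<in> widx i"
  shows "of_real (wav h i k x) = (\<Sum>l\<in>freqs i. wav_ft h i k l * fexp l x)"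
proof (cases i)
  case 0
  have "C2 (\<lambda>\<xi>. of_real (meyer_low h (1 / (2 * pi) * \<xi>)) :: complex)"
    by (intro C2_of_real C2_scale C2_phis)
  then have c: "C2 (meyer_scaling_ft h)" by (simp add: scaling_ft[abs_def])
  have "of_real (periodize (dilate (meyer_scaling h) 0 0) x) =
     (\<Sum>m\<in>{-int 1..int 1}. meyer_scaling_ft h (2 * pi * of_int m) * fexp m x)"
  proof (rule periodize_series[OF c])
    show "meyer_scaling_ft h \<xi> = 0" if "2 * pi * real 1 \<le> \<bar>\<xi>\<bar>" for \<xi>
      using that unfolding scaling_ft by (subst phis_large) (auto simp: abs_divide field_simps)
    show "meyer_scaling_ft h (-\<xi>) = cnj (meyer_scaling_ft h \<xi>)" for \<xi>
      unfolding scaling_ft using mang_minus[of "\<xi> / (2 * pi)"] by (simp add: meyer_low_def)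
    show "dilate (meyer_scaling h) 0 0 y = Re (fourier_int (meyer_scaling_ft h) y / (2 * pi))" for y
      by (simp add: dilate_def meyer_scaling_def inv_fourier_ftint)
  qed
  also have "\<dots> = (\<Sum>m\<in>{0::int}. fexp m x)"
  proof (rule sum.mono_neutral_cong_right)
    show "\<forall>m\<in>{-int 1..int 1} - {0}. meyer_scaling_ft h (2 * pi * of_int m) * fexp m x = 0"
    proof
      fix m assume "m \<in> {-int 1..int 1} - {0}"
      then have "\<bar>m\<bar> = 1" by auto
      then have "\<bar>real_of_int m\<bar> = 1" by linarith
      then show "meyer_scaling_ft h (2 * pi * of_int m) * fexp m x = 0" unfolding scaling_ft
          by (simp add: phis_large)
    qed
  qed (auto simp: scaling_ft phis_small)
  also have "\<dots> = (\<Sum>l\<in>freqs i. wav_ft h i k l * fexp l x)"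
  proof -
    have "freqs 0 = {0}" by (auto simp: freqs_def)
    then show ?thesis by (simp add: 0 wav_ft_def)
  qed
  finally show ?thesis using assms by (simp add: 0 wav_def per_wavelet_def)
next
  case (Suc j)
  have "of_real (periodize (dilate (meyer_wavelet h) j k) x) =
     (\<Sum>m\<in>{-int (2 ^ Suc j)..int (2 ^ Suc j)}. dilated_ft j k (2 * pi * of_int m) * fexp m x)"
    by (rule periodize_series[OF C2_dilft]) (rule dilft_supp dilft_herm dilate_wavelet; simp)+
  also have "\<dots> = (\<Sum>l\<in>freqs i. wav_ft h i k l * fexp l x)"
  proof (rule sum.mono_neutral_cong_right)
    show "freqs i \<subseteq> {-int (2 ^ Suc j)..int (2 ^ Suc j)}" by (auto simp: freqs_def Suc)
    show "\<forall>m\<in>{-int (2 ^ Suc j)..int (2 ^ Suc j)} - freqs i. dilated_ft j k (2 * pi * of_int m)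
        * fexp m x = 0"
      using wc_0[of _ i k] by (auto simp: dilft_wc Suc)
  qed (auto simp: dilft_wc Suc)
  finally show ?thesis by (simp add: Suc wav_def per_wavelet_def)
qed

lemma wav_continuous: "k \<in> widx i \<Longrightarrow> continuous_on A (wav h i k)"
proof -
  assume k: "k \<in> widx i"
  have "wav h i k x = Re (\<Sum>l\<in>freqs i. wav_ft h i k l * fexp l x)" for x
    using wav_series[OF k, of x] by (metis Re_complex_of_real)
  then have "wav h i k = (\<lambda>x. Re (\<Sum>l\<in>freqs i. wav_ft h i k l * fexp l x))" by auto
  then show ?thesis by (simp only:) (intro continuous_intros)
qed

lemma wav_periodic: "k \<in> widx i \<Longrightarrow> wav h i k (x + of_int m) = wav h i k x"
proof -
  assume k: "k \<in> widx i"
  have "complex_of_real (wav h i k (x + of_int m)) = of_real (wav h i k x)"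
    unfolding wav_series[OF k] ee_plus_int ..
  then show ?thesis by (simp only: of_real_eq_iff)
qed

lemma wav_shift:
  assumes "k \<in> widx (Suc j)"
  shows "wav h (Suc j) k x = wav h (Suc j) 0 (x - real k / 2 ^ j)"
proof -
  have "0 \<in> widx (Suc j)" by (simp add: widx_Suc)
  have "wav_ft h (Suc j) k l * fexp l x = wav_ft h (Suc j) 0 l * fexp l (x - real k / 2 ^ j)" for l
  proof -
    have "cis (- 2 * pi * (of_int l / 2 ^ j) * real k) * fexp l x = fexp l (x - real k / 2 ^ j)"
      unfolding fexp_def cis_mult by (simp add: algebra_simps)
    then show ?thesis by (simp add: wav_ft_def mult_ac)
  qed
  then have "complex_of_real (wav h (Suc j) k x) = of_real (wav h (Suc j) 0 (x - real k / 2 ^ j))"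
    using wav_series[OF assms] wav_series[OF \<open>0 \<in> widx (Suc j)\<close>] by simp
  then show ?thesis by (simp only: of_real_eq_iff)
qed

lemma wav_0: "wav h 0 0 x = 1"
proof -
  have "freqs 0 = {0}" by (auto simp: freqs_def)
  then have "complex_of_real (wav h 0 0 x) = of_real 1"
    using wav_series[of 0 0 x] by (simp add: widx_0 wav_ft_def)
  then show ?thesis by (simp only: of_real_eq_iff)
qed

end

section \<open>Size of the periodized wavelets\<close>

lemma infsum_decay_uniform:
  fixes y :: real
  shows "(\<Sum>\<^sub>\<infinity>m::int. 1 / (1 + (y + of_int m)\<^sup>2)) \<le> 4 * (\<Sum>\<^sub>\<infinity>m::int. 1 / (1 + (real_of_int m)\<^sup>2))"
proof -
  have "(\<Sum>\<^sub>\<infinity>m::int. 1 / (1 + (y + of_int m)\<^sup>2)) = (\<Sum>\<^sub>\<infinity>m::int. 1 / (1 + (frac y + of_int (m + \<lfloor>y\<rfloor>))\<^sup>2))"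
    by (intro infsum_cong) (simp add: frac_def)
  also have "\<dots> = (\<Sum>\<^sub>\<infinity>m::int. 1 / (1 + (frac y + of_int m)\<^sup>2))"
    by (rule infsum_reindex_bij_betw[of "\<lambda>m. m + \<lfloor>y\<rfloor>" UNIV UNIV "\<lambda>m. 1 / (1 + (frac y + of_int m)\<^sup>2)"])
       (rule bij_betw_byWitness[where f'="\<lambda>m. m - \<lfloor>y\<rfloor>"]; auto)
  also have "\<dots> \<le> (\<Sum>\<^sub>\<infinity>m::int. 4 * (1 / (1 + (real_of_int m)\<^sup>2)))"
  proof (rule infsum_mono)
    \<comment> \<open>Reindexing by the floor of \<open>y\<close> has reduced the shift to its
      fractional part; for shifts below 1 the factor in \<open>decay_shift\<close> is at most
      4.\<close>
    fix m :: int
    have "(frac y)\<^sup>2 \<le> 1" using frac_lt_1[of y] by (simp add: abs_square_le_1)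
    then have "2 * (1 + (frac y)\<^sup>2) * (1 / (1 + (real_of_int m)\<^sup>2)) \<le> 4 * (1 / (1 + (real_of_int m)\<^sup>2))"
      by (intro mult_right_mono) auto
    then show "1 / (1 + (frac y + of_int m)\<^sup>2) \<le> 4 * (1 / (1 + (real_of_int m)\<^sup>2))"
      using decay_shift[of "frac y" "of_int m"] by linarith
  qed (rule summable_on_int_decay summable_on_cmult_right summable_on_int_square)+
  also have "\<dots> = 4 * (\<Sum>\<^sub>\<infinity>m::int. 1 / (1 + (real_of_int m)\<^sup>2))"
    by (rule infsum_cmult_right') 
  finally show ?thesis .
qed

text \<open>The shifted interval is cut at 0 and its left piece moved by one period.\<close>

lemma integral_I01_shift:
  fixes g :: "real \<Rightarrow> 'a::euclidean_space"
  assumes g: "continuous_on UNIV g" "\<And>x. g (x + 1) = g x" and c: "0 \<le> c" "c \<le> 1"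
  shows "(LINT x|I01. g (x - c)) = (LINT x|I01. g x)"
proof -
  have hk: "(LINT x|I01. u x) = integral {0..1} u" if "continuous_on {0..1} u" for u :: "real \<Rightarrow> 'a"
    using set_borel_integral_eq_integral(2)[of "{0..1}" u] integrable_I01_continuous[OF that]
    by (simp add: set_integral_I01 set_integrable_I01)
  have int: "g integrable_on {a..b}" for a b
    by (rule integrable_continuous_interval) (rule continuous_on_subset[OF g(1)], simp)
  have "(LINT x|I01. g (x - c)) = integral {0..1} (\<lambda>x. g (x - c))"
    by (rule hk) (intro continuous_on_compose2[OF g(1)] continuous_intros, simp)
  also have "\<dots> = integral {0-c..1-c} g"
    using integral_shift_real_ivl[of 0 c 1 "\<lambda>x. g (x - c)"] by simp
  also have "\<dots> = integral {-c..0} g + integral {0..1-c} g"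
    using Henstock_Kurzweil_Integration.integral_combine[of "-c" 0 "1-c" g] c int by simp
  also have "integral {-c..0} g = integral {1-c..1} g"
  proof -
    have "integral {1-c-1..1-1} (\<lambda>x. g (x + 1)) = integral {1-c..1} g"
      by (rule integral_shift_real_ivl)
    then show ?thesis by (simp add: g(2))
  qed
  also have "integral {1-c..1} g + integral {0..1-c} g = integral {0..1} g"
    using Henstock_Kurzweil_Integration.integral_combine[of 0 "1-c" 1 g] c int by (simp add: add.commute)
  also have "\<dots> = (LINT x|I01. g x)" by (rule hk[symmetric]) (rule continuous_on_subset[OF g(1)], simp)
  finally show ?thesis .
qed

text \<open>The numbers \<open>2 ^ j * l - int k\<close> with \<open>k\<close> below
  \<open>2 ^ j\<close> and integer \<open>l\<close> run through the integers without repetition. The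
  sum over the positions of the periodized wavelets is thus dominated by a single sum of the
  quadratic decay over all integers, bounded uniformly in the point.\<close>

lemma wav_sum_bound:
  assumes h: "meyer_aux h"
  shows "\<exists>C\<ge>1. \<forall>i x. (\<Sum>k\<in>widx i. \<bar>wav h i k x\<bar>) \<le> C * 2 powr (real i / 2)"
proof -
  have ftC2: "C2 (meyer_wavelet_ft h)"
  proof -
    have "C2 (\<lambda>\<xi>. of_real (meyer_high h (1 / (2 * pi) * \<xi>)) * cis (1 / 2 * \<xi>))"
      by (intro C2_mult C2_of_real C2_scale[OF h C2_psis[OF h]] C2_cis C2_const C2_ident)
    then show ?thesis by (simp add: wavelet_ft[OF h, abs_def])
  qed
  have "meyer_wavelet_ft h \<xi> = 0" if "\<bar>\<xi>\<bar> \<ge> 3 * pi" for \<xi>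
    using that unfolding wavelet_ft[OF h] by (subst psis_large[OF h]) (auto simp: abs_divide field_simps)
  then obtain K where K: "K \<ge> 0" "\<And>x. norm (fourier_int (meyer_wavelet_ft h) x) \<le> K / (1 + x\<^sup>2)"
    using ftint_decay[OF ftC2, of "3 * pi"] by auto
  define S0 where "S0 = (\<Sum>\<^sub>\<infinity>m::int. 1 / (1 + (real_of_int m)\<^sup>2))"
  have S0: "S0 \<ge> 0" unfolding S0_def by (rule infsum_nonneg) simp
  \<comment> \<open>The 1 pays for the constant function of level 0.\<close>
  define C where "C = 1 + K * (4 * S0)"
  have "(\<Sum>k\<in>widx i. \<bar>wav h i k x\<bar>) \<le> C * 2 powr (real i / 2)" for i x
  proof (cases i)
    case 0
    then show ?thesis using K S0 by (simp add: widx_0 wav_0[OF h] C_def)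
  next
    case (Suc j)
    define q where "q m = 1 / (1 + (2 ^ j * x + of_int m)\<^sup>2)" for m :: int
    have qs: "q summable_on A" for A
      unfolding q_def by (rule summable_on_subset_banach[OF summable_on_int_decay]) simp
    define b where "b k l = 2 ^ j * l - int k" for k l
    have binj: "inj (b k)" for k by (auto simp: inj_def b_def)
    have w: "\<bar>wav h i k x\<bar> \<le> 2 powr (real j / 2) * K * infsum q (range (b k))" if k: "k \<in> widx i" for k
    proof -
      define g where "g = dilate (meyer_wavelet h) j k"
      have gb: "\<bar>g (x + of_int l)\<bar> \<le> 2 powr (real j / 2) * K * (q \<circ> b k) l" for l
      proof -
        have "\<bar>g (x + of_int l)\<bar> \<le> norm (fourier_int (dilated_ft h j k) (x + of_int l) / (2 * pi))"
          unfolding g_def dilate_wavelet(1)[OF h] by (rule abs_Re_le_cmod)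
        also have "\<dots> \<le> norm (fourier_int (dilated_ft h j k) (x + of_int l))"
        proof -
          have "norm (z / (2 * pi)) \<le> norm z" for z :: complex
          proof -
            have "norm z / (2 * pi) \<le> norm z / 1" by (rule divide_left_mono) (use pi_gt3 in auto)
            then show ?thesis by (simp add: norm_divide norm_mult)
          qed
          then show ?thesis by simp
        qed
        also have "\<dots> = 2 powr (real j / 2) * norm (fourier_int (meyer_wavelet_ft h) (2 ^ j * (x
            + of_int l) - real k))"
          by (rule dilate_wavelet(2)[OF h])
        also have "2 ^ j * (x + of_int l) - real k = 2 ^ j * x + of_int (b k l)"
          by (simp add: b_def algebra_simps)
        also have "2 powr (real j / 2) * norm (fourier_int (meyer_wavelet_ft h) (2 ^ j * x
            + of_int (b k l))) \<le>
            2 powr (real j / 2) * (K / (1 + (2 ^ j * x + of_int (b k l))\<^sup>2))"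
          by (intro mult_left_mono K) auto
        finally show ?thesis by (simp add: q_def)
      qed
      have qb: "(q \<circ> b k) summable_on UNIV" using qs binj summable_on_reindex by blast
      have gs: "(\<lambda>l::int. \<bar>g (x + of_int l)\<bar>) summable_on UNIV"
        by (rule summable_on_comparison_test[OF summable_on_cmult_right[OF qb]]) (use gb in auto)
      have "\<bar>wav h i k x\<bar> = norm (\<Sum>\<^sub>\<infinity>l::int. g (x + of_int l))"
        by (simp add: wav_def Suc per_wavelet_def g_def periodize_def)
      also have "\<dots> \<le> (\<Sum>\<^sub>\<infinity>l::int. norm (g (x + of_int l)))"
        by (rule norm_infsum_bound) (use gs in simp)
      also have "\<dots> \<le> (\<Sum>\<^sub>\<infinity>l. 2 powr (real j / 2) * K * (q \<circ> b k) l)"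
        by (rule infsum_mono) (use gs gb summable_on_cmult_right[OF qb] in auto)
      also have "\<dots> = 2 powr (real j / 2) * K * infsum (q \<circ> b k) UNIV" by (rule infsum_cmult_right')
      also have "infsum (q \<circ> b k) UNIV = infsum q (range (b k))" using binj by (simp add: infsum_reindex)
      finally show ?thesis .
    qed
    have disj: "range (b k) \<inter> range (b k') = {}" if "k \<in> widx i" "k' \<in> widx i" "k \<noteq> k'" for k k'
    proof (rule ccontr)
      assume "range (b k) \<inter> range (b k') \<noteq> {}"
      then obtain l l' where "2 ^ j * l - int k = 2 ^ j * l' - int k'" by (auto simp: b_def)
      then have "2 ^ j * (l - l') = int k - int k'" by (simp add: algebra_simps)
      then have "2 ^ j dvd int k - int k'" by (metis dvd_triv_left)
      moreover have "\<bar>int k - int k'\<bar> < 2 ^ j" 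
      proof -
        have "k < 2 ^ j" "k' < 2 ^ j" using that by (simp_all add: Suc widx_Suc)
        then have "int k < 2 ^ j" "int k' < 2 ^ j" by (metis of_nat_less_iff of_nat_numeral
            of_nat_power)+
        then show ?thesis by linarith
      qed
      ultimately show False using that(3) dvd_imp_le_int[of "int k - int k'" "2 ^ j"] by simp
    qed
    have "(\<Sum>k\<in>widx i. \<bar>wav h i k x\<bar>) \<le> (\<Sum>k\<in>widx i. 2 powr (real j / 2) * K * infsum q (range (b k)))"
      by (rule sum_mono) (rule w)
    also have "\<dots> = 2 powr (real j / 2) * K * infsum q (\<Union>k\<in>widx i. range (b k))"
      using sum_infsum[of "widx i" q "\<lambda>k. range (b k)"] qs disj
          by (simp add: sum_distrib_left[symmetric])
    also have "\<dots> \<le> 2 powr (real j / 2) * K * infsum q UNIV"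
      using K by (intro mult_left_mono infsum_mono2 qs) (auto simp: q_def)
    also have "\<dots> \<le> 2 powr (real j / 2) * K * (4 * S0)"
      using K infsum_decay_uniform[of "2 ^ j * x"] by (intro mult_left_mono) (auto simp:
          q_def[abs_def] S0_def)
    also have "\<dots> \<le> C * 2 powr (real j / 2)" by (simp add: C_def algebra_simps)
    also have "\<dots> \<le> C * 2 powr (real i / 2)" using K S0 by (intro mult_left_mono powr_mono) (auto
        simp: Suc C_def)
    finally show ?thesis .
  qed
  moreover have "C \<ge> 1" using K S0 by (simp add: C_def)
  ultimately show ?thesis by blast
qed

text \<open>The wavelets of one level are translates of each other, so each has the average of their norms.\<close>

lemma wav_integral_bound:
  assumes h: "meyer_aux h" and C: "C \<ge> 1" "\<And>i x. (\<Sum>k\<in>widx i. \<bar>wav h i k x\<bar>) \<le> C * 2 powr (real i / 2)"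
    and k: "k \<in> widx i"
  shows "(LINT x|I01. \<bar>wav h i k x\<bar>) \<le> 2 * C * 2 powr (- real i / 2)"
proof (cases i)
  case 0
  then show ?thesis using k C by (simp add: widx_0 wav_0[OF h])
next
  case (Suc j)
  have z: "0 \<in> widx i" by (simp add: Suc widx_Suc)
  have int: "integrable I01 (\<lambda>x. \<bar>wav h i k' x\<bar>)" if "k' \<in> widx i" for k'
    by (intro integrable_I01_continuous continuous_intros wav_continuous[OF h that])
  have eq: "(LINT x|I01. \<bar>wav h i k' x\<bar>) = (LINT x|I01. \<bar>wav h i 0 x\<bar>)" if "k' \<in> widx i" for k'
  proof -
    have "k' < 2 ^ j" using that by (simp add: Suc widx_Suc)
    then have "real k' \<le> 2 ^ j" by (metis less_imp_le of_nat_less_iff of_nat_numeral of_nat_power)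
    have "(LINT x|I01. \<bar>wav h i k' x\<bar>) = (LINT x|I01. \<bar>wav h i 0 (x - real k' / 2 ^ j)\<bar>)"
      using wav_shift[OF h, of k' j] that by (simp add: Suc)
    also have "\<dots> = (LINT x|I01. \<bar>wav h i 0 x\<bar>)"
      using \<open>real k' \<le> 2 ^ j\<close> wav_periodic[OF h z, of _ 1]
      by (intro integral_I01_shift[of "\<lambda>x. \<bar>wav h i 0 x\<bar>"] continuous_intros wav_continuous[OF h z]) auto
    finally show ?thesis .
  qed
  have "2 ^ j * (LINT x|I01. \<bar>wav h i k x\<bar>) = (\<Sum>k'\<in>widx i. LINT x|I01. \<bar>wav h i k' x\<bar>)"
  proof -
    have "(\<Sum>k'\<in>widx i. LINT x|I01. \<bar>wav h i k' x\<bar>) = (\<Sum>k'\<in>widx i. LINT x|I01. \<bar>wav h i k x\<bar>)"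
      by (intro sum.cong refl) (rule trans[OF eq eq[OF k, symmetric]])
    then show ?thesis by (simp add: Suc widx_Suc)
  qed
  also have "\<dots> = (LINT x|I01. (\<Sum>k'\<in>widx i. \<bar>wav h i k' x\<bar>))"
    using int by (subst Bochner_Integration.integral_sum) auto
  also have "\<dots> \<le> (LINT x|I01. C * 2 powr (real i / 2))"
    using int C(2) by (intro integral_mono) auto
  also have "\<dots> = C * 2 powr (real i / 2)" by simp
  also have "\<dots> = 2 ^ j * (2 * C * 2 powr (- real i / 2))"
  proof -
    have "2 powr (real i / 2) = 2 powr (real i) * 2 powr (- real i / 2)"
        by (simp add: powr_add[symmetric])
    also have "2 powr (real i) = 2 * 2 ^ j" by (simp add: Suc powr_realpow powr_add)
    finally show ?thesis by simp
  qed
  finally show ?thesis by simp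
qed


section \<open>Wavelet coefficients and the wavelet expansion\<close>

lemma fourier_coeff_I01: "fourier_coeff f l = (LINT x|I01. of_real (f x) * fexp (-l) x)"
proof -
  have "exp (- 2 * of_real pi * \<i> * of_int l * of_real t) = fexp (-l) t" for t
    by (simp add: fexp_def cis_conv_exp mult_ac)
  then show ?thesis by (simp add: fourier_coeff_def set_integral_I01)
qed

definition wav_coeff :: "(real \<Rightarrow> real) \<Rightarrow> (real \<Rightarrow> real) \<Rightarrow> nat \<Rightarrow> nat \<Rightarrow> real" where
  "wav_coeff h f i k = wavelet_coeff h f (int i - 1) k"

text \<open>A coefficient of level \<open>i\<close> involves only the frequencies in
  \<open>freqs i\<close>; this finiteness allows deconvolution by finitely many divisions. The
  wavelets are real, so the change of sign of the frequency is a conjugation.\<close>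

lemma wcoef_fourier:
  assumes h: "meyer_aux h" and f: "integrable I01 f" and k: "k \<in> widx i"
  shows "of_real (wav_coeff h f i k) = (\<Sum>m\<in>freqs i. cnj (wav_ft h i k m) * fourier_coeff f m)"
proof -
  have fi: "integrable I01 (\<lambda>x. complex_of_real (f x))" using f by simp
  have fe: "integrable I01 (\<lambda>x. complex_of_real (f x) * fexp l x)" for l
    by (rule integrable_mult_bounded_I01[where B=1]) (auto intro: fi)
  have "of_real (wav_coeff h f i k) = (LINT x|I01. complex_of_real (f x * wav h i k x))"
    unfolding wav_coeff_def wavelet_coeff_def set_integral_I01 wav_def
        by (rule integral_complex_of_real[symmetric])
  also have "\<dots> = (LINT x|I01. (\<Sum>l\<in>freqs i. wav_ft h i k l * (complex_of_real (f x) * fexp l x)))"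
    by (simp add: wav_series[OF h k] sum_distrib_left mult_ac)
  also have "\<dots> = (\<Sum>l\<in>freqs i. wav_ft h i k l * (LINT x|I01. complex_of_real (f x) * fexp l x))"
    using fe by (subst Bochner_Integration.integral_sum) auto
  also have "\<dots> = (\<Sum>m\<in>freqs i. wav_ft h i k (-m) * (LINT x|I01. complex_of_real (f x) * fexp (-m) x))"
    by (rule sum.reindex_bij_witness[of _ uminus uminus]) (auto simp: freqs_def)
  finally show ?thesis by (simp add: wc_cnj[OF h] fourier_coeff_I01)
qed

definition level_sum :: "(real \<Rightarrow> real) \<Rightarrow> (real \<Rightarrow> real) \<Rightarrow> nat \<Rightarrow> real \<Rightarrow> real" where
  "level_sum h f i x = (\<Sum>k\<in>widx i. wav_coeff h f i k * wav h i k x)"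

lemma dlev_continuous: "meyer_aux h \<Longrightarrow> continuous_on A (level_sum h f i)"
  unfolding level_sum_def[abs_def] by (intro continuous_intros wav_continuous)

text \<open>Inserting \<open>wcoef_fourier\<close> leaves the kernel of
  \<open>kernel_complete\<close>, which is the identity in the row of \<open>l\<close>. Partial sums
  thus reproduce the coefficient exactly and not only in the limit.\<close>

lemma fourier_coeff_dlev_sum:
  assumes h: "meyer_aux h" and f: "integrable I01 f" and J: "3 * \<bar>l\<bar> \<le> 2 ^ J"
  shows "(LINT x|I01. of_real (\<Sum>i\<le>J. level_sum h f i x) * fexp (-l) x) = fourier_coeff f l"
proof -
  have w: "(LINT x|I01. complex_of_real (wav h i k x) * fexp (-l) x) = wav_ft h i k l"
      if k: "k \<in> widx i" for i k
  proof -
    have "complex_of_real (wav h i k x) * fexp (-l) x = (\<Sum>m\<in>freqs i. wav_ft h i k m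
        * fexp (m - l) x)" for x
      using ee_add[of _ "-l" x] by (simp add: wav_series[OF h k] sum_distrib_right mult.assoc)
    then have "(LINT x|I01. complex_of_real (wav h i k x) * fexp (-l) x)
        = (LINT x|I01. (\<Sum>m\<in>freqs i. wav_ft h i k m * fexp (m - l) x))"
      by simp
    also have "\<dots> = (\<Sum>m\<in>freqs i. wav_ft h i k m * (LINT x|I01. fexp (m - l) x))"
      by (subst Bochner_Integration.integral_sum) (auto intro!: integrable_I01_continuous
          continuous_intros)
    also have "\<dots> = (\<Sum>m\<in>freqs i. if m = l then wav_ft h i k m else 0)"
      by (intro sum.cong) (auto simp: integral_ee)
    also have "\<dots> = wav_ft h i k l" using wc_0[OF h, of l i k] by (simp add: sum.delta)
    finally show ?thesis .
  qed
  \<comment> \<open>One finite set of frequencies for all levels up to \<open>J\<close>, so that the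
    sums can be exchanged; \<open>l\<close> is added to have the diagonal term present.\<close>
  define M where "M = freqs J \<union> {l}"
  have "(LINT x|I01. of_real (\<Sum>i\<le>J. level_sum h f i x) * fexp (-l) x) =
    (LINT x|I01. (\<Sum>i\<le>J. \<Sum>k\<in>widx i. of_real (wav_coeff h f i k) * (complex_of_real (wav h i k x)
        * fexp (-l) x)))"
    by (simp add: level_sum_def sum_distrib_right mult.assoc)
  also have "\<dots> = (\<Sum>i\<le>J. \<Sum>k\<in>widx i. of_real (wav_coeff h f i k)
      * (LINT x|I01. complex_of_real (wav h i k x) * fexp (-l) x))"
  proof -
    have int: "integrable I01 (\<lambda>x. complex_of_real (wav_coeff h f i k)
        * (complex_of_real (wav h i k x) * fexp (-l) x))" if "k \<in> widx i" for i k
      by (intro integrable_I01_continuous continuous_intros wav_continuous[OF h that])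
    show ?thesis
      by (subst Bochner_Integration.integral_sum, intro Bochner_Integration.integrable_sum int,
          assumption,
          intro sum.cong refl, subst Bochner_Integration.integral_sum, rule int, assumption, simp)
  qed
  also have "\<dots> = (\<Sum>i\<le>J. \<Sum>k\<in>widx i. (\<Sum>m\<in>M. cnj (wav_ft h i k m) * fourier_coeff f m) * wav_ft h i k l)"
  proof (intro sum.cong refl)
    fix i k assume i: "i \<in> {..J}" and k: "k \<in> widx i"
    have "freqs i \<subseteq> freqs J"
    proof
      fix m assume "m \<in> freqs i"
      then have "\<bar>m\<bar> < 2 ^ i" by (simp add: freqs_def)
      also have "(2::int) ^ i \<le> 2 ^ J" using i by (intro power_increasing) auto
      finally show "m \<in> freqs J" by (simp add: freqs_def)
    qed
    then have "(\<Sum>m\<in>freqs i. cnj (wav_ft h i k m) * fourier_coeff f m) = (\<Sum>m\<in>M. cnj (wav_ft h i k m)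
        * fourier_coeff f m)"
      using wc_0[OF h, of _ i k] by (intro sum.mono_neutral_left) (auto simp: M_def)
    then show "of_real (wav_coeff h f i k) * (LINT x|I01. complex_of_real (wav h i k x) * fexp (-l) x) =
      (\<Sum>m\<in>M. cnj (wav_ft h i k m) * fourier_coeff f m) * wav_ft h i k l"
      using w[OF k] wcoef_fourier[OF h f k] by simp
  qed
  also have "\<dots> = (\<Sum>i\<le>J. \<Sum>k\<in>widx i. \<Sum>m\<in>M. wav_ft h i k l * cnj (wav_ft h i k m) * fourier_coeff f m)"
    by (simp add: sum_distrib_left mult_ac)
  also have "\<dots> = (\<Sum>i\<le>J. \<Sum>m\<in>M. \<Sum>k\<in>widx i. wav_ft h i k l * cnj (wav_ft h i k m) * fourier_coeff f m)"
    by (intro sum.cong refl sum.swap)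
  also have "\<dots> = (\<Sum>m\<in>M. \<Sum>i\<le>J. \<Sum>k\<in>widx i. wav_ft h i k l * cnj (wav_ft h i k m) * fourier_coeff f m)"
    by (rule sum.swap)
  also have "\<dots> = (\<Sum>m\<in>M. (\<Sum>i\<le>J. \<Sum>k\<in>widx i. wav_ft h i k l * cnj (wav_ft h i k m)) * fourier_coeff f m)"
    by (simp add: sum_distrib_right)
  also have "\<dots> = (\<Sum>m\<in>M. if l = m then fourier_coeff f m else 0)"
    unfolding kernel_complete[OF h J] by (intro sum.cong) auto
  also have "\<dots> = fourier_coeff f l" by (simp add: M_def sum.delta)
  finally show ?thesis .
qed

text \<open>The uniform limit of the partial sums has the Fourier coefficients of \<open>f\<close>,
  because each of them is constant from some partial sum on; uniqueness identifies the two functions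
  up to a null set.\<close>

lemma wavelet_expansion:
  assumes h: "meyer_aux h" and f: "integrable I01 f"
    and B: "\<And>i x. \<bar>level_sum h f i x\<bar> \<le> B i" "summable B"
  shows "AE x in I01. f x = (\<Sum>i. level_sum h f i x)"
proof -
  define g where "g x = (\<Sum>i. level_sum h f i x)" for x
  have u: "uniform_limit UNIV (\<lambda>n x. \<Sum>i<n. level_sum h f i x) g sequentially"
    unfolding g_def using B by (intro Weierstrass_m_test) auto
  have gc: "continuous_on UNIV g"
    by (rule uniform_limit_theorem[OF _ u]) (auto intro!: always_eventually continuous_intros
        dlev_continuous[OF h])
  have fi: "integrable I01 (\<lambda>x. complex_of_real (f x))" using f by simp
  have gi: "integrable I01 (\<lambda>x. complex_of_real (g x) * fexp (-l) x)" for l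
    by (intro integrable_I01_continuous continuous_intros continuous_on_subset[OF gc]) auto
  have coef: "(LINT x|I01. complex_of_real (g x) * fexp (-l) x) = fourier_coeff f l" for l
  proof (rule LIMSEQ_unique)
    have "uniform_limit {0..1} (\<lambda>n x. of_real (\<Sum>i<n. level_sum h f i x)
        * fexp (-l) x) (\<lambda>x. of_real (g x) * fexp (-l) x) sequentially"
      unfolding uniform_limit_iff
    proof safe
      fix e :: real assume "e > 0"
      then have "\<forall>\<^sub>F n in sequentially. \<forall>x\<in>UNIV. dist (\<Sum>i<n. level_sum h f i x) (g x) < e"
        using u unfolding uniform_limit_iff by blast
      then show "\<forall>\<^sub>F n in sequentially. \<forall>x\<in>{0..1}. dist (complex_of_real (\<Sum>i<n. level_sum h f i x)
          * fexp (-l) x) (of_real (g x) * fexp (-l) x) < e"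
        by (rule eventually_mono) (simp add: dist_norm norm_mult left_diff_distrib[symmetric] del:
            of_real_sum flip: of_real_diff)
    qed
    then show "(\<lambda>n. LINT x|I01. complex_of_real (\<Sum>i<n. level_sum h f i x) * fexp (-l) x)
        \<longlonglongrightarrow> (LINT x|I01. complex_of_real (g x) * fexp (-l) x)"
    proof (rule integral_I01_uniform_limit)
      show "integrable I01 (\<lambda>x. complex_of_real (\<Sum>i<n. level_sum h f i x) * fexp (-l) x)" for n
        by (intro integrable_I01_continuous continuous_intros dlev_continuous[OF h])
    qed (auto intro: gi)
    obtain n0 where n0: "nat (3 * \<bar>l\<bar>) < 2 ^ n0" using less_exp by blast
    have "(LINT x|I01. complex_of_real (\<Sum>i<n. level_sum h f i x) * fexp (-l) x) = fourier_coeff f l"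
        if "n \<ge> Suc n0" for n
    proof -
      obtain J where J: "n = Suc J" "n0 \<le> J" using \<open>n \<ge> Suc n0\<close> by (cases n) auto
      have "3 * \<bar>l\<bar> = int (nat (3 * \<bar>l\<bar>))" by simp
      also have "\<dots> \<le> int (2 ^ n0)" using n0 by linarith
      also have "\<dots> \<le> 2 ^ J" using J(2) by simp
      finally have "3 * \<bar>l\<bar> \<le> 2 ^ J" .
      then show ?thesis using fourier_coeff_dlev_sum[OF h f, of l J]
          by (simp add: J(1) lessThan_Suc_atMost)
    qed
    then show "(\<lambda>n. LINT x|I01. complex_of_real (\<Sum>i<n. level_sum h f i x) * fexp (-l) x)
        \<longlonglongrightarrow> fourier_coeff f l"
      by (intro tendsto_eventually) (auto simp: eventually_sequentially)
  qed
  have "AE x in I01. complex_of_real (f x) - of_real (g x) = 0"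
  proof (rule fourier_unique)
    have g1: "integrable I01 (\<lambda>x. complex_of_real (g x))" using gi[of 0] by simp
    show "integrable I01 (\<lambda>x. complex_of_real (f x) - of_real (g x))"
      by (rule Bochner_Integration.integrable_diff[OF fi g1])
    fix l
    have fe: "integrable I01 (\<lambda>x. complex_of_real (f x) * fexp l x)"
      by (rule integrable_mult_bounded_I01[where B=1]) (auto intro: fi)
    have "(LINT x|I01. (complex_of_real (f x) - of_real (g x)) * fexp l x) =
        (LINT x|I01. complex_of_real (f x) * fexp l x - of_real (g x) * fexp l x)"
      by (simp add: algebra_simps)
    also have "\<dots> = (LINT x|I01. complex_of_real (f x) * fexp l x) - (LINT x|I01. of_real (g x)
        * fexp l x)"
      using gi[of "-l"] by (intro Bochner_Integration.integral_diff fe) simp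
    also have "\<dots> = 0" using coef[of "-l"] fourier_coeff_I01[of f "-l"] by simp
    finally show "(LINT x|I01. (complex_of_real (f x) - of_real (g x)) * fexp l x) = 0" .
  qed
  then show ?thesis by eventually_elim (simp add: g_def flip: of_real_diff)
qed

section \<open>Fourier coefficients from the observed path\<close>

lemma set_integral_increment:
  fixes f :: "real \<Rightarrow> 'a::{banach, second_countable_topology}"
  assumes f: "integrable I01 f" and ab: "0 \<le> a" "a \<le> b" "b \<le> 1"
  shows "set_lebesgue_integral lborel {0..b} f - set_lebesgue_integral lborel {0..a} f
      = set_lebesgue_integral lborel {a<..b} f"
proof -
  have i: "set_integrable lborel {0..1} f" using f by (simp add: set_integrable_I01)
  have "{0..b} = {0..a} \<union> {a<..b}" using ab by auto
  moreover have "set_lebesgue_integral lborel ({0..a} \<union> {a<..b}) f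
      = set_lebesgue_integral lborel {0..a} f + set_lebesgue_integral lborel {a<..b} f"
    by (rule set_integral_Un) (use ab in \<open>auto intro: set_integrable_subset[OF i]\<close>)
  ultimately show ?thesis by simp
qed

lemma set_integral_split:
  fixes f :: "real \<Rightarrow> 'a::{banach, second_countable_topology}"
  assumes f: "integrable I01 f" and n: "n > 0"
  shows "(LINT x|I01. f x) = (\<Sum>i<n. set_lebesgue_integral lborel {real i / real n<..real (Suc i) /
      real n} f)"
proof -
  have "set_lebesgue_integral lborel {0..real k / real n} f
      = (\<Sum>i<k. set_lebesgue_integral lborel {real i / real n<..real (Suc i) / real n} f)"
    if "k \<le> n" for k
    using that
  proof (induction k)
    case 0
    have "AE x in lborel. indicator {0..0::real} x *\<^sub>R f x = 0"
      using AE_lborel_singleton[of 0] by eventually_elim auto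
    then show ?case unfolding set_lebesgue_integral_def by (simp add: integral_eq_zero_AE)
  next
    case (Suc k)
    have "set_lebesgue_integral lborel {0..real (Suc k) / real n} f - set_lebesgue_integral lborel
        {0..real k / real n} f =
       set_lebesgue_integral lborel {real k / real n<..real (Suc k) / real n} f"
      using Suc.prems n by (intro set_integral_increment f) (auto simp: divide_right_mono)
    then show ?case using Suc by (simp add: algebra_simps)
  qed
  from this[of n] show ?thesis using n by (simp add: set_integral_I01)
qed

text \<open>The tags are arbitrary points of the closed cells: right endpoints occur after summation
  by parts, left endpoints in the drift. Uniform continuity of \<open>p\<close> controls each cell,
  while \<open>q\<close> is integrated exactly.\<close>

lemma riemann_sum_tendsto:
  fixes p q :: "real \<Rightarrow> complex"
  assumes p: "continuous_on {0..1} p" and q: "integrable I01 q" "\<And>x. x \<in> {0..1} \<Longrightarrow> norm (q x) \<le> B"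
    and tau: "\<And>n i. i < n \<Longrightarrow> tau n i \<in> {real i / real n..real (Suc i) / real n}"
  shows "(\<lambda>n. \<Sum>i<n. p (tau n i) * set_lebesgue_integral lborel {real i / real n<..real (Suc i) /
      real n} q)
    \<longlonglongrightarrow> (LINT x|I01. p x * q x)"
proof (rule LIMSEQ_I)
  fix e :: real assume e: "e > 0"
  have B: "B \<ge> 0" using order_trans[OF norm_ge_zero q(2)[of 0]] by simp
  define eta where "eta = e / (B + 1)"
  have eta: "eta > 0" "eta * B < e" using e B by (auto simp: eta_def field_simps)
  have "uniformly_continuous_on {0..1} p" by (rule compact_uniformly_continuous[OF p]) simp
  then obtain d where d: "d > 0" "\<And>x y. x \<in> {0..1} \<Longrightarrow> y \<in> {0..1} \<Longrightarrow> dist y x < d \<Longrightarrow> dist (p y) (p x) < eta"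
    using eta(1) unfolding uniformly_continuous_on_def by metis
  obtain N where N: "N > 0" "1 / real N < d" using real_arch_inverse[of d] d(1)
      by (auto simp: inverse_eq_divide)
  show "\<exists>N. \<forall>n\<ge>N. norm ((\<Sum>i<n. p (tau n i) * set_lebesgue_integral lborel {real i / real n<..real
      (Suc i) / real n} q) - (LINT x|I01. p x * q x)) < e"
  proof (intro exI[of _ N] allI impI)
    fix n assume "n \<ge> N"
    then have n: "n > 0" using N by simp
    have "1 / real n \<le> 1 / real N" using \<open>n \<ge> N\<close> N by (simp add: frac_le)
    then have nd: "1 / real n < d" using N by simp
    define A where "A i = {real i / real n<..real (Suc i) / real n}" for i
    have pm: "p \<in> borel_measurable I01"
      by (rule borel_measurable_integrable[OF integrable_I01_continuous[OF p]])
    obtain P where P: "\<And>x. x \<in> {0..1} \<Longrightarrow> norm (p x) \<le> P"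
      using compact_continuous_image[OF p] compact_imp_bounded by (metis bounded_iff compact_Icc imageI)
    have pq: "integrable I01 (\<lambda>x. p x * q x)"
      using integrable_mult_bounded_I01[OF pm P q(1)] by (simp add: mult.commute)
    have As: "A i \<subseteq> {0..1}" if "i < n" for i
    proof -
      have "real (Suc i) / real n \<le> 1" using that by (simp add: divide_le_eq)
      moreover have "0 \<le> real i / real n" by simp
      ultimately show ?thesis unfolding A_def by (intro subsetI) (simp only: greaterThanAtMost_iff
          atLeastAtMost_iff, linarith)
    qed
    have qi: "set_integrable lborel (A i) q" "set_integrable lborel (A i) (\<lambda>x. p x * q x)"
        if "i < n" for i
    proof -
      have si: "set_integrable lborel {0..1} q" "set_integrable lborel {0..1} (\<lambda>x. p x * q x)"
        using q(1) pq by (simp_all add: set_integrable_I01)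
      show "set_integrable lborel (A i) q" "set_integrable lborel (A i) (\<lambda>x. p x * q x)"
        by (rule set_integrable_subset[OF si(1) _ As[OF that]], simp add: A_def)
           (rule set_integrable_subset[OF si(2) _ As[OF that]], simp add: A_def)
    qed
    have trm: "norm (p (tau n i) * set_lebesgue_integral lborel (A i) q - set_lebesgue_integral
        lborel (A i) (\<lambda>x. p x * q x)) \<le> eta * B / real n"
      if i: "i < n" for i
    proof -
      have "p (tau n i) * set_lebesgue_integral lborel (A i) q - set_lebesgue_integral lborel (A i)
          (\<lambda>x. p x * q x) =
         set_lebesgue_integral lborel (A i) (\<lambda>x. p (tau n i) * q x - p x * q x)"
        using qi[OF i] by (subst set_integral_diff) (auto simp: set_integral_mult_right)
      also have "norm \<dots> \<le> (LINT x|lborel. norm (indicator (A i) x *\<^sub>R (p (tau n i) * q x - p x * q x)))"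
        unfolding set_lebesgue_integral_def by (rule integral_norm_bound)
      also have "\<dots> \<le> (LINT x|lborel. indicator (A i) x * (eta * B))"
      proof (rule integral_mono)
        have "set_integrable lborel (A i) (\<lambda>x. p (tau n i) * q x - p x * q x)"
          using qi[OF i] by (intro set_integral_diff set_integrable_mult_right) auto
        then show "integrable lborel (\<lambda>x. norm (indicator (A i) x *\<^sub>R (p (tau n i) * q x - p x * q x)))"
          unfolding set_integrable_def by (rule integrable_norm)
        show "integrable lborel (\<lambda>x. indicator (A i) x * (eta * B))"
          by (intro integrable_mult_left integrable_real_indicator) (auto simp: A_def divide_right_mono)
        fix x :: real
        show "norm (indicator (A i) x *\<^sub>R (p (tau n i) * q x - p x * q x)) \<le> indicator (A i) x
            * (eta * B)"
        proof (cases "x \<in> A i")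
          case True
          then have x01: "x \<in> {0..1}" using As[OF i] by auto
          have t: "tau n i \<in> {real i / real n..real (Suc i) / real n}" by (rule tau[OF i])
          have "tau n i \<in> {0..1}"
          proof -
            have "real (Suc i) / real n \<le> 1" using i by (simp add: divide_le_eq)
            moreover have "0 \<le> real i / real n" by simp
            ultimately show ?thesis using t by (simp only: atLeastAtMost_iff) linarith
          qed
          moreover have "dist (tau n i) x < d"
          proof -
            have "\<bar>tau n i - x\<bar> \<le> real (Suc i) / real n - real i / real n" using t True
                unfolding A_def by auto
            also have "\<dots> = 1 / real n" by (simp add: diff_divide_distrib[symmetric])
            finally show ?thesis using nd by (simp add: dist_real_def)
          qed
          ultimately have "norm (p (tau n i) - p x) \<le> eta" using d(2)[of x "tau n i"] x01
              by (simp add: dist_norm)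
          then have "norm (p (tau n i) - p x) * norm (q x) \<le> eta * B" using q(2)[OF x01] eta(1)
              by (intro mult_mono) auto
          then show ?thesis using True by (simp add: norm_mult left_diff_distrib[symmetric])
        qed simp
      qed
      also have "\<dots> = eta * B / real n"
        by (simp add: A_def divide_right_mono diff_divide_distrib[symmetric])
      finally show ?thesis .
    qed
    have "norm ((\<Sum>i<n. p (tau n i) * set_lebesgue_integral lborel (A i) q) - (LINT x|I01. p x * q x)) =
      norm (\<Sum>i<n. p (tau n i) * set_lebesgue_integral lborel (A i) q - set_lebesgue_integral lborel
          (A i) (\<lambda>x. p x * q x))"
      using set_integral_split[OF pq n] by (simp add: A_def sum_subtractf)
    also have "\<dots> \<le> (\<Sum>i<n. eta * B / real n)" by (intro sum_norm_le) (use trm in auto)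
    also have "\<dots> = eta * B" using n by simp
    also have "\<dots> < e" by (rule eta(2))
    finally show "norm ((\<Sum>i<n. p (tau n i) * set_lebesgue_integral lborel {real i / real n<..real
        (Suc i) / real n} q) - (LINT x|I01. p x * q x)) < e"
      unfolding A_def .
  qed
qed

text \<open>Left-point sums for the integral of the conjugate character against the increments of a
  path. Only values at rational times enter, which keeps the limit measurable on path space.\<close>

definition stieltjes_sum :: "(real \<Rightarrow> real) \<Rightarrow> int \<Rightarrow> nat \<Rightarrow> complex" where
  "stieltjes_sum x l n = (\<Sum>i<n. fexp (-l) (real i / real n)
      * of_real (x (real (Suc i) / real n) - x (real i / real n)))"

definition stieltjes_lim :: "(real \<Rightarrow> real) \<Rightarrow> int \<Rightarrow> complex" where
  "stieltjes_lim x l = lim (stieltjes_sum x l)"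

lemma stj_convergent:
  assumes w: "continuous_on {0..1} w"
  shows "stieltjes_sum w l \<longlonglongrightarrow> stieltjes_lim w l"
proof -
  define e' where "e' x = 2 * pi * of_int (-l) * \<i> * fexp (-l) x" for x
  have e'c: "continuous_on A e'" for A unfolding e'_def by (intro continuous_intros)
  have e'i: "integrable I01 e'" by (rule integrable_I01_continuous[OF e'c])
  have wav_ft: "continuous_on {0..1} (\<lambda>x. complex_of_real (w x))" by (intro continuous_intros w)
  have lim: "(\<lambda>n. \<Sum>i<n. of_real (w (real (Suc i) / real n))
      * set_lebesgue_integral lborel {real i / real n<..real (Suc i) / real n} e')
      \<longlonglongrightarrow> (LINT x|I01. of_real (w x) * e' x)"
    by (rule riemann_sum_tendsto[OF wav_ft e'i, where B="2 * pi * \<bar>of_int l\<bar>"])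
       (auto simp: e'_def norm_mult divide_right_mono)
  have ftc: "fexp (-l) b - fexp (-l) a = set_lebesgue_integral lborel {a<..b} e'" if "0 \<le> a" "a
      \<le> b" "b \<le> 1" for a b
  proof -
    have f: "set_lebesgue_integral lborel {0..c} e' = fexp (-l) c - fexp (-l) 0" if "0 \<le> c" for c
      unfolding set_lebesgue_integral_def e'_def
      by (rule integral_FTC_atLeastAtMost[OF that]) (rule ee_has_vector_derivative, intro
          continuous_intros)
    show ?thesis using set_integral_increment[OF e'i that] f[of a] f[of b] that by simp
  qed
  have parts: "stieltjes_sum w l n = fexp (-l) 1 * of_real (w 1) - fexp (-l) 0 * of_real (w 0) -
     (\<Sum>i<n. of_real (w (real (Suc i) / real n)) * set_lebesgue_integral lborel {real i / real
         n<..real (Suc i) / real n} e')"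
    if n: "n > 0" for n
  proof -
    have tel: "(\<Sum>i<n. fexp (-l) (real (Suc i) / real n)
        * of_real (w (real (Suc i) / real n)) - fexp (-l) (real i / real n)
        * of_real (w (real i / real n)))
        = fexp (-l) 1 * of_real (w 1) - fexp (-l) 0 * of_real (w 0)"
      using sum_lessThan_telescope[of "\<lambda>i. fexp (-l) (real i / real n)
          * of_real (w (real i / real n))" n] n by simp
    have "stieltjes_sum w l n = (\<Sum>i<n. (fexp (-l) (real (Suc i) / real n)
        * of_real (w (real (Suc i) / real n)) - fexp (-l) (real i / real n)
        * of_real (w (real i / real n)))
        - of_real (w (real (Suc i) / real n)) * (fexp (-l) (real (Suc i) / real n) - fexp (-l) (real
            i / real n)))"
      unfolding stieltjes_sum_def by (intro sum.cong refl) (simp add: algebra_simps)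
    also have "\<dots> = fexp (-l) 1 * of_real (w 1) - fexp (-l) 0 * of_real (w 0) -
      (\<Sum>i<n. of_real (w (real (Suc i) / real n)) * (fexp (-l) (real (Suc i) / real n) - fexp (-l)
          (real i / real n)))"
      by (simp only: sum_subtractf[of "\<lambda>i. fexp (-l) (real (Suc i) / real n)
          * of_real (w (real (Suc i) / real n)) - fexp (-l) (real i / real n)
          * of_real (w (real i / real n))"] tel)
    also have "(\<Sum>i<n. of_real (w (real (Suc i) / real n))
        * (fexp (-l) (real (Suc i) / real n) - fexp (-l) (real i / real n))) =
       (\<Sum>i<n. of_real (w (real (Suc i) / real n)) * set_lebesgue_integral lborel {real i / real
           n<..real (Suc i) / real n} e')"
    proof (intro sum.cong refl)
      fix i assume "i \<in> {..<n}"
      then have "real (Suc i) / real n \<le> 1" by (simp add: divide_le_eq)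
      then show "of_real (w (real (Suc i) / real n)) * (fexp (-l) (real (Suc i) / real n) - fexp
          (-l) (real i / real n)) =
        of_real (w (real (Suc i) / real n)) * set_lebesgue_integral lborel {real i / real n<..real
            (Suc i) / real n} e'"
        by (subst ftc) (auto simp: divide_right_mono)
    qed
    finally show ?thesis .
  qed
  have "(\<lambda>n. fexp (-l) 1 * of_real (w 1) - fexp (-l) 0 * of_real (w 0) -
     (\<Sum>i<n. of_real (w (real (Suc i) / real n)) * set_lebesgue_integral lborel {real i / real
         n<..real (Suc i) / real n} e'))
     \<longlonglongrightarrow> fexp (-l) 1 * of_real (w 1) - fexp (-l) 0 * of_real (w 0) - (LINT x|I01. of_real (w x) * e' x)"
    by (intro tendsto_intros lim)
  then have "stieltjes_sum w l \<longlonglongrightarrow> fexp (-l) 1 * of_real (w 1) - fexp (-l) 0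
      * of_real (w 0) - (LINT x|I01. of_real (w x) * e' x)"
    by (rule Lim_transform_eventually) (use parts in \<open>auto intro!: eventually_mono[OF
        eventually_gt_at_top[of 0]]\<close>)
  then have "convergent (stieltjes_sum w l)" by (auto simp: convergent_def)
  then show ?thesis unfolding stieltjes_lim_def by (simp add: convergent_LIMSEQ_iff)
qed

text \<open>The sums are linear in the path: the constant \<open>x0\<close> has no increments, the
  drift yields a Riemann sum for its Fourier coefficient, and the noise converges by
  \<open>stj_convergent\<close>.\<close>

lemma slim_observation:
  fixes b :: "real \<Rightarrow> real"
  assumes w: "continuous_on {0..1} w" and b: "integrable I01 b" "\<And>x. x \<in> {0..1} \<Longrightarrow> \<bar>b x\<bar> \<le> B"
    and x: "\<And>t. t \<in> {0..1} \<Longrightarrow> x t = x0 + set_lebesgue_integral lborel {0..t} b + c * w t"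
  shows "stieltjes_lim x l = fourier_coeff b l + of_real c * stieltjes_lim w l"
proof -
  have bi: "integrable I01 (\<lambda>t. complex_of_real (b t))" using b(1) by simp
  have r: "(\<lambda>n. \<Sum>i<n. fexp (-l) (real i / real n) * set_lebesgue_integral lborel {real i / real
      n<..real (Suc i) / real n} (\<lambda>t. complex_of_real (b t)))
     \<longlonglongrightarrow> (LINT t|I01. fexp (-l) t * complex_of_real (b t))"
    by (rule riemann_sum_tendsto[where B=B]) (use bi b in \<open>auto intro!: continuous_intros simp:
        divide_right_mono\<close>)
  have st: "stieltjes_sum x l n = (\<Sum>i<n. fexp (-l) (real i / real n)
      * set_lebesgue_integral lborel {real i / real n<..real (Suc i) / real n} (\<lambda>t. complex_of_real
      (b t)))
     + of_real c * stieltjes_sum w l n" for n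
  proof -
    have "fexp (-l) (real i / real n) * of_real (x (real (Suc i) / real n) - x (real i / real n)) =
       fexp (-l) (real i / real n) * set_lebesgue_integral lborel {real i / real n<..real (Suc i) /
           real n} (\<lambda>t. complex_of_real (b t))
       + of_real c * (fexp (-l) (real i / real n) * of_real (w (real (Suc i) / real n) - w (real i /
           real n)))" if "i < n" for i
    proof -
      have i: "0 \<le> real i / real n" "real i / real n \<le> real (Suc i) / real n" "real (Suc i) / real n \<le> 1"
        using that by (auto simp: divide_right_mono divide_le_eq)
      have "x (real (Suc i) / real n) - x (real i / real n) =
        (set_lebesgue_integral lborel {0..real (Suc i) / real n} b - set_lebesgue_integral lborel
            {0..real i / real n} b)
         + c * (w (real (Suc i) / real n) - w (real i / real n))"
        using i x[of "real (Suc i) / real n"] x[of "real i / real n"] by (simp add: algebra_simps)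
      also have "set_lebesgue_integral lborel {0..real (Suc i) / real n} b - set_lebesgue_integral
          lborel {0..real i / real n} b =
         set_lebesgue_integral lborel {real i / real n<..real (Suc i) / real n} b"
        by (rule set_integral_increment[OF b(1) i])
      finally have "complex_of_real (x (real (Suc i) / real n) - x (real i / real n)) =
         of_real (set_lebesgue_integral lborel {real i / real n<..real (Suc i) / real n} b)
         + of_real c * of_real (w (real (Suc i) / real n) - w (real i / real n))" by simp
      moreover have "complex_of_real (set_lebesgue_integral lborel A b)
          = set_lebesgue_integral lborel A (\<lambda>t. complex_of_real (b t))" for A
        unfolding set_lebesgue_integral_def by (simp add: scaleR_conv_of_real flip:
            integral_complex_of_real)
      ultimately show ?thesis by (simp only: distrib_left mult_ac)
    qed
    then show ?thesis unfolding stieltjes_sum_def by (simp add: sum.distrib sum_distrib_left)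
  qed
  have "(\<lambda>n. (\<Sum>i<n. fexp (-l) (real i / real n) * set_lebesgue_integral lborel {real i / real
      n<..real (Suc i) / real n} (\<lambda>t. complex_of_real (b t)))
     + of_real c * stieltjes_sum w l n) \<longlonglongrightarrow> (LINT t|I01. fexp (-l) t * complex_of_real (b t))
         + of_real c * stieltjes_lim w l"
    by (intro tendsto_intros r stj_convergent[OF w])
  then have "stieltjes_sum x l \<longlonglongrightarrow> (LINT t|I01. fexp (-l) t * complex_of_real (b t)) + of_real c
      * stieltjes_lim w l"
    unfolding st[symmetric] .
  then show ?thesis unfolding stieltjes_lim_def[of x] by (simp add: limI fourier_coeff_I01 mult.commute)
qed

section \<open>Convolution of periodic functions\<close>

lemma AE_periodic:
  assumes P: "AE x in I01. P x" and per: "\<And>x. P (x + 1) \<longleftrightarrow> P (x :: real)"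
  shows "AE x in lborel. P x"
proof -
  have perz: "P (x + of_int m) \<longleftrightarrow> P x" for x m
  proof (induction m rule: int_induct[of _ 0])
    case (step1 i)
    then show ?case using per[of "x + of_int i"] by (simp add: add.assoc)
  next
    case (step2 i)
    then show ?case using per[of "x + of_int (i - 1)"] by (simp add: algebra_simps)
  qed simp
  have "AE x in lborel. x \<in> {0..1} \<longrightarrow> P x" using P by (simp add: AE_I01)
  then obtain N where N: "{x. \<not> (x \<in> {0..1} \<longrightarrow> P x)} \<subseteq> N" "N \<in> null_sets lborel"
    unfolding eventually_ae_filter by (auto simp: space_lborel)
  have tr: "(\<lambda>x. m + x) -` N \<in> null_sets lborel" for m :: real
  proof -
    have "emeasure lborel N = emeasure (distr lborel borel ((+) m)) N" by (simp add: lborel_distr_plus)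
    also have "\<dots> = emeasure lborel ((+) m -` N)" using N(2)
        by (subst emeasure_distr) (auto simp: null_sets_def)
    finally show ?thesis using N(2) by (auto simp: null_sets_def intro!: measurable_sets_borel[OF _
        , of _ borel])
  qed
  have "(\<Union>m::int. (\<lambda>x. of_int m + x) -` N) \<in> null_sets lborel"
    by (rule null_sets_UN') (use tr in auto)
  then show ?thesis
  proof (rule AE_I')
    show "{x \<in> space lborel. \<not> P x} \<subseteq> (\<Union>m::int. (\<lambda>x. of_int m + x) -` N)"
    proof
      fix x assume "x \<in> {x \<in> space lborel. \<not> P x}"
      then have "\<not> P (frac x)" using perz[of x "- \<lfloor>x\<rfloor>"] by (simp add: frac_def)
      moreover have "frac x \<in> {0..1}" using frac_lt_1[of x] by simp
      ultimately have "frac x \<in> N" using N(1) by blast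
      then show "x \<in> (\<Union>m::int. (\<lambda>x. of_int m + x) -` N)"
        by (intro UN_I[of "- \<lfloor>x\<rfloor>"]) (auto simp: frac_def)
    qed
  qed
qed

text \<open>The convolution reads its first argument at t - u, also outside the unit interval, so
  equality almost everywhere is first spread periodically over the line and then transported by the
  reflection from u to t - u.\<close>

lemma conv01_cong:
  assumes f: "\<And>x. f (x + 1) = f x" "\<And>x. g (x + 1) = g x" "AE x in I01. f x = g x"
    and m: "f \<in> borel_measurable borel" "g \<in> borel_measurable borel" "y \<in> borel_measurable I01"
  shows "conv01 f y t = conv01 g y t"
proof -
  have "AE x in lborel. f x = g x" using AE_periodic[of "\<lambda>x. f x = g x"] f by simp
  then have "AE u in lborel. f (t + (-1) * u) = g (t + (-1) * u)"
    by (subst AE_borel_affine) (use m in \<open>auto intro!: borel_measurable_eq\<close>)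
  then have ae: "AE u in I01. f (t - u) = g (t - u)" by (simp add: AE_I01) (auto elim: eventually_mono)
  have "(\<lambda>u. f (t - u) * y u) \<in> borel_measurable I01" "(\<lambda>u. g (t - u) * y u) \<in> borel_measurable I01"
    using m measurable_I01[of "\<lambda>u. f (t - u)"] measurable_I01[of "\<lambda>u. g (t - u)"] by measurable
  then show ?thesis unfolding conv01_def set_integral_I01
    by (rule integral_cong_AE) (use ae in \<open>auto elim: eventually_mono\<close>)
qed

text \<open>Fubini's theorem and the shift invariance of integrals of continuous periodic functions.
  Boundedness of \<open>g\<close> makes the double integral converge absolutely for a merely
  integrable \<open>y\<close>.\<close>

lemma conv01_fourier:
  fixes g y :: "real \<Rightarrow> real"
  assumes g: "continuous_on UNIV g" "\<And>x. g (x + 1) = g x" "\<And>x. \<bar>g x\<bar> \<le> B"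
    and y: "integrable I01 y"
  shows "integrable I01 (conv01 g y)" "\<bar>conv01 g y t\<bar> \<le> B * (LINT u|I01. \<bar>y u\<bar>)"
    "fourier_coeff (conv01 g y) l = fourier_coeff g l * fourier_coeff y l"
proof -
  interpret P: pair_sigma_finite I01 I01 ..
  have B: "B \<ge> 0" using g(3)[of 0] by linarith
  have gm[measurable]: "g \<in> borel_measurable borel" by (rule borel_measurable_continuous_onI[OF g(1)])
  have ym[measurable]: "y \<in> borel_measurable I01" by (rule borel_measurable_integrable[OF y])
  have id[measurable]: "(\<lambda>x. x) \<in> borel_measurable I01" by (rule measurable_I01) simp
  have c: "conv01 g y t = (LINT u|I01. g (t - u) * y u)" for t by (simp add: conv01_def set_integral_I01)
  have int: "integrable I01 (\<lambda>u. g (t - u) * y u)" for t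
  proof (rule Bochner_Integration.integrable_bound[of _ "\<lambda>u. B * \<bar>y u\<bar>"])
    show "integrable I01 (\<lambda>u. B * \<bar>y u\<bar>)" using y by auto
    show "AE u in I01. norm (g (t - u) * y u) \<le> norm (B * \<bar>y u\<bar>)"
      using g(3) B by (auto simp: abs_mult intro!: mult_right_mono)
  qed measurable
  show bd: "\<bar>conv01 g y t\<bar> \<le> B * (LINT u|I01. \<bar>y u\<bar>)" for t
  proof -
    have "\<bar>conv01 g y t\<bar> \<le> (LINT u|I01. \<bar>g (t - u) * y u\<bar>)" unfolding c by (rule integral_abs_bound)
    also have "\<dots> \<le> (LINT u|I01. B * \<bar>y u\<bar>)"
      using integrable_abs[OF int[of t]] y g(3) by (intro integral_mono) (auto simp: abs_mult
          intro!: mult_right_mono)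
    finally show ?thesis by simp
  qed
  have cm: "conv01 g y \<in> borel_measurable I01" unfolding c[abs_def]
    by (rule I01.borel_measurable_lebesgue_integral) measurable
  show "integrable I01 (conv01 g y)"
    by (rule I01.integrable_const_bound[of _ "B * (LINT u|I01. \<bar>y u\<bar>)"]) (use bd cm in auto)
  define F where "F = (\<lambda>(u, t). complex_of_real (y u) * (of_real (g (t - u)) * fexp (-l) t))"
  have Fm[measurable]: "F \<in> borel_measurable (I01 \<Otimes>\<^sub>M I01)" unfolding F_def by measurable
  have inner: "(LINT t|I01. of_real (g (t - u)) * fexp (-l) t) = fexp (-l) u * fourier_coeff g l"
      if "u \<in> {0..1}" for u
  proof -
    have "(LINT t|I01. of_real (g (t - u)) * fexp (-l) t) = (LINT t|I01. fexp (-l) u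
        * (of_real (g (t - u)) * fexp (-l) (t - u)))"
    proof (intro Bochner_Integration.integral_cong refl)
      fix t
      have "fexp (-l) t = fexp (-l) u * fexp (-l) (t - u)" unfolding fexp_def cis_mult
          by (simp add: algebra_simps)
      then show "complex_of_real (g (t - u)) * fexp (-l) t = fexp (-l) u * (of_real (g (t - u))
          * fexp (-l) (t - u))" by simp
    qed
    also have "\<dots> = fexp (-l) u * (LINT t|I01. of_real (g (t - u)) * fexp (-l) (t - u))"
        by (rule integral_mult_right_zero)
    also have "(LINT t|I01. of_real (g (t - u)) * fexp (-l) (t - u)) = (LINT t|I01. of_real (g t)
        * fexp (-l) t)"
      by (rule integral_I01_shift[of "\<lambda>t. of_real (g t) * fexp (-l) t"])
         (use g that ee_plus_int[of _ _ 1] in \<open>auto intro!: continuous_intros\<close>)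
    finally show ?thesis by (simp add: fourier_coeff_I01)
  qed
  have Fi: "integrable (I01 \<Otimes>\<^sub>M I01) F"
  proof (rule P.Fubini_integrable[OF Fm])
    have "integrable I01 (\<lambda>u. \<bar>y u\<bar> * (LINT t|I01. \<bar>g (t - u)\<bar>))"
    proof (rule Bochner_Integration.integrable_bound[of _ "\<lambda>u. B * \<bar>y u\<bar>"])
      show "integrable I01 (\<lambda>u. B * \<bar>y u\<bar>)" using y by auto
      have "(\<lambda>u. LINT t|I01. \<bar>g (t - u)\<bar>) \<in> borel_measurable I01"
        by (rule I01.borel_measurable_lebesgue_integral) measurable
      then show "(\<lambda>u. \<bar>y u\<bar> * (LINT t|I01. \<bar>g (t - u)\<bar>)) \<in> borel_measurable I01" by measurable
      have "(LINT t|I01. \<bar>g (t - u)\<bar>) \<le> (LINT t|I01. B)" for u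
        by (intro integral_mono integrable_I01_continuous continuous_intros
            continuous_on_compose2[OF g(1)]) (use g(3) in auto)
      then show "AE u in I01. norm (\<bar>y u\<bar> * (LINT t|I01. \<bar>g (t - u)\<bar>)) \<le> norm (B * \<bar>y u\<bar>)"
        using B by (intro AE_I2) (simp add: abs_mult mult.commute[of B] mult_left_mono)
    qed
    then show "integrable I01 (\<lambda>u. LINT t|I01. norm (F (u, t)))" by (simp add: F_def norm_mult)
    show "AE u in I01. integrable I01 (\<lambda>t. F (u, t))"
      unfolding F_def by (intro AE_I2) (simp, intro integrable_I01_continuous continuous_intros
          continuous_on_compose2[OF g(1)], auto)
  qed
  have "fourier_coeff (conv01 g y) l = (LINT t|I01. (LINT u|I01. F (u, t)))"
  proof -
    have "of_real (conv01 g y t) * fexp (-l) t = (LINT u|I01. F (u, t))" for t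
    proof -
      have "(LINT u|I01. F (u, t)) = (LINT u|I01. complex_of_real (g (t - u) * y u) * fexp (-l) t)"
        unfolding F_def by (intro Bochner_Integration.integral_cong) auto
      also have "\<dots> = (LINT u|I01. complex_of_real (g (t - u) * y u)) * fexp (-l) t"
          by (rule integral_mult_left_zero)
      also have "(LINT u|I01. complex_of_real (g (t - u) * y u)) = of_real (conv01 g y t)"
          unfolding c by (rule integral_complex_of_real)
      finally show ?thesis by simp
    qed
    then show ?thesis by (simp add: fourier_coeff_I01)
  qed
  also have "\<dots> = (LINT u|I01. (LINT t|I01. F (u, t)))"
    using P.Fubini_integral[of "\<lambda>u t. F (u, t)"] Fi by simp
  also have "\<dots> = (LINT u|I01. of_real (y u) * fexp (-l) u * fourier_coeff g l)"
  proof (intro Bochner_Integration.integral_cong refl)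
    fix u assume "u \<in> space I01"
    then have "(LINT t|I01. F (u, t)) = of_real (y u) * (LINT t|I01. of_real (g (t - u)) * fexp (-l) t)"
      unfolding F_def by (simp only: prod.case integral_mult_right_zero)
    then show "(LINT t|I01. F (u, t)) = of_real (y u) * fexp (-l) u * fourier_coeff g l"
      using inner \<open>u \<in> space I01\<close> by simp
  qed
  also have "\<dots> = fourier_coeff y l * fourier_coeff g l"
    unfolding fourier_coeff_I01[of y] by (rule integral_mult_left_zero)
  finally show "fourier_coeff (conv01 g y) l = fourier_coeff g l * fourier_coeff y l"
      by (simp add: mult.commute)
qed

section \<open>Sampling the filter\<close>

lemma sets_pair_I01: "sets (M \<Otimes>\<^sub>M I01) = sets (M \<Otimes>\<^sub>M restrict_space borel {0..1::real})"
  by (intro sets_pair_measure_cong refl) (simp add: sets_I01)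

lemma L2_process_measurable:
  "L2_process M Y \<Longrightarrow> (\<lambda>(\<omega>, t). Y t \<omega>) \<in> borel_measurable (M \<Otimes>\<^sub>M I01)"
  unfolding L2_process_def by (subst measurable_cong_sets[OF sets_pair_I01 refl]) blast

lemma I01_square_integrable:
  fixes y :: "real \<Rightarrow> real"
  assumes "y \<in> borel_measurable I01" "integrable I01 (\<lambda>t. (y t)\<^sup>2)"
  shows "integrable I01 y"
proof (rule Bochner_Integration.integrable_bound[of _ "\<lambda>t. 1 + (y t)\<^sup>2"])
  show "integrable I01 (\<lambda>t. 1 + (y t)\<^sup>2)" using assms by simp
  have "\<bar>a\<bar> \<le> 1 + a\<^sup>2" for a :: real
  proof -
    have "0 \<le> (\<bar>a\<bar> - 1)\<^sup>2" by simp
    then show ?thesis by (simp add: power2_diff)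
  qed
  then show "AE t in I01. norm (y t) \<le> norm (1 + (y t)\<^sup>2)" by (intro AE_I2) (simp add: abs_of_nonneg)
qed (use assms in auto)

lemma L2_process_section:
  assumes "L2_process M Y" "\<omega> \<in> space M"
  shows "(\<lambda>t. Y t \<omega>) \<in> borel_measurable I01" "integrable I01 (\<lambda>t. (Y t \<omega>)\<^sup>2)" "integrable I01 (\<lambda>t. Y
      t \<omega>)"
proof -
  show 1: "(\<lambda>t. Y t \<omega>) \<in> borel_measurable I01"
    using measurable_compose[OF measurable_Pair1'[OF assms(2)] L2_process_measurable[OF assms(1)]]
        by simp
  show 2: "integrable I01 (\<lambda>t. (Y t \<omega>)\<^sup>2)"
    using assms by (auto simp: L2_process_def set_integrable_I01)
  show "integrable I01 (\<lambda>t. Y t \<omega>)" by (rule I01_square_integrable[OF 1 2])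
qed

lemma fourier_coeff_measurable:
  assumes Y: "L2_process M Y"
  shows "(\<lambda>\<omega>. fourier_coeff (\<lambda>t. Y t \<omega>) l) \<in> borel_measurable M"
proof -
  note [measurable] = L2_process_measurable[OF Y]
  have id[measurable]: "(\<lambda>x. x) \<in> borel_measurable I01" by (rule measurable_I01) simp
  have "(\<lambda>(\<omega>, t). complex_of_real (Y t \<omega>) * fexp (-l) t) \<in> borel_measurable (M \<Otimes>\<^sub>M I01)"
  proof -
    have "(\<lambda>p. complex_of_real ((\<lambda>(\<omega>, t). Y t \<omega>) p) * fexp (-l) (snd p)) \<in> borel_measurable (M \<Otimes>\<^sub>M I01)"
      by measurable
    then show ?thesis by (simp add: case_prod_beta')
  qed
  then show ?thesis unfolding fourier_coeff_I01 by (rule I01.borel_measurable_lebesgue_integral)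
qed

text \<open>At a uniformly distributed point \<open>Z\<close> has mean zero, so the mixed term
  vanishes on average and the square grows by the variance of one sample, at most the integral of
  the square of \<open>y\<close>.\<close>

lemma fourier_coeff_deviation:
  fixes y :: "real \<Rightarrow> real" and S :: complex and l :: int
  assumes m: "y \<in> borel_measurable I01" and y2: "integrable I01 (\<lambda>t. (y t)\<^sup>2)"
  defines "Z \<equiv> \<lambda>t. of_real (y t) * fexp (-l) t - fourier_coeff y l"
  shows "(\<integral>\<^sup>+t. ennreal ((norm (S + Z t))\<^sup>2) \<partial>I01) \<le> ennreal ((norm S)\<^sup>2 + (LINT t|I01. (y t)\<^sup>2))"
proof -
  define a where "a = fourier_coeff y l"
  have yi: "integrable I01 y" by (rule I01_square_integrable[OF m y2])
  have yi': "integrable I01 (\<lambda>t. complex_of_real (y t))" using yi by simp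
  have ye: "integrable I01 (\<lambda>t. of_real (y t) * fexp (-l) t)"
    by (rule integrable_mult_bounded_I01[where B=1]) (auto intro: yi')
  have inn: "integrable I01 (\<lambda>t. (S - a) \<bullet> (of_real (y t) * fexp (-l) t))" 
     "(LINT t|I01. (S - a) \<bullet> (of_real (y t) * fexp (-l) t)) = (S - a) \<bullet> a"
    using ye integral_bounded_linear[OF bounded_linear_inner_right ye, of "S - a"]
    by (auto simp: a_def fourier_coeff_I01 intro: integrable_bounded_linear[OF
        bounded_linear_inner_right])
  have exp: "(norm (S + Z t))\<^sup>2 = (norm (S - a))\<^sup>2 + 2 * ((S - a) \<bullet> (of_real (y t) * fexp (-l) t))
      + (y t)\<^sup>2" for t
  proof -
    have "S + Z t = (S - a) + of_real (y t) * fexp (-l) t" by (simp add: Z_def a_def)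
    moreover have "(norm (A + B))\<^sup>2 = (norm A)\<^sup>2 + 2 * (A \<bullet> B) + (norm B)\<^sup>2" for A B :: complex
      by (simp add: power2_norm_eq_inner inner_add_left inner_add_right inner_commute)
    ultimately have "(norm (S + Z t))\<^sup>2 = (norm (S - a))\<^sup>2 + 2 * ((S - a) \<bullet> (of_real (y t)
        * fexp (-l) t)) + (norm (of_real (y t) * fexp (-l) t))\<^sup>2"
      by (simp only:)
    then show ?thesis by (simp add: norm_mult)
  qed
  have int: "integrable I01 (\<lambda>t. (norm (S + Z t))\<^sup>2)" unfolding exp using inn(1) y2 by simp
  have "(\<integral>\<^sup>+t. ennreal ((norm (S + Z t))\<^sup>2) \<partial>I01) = ennreal (LINT t|I01. (norm (S + Z t))\<^sup>2)"
    by (rule nn_integral_eq_integral[OF int]) simp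
  also have "(LINT t|I01. (norm (S + Z t))\<^sup>2) = (norm (S - a))\<^sup>2 + 2 * ((S - a) \<bullet> a)
      + (LINT t|I01. (y t)\<^sup>2)"
    unfolding exp using inn y2 by simp
  also have "\<dots> = (norm S)\<^sup>2 - (norm a)\<^sup>2 + (LINT t|I01. (y t)\<^sup>2)"
    by (simp add: power2_norm_eq_inner inner_diff_left inner_diff_right inner_commute)
  also have "ennreal \<dots> \<le> ennreal ((norm S)\<^sup>2 + (LINT t|I01. (y t)\<^sup>2))" by (rule ennreal_leI) simp
  finally show ?thesis .
qed

text \<open>An empirical mean over the first \<open>4^m\<close> points. For well-chosen points its
  mean square error is of order \<open>1 / 4^m\<close>, which is summable in m; this turns control
  in mean square into almost sure convergence.\<close>

definition sampled_coeff :: "(nat \<Rightarrow> real) \<Rightarrow> (real \<Rightarrow> real) \<Rightarrow> int \<Rightarrow> complex" where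
  "sampled_coeff u y l = lim (\<lambda>m::nat. (\<Sum>i<4^m. of_real (y (u i)) * fexp (-l) (u i)) / 4^m)"

text \<open>The sigma-algebra generated by \<open>Y\<close> only sees countably many of its values, so its Fourier
  coefficients have to be recovered by sampling.  The sampling points are chosen greedily: averaged
  over the next point, the weighted sum of the squared deviations grows by at most a constant.\<close>

lemma sampling_points:
  assumes M: "prob_space M" and Y: "L2_process M Y" and L: "finite L"
  shows "\<exists>u::nat \<Rightarrow> real. (\<forall>i. u i \<in> {0..1}) \<and>
    (AE \<omega> in M. \<forall>l\<in>L. sampled_coeff u (\<lambda>t. Y t \<omega>) l = fourier_coeff (\<lambda>t. Y t \<omega>) l)"
proof -
  interpret M: prob_space M by fact
  interpret P: pair_sigma_finite M I01 ..
  note [measurable] = L2_process_measurable[OF Y] fourier_coeff_measurable[OF Y]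
  have id[measurable]: "(\<lambda>x. x) \<in> borel_measurable I01" by (rule measurable_I01) simp
  define q where "q \<omega> = (LINT t|I01. (Y t \<omega>)\<^sup>2)" for \<omega>
  have q[measurable]: "q \<in> borel_measurable M"
  proof -
    have "(\<lambda>p. ((\<lambda>(\<omega>, t). Y t \<omega>) p)\<^sup>2) \<in> borel_measurable (M \<Otimes>\<^sub>M I01)" by measurable
    then have "(\<lambda>(\<omega>, t). (Y t \<omega>)\<^sup>2) \<in> borel_measurable (M \<Otimes>\<^sub>M I01)" by (simp add: case_prod_beta')
    then show ?thesis unfolding q_def by (rule I01.borel_measurable_lebesgue_integral)
  qed
  have q0: "q \<omega> \<ge> 0" for \<omega> unfolding q_def by simp
  \<comment> \<open>The integral of the square of \<open>Y\<close> may have infinite expectation;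
    the weight \<open>psi\<close> brings it below 1 for every \<omega> and, being positive, does not
    affect almost sure statements.\<close>
  define psi where "psi \<omega> = 1 / (1 + q \<omega>)" for \<omega>
  have psi[measurable]: "psi \<in> borel_measurable M" unfolding psi_def by measurable
  have psi0: "psi \<omega> > 0" "psi \<omega> * q \<omega> \<le> 1" for \<omega>
    using q0[of \<omega>] by (auto simp: psi_def field_simps)
  define Z where "Z l \<omega> t = of_real (Y t \<omega>) * fexp (-l) t - fourier_coeff (\<lambda>t. Y t \<omega>) l" for l \<omega> t
  have Zm[measurable]: "(\<lambda>p. Z l (fst p) (snd p)) \<in> borel_measurable (M \<Otimes>\<^sub>M I01)" for l
  proof -
    have "(\<lambda>p. complex_of_real ((\<lambda>(\<omega>, t). Y t \<omega>) p) * fexp (-l) (snd p) - fourier_coeff (\<lambda>t. Y t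
        (fst p)) l) \<in> borel_measurable (M \<Otimes>\<^sub>M I01)"
      by measurable
    then show ?thesis by (simp add: Z_def case_prod_beta')
  qed
  define E where "E S = (\<integral>\<^sup>+\<omega>. ennreal (psi \<omega> * (\<Sum>l\<in>L. (norm (S l \<omega>))\<^sup>2)) \<partial>M)"
      for S :: "int \<Rightarrow> 'a \<Rightarrow> complex"
  \<comment> \<open>One more than the average growth \<open>card L\<close>; the strict excess yields
    the contradiction in \<open>step\<close>.\<close>
  define c where "c = real (card L) + 1"
  have step: "\<exists>t\<in>{0..1}. E (\<lambda>l \<omega>. S l \<omega> + Z l \<omega> t) \<le> ennreal (real k * c + c)"
    if S[measurable]: "\<And>l. S l \<in> borel_measurable M" and ES: "E S \<le> ennreal (real k * c)"
        for S :: "int \<Rightarrow> 'a \<Rightarrow> complex" and k :: nat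
  proof (rule ccontr)
    assume neg: "\<not> ?thesis"
    define G where "G \<omega> t = ennreal (psi \<omega> * (\<Sum>l\<in>L. (norm (S l \<omega> + Z l \<omega> t))\<^sup>2))" for \<omega> t
    have Gm: "(\<lambda>(\<omega>, t). G \<omega> t) \<in> borel_measurable (M \<Otimes>\<^sub>M I01)"
    proof -
      have "(\<lambda>p. ennreal (psi (fst p) * (\<Sum>l\<in>L. (norm (S l (fst p)
          + Z l (fst p) (snd p)))\<^sup>2))) \<in> borel_measurable (M \<Otimes>\<^sub>M I01)"
        by measurable
      then show ?thesis by (simp add: G_def case_prod_beta')
    qed
    have cL: "c \<ge> 0" by (simp add: c_def)
    have "ennreal (real k * c + c) = (\<integral>\<^sup>+t. ennreal (real k * c + c) \<partial>I01)"
        by (simp add: I01.emeasure_space_1[simplified])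
    also have "\<dots> \<le> (\<integral>\<^sup>+t. (\<integral>\<^sup>+\<omega>. G \<omega> t \<partial>M) \<partial>I01)"
    proof (rule nn_integral_mono)
      fix t assume "t \<in> space I01"
      then have "\<not> E (\<lambda>l \<omega>. S l \<omega> + Z l \<omega> t) \<le> ennreal (real k * c + c)" using neg by auto
      moreover have "E (\<lambda>l \<omega>. S l \<omega> + Z l \<omega> t) = (\<integral>\<^sup>+\<omega>. G \<omega> t \<partial>M)" by (simp add: E_def G_def)
      ultimately show "ennreal (real k * c + c) \<le> (\<integral>\<^sup>+\<omega>. G \<omega> t \<partial>M)" by simp
    qed
    also have "\<dots> = (\<integral>\<^sup>+\<omega>. (\<integral>\<^sup>+t. G \<omega> t \<partial>I01) \<partial>M)" by (rule P.Fubini'[OF Gm])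
    also have "\<dots> \<le> (\<integral>\<^sup>+\<omega>. ennreal (psi \<omega> * (\<Sum>l\<in>L. (norm (S l \<omega>))\<^sup>2)) + ennreal (real (card L)) \<partial>M)"
    proof (rule nn_integral_mono)
      fix \<omega> assume w: "\<omega> \<in> space M"
      note sec = L2_process_section[OF Y w]
      have Zt[measurable]: "(\<lambda>t. Z l \<omega> t) \<in> borel_measurable I01" for l
        using measurable_compose[OF measurable_Pair1'[OF w] Zm[of l]] by simp
      have "(\<integral>\<^sup>+t. G \<omega> t \<partial>I01) = (\<integral>\<^sup>+t. ennreal (psi \<omega>) * (\<Sum>l\<in>L. ennreal ((norm (S l \<omega>
          + Z l \<omega> t))\<^sup>2)) \<partial>I01)"
        using psi0(1)[of \<omega>] by (simp add: G_def ennreal_mult' less_imp_le sum_ennreal)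
      also have "\<dots> = ennreal (psi \<omega>) * (\<integral>\<^sup>+t. (\<Sum>l\<in>L. ennreal ((norm (S l \<omega> + Z l \<omega> t))\<^sup>2)) \<partial>I01)"
        by (rule nn_integral_cmult) measurable
      also have "\<dots> = ennreal (psi \<omega>) * (\<Sum>l\<in>L. (\<integral>\<^sup>+t. ennreal ((norm (S l \<omega> + Z l \<omega> t))\<^sup>2) \<partial>I01))"
        by (subst nn_integral_sum) auto
      also have "\<dots> \<le> ennreal (psi \<omega>) * (\<Sum>l\<in>L. ennreal ((norm (S l \<omega>))\<^sup>2 + q \<omega>))"
        unfolding q_def Z_def by (intro mult_left_mono sum_mono fourier_coeff_deviation sec) auto
      also have "\<dots> = ennreal (psi \<omega> * (\<Sum>l\<in>L. (norm (S l \<omega>))\<^sup>2) + real (card L) * (psi \<omega> * q \<omega>))"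
      proof -
        have "(\<Sum>l\<in>L. ennreal ((norm (S l \<omega>))\<^sup>2 + q \<omega>)) = ennreal (\<Sum>l\<in>L. (norm (S l \<omega>))\<^sup>2 + q \<omega>)"
          using q0[of \<omega>] by (intro sum_ennreal) (auto intro: add_nonneg_nonneg)
        then have "ennreal (psi \<omega>) * (\<Sum>l\<in>L. ennreal ((norm (S l \<omega>))\<^sup>2 + q \<omega>)) = ennreal (psi \<omega>
            * (\<Sum>l\<in>L. (norm (S l \<omega>))\<^sup>2 + q \<omega>))"
          using psi0(1)[of \<omega>] by (simp only: ennreal_mult'[OF less_imp_le])
        also have "psi \<omega> * (\<Sum>l\<in>L. (norm (S l \<omega>))\<^sup>2 + q \<omega>) = psi \<omega> * (\<Sum>l\<in>L. (norm (S l \<omega>))\<^sup>2)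
            + real (card L) * (psi \<omega> * q \<omega>)"
          by (simp add: sum.distrib distrib_left)
        finally show ?thesis .
      qed
      also have "\<dots> \<le> ennreal (psi \<omega> * (\<Sum>l\<in>L. (norm (S l \<omega>))\<^sup>2) + real (card L))"
        using psi0(2)[of \<omega>] by (intro ennreal_leI add_left_mono) (simp add: mult_left_le)
      also have "\<dots> = ennreal (psi \<omega> * (\<Sum>l\<in>L. (norm (S l \<omega>))\<^sup>2)) + ennreal (real (card L))"
        using psi0(1)[of \<omega>] by (intro ennreal_plus mult_nonneg_nonneg sum_nonneg) auto
      finally show "(\<integral>\<^sup>+t. G \<omega> t \<partial>I01) \<le> ennreal (psi \<omega> * (\<Sum>l\<in>L. (norm (S l \<omega>))\<^sup>2))
          + ennreal (real (card L))" .
    qed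
    also have "\<dots> = E S + ennreal (real (card L))"
      unfolding E_def by (subst nn_integral_add) (auto simp: M.emeasure_space_1)
    also have "\<dots> \<le> ennreal (real k * c) + ennreal (real (card L))" using ES by (rule add_right_mono)
    also have "\<dots> = ennreal (real k * c + real (card L))" using cL by simp
    also have "\<dots> < ennreal (real k * c + c)" using cL by (intro ennreal_lessI) (auto simp: c_def
        add_nonneg_pos)
    finally show False by simp
  qed
  \<comment> \<open>The state of the recursion is the last point chosen together with the running
    sums of deviations. The point in the initial state is a dummy, so the sampling points are read
    off from the successor states.\<close>
  define Q where "Q k x \<longleftrightarrow> (\<forall>l. snd x l \<in> borel_measurable M) \<and> E (snd x) \<le> ennreal (real k * c)"
      for k and x :: "real \<times> (int \<Rightarrow> 'a \<Rightarrow> complex)"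
  have "\<exists>x. \<forall>k. Q k (x k) \<and> (fst (x (Suc k)) \<in> {0..1} \<and> snd (x (Suc k)) = (\<lambda>l \<omega>. snd (x k) l \<omega>
      + Z l \<omega> (fst (x (Suc k)))))"
  proof (rule dependent_nat_choice)
    show "\<exists>x. Q 0 x" by (rule exI[of _ "(0, \<lambda>_ _. 0)"]) (simp add: Q_def E_def)
    fix x k assume "Q k x"
    then have m: "\<And>l. snd x l \<in> borel_measurable M" and e: "E (snd x) \<le> ennreal (real k * c)"
        by (auto simp: Q_def)
    from step[OF m e] obtain t where t: "t \<in> {0..1}" "E (\<lambda>l \<omega>. snd x l \<omega> + Z l \<omega> t)
        \<le> ennreal (real k * c + c)" by blast
    have "(\<lambda>\<omega>. Z l \<omega> t) \<in> borel_measurable M" for l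
      using measurable_compose[OF measurable_Pair2'[of t I01 M] Zm[of l]] t(1) by simp
    then have "Q (Suc k) (t, \<lambda>l \<omega>. snd x l \<omega> + Z l \<omega> t)" using m t by (auto simp: Q_def algebra_simps)
    then show "\<exists>y. Q (Suc k) y \<and> (fst y \<in> {0..1} \<and> snd y = (\<lambda>l \<omega>. snd x l \<omega> + Z l \<omega> (fst y)))"
      using t by (intro exI[of _ "(t, \<lambda>l \<omega>. snd x l \<omega> + Z l \<omega> t)"]) auto
  qed
  then obtain x where x: "\<And>k. Q k (x k)" "\<And>k. fst (x (Suc k)) \<in> {0..1}"
    "\<And>k. snd (x (Suc k)) = (\<lambda>l \<omega>. snd (x k) l \<omega> + Z l \<omega> (fst (x (Suc k))))" by blast
  define u where "u i = fst (x (Suc i))" for i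
  define S where "S k l \<omega> = snd (x k) l \<omega>" for k l \<omega>
  have Sm[measurable]: "S k l \<in> borel_measurable M" for k l using x(1)[of k]
      by (auto simp: Q_def S_def[abs_def])
  have ES: "E (S k) \<le> ennreal (real k * c)" for k using x(1)[of k] by (simp add: Q_def S_def[abs_def])
  have Ssum: "S k l \<omega> = S 0 l \<omega> + (\<Sum>i<k. Z l \<omega> (u i))" for k l \<omega>
    by (induction k) (simp_all add: S_def x(3) u_def)
  have S0: "AE \<omega> in M. \<forall>l\<in>L. S 0 l \<omega> = 0"
  proof -
    have "E (S 0) = 0" using ES[of 0] by simp
    then have "AE \<omega> in M. ennreal (psi \<omega> * (\<Sum>l\<in>L. (norm (S 0 l \<omega>))\<^sup>2)) = 0"
      unfolding E_def by (subst (asm) nn_integral_0_iff_AE) auto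
    then show ?thesis
    proof eventually_elim
      case (elim \<omega>)
      have "psi \<omega> * (\<Sum>l\<in>L. (norm (S 0 l \<omega>))\<^sup>2) \<ge> 0" using psi0(1)[of \<omega>]
          by (intro mult_nonneg_nonneg sum_nonneg) auto
      then have "psi \<omega> * (\<Sum>l\<in>L. (norm (S 0 l \<omega>))\<^sup>2) = 0" using elim by (simp add: ennreal_eq_0_iff)
      then have "(\<Sum>l\<in>L. (norm (S 0 l \<omega>))\<^sup>2) = 0" using psi0(1)[of \<omega>] by simp
      then show ?case using L by (simp add: sum_nonneg_eq_0_iff)
    qed
  qed
  \<comment> \<open>The weighted mean square error of the average over \<open>4^m\<close> points.
    Its expectation is at most \<open>c * (1/4)^m\<close>, so the sum over m is almost surely finite
    and the terms tend to 0.\<close>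
  define D where "D m \<omega> = psi \<omega> * (\<Sum>l\<in>L. (norm (S (4^m) l \<omega> / 4^m))\<^sup>2)" for m :: nat and \<omega>
  have D0: "D m \<omega> \<ge> 0" for m \<omega> unfolding D_def using psi0(1)[of \<omega>]
      by (intro mult_nonneg_nonneg sum_nonneg) auto
  have Dm[measurable]: "D m \<in> borel_measurable M" for m unfolding D_def by measurable
  have ED: "(\<integral>\<^sup>+\<omega>. ennreal (D m \<omega>) \<partial>M) \<le> ennreal (c * (1/4)^m)" for m
  proof -
    have "D m \<omega> = (1 / (4^m)\<^sup>2) * (psi \<omega> * (\<Sum>l\<in>L. (norm (S (4^m) l \<omega>))\<^sup>2))" for \<omega>
      by (simp add: D_def norm_divide norm_power power_divide sum_divide_distrib[symmetric])
    then have "(\<integral>\<^sup>+\<omega>. ennreal (D m \<omega>) \<partial>M) = (\<integral>\<^sup>+\<omega>. ennreal (1 / (4^m)\<^sup>2) * ennreal (psi \<omega>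
        * (\<Sum>l\<in>L. (norm (S (4^m) l \<omega>))\<^sup>2)) \<partial>M)"
      by (simp only: ennreal_mult'[symmetric] zero_le_divide_1_iff zero_le_power2) 
    also have "\<dots> = ennreal (1 / (4^m)\<^sup>2) * E (S (4^m))" unfolding E_def
        by (rule nn_integral_cmult) measurable
    also have "\<dots> \<le> ennreal (1 / (4^m)\<^sup>2) * ennreal (real (4^m) * c)" by (intro mult_left_mono ES) auto
    also have "\<dots> = ennreal (c * (1/4)^m)"
      by (simp add: ennreal_mult'[symmetric] power2_eq_square power_divide)
    finally show ?thesis .
  qed
  have "(\<integral>\<^sup>+\<omega>. (\<Sum>m. ennreal (D m \<omega>)) \<partial>M) = (\<Sum>m. \<integral>\<^sup>+\<omega>. ennreal (D m \<omega>) \<partial>M)"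
    by (rule nn_integral_suminf) measurable
  also have "\<dots> \<le> (\<Sum>m. ennreal (c * (1/4)^m))" by (intro suminf_le ED) auto
  also have "\<dots> < \<infinity>"
  proof -
    have "summable (\<lambda>m. c * (1/4::real)^m)" by (intro summable_mult summable_geometric) simp
    then show ?thesis
      by (subst suminf_ennreal2) (auto simp: c_def)
  qed
  finally have "AE \<omega> in M. (\<Sum>m. ennreal (D m \<omega>)) \<noteq> \<infinity>"
    by (intro nn_integral_PInf_AE) auto
  then have "AE \<omega> in M. \<forall>l\<in>L. sampled_coeff u (\<lambda>t. Y t \<omega>) l = fourier_coeff (\<lambda>t. Y t \<omega>) l"
    using S0
  proof eventually_elim
    case (elim \<omega>)
    have "summable (\<lambda>m. D m \<omega>)" using elim(1) D0 by (intro summable_suminf_not_top) auto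
    then have Dlim: "(\<lambda>m. D m \<omega>) \<longlonglongrightarrow> 0" by (rule summable_LIMSEQ_zero)
    show ?case
    proof
      fix l assume l: "l \<in> L"
      define a where "a = fourier_coeff (\<lambda>t. Y t \<omega>) l"
      have avg: "(\<Sum>i<4^m. of_real (Y (u i) \<omega>) * fexp (-l) (u i)) / 4^m = S (4^m) l \<omega> / 4^m + a"
          for m :: nat
        using elim(2) l by (simp add: Ssum[of "4^m"] Z_def sum_subtractf a_def add_divide_distrib
            diff_divide_distrib)
      have "(\<lambda>m. (norm (S (4^m) l \<omega> / 4^m))\<^sup>2) \<longlonglongrightarrow> 0"
      proof (rule tendsto_sandwich[OF always_eventually always_eventually tendsto_const])
        show "(\<lambda>m. D m \<omega> / psi \<omega>) \<longlonglongrightarrow> 0" using tendsto_divide[OF Dlim tendsto_const[of "psi \<omega>"]]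
            psi0(1)[of \<omega>] by simp
        show "\<forall>m. (norm (S (4^m) l \<omega> / 4^m))\<^sup>2 \<le> D m \<omega> / psi \<omega>"
          using member_le_sum[OF l _ L, of "\<lambda>l. (norm (S (4^_) l \<omega> / 4^_))\<^sup>2"] psi0(1)[of \<omega>] L l
          by (auto simp: D_def intro!: member_le_sum[of l L])
      qed simp
      then have "(\<lambda>m. sqrt ((norm (S (4^m) l \<omega> / 4^m))\<^sup>2)) \<longlonglongrightarrow> sqrt 0" by (rule tendsto_real_sqrt)
      then have "(\<lambda>m. S (4^m) l \<omega> / 4^m) \<longlonglongrightarrow> 0" by (simp add: tendsto_norm_zero_iff)
      then have "(\<lambda>m. S (4^m) l \<omega> / 4^m + a) \<longlonglongrightarrow> 0 + a" by (intro tendsto_intros)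
      then show "sampled_coeff u (\<lambda>t. Y t \<omega>) l = fourier_coeff (\<lambda>t. Y t \<omega>) l"
        unfolding sampled_coeff_def avg by (simp add: limI a_def)
    qed
  qed
  moreover have "\<forall>i. u i \<in> {0..1}" using x(2) by (simp add: u_def)
  ultimately show ?thesis by blast
qed

section \<open>Gaussian bounds\<close>

lemma normal_mgf:
  assumes "s > 0"
  shows "(\<integral>\<^sup>+x. ennreal (normal_density 0 s x) * ennreal (exp (r * x)) \<partial>lborel) = ennreal (exp (r\<^sup>2
      * s\<^sup>2 / 2))"
proof -
  have eq: "normal_density 0 s x * exp (r * x) = exp (r\<^sup>2 * s\<^sup>2 / 2) * normal_density (r * s\<^sup>2) s x"
      for x
  proof -
    have "- (x - 0)\<^sup>2 / (2 * s\<^sup>2) + r * x = r\<^sup>2 * s\<^sup>2 / 2 + - (x - r * s\<^sup>2)\<^sup>2 / (2 * s\<^sup>2)"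
      using assms by (simp add: field_simps power2_eq_square)
    then have "exp (- (x - 0)\<^sup>2 / (2 * s\<^sup>2)) * exp (r * x) = exp (r\<^sup>2 * s\<^sup>2 / 2) * exp (- (x - r
        * s\<^sup>2)\<^sup>2 / (2 * s\<^sup>2))"
      by (simp only: exp_add[symmetric])
    then show ?thesis by (simp add: normal_density_def)
  qed
  have "(\<integral>\<^sup>+x. ennreal (normal_density 0 s x) * ennreal (exp (r * x)) \<partial>lborel) =
     (\<integral>\<^sup>+x. ennreal (exp (r\<^sup>2 * s\<^sup>2 / 2)) * ennreal (normal_density (r * s\<^sup>2) s x) \<partial>lborel)"
    by (simp only: ennreal_mult'[symmetric] exp_ge_zero normal_density_nonneg eq
        ennreal_mult''[symmetric])
  also have "\<dots> = ennreal (exp (r\<^sup>2 * s\<^sup>2 / 2)) * (\<integral>\<^sup>+x. ennreal (normal_density (r * s\<^sup>2) s x) \<partial>lborel)"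
    by (rule nn_integral_cmult) measurable
  also have "(\<integral>\<^sup>+x. ennreal (normal_density (r * s\<^sup>2) s x) \<partial>lborel) = 1"
    using assms by (subst nn_integral_eq_integral) (auto intro: integrable_normal_density)
  finally show ?thesis by simp
qed

lemma wiener_increments_exp:
  assumes W: "wiener_process M W" and m: "m > 0"
  shows "(\<integral>\<^sup>+\<omega>. ennreal (exp (\<Sum>i<m. r i * (W (real (Suc i) / real m) \<omega> - W (real i / real m) \<omega>))) \<partial>M)
    = ennreal (exp ((\<Sum>i<m. (r i)\<^sup>2) / (2 * real m)))"
proof -
  interpret prob_space M using W by (simp add: wiener_process_def)
  define D where "D i \<omega> = W (real (Suc i) / real m) \<omega> - W (real i / real m) \<omega>" for i \<omega>
  have tau: "0 \<le> real 0 / real m \<and> (\<forall>i<m. real i / real m < real (Suc i) / real m)"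
    using m by (simp add: divide_strict_right_mono)
  have "indep_vars (\<lambda>_. borel) D {..<m}"
  proof -
    have "\<forall>(m::nat) \<tau>. 0 \<le> \<tau> 0 \<and> (\<forall>i<m. \<tau> i < \<tau> (Suc i)) \<longrightarrow>
        indep_vars (\<lambda>_. borel) (\<lambda>i \<omega>. W (\<tau> (Suc i)) \<omega> - W (\<tau> i) \<omega>) {..<m}"
      using W unfolding wiener_process_def by blast
    from this[rule_format, of "\<lambda>i. real i / real m" m] tau show ?thesis unfolding D_def[abs_def] by blast
  qed
  then have ind: "indep_vars (\<lambda>_. borel) (\<lambda>i \<omega>. ennreal (exp (r i * D i \<omega>))) {..<m}"
    by (rule indep_vars_compose2) measurable
  have "(\<integral>\<^sup>+\<omega>. ennreal (exp (\<Sum>i<m. r i * D i \<omega>)) \<partial>M) = (\<integral>\<^sup>+\<omega>. (\<Prod>i<m. ennreal (exp (r i * D i \<omega>))) \<partial>M)"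
    by (simp add: exp_sum prod_ennreal)
  also have "\<dots> = (\<Prod>i<m. \<integral>\<^sup>+\<omega>. ennreal (exp (r i * D i \<omega>)) \<partial>M)"
    by (rule indep_vars_nn_integral[OF _ ind]) auto
  also have "\<dots> = (\<Prod>i<m. ennreal (exp ((r i)\<^sup>2 / (2 * real m))))"
  proof (intro prod.cong refl)
    fix i assume i: "i \<in> {..<m}"
    have len: "real (Suc i) / real m - real i / real m = 1 / real m"
        by (simp add: diff_divide_distrib[symmetric])
    have "0 \<le> real i / real m \<and> real i / real m < real (Suc i) / real m" using m
        by (simp add: divide_strict_right_mono)
    then have "distributed M lborel (D i) (normal_density 0 (sqrt (real (Suc i) / real m - real i /
        real m)))"
      using W unfolding wiener_process_def D_def[abs_def] by blast
    then have d: "distributed M lborel (D i) (normal_density 0 (sqrt (1 / real m)))" unfolding len .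
    have "(\<integral>\<^sup>+\<omega>. ennreal (exp (r i * D i \<omega>)) \<partial>M) = (\<integral>\<^sup>+x. ennreal (normal_density 0 (sqrt (1 / real
        m)) x) * ennreal (exp (r i * x)) \<partial>lborel)"
      by (rule distributed_nn_integral[OF d, symmetric]) measurable
    also have "\<dots> = ennreal (exp ((r i)\<^sup>2 * (sqrt (1 / real m))\<^sup>2 / 2))" using m
        by (intro normal_mgf) simp
    also have "(r i)\<^sup>2 * (sqrt (1 / real m))\<^sup>2 / 2 = (r i)\<^sup>2 / (2 * real m)" by simp
    finally show "(\<integral>\<^sup>+\<omega>. ennreal (exp (r i * D i \<omega>)) \<partial>M) = ennreal (exp ((r i)\<^sup>2 / (2 * real m)))" .
  qed
  also have "\<dots> = ennreal (exp (\<Sum>i<m. (r i)\<^sup>2 / (2 * real m)))" by (simp add: exp_sum prod_ennreal)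
  finally show ?thesis by (simp add: D_def sum_divide_distrib)
qed

text \<open>Equidistant sampling keeps characters orthogonal as long as their frequencies differ by
  less than the number of points: no aliasing occurs.\<close>

lemma discrete_parseval:
  fixes a :: "int \<Rightarrow> complex"
  assumes L: "finite L" and m: "m > 0" and sep: "\<And>l l'. l \<in> L \<Longrightarrow> l' \<in> L \<Longrightarrow> \<bar>l - l'\<bar> < int m"
  shows "(\<Sum>i<m. (norm (\<Sum>l\<in>L. a l * fexp (-l) (real i / real m)))\<^sup>2) = real m * (\<Sum>l\<in>L. (norm (a l))\<^sup>2)"
proof -
  have "complex_of_real (\<Sum>i<m. (norm (\<Sum>l\<in>L. a l * fexp (-l) (real i / real m)))\<^sup>2) =
    (\<Sum>i<m. (\<Sum>l\<in>L. a l * fexp (-l) (real i / real m)) * cnj (\<Sum>l\<in>L. a l * fexp (-l) (real i / real m)))"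
    by (simp only: of_real_sum complex_norm_square)
  also have "\<dots> = (\<Sum>i<m. \<Sum>l\<in>L. \<Sum>l'\<in>L. a l * cnj (a l') * fexp (l' - l) (real i / real m))"
  proof (intro sum.cong refl)
    fix i
    have "fexp (-l) x * fexp l' x = fexp (l' - l) x" for l l' x using ee_add[of "-l" l' x] by simp
    then have "a l * fexp (-l) x * (cnj (a l') * fexp l' x) = a l * cnj (a l') * fexp (l' - l) x"
        for l l' x
      by (metis mult.assoc mult.left_commute)
    note e = this
    have "cnj (\<Sum>l\<in>L. a l * fexp (-l) (real i / real m)) = (\<Sum>l\<in>L. cnj (a l) * fexp l (real i / real m))"
      by (simp add: cnj_ee)
    then show "(\<Sum>l\<in>L. a l * fexp (-l) (real i / real m)) * cnj (\<Sum>l\<in>L. a l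
        * fexp (-l) (real i / real m)) =
       (\<Sum>l\<in>L. \<Sum>l'\<in>L. a l * cnj (a l') * fexp (l' - l) (real i / real m))"
      by (simp only: sum_product e)
  qed
  also have "\<dots> = (\<Sum>l\<in>L. \<Sum>l'\<in>L. \<Sum>i<m. a l * cnj (a l') * fexp (l' - l) (real i / real m))"
    by (subst sum.swap, intro sum.cong refl, rule sum.swap)
  also have "\<dots> = (\<Sum>l\<in>L. \<Sum>l'\<in>L. if l' = l then of_nat m * (a l * cnj (a l')) else 0)"
  proof (intro sum.cong refl)
    fix l l' assume l: "l \<in> L" "l' \<in> L"
    have "int m dvd l' - l \<longleftrightarrow> l' = l"
      using sep[OF l(2,1)] dvd_imp_le_int[of "l' - l" "int m"] m by auto
    then show "(\<Sum>i<m. a l * cnj (a l') * fexp (l' - l) (real i / real m)) = (if l' = l then of_nat m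
        * (a l * cnj (a l')) else 0)"
      using sum_roots_of_unity[OF m, of "l' - l"] by (simp add: sum_distrib_left[symmetric] mult.commute)
  qed
  also have "\<dots> = (\<Sum>l\<in>L. of_nat m * (a l * cnj (a l)))" using L by (simp add: sum.delta')
  also have "\<dots> = complex_of_real (real m * (\<Sum>l\<in>L. (norm (a l))\<^sup>2))"
    by (simp only: complex_norm_square[symmetric] of_real_mult of_real_sum sum_distrib_left
        of_real_of_nat_eq)
  finally show ?thesis by (simp only: of_real_eq_iff)
qed

lemma wiener_measurable:
  "wiener_process M W \<Longrightarrow> 0 \<le> t \<Longrightarrow> W t \<in> borel_measurable M"
  by (simp add: wiener_process_def)

lemma stj_measurable:
  assumes "\<And>t. 0 \<le> t \<Longrightarrow> (\<lambda>\<omega>. W t \<omega>) \<in> borel_measurable M"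
  shows "(\<lambda>\<omega>. stieltjes_sum (\<lambda>t. W t \<omega>) l n) \<in> borel_measurable M"
  unfolding stieltjes_sum_def
  by (intro borel_measurable_sum borel_measurable_times borel_measurable_const
      measurable_compose[OF _ measurable_of_real] borel_measurable_diff assms) auto

lemma slim_measurable:
  assumes "\<And>t. 0 \<le> t \<Longrightarrow> (\<lambda>\<omega>. W t \<omega>) \<in> borel_measurable M"
  shows "(\<lambda>\<omega>. stieltjes_lim (\<lambda>t. W t \<omega>) l) \<in> borel_measurable M"
  unfolding stieltjes_lim_def by (rule borel_measurable_lim_metric) (rule stj_measurable[OF assms])

lemma wiener_stj_AE:
  assumes W: "wiener_process M W"
  shows "AE \<omega> in M. \<forall>l. stieltjes_sum (\<lambda>t. W t \<omega>) l \<longlonglongrightarrow> stieltjes_lim (\<lambda>t. W t \<omega>) l"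
proof -
  have "AE \<omega> in M. continuous_on {0..} (\<lambda>t. W t \<omega>)" using W by (simp add: wiener_process_def)
  then show ?thesis
  proof eventually_elim
    case (elim \<omega>)
    then have "continuous_on {0..1} (\<lambda>t. W t \<omega>)" by (rule continuous_on_subset) auto
    then show ?case by (simp add: stj_convergent)
  qed
qed

text \<open>For finite sums the exponential moment is explicit, and \<open>discrete_parseval\<close>
  bounds its exponent; Fatou's lemma carries the bound to the limit. Passing from the real part of
  the trigonometric sum to its modulus makes the exponent an upper bound, hence sub-Gaussian rather
  than Gaussian.\<close>

lemma wiener_subgauss:
  assumes W: "wiener_process M W" and L: "finite L"
  shows "(\<integral>\<^sup>+\<omega>. ennreal (exp (Re (\<Sum>l\<in>L. a l * stieltjes_lim (\<lambda>t. W t \<omega>) l))) \<partial>M)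
      \<le> ennreal (exp ((\<Sum>l\<in>L. (norm (a l))\<^sup>2) / 2))"
proof -
  define K where "K = ennreal (exp ((\<Sum>l\<in>L. (norm (a l))\<^sup>2) / 2))"
  define g where "g n \<omega> = ennreal (exp (Re (\<Sum>l\<in>L. a l * stieltjes_sum (\<lambda>t. W t \<omega>) l n)))" for n \<omega>
  have gm: "g n \<in> borel_measurable M" for n
  proof -
    have [measurable]: "(\<lambda>\<omega>. stieltjes_sum (\<lambda>t. W t \<omega>) l n) \<in> borel_measurable M" for l
      by (rule stj_measurable) (rule wiener_measurable[OF W])
    show ?thesis unfolding g_def by measurable
  qed
  \<comment> \<open>A bound for the frequencies: once n exceeds \<open>2 * b\<close>, all their
    differences are below n.\<close>
  obtain b where b: "\<And>l. l \<in> L \<Longrightarrow> \<bar>l\<bar> \<le> int b"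
  proof (rule that[of "nat (Max (abs ` L))"])
    fix l assume "l \<in> L"
    then have "\<bar>l\<bar> \<le> Max (abs ` L)" using L by (intro Max_ge) auto
    then show "\<bar>l\<bar> \<le> int (nat (Max (abs ` L)))" by linarith
  qed
  have bound: "integral\<^sup>N M (g n) \<le> K" if n: "n > 2 * b" for n
  proof -
    have n0: "n > 0" using n by simp
    have sep: "\<bar>l - l'\<bar> < int n" if "l \<in> L" "l' \<in> L" for l l' using b[OF that(1)] b[OF that(2)] n
        by linarith
    define r where "r i = Re (\<Sum>l\<in>L. a l * fexp (-l) (real i / real n))" for i
    have "Re (\<Sum>l\<in>L. a l * stieltjes_sum (\<lambda>t. W t \<omega>) l n) = (\<Sum>i<n. r i
        * (W (real (Suc i) / real n) \<omega> - W (real i / real n) \<omega>))" for \<omega>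
    proof -
      have "(\<Sum>l\<in>L. a l * stieltjes_sum (\<lambda>t. W t \<omega>) l n) = (\<Sum>i<n. (\<Sum>l\<in>L. a l
          * fexp (-l) (real i / real n)) * of_real (W (real (Suc i) / real n) \<omega> - W (real i / real
          n) \<omega>))"
        unfolding stieltjes_sum_def sum_distrib_left sum_distrib_right
            by (subst sum.swap) (simp only: mult.assoc)
      then have "Re (\<Sum>l\<in>L. a l * stieltjes_sum (\<lambda>t. W t \<omega>) l n) = (\<Sum>i<n. Re ((\<Sum>l\<in>L. a l
          * fexp (-l) (real i / real n)) * of_real (W (real (Suc i) / real n) \<omega> - W (real i / real
          n) \<omega>)))"
        by (simp only: Re_sum)
      also have "\<dots> = (\<Sum>i<n. r i * (W (real (Suc i) / real n) \<omega> - W (real i / real n) \<omega>))"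
      proof (intro sum.cong refl)
        have "Re (z * of_real x) = Re z * x" for z x by simp
        then show "Re ((\<Sum>l\<in>L. a l * fexp (-l) (real i / real n))
            * of_real (W (real (Suc i) / real n) \<omega> - W (real i / real n) \<omega>))
          = r i * (W (real (Suc i) / real n) \<omega> - W (real i / real n) \<omega>)" for i unfolding r_def .
      qed
      finally show ?thesis .
    qed
    then have "integral\<^sup>N M (g n) = ennreal (exp ((\<Sum>i<n. (r i)\<^sup>2) / (2 * real n)))"
      unfolding g_def by (simp only: wiener_increments_exp[OF W n0])
    also have "\<dots> \<le> K"
    proof -
      have "(\<Sum>i<n. (r i)\<^sup>2) \<le> (\<Sum>i<n. (norm (\<Sum>l\<in>L. a l * fexp (-l) (real i / real n)))\<^sup>2)"
        unfolding r_def using abs_Re_le_cmod by (intro sum_mono) (metis abs_le_square_iff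
            abs_norm_cancel)
      also have "\<dots> = real n * (\<Sum>l\<in>L. (norm (a l))\<^sup>2)" by (rule discrete_parseval[OF L n0 sep])
      finally show ?thesis unfolding K_def using n0 by (intro ennreal_leI) (simp add: field_simps)
    qed
    finally show ?thesis .
  qed
  have "(\<integral>\<^sup>+\<omega>. ennreal (exp (Re (\<Sum>l\<in>L. a l * stieltjes_lim (\<lambda>t. W t \<omega>) l))) \<partial>M)
      = (\<integral>\<^sup>+\<omega>. liminf (\<lambda>n. g n \<omega>) \<partial>M)"
  proof (rule nn_integral_cong_AE)
    show "AE \<omega> in M. ennreal (exp (Re (\<Sum>l\<in>L. a l * stieltjes_lim (\<lambda>t. W t \<omega>) l))) = liminf (\<lambda>n. g n \<omega>)"
      using wiener_stj_AE[OF W]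
    proof eventually_elim
      case (elim \<omega>)
      then have "(\<lambda>n. g n \<omega>) \<longlonglongrightarrow> ennreal (exp (Re (\<Sum>l\<in>L. a l * stieltjes_lim (\<lambda>t. W t \<omega>) l)))"
        unfolding g_def by (intro tendsto_ennrealI tendsto_exp tendsto_Re tendsto_sum tendsto_mult
            tendsto_const) auto
      then show ?case using lim_imp_Liminf[of sequentially] by force
    qed
  qed
  also have "\<dots> \<le> liminf (\<lambda>n. integral\<^sup>N M (g n))" by (rule nn_integral_liminf[OF gm])
  also have "\<dots> \<le> liminf (\<lambda>n::nat. K)"
    by (rule Liminf_mono) (use bound in \<open>auto intro!: eventually_mono[OF eventually_gt_at_top[of "2
        * b"]]\<close>)
  also have "\<dots> = K" by (simp add: Liminf_const)
  finally show ?thesis unfolding K_def .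
qed

section \<open>Moments from exponential bounds\<close>

lemma powr_le_exp: 
  assumes "x \<ge> 0" "\<rho> > 0" shows "x powr \<rho> \<le> \<rho> powr \<rho> * exp (x::real)"
proof (cases "x = 0")
  case False
  then have x: "x > 0" using assms by simp
  have "ln (x / \<rho>) \<le> x / \<rho> - 1" using x assms by (intro ln_le_minus_one) simp
  then have "\<rho> * ln (x / \<rho>) \<le> \<rho> * (x / \<rho>)" using assms by (intro mult_left_mono) auto
  then have "\<rho> * ln x \<le> \<rho> * ln \<rho> + x" using x assms by (simp add: ln_div algebra_simps)
  then have "exp (\<rho> * ln x) \<le> exp (\<rho> * ln \<rho> + x)" by simp
  then show ?thesis using x assms by (simp add: powr_def exp_add)
qed (use assms in simp)

text \<open>An exponential Markov inequality for a truncated moment. At d = 0 it is a plain moment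
  bound, as used for the levels up to \<open>i0\<close>; for larger \<open>d\<close> the last factor
  is the gain from thresholding.\<close>

lemma subgauss_tail:
  fixes Z :: "'a \<Rightarrow> real"
  assumes Z[measurable]: "Z \<in> borel_measurable M" and V: "V > 0"
    and sg: "\<And>t. (\<integral>\<^sup>+\<omega>. ennreal (exp (t * Z \<omega>)) \<partial>M) \<le> ennreal (exp (t\<^sup>2 * V / 2))"
    and rho: "\<rho> > 0" and d: "d \<ge> 0" and thr_const: "\<kappa> \<ge> 0"
  shows "(\<integral>\<^sup>+\<omega>. ennreal (\<bar>Z \<omega>\<bar> powr \<rho> * (if \<bar>Z \<omega>\<bar> > \<kappa> * sqrt (V * d) / 2 then 1 else 0)) \<partial>M)
    \<le> ennreal (2 * \<rho> powr \<rho> * exp 1 * V powr (\<rho> / 2) * exp (- (\<kappa> / 2 - 1) * d))"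
proof -
  \<comment> \<open>The rate has two parts, applied to |Z| / sqrt V: the 1 absorbs the power by
    \<open>powr_le_exp\<close>, and \<open>sqrt d\<close> produces
    \<open>exp (- (\<kappa> * d / 2))\<close> above the threshold. The price is exp(b^2 / 2) \<le>
    exp(1 + d).\<close>
  define b where "b = 1 + sqrt d"
  define K where "K = V powr (\<rho> / 2) * (\<rho> powr \<rho> * exp (- (\<kappa> * d / 2)))"
  have K: "K \<ge> 0" by (simp add: K_def)
  have pw: "\<bar>z\<bar> powr \<rho> * (if \<bar>z\<bar> > \<kappa> * sqrt (V * d) / 2 then 1 else 0) \<le> K * (exp (b / sqrt V * z)
      + exp (- b / sqrt V * z))" for z
  proof (cases "\<bar>z\<bar> > \<kappa> * sqrt (V * d) / 2")
    case True
    define S where "S = \<bar>z\<bar> / sqrt V"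
    have z: "\<bar>z\<bar> = sqrt V * S" and S: "S \<ge> 0" using V by (auto simp: S_def)
    have "sqrt V * (\<kappa> * sqrt d / 2) \<le> sqrt V * S" using True z by (simp add: real_sqrt_mult mult_ac)
    then have "\<kappa> * sqrt d / 2 \<le> S" using V by simp
    then have "sqrt d * (\<kappa> * sqrt d / 2) \<le> sqrt d * S" using d by (intro mult_left_mono) auto
    then have "\<kappa> * d / 2 \<le> sqrt d * S" using d by (simp add: mult_ac power2_eq_square[symmetric]
        flip: real_sqrt_mult)
    then have e1: "1 \<le> exp (sqrt d * S - \<kappa> * d / 2)" by simp
    have "\<bar>z\<bar> powr \<rho> = V powr (\<rho> / 2) * S powr \<rho>"
      using V S z by (simp add: powr_mult powr_half_sqrt[symmetric] powr_powr)
    also have "\<dots> \<le> V powr (\<rho> / 2) * ((\<rho> powr \<rho> * exp S) * exp (sqrt d * S - \<kappa> * d / 2))"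
      using powr_le_exp[OF S rho] e1 mult_mono[of "S powr \<rho>" "\<rho> powr \<rho> * exp S" 1 "exp (sqrt d
          * S - \<kappa> * d / 2)"]
      by (intro mult_left_mono) auto
    also have "(\<rho> powr \<rho> * exp S) * exp (sqrt d * S - \<kappa> * d / 2) = \<rho> powr \<rho> * exp (- (\<kappa> * d / 2))
        * exp (b * S)"
      by (simp add: b_def algebra_simps flip: exp_add)
    also have "V powr (\<rho> / 2) * \<dots> = K * exp (b * S)" by (simp add: K_def)
    also have "\<dots> \<le> K * (exp (b / sqrt V * z) + exp (- b / sqrt V * z))"
    proof (intro mult_left_mono K)
      have "b * S = b / sqrt V * z \<or> b * S = - b / sqrt V * z" by (auto simp: S_def abs_if)
      then show "exp (b * S) \<le> exp (b / sqrt V * z) + exp (- b / sqrt V * z)" by auto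
    qed
    finally show ?thesis using True by simp
  qed (use K in \<open>simp add: add_nonneg_nonneg\<close>)
  have "(\<integral>\<^sup>+\<omega>. ennreal (\<bar>Z \<omega>\<bar> powr \<rho> * (if \<bar>Z \<omega>\<bar> > \<kappa> * sqrt (V * d) / 2 then 1 else 0)) \<partial>M)
     \<le> (\<integral>\<^sup>+\<omega>. ennreal K * (ennreal (exp (b / sqrt V * Z \<omega>)) + ennreal (exp (- b / sqrt V * Z \<omega>))) \<partial>M)"
    by (intro nn_integral_mono) (use pw K in \<open>simp add: ennreal_leI flip: ennreal_plus ennreal_mult''\<close>)
  also have "\<dots> = ennreal K * ((\<integral>\<^sup>+\<omega>. ennreal (exp (b / sqrt V * Z \<omega>)) \<partial>M)
      + (\<integral>\<^sup>+\<omega>. ennreal (exp (- b / sqrt V * Z \<omega>)) \<partial>M))"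
    by (subst nn_integral_cmult, measurable) (subst nn_integral_add, auto)
  also have "\<dots> \<le> ennreal K * (ennreal (exp (b\<^sup>2 / 2)) + ennreal (exp (b\<^sup>2 / 2)))"
    using sg[of "b / sqrt V"] sg[of "- b / sqrt V"] V
    by (intro mult_left_mono add_mono) (auto simp: power_divide)
  also have "\<dots> = ennreal (K * (2 * exp (b\<^sup>2 / 2)))"
    using K by (simp flip: ennreal_plus ennreal_mult'')
  also have "\<dots> \<le> ennreal (2 * \<rho> powr \<rho> * exp 1 * V powr (\<rho> / 2) * exp (- (\<kappa> / 2 - 1) * d))"
  proof (rule ennreal_leI)
    have "0 \<le> (1 - sqrt d)\<^sup>2" by simp
    then have "b\<^sup>2 / 2 \<le> 1 + d" using d by (simp add: b_def power2_diff power2_sum)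
    then have "exp (b\<^sup>2 / 2) \<le> exp (1 + d)" by simp
    then have "K * (2 * exp (b\<^sup>2 / 2)) \<le> K * (2 * exp (1 + d))" using K by (intro mult_left_mono) auto
    also have "\<dots> = 2 * \<rho> powr \<rho> * exp 1 * V powr (\<rho> / 2) * (exp (- (\<kappa> * d / 2)) * exp d)"
      by (simp add: K_def exp_add)
    also have "exp (- (\<kappa> * d / 2)) * exp d = exp (- (\<kappa> / 2 - 1) * d)"
        by (simp add: algebra_simps flip: exp_add)
    finally show "K * (2 * exp (b\<^sup>2 / 2)) \<le> 2 * \<rho> powr \<rho> * exp 1 * V powr (\<rho> / 2)
        * exp (- (\<kappa> / 2 - 1) * d)" .
  qed
  finally show ?thesis .
qed

text \<open>The power is rounded up to the next integer; under an integral the indicators become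
  tail probabilities.\<close>

lemma powr_layer_cake:
  assumes "x \<ge> 0" "r \<ge> 0"
  shows "ennreal (x powr r) \<le> (\<Sum>m::nat. ennreal ((real m + 1) powr r) * (if x \<ge> real m then 1 else 0))"
proof -
  define k where "k = nat \<lfloor>x\<rfloor>"
  have k: "real k \<le> x" "x \<le> real k + 1" using assms(1) unfolding k_def by linarith+
  have "ennreal (x powr r) \<le> ennreal ((real k + 1) powr r)" using k assms
      by (intro ennreal_leI powr_mono2) auto
  also have "\<dots> = (\<Sum>m\<in>{k}. ennreal ((real m + 1) powr r) * (if x \<ge> real m then 1 else 0))" using k by simp
  also have "\<dots> \<le> (\<Sum>m::nat. ennreal ((real m + 1) powr r) * (if x \<ge> real m then 1 else 0))"
    by (rule sum_le_suminf) auto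
  finally show ?thesis .
qed

lemma summable_stretched_exp:
  assumes "c > 0" "\<alpha> > 0"
  shows "summable (\<lambda>m. (real m + 1) powr r * exp (- c * real m powr \<alpha>))"
proof (rule summable_comparison_test_bigo)
  show "summable (\<lambda>m. norm (1 / (real m)\<^sup>2))"
    using inverse_power_summable[of 2, where 'a=real] by (simp add: inverse_eq_divide)
  show "(\<lambda>m. (real m + 1) powr r * exp (- c * real m powr \<alpha>)) \<in> O(\<lambda>m. 1 / (real m)\<^sup>2)"
    using assms by real_asymp
qed

lemma U_filter_nonneg: "U_filter y j \<ge> 0"
  unfolding U_filter_def by (intro mult_nonneg_nonneg sum_nonneg) auto

lemma U_filter_measurable:
  assumes "L2_process M Y" shows "(\<lambda>\<omega>. U_filter (\<lambda>t. Y t \<omega>) j) \<in> borel_measurable M"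
proof -
  note [measurable] = fourier_coeff_measurable[OF assms]
  show ?thesis unfolding U_filter_def by measurable
qed

text \<open>After division by 2^(2 \<nu> j) the tails are stretched exponentials with constants
  independent of j, so the series from \<open>powr_layer_cake\<close> is bounded uniformly in
  j.\<close>

lemma U_filter_moment:
  assumes M: "prob_space M" and Y: "L2_process M Y" and C: "cond_Cup M Y \<nu>" and r: "r \<ge> 0"
  shows "\<exists>B>0. \<forall>j. (\<integral>\<^sup>+\<omega>. ennreal (U_filter (\<lambda>t. Y t \<omega>) j powr r) \<partial>M) \<le> ennreal (B * 2 powr (2 * \<nu>
      * r * real j))"
proof -
  interpret prob_space M by fact
  obtain c \<alpha> C where c: "c > 0" "\<alpha> > 0" "C > 0" and
    tail: "\<And>j t. t \<ge> 0 \<Longrightarrow> measure M {\<omega> \<in> space M. U_filter (\<lambda>u. Y u \<omega>) j \<ge> t * 2 powr (2 * \<nu>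
        * real j)} \<le> C * exp (- c * t powr \<alpha>)"
    using C unfolding cond_Cup_def by blast
  define s where "s m = (real m + 1) powr r * (C * exp (- c * real m powr \<alpha>))" for m
  have ss: "summable s"
  proof -
    have "s = (\<lambda>m. C * ((real m + 1) powr r * exp (- c * real m powr \<alpha>)))" by (auto simp: s_def)
    then show ?thesis by (simp only:) (rule summable_mult[OF summable_stretched_exp[OF c(1,2)]])
  qed
  have s0: "s m \<ge> 0" for m using c by (simp add: s_def)
  define B where "B = 1 + suminf s"
  have B: "B > 0" using suminf_nonneg[OF ss s0] by (simp add: B_def)
  have "(\<integral>\<^sup>+\<omega>. ennreal (U_filter (\<lambda>t. Y t \<omega>) j powr r) \<partial>M) \<le> ennreal (B * 2 powr (2 * \<nu> * r
      * real j))" for j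
  proof -
    define q where "q = 2 powr (2 * \<nu> * real j)"
    have q: "q > 0" by (simp add: q_def)
    define X where "X \<omega> = U_filter (\<lambda>t. Y t \<omega>) j / q" for \<omega>
    note [measurable] = U_filter_measurable[OF Y, of j]
    have Xm[measurable]: "X \<in> borel_measurable M" unfolding X_def by measurable
    have X0: "X \<omega> \<ge> 0" for \<omega> using q U_filter_nonneg by (simp add: X_def)
    have "U_filter (\<lambda>t. Y t \<omega>) j powr r = q powr r * X \<omega> powr r" for \<omega>
      using q X0[of \<omega>] by (simp add: X_def powr_mult[symmetric] U_filter_nonneg)
    then have "(\<integral>\<^sup>+\<omega>. ennreal (U_filter (\<lambda>t. Y t \<omega>) j powr r) \<partial>M) = (\<integral>\<^sup>+\<omega>. ennreal (q powr r)
        * ennreal (X \<omega> powr r) \<partial>M)"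
      by (simp add: ennreal_mult')
    also have "\<dots> = ennreal (q powr r) * (\<integral>\<^sup>+\<omega>. ennreal (X \<omega> powr r) \<partial>M)"
        by (rule nn_integral_cmult) measurable
    also have "(\<integral>\<^sup>+\<omega>. ennreal (X \<omega> powr r) \<partial>M) \<le> (\<integral>\<^sup>+\<omega>. (\<Sum>m::nat. ennreal ((real m + 1) powr r)
        * (if X \<omega> \<ge> real m then 1 else 0)) \<partial>M)"
      by (intro nn_integral_mono powr_layer_cake X0 r)
    also have "\<dots> = (\<Sum>m::nat. \<integral>\<^sup>+\<omega>. ennreal ((real m + 1) powr r) * (if X \<omega> \<ge> real m then 1 else 0) \<partial>M)"
      by (rule nn_integral_suminf) measurable
    also have "\<dots> \<le> (\<Sum>m. ennreal (s m))"
    proof (rule suminf_le)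
      fix m :: nat
      define A where "A = {\<omega> \<in> space M. X \<omega> \<ge> real m}"
      have A: "A \<in> sets M" unfolding A_def by measurable
      have "(\<integral>\<^sup>+\<omega>. ennreal ((real m + 1) powr r) * (if X \<omega> \<ge> real m then 1 else 0) \<partial>M) =
          (\<integral>\<^sup>+\<omega>. ennreal ((real m + 1) powr r) * indicator A \<omega> \<partial>M)"
        by (intro nn_integral_cong) (auto simp: A_def indicator_def)
      also have "\<dots> = ennreal ((real m + 1) powr r) * emeasure M A"
          by (rule nn_integral_cmult_indicator[OF A])
      also have "\<dots> = ennreal ((real m + 1) powr r) * ennreal (measure M A)"
          by (simp add: emeasure_eq_measure)
      also have "A = {\<omega> \<in> space M. U_filter (\<lambda>u. Y u \<omega>) j \<ge> real m * 2 powr (2 * \<nu> * real j)}"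
        unfolding A_def X_def q_def[symmetric] using q by (simp add: pos_le_divide_eq)
      also have "ennreal ((real m + 1) powr r) * ennreal (measure M \<dots>) \<le> ennreal ((real m
          + 1) powr r) * ennreal (C * exp (- c * real m powr \<alpha>))"
        by (intro mult_left_mono ennreal_leI tail) auto
      also have "\<dots> = ennreal (s m)" by (simp add: s_def ennreal_mult')
      finally show "(\<integral>\<^sup>+\<omega>. ennreal ((real m + 1) powr r) * (if X \<omega> \<ge> real m then 1 else 0) \<partial>M)
          \<le> ennreal (s m)" .
    qed auto
    also have "\<dots> = ennreal (suminf s)" by (rule suminf_ennreal2[OF s0 ss])
    also have "\<dots> \<le> ennreal B" by (rule ennreal_leI) (simp add: B_def)
    finally have "(\<integral>\<^sup>+\<omega>. ennreal (U_filter (\<lambda>t. Y t \<omega>) j powr r) \<partial>M) \<le> ennreal (q powr r) * ennreal B"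
      by (simp add: mult_left_mono)
    also have "\<dots> = ennreal (B * 2 powr (2 * \<nu> * r * real j))"
      using B by (simp add: q_def powr_powr mult_ac flip: ennreal_mult'')
    finally show ?thesis .
  qed
  then show ?thesis using B by blast
qed

text \<open>Independence as a product law of the two restricted paths: averaging over W with the
  filter frozen takes the place of a conditional expectation.\<close>

lemma indep_processes_nn_integral:
  assumes M: "prob_space M" and ind: "indep_processes M W Y"
    and F[measurable]: "F \<in> borel_measurable (Pi\<^sub>M {0..} (\<lambda>_. borel) \<Otimes>\<^sub>M Pi\<^sub>M {0..1} (\<lambda>_. borel))"
  shows "(\<integral>\<^sup>+\<omega>. F ((\<lambda>t\<in>{0..}. W t \<omega>), (\<lambda>t\<in>{0..1}. Y t \<omega>)) \<partial>M) =
    (\<integral>\<^sup>+\<omega>'. (\<integral>\<^sup>+\<omega>. F ((\<lambda>t\<in>{0..}. W t \<omega>), (\<lambda>t\<in>{0..1}. Y t \<omega>')) \<partial>M) \<partial>M)"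
proof -
  interpret prob_space M by fact
  let ?S = "Pi\<^sub>M {0..} (\<lambda>_. borel) :: (real \<Rightarrow> real) measure"
  let ?T = "Pi\<^sub>M {0..1} (\<lambda>_. borel) :: (real \<Rightarrow> real) measure"
  let ?W = "\<lambda>\<omega>. \<lambda>t\<in>{0..}. W t \<omega>" and ?Y = "\<lambda>\<omega>. \<lambda>t\<in>{0..1}. Y t \<omega>"
  have Wm[measurable]: "?W \<in> measurable M ?S" and Ym[measurable]: "?Y \<in> measurable M ?T"
    and eq: "distr M ?S ?W \<Otimes>\<^sub>M distr M ?T ?Y = distr M (?S \<Otimes>\<^sub>M ?T) (\<lambda>x. (?W x, ?Y x))"
    using ind unfolding indep_processes_def indep_var_distribution_eq by auto
  interpret S: prob_space "distr M ?S ?W" by (rule prob_space_distr[OF Wm])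
  interpret T: prob_space "distr M ?T ?Y" by (rule prob_space_distr[OF Ym])
  interpret P: pair_sigma_finite "distr M ?S ?W" "distr M ?T ?Y" ..
  have "(\<integral>\<^sup>+\<omega>. F (?W \<omega>, ?Y \<omega>) \<partial>M) = integral\<^sup>N (distr M (?S \<Otimes>\<^sub>M ?T) (\<lambda>x. (?W x, ?Y x))) F"
    by (rule nn_integral_distr[symmetric]) measurable
  also have "\<dots> = integral\<^sup>N (distr M ?S ?W \<Otimes>\<^sub>M distr M ?T ?Y) F" unfolding eq ..
  also have "\<dots> = (\<integral>\<^sup>+y. (\<integral>\<^sup>+x. F (x, y) \<partial>distr M ?S ?W) \<partial>distr M ?T ?Y)"
    by (rule P.nn_integral_snd[symmetric]) simp
  also have "\<dots> = (\<integral>\<^sup>+\<omega>'. (\<integral>\<^sup>+x. F (x, ?Y \<omega>') \<partial>distr M ?S ?W) \<partial>M)"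
  proof (rule nn_integral_distr[OF Ym])
    show "(\<lambda>y. \<integral>\<^sup>+x. F (x, y) \<partial>distr M ?S ?W) \<in> borel_measurable (distr M ?T ?Y)"
      by (rule S.borel_measurable_nn_integral) measurable
  qed
  also have "\<dots> = (\<integral>\<^sup>+\<omega>'. (\<integral>\<^sup>+\<omega>. F (?W \<omega>, ?Y \<omega>') \<partial>M) \<partial>M)"
  proof (rule nn_integral_cong)
    fix \<omega>' assume "\<omega>' \<in> space M"
    then have "?Y \<omega>' \<in> space ?T" using measurable_space[OF Ym] by blast
    then have "(\<lambda>x. F (x, ?Y \<omega>')) \<in> borel_measurable (distr M ?S ?W)" by measurable
    then show "(\<integral>\<^sup>+x. F (x, ?Y \<omega>') \<partial>distr M ?S ?W) = (\<integral>\<^sup>+\<omega>. F (?W \<omega>, ?Y \<omega>') \<partial>M)"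
      by (rule nn_integral_distr[OF Wm])
  qed
  finally show ?thesis .
qed

section \<open>Sums over the levels\<close>

text \<open>The graph of a convex power lies above its tangent at \<open>T\<close>, obtained from
  Young's inequality with conjugate exponents.\<close>

lemma powr_tangent:
  fixes t T :: real
  assumes "\<rho> > 1" "t \<ge> 0" "T \<ge> 0"
  shows "\<rho> * (t * T powr (\<rho> - 1)) \<le> t powr \<rho> + (\<rho> - 1) * T powr \<rho>"
proof -
  define q where "q = \<rho> / (\<rho> - 1)"
  have q: "q > 1" "1/\<rho> + 1/q = 1" "(\<rho> - 1) * q = \<rho>" using assms by (auto simp: q_def field_simps)
  have "t * T powr (\<rho> - 1) \<le> t powr \<rho> / \<rho> + (T powr (\<rho> - 1)) powr q / q"
    by (rule Youngs_inequality) (use assms q in auto)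
  also have "(T powr (\<rho> - 1)) powr q = T powr \<rho>" by (simp add: powr_powr q)
  also have "T powr \<rho> / q = (\<rho> - 1) * T powr \<rho> / \<rho>" by (simp add: q_def)
  finally show ?thesis using assms by (simp add: field_simps)
qed

text \<open>Jensen's inequality for weights of arbitrary total, by adding the tangent inequalities
  at the weighted mean \<open>T\<close>. With unit weights it is Hoelder's inequality for finite
  sums; with weights taken from wavelets it bounds the norm of a level.\<close>

lemma powr_sum_jensen:
  fixes w t :: "'a \<Rightarrow> real"
  assumes A: "finite A" and rho: "\<rho> \<ge> 1" and w: "\<And>a. a \<in> A \<Longrightarrow> w a \<ge> 0" and t: "\<And>a. a \<in> A \<Longrightarrow> t a \<ge> 0"
  shows "(\<Sum>a\<in>A. w a * t a) powr \<rho> \<le> (\<Sum>a\<in>A. w a) powr (\<rho> - 1) * (\<Sum>a\<in>A. w a * t a powr \<rho>)"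
proof (cases "(\<Sum>a\<in>A. w a) = 0")
  case True
  then have "w a = 0" if "a \<in> A" for a using A w that by (simp add: sum_nonneg_eq_0_iff)
  then show ?thesis by simp
next
  case False
  define W where "W = (\<Sum>a\<in>A. w a)"
  have W: "W > 0" using False w sum_nonneg[of A w] by (auto simp: W_def less_le)
  define T where "T = (\<Sum>a\<in>A. w a * t a) / W"
  have T: "T \<ge> 0" using W w t by (auto simp: T_def intro!: divide_nonneg_nonneg sum_nonneg)
  have WT: "(\<Sum>a\<in>A. w a * t a) = W * T" using W by (simp add: T_def)
  show ?thesis
  proof (cases "\<rho> = 1")
    case True
    then show ?thesis using False W w t by (simp add: W_def[symmetric] sum_nonneg)
  next
    case False
    then have r: "\<rho> > 1" using rho by simp
    have "(\<Sum>a\<in>A. w a * (\<rho> * (t a * T powr (\<rho> - 1)))) \<le> (\<Sum>a\<in>A. w a * (t a powr \<rho> + (\<rho> - 1) * T powr \<rho>))"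
      using w t T r by (intro sum_mono mult_left_mono powr_tangent) auto
    moreover have "(\<Sum>a\<in>A. w a * (\<rho> * (t a * T powr (\<rho> - 1)))) = \<rho> * T powr (\<rho> - 1) * (W * T)"
      unfolding WT[symmetric] by (simp add: sum_distrib_left mult_ac)
    moreover have "(\<Sum>a\<in>A. w a * (t a powr \<rho> + (\<rho> - 1) * T powr \<rho>)) = (\<Sum>a\<in>A. w a * t a powr \<rho>)
        + (\<rho> - 1) * T powr \<rho> * W"
      by (simp add: W_def sum.distrib sum_distrib_left sum_distrib_right distrib_left mult_ac)
    moreover have "\<rho> * T powr (\<rho> - 1) * (W * T) = \<rho> * (W * T powr \<rho>)"
        using T powr_mult_base[of T "\<rho> - 1"] by (simp add: mult.commute[of _ T])
    moreover have "(\<rho> - 1) * T powr \<rho> * W = \<rho> * (W * T powr \<rho>) - W * T powr \<rho>"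
        by (simp add: algebra_simps)
    ultimately have "W * T powr \<rho> \<le> (\<Sum>a\<in>A. w a * t a powr \<rho>)" by linarith
    then have "W powr (\<rho> - 1) * (W * T powr \<rho>) \<le> W powr (\<rho> - 1) * (\<Sum>a\<in>A. w a * t a powr \<rho>)"
      by (intro mult_left_mono) auto
    moreover have "W powr (\<rho> - 1) * (W * T powr \<rho>) = (W * T) powr \<rho>"
      using W T powr_mult_base[of W "\<rho> - 1"] by (simp add: powr_mult mult_ac)
    ultimately show ?thesis unfolding WT W_def[symmetric] by simp
  qed
qed

text \<open>What thresholding loses of the signal at a level, in L^\<rho>. The first entry of the
  minimum is the embedding bound for losing the whole level; the second comes from min(|\<beta>|,
  t)^\<rho> \<le> |\<beta>|^p t^(\<rho> - p) with t^2 of order 2^(2 \<nu> i) (i - i0) / x. Up to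
  \<open>i0\<close> no coefficient is thresholded.\<close>

definition signal_bound :: "real \<Rightarrow> real \<Rightarrow> real \<Rightarrow> real \<Rightarrow> real \<Rightarrow> nat \<Rightarrow> (nat \<Rightarrow> real) \<Rightarrow> nat \<Rightarrow> real" where
  "signal_bound \<rho> p s \<nu> x i0 b i = (if i \<le> i0 then 0 else
     min (b i * 2 powr (- real i * (s - 1/p + 1/\<rho>)))
         (b i powr (p/\<rho>) * 2 powr (- real i * (p/\<rho> * (s + \<nu> + 1/2) - (\<nu> + 1/2)))
             * (real (i - i0) / x) powr ((1 - p/\<rho>)/2)))"

text \<open>In L^\<rho> the noise grows by 2^(\<nu> + 1/2) per level; beyond \<open>i0\<close> the
  natural difference \<open>i - i0\<close> becomes positive and the exceedance probability takes
  twice that growth away, so the bound falls at the rate at which it had risen.\<close>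

definition noise_bound :: "real \<Rightarrow> real \<Rightarrow> nat \<Rightarrow> nat \<Rightarrow> real" where
  "noise_bound \<nu> x i0 i = x powr (-1/2) * 2 powr ((\<nu> + 1/2) * (real i - 2 * real (i - i0)))"

lemma sum_powr_le:
  assumes "g > 0"
  shows "summable (\<lambda>k. 2 powr (- g * real k))" "finite A \<Longrightarrow> (\<Sum>k\<in>A. 2 powr (- g * real k))
      \<le> (\<Sum>k. 2 powr (- g * real k))"
proof -
  have "2 powr (- g * real k) = (2 powr (- g)) ^ k" for k
    by (simp add: powr_realpow[symmetric] powr_powr)
  moreover have "2 powr (- g) < 1" using assms powr_less_mono[of "-g" 0 2] by simp
  ultimately show s: "summable (\<lambda>k. 2 powr (- g * real k))" by (simp add: summable_geometric)
  show "finite A \<Longrightarrow> (\<Sum>k\<in>A. 2 powr (- g * real k)) \<le> (\<Sum>k. 2 powr (- g * real k))"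
    by (rule sum_le_suminf[OF s]) auto
qed

text \<open>The exponent is \<open>\<nu> + 1/2\<close> times the difference of \<open>i0\<close> and
  the distance between \<open>i\<close> and \<open>i0\<close>: two geometric series around
  \<open>i0\<close>.\<close>

lemma nzlev_sum:
  assumes "\<nu> \<ge> 0"
  shows "\<exists>G>0. \<forall>x>0. \<forall>i0 J. (\<Sum>i\<le>J. noise_bound \<nu> x i0 i) \<le> G * (x powr (-1/2) * 2 powr ((\<nu> + 1/2)
      * real i0))"
proof -
  define th where "th = \<nu> + 1/2"
  have th: "th > 0" using assms by (simp add: th_def)
  define G where "G = (\<Sum>k. 2 powr (- th * real k))"
  have G: "G \<ge> 0" unfolding G_def by (rule suminf_nonneg[OF sum_powr_le(1)[OF th]]) simp
  have "(\<Sum>i\<le>J. noise_bound \<nu> x i0 i) \<le> (2 * G + 1) * (x powr (-1/2) * 2 powr (th * real i0))"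
      if x: "x > 0" for x i0 J
  proof -
    have eq: "noise_bound \<nu> x i0 i = x powr (-1/2) * 2 powr (th * real i0) * 2 powr (- th
        * real (if i \<le> i0 then i0 - i else i - i0))" for i
    proof -
      have "(\<nu> + 1/2) * (real i - 2 * real (i - i0)) = th * real i0 + (- th * real (if i
          \<le> i0 then i0 - i else i - i0))"
        unfolding th_def[symmetric] by (auto simp: of_nat_diff algebra_simps)
      then show ?thesis unfolding noise_bound_def by (simp only: powr_add mult.assoc)
    qed
    have "(\<Sum>i\<le>J. 2 powr (- th * real (if i \<le> i0 then i0 - i else i - i0))) =
       (\<Sum>i\<in>{..J} \<inter> {..i0}. 2 powr (- th * real (i0 - i))) + (\<Sum>i\<in>{..J} - {..i0}. 2 powr (- th
           * real (i - i0)))"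
      by (subst sum.Int_Diff[of _ _ "{..i0}"]) (auto intro!: arg_cong2[of _ _ _ _ "(+)"] sum.cong)
    also have "\<dots> = (\<Sum>k\<in>(\<lambda>i. i0 - i) ` ({..J} \<inter> {..i0}). 2 powr (- th * real k))
        + (\<Sum>k\<in>(\<lambda>i. i - i0) ` ({..J} - {..i0}). 2 powr (- th * real k))"
      by (subst (1 2) sum.reindex) (auto simp: inj_on_def)
    also have "\<dots> \<le> G + G" unfolding G_def by (intro add_mono sum_powr_le[OF th]) auto
    finally have "(\<Sum>i\<le>J. 2 powr (- th * real (if i \<le> i0 then i0 - i else i - i0))) \<le> 2 * G + 1" by simp
    then have "x powr (-1/2) * 2 powr (th * real i0) * (\<Sum>i\<le>J. 2 powr (- th * real (if i
        \<le> i0 then i0 - i else i - i0)))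
      \<le> x powr (-1/2) * 2 powr (th * real i0) * (2 * G + 1)" by (intro mult_left_mono) auto
    then show ?thesis by (simp only: eq sum_distrib_left[symmetric] mult.commute)
  qed
  then show ?thesis unfolding th_def using G by (intro exI[of _ "2 * G + 1"]) auto
qed

lemma dyadic_scale:
  assumes "\<tau> > 0" "x \<ge> 1"
  defines "m \<equiv> nat \<lfloor>log 2 x / \<tau>\<rfloor>"
  shows "2 powr (real m * \<tau>) \<le> x" "x \<le> 2 powr ((real m + 1) * \<tau>)"
proof -
  have "log 2 x / \<tau> \<ge> 0" using assms by simp
  then have m: "real m \<le> log 2 x / \<tau>" "log 2 x / \<tau> \<le> real m + 1" unfolding m_def by linarith+
  have "2 powr (real m * \<tau>) \<le> 2 powr (log 2 x)" using m(1) assms(1)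
      by (intro powr_mono) (auto simp: pos_le_divide_eq)
  then show "2 powr (real m * \<tau>) \<le> x" using assms by simp
  have "2 powr (log 2 x) \<le> 2 powr ((real m + 1) * \<tau>)" using m(2) assms(1)
      by (intro powr_mono) (auto simp: pos_divide_le_eq)
  then show "x \<le> 2 powr ((real m + 1) * \<tau>)" using assms by simp
qed

lemma dyadic_powr_bounds:
  assumes "\<tau> > 0" "x \<ge> 1" "2 powr (real m * \<tau>) \<le> x" "x \<le> 2 powr ((real m + 1) * \<tau>)" "a \<ge> 0"
  shows "2 powr (real m * a) \<le> x powr (a / \<tau>)" "2 powr (- real m * a) \<le> 2 powr a * x powr (- a / \<tau>)"
proof -
  have "(2 powr (real m * \<tau>)) powr (a / \<tau>) \<le> x powr (a / \<tau>)" using assms by (intro powr_mono2) auto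
  then show "2 powr (real m * a) \<le> x powr (a / \<tau>)" using assms by (simp add: powr_powr)
  have "x powr (a / \<tau>) \<le> (2 powr ((real m + 1) * \<tau>)) powr (a / \<tau>)" using assms by (intro powr_mono2) auto
  then have "x powr (a / \<tau>) \<le> 2 powr (real m * a) * 2 powr a" using assms
      by (simp add: powr_powr powr_add[symmetric] algebra_simps)
  then have "1 / (2 powr (real m * a) * 2 powr a) \<le> 1 / x powr (a / \<tau>)" using assms
      by (intro divide_left_mono) auto
  then show "2 powr (- real m * a) \<le> 2 powr a * x powr (- a / \<tau>)" by (simp add: powr_minus field_simps)
qed

text \<open>The level \<open>i0\<close> makes 2^(i0 (2 s + 2 \<nu> + 1)) comparable to n. Beyond it
  the second entry of \<open>signal_bound\<close> decays geometrically up to a power of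
  \<open>i - i0\<close>, since g > 0, and near \<open>i0\<close> it has the size of the noise.
  \<open>i0\<close> is fixed before \<open>b\<close> and \<open>J\<close>, as the estimator must not
  depend on the target.\<close>

lemma regular_sum:
  assumes rho: "\<rho> > 1" and p: "p > 1" "p \<le> \<rho>" and s: "s > 0" and nu: "\<nu> \<ge> 0" and R: "R > 0"
    and g: "p/\<rho> * (s + \<nu> + 1/2) - (\<nu> + 1/2) > 0"
  shows "\<exists>C>0. \<forall>n::nat\<ge>1. \<exists>i0. \<forall>b J. (\<forall>i. 0 \<le> b i \<and> b i \<le> R) \<longrightarrow>
    (\<Sum>i\<le>J. signal_bound \<rho> p s \<nu> (real n) i0 b i + noise_bound \<nu> (real n) i0 i) + 1 / real n \<le> C
        * (1 / real n) powr (s / (2 * s + 2 * \<nu> + 1))"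
proof -
  define g where "g = p/\<rho> * (s + \<nu> + 1/2) - (\<nu> + 1/2)"
  define \<tau> where "\<tau> = 2 * s + 2 * \<nu> + 1"
  define \<eta> where "\<eta> = (1 - p/\<rho>)/2"
  have pos: "g > 0" "\<tau> > 0" "\<eta> \<ge> 0" using assms by (auto simp: g_def \<tau>_def \<eta>_def)
  have st: "s / \<tau> \<le> 1" using s nu by (simp add: \<tau>_def)
  obtain G where G: "G > 0" "\<And>x i0 J. x > 0 \<Longrightarrow> (\<Sum>i\<le>J. noise_bound \<nu> x i0 i) \<le> G * (x powr (-1/2)
      * 2 powr ((\<nu> + 1/2) * real i0))"
    using nzlev_sum[OF nu] by blast
  \<comment> \<open>A summable majorant of geometric decay times a power of the distance from
    \<open>i0\<close>, written with an exponential to fit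
    \<open>summable_stretched_exp\<close>.\<close>
  define S where "S d = (real d + 1) powr \<eta> * exp (- (g * ln 2) * real d powr 1)" for d :: nat
  have Ss: "summable S" unfolding S_def using pos by (intro summable_stretched_exp) auto
  have S0: "S d \<ge> 0" for d by (simp add: S_def)
  have Sd: "2 powr (- g * real d) * real d powr \<eta> \<le> S d" for d
  proof -
    have "real d powr \<eta> \<le> (real d + 1) powr \<eta>" using pos by (intro powr_mono2) auto
    moreover have "2 powr (- g * real d) = exp (- (g * ln 2) * real d powr 1)"
        by (simp add: powr_def mult_ac)
    ultimately show ?thesis unfolding S_def by (simp add: mult.commute mult_right_mono)
  qed
  define C where "C = R powr (p/\<rho>) * 2 powr g * suminf S + G + 1"
  have Spos: "suminf S \<ge> 0" by (rule suminf_nonneg[OF Ss S0])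
  have C: "C > 0" using Spos G R by (simp add: C_def add_nonneg_pos)
  have "\<exists>i0. \<forall>b J. (\<forall>i. 0 \<le> b i \<and> b i \<le> R) \<longrightarrow>
    (\<Sum>i\<le>J. signal_bound \<rho> p s \<nu> (real n) i0 b i + noise_bound \<nu> (real n) i0 i) + 1 / real n \<le> C
        * (1 / real n) powr (s / \<tau>)" if n: "n \<ge> 1" for n
  proof -
    define x where "x = real n"
    have x: "x \<ge> 1" using n by (simp add: x_def)
    define i0 where "i0 = nat \<lfloor>log 2 x / \<tau>\<rfloor>"
    note ds = dyadic_scale[OF pos(2) x, folded i0_def]
    note db = dyadic_powr_bounds[OF pos(2) x ds]
    define r where "r = x powr (- s / \<tau>)"
    have r: "(1 / real n) powr (s / \<tau>) = r" using x by (simp add: r_def x_def powr_minus_divide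
        powr_divide)
    \<comment> \<open>This identity and the next say that noise and signal at \<open>i0\<close> are
      of the same order, namely the rate.\<close>
    have e2: "(\<nu> + 1/2) / \<tau> - 1/2 = - s / \<tau>" using pos by (simp add: \<tau>_def field_simps)
    have e1: "- g / \<tau> - \<eta> = - s / \<tau>"
    proof -
      have "g = p/\<rho> / 2 * \<tau> - (\<nu> + 1/2)" by (simp add: g_def \<tau>_def algebra_simps)
      then have "g / \<tau> = p/\<rho> / 2 - (\<nu> + 1/2) / \<tau>" using pos by (simp add: diff_divide_distrib)
      moreover have "\<eta> = 1/2 - p/\<rho> / 2" by (simp add: \<eta>_def diff_divide_distrib)
      ultimately show ?thesis using e2 by simp
    qed
    show ?thesis
    proof (intro exI[of _ i0] allI impI)
      fix b :: "nat \<Rightarrow> real" and J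
      assume b: "\<forall>i. 0 \<le> b i \<and> b i \<le> R"
      have al: "signal_bound \<rho> p s \<nu> x i0 b i \<le> (if i \<le> i0 then 0 else R powr (p/\<rho>) * 2 powr g * r
          * S (i - i0))" for i
      proof (cases "i \<le> i0")
        case False
        define d where "d = i - i0"
        have id: "real i = real i0 + real d" using False by (simp add: d_def)
        have "signal_bound \<rho> p s \<nu> x i0 b i \<le> b i powr (p/\<rho>) * 2 powr (- real i * g)
            * (real d / x) powr \<eta>"
          using False by (simp add: signal_bound_def g_def \<eta>_def d_def)
        also have "\<dots> \<le> R powr (p/\<rho>) * 2 powr (- real i * g) * (real d / x) powr \<eta>"
          using b p rho by (intro mult_right_mono powr_mono2) auto
        also have "\<dots> = R powr (p/\<rho>) * 2 powr (- real i0 * g) * x powr (- \<eta>) * (2 powr (- g * real d)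
            * real d powr \<eta>)"
        proof -
          have "2 powr (- real i * g) = 2 powr (- real i0 * g) * 2 powr (- g * real d)"
            by (simp add: id powr_add[symmetric] algebra_simps)
          moreover have "(real d / x) powr \<eta> = real d powr \<eta> * x powr (- \<eta>)" using x
              by (simp add: powr_divide powr_minus_divide)
          ultimately show ?thesis by simp
        qed
        also have "\<dots> \<le> R powr (p/\<rho>) * (2 powr g * x powr (- g / \<tau>)) * x powr (- \<eta>) * S d"
          using db(2)[of g] pos Sd by (intro mult_mono) auto
        also have "\<dots> = R powr (p/\<rho>) * 2 powr g * (x powr (- g / \<tau>) * x powr (- \<eta>)) * S d" by simp
        also have "x powr (- g / \<tau>) * x powr (- \<eta>) = r" unfolding r_def using e1
            by (simp add: powr_add[symmetric])
        finally show ?thesis using False by (simp add: d_def)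
      qed (simp add: signal_bound_def)
      have "(\<Sum>i\<le>J. signal_bound \<rho> p s \<nu> x i0 b i) \<le> (\<Sum>i\<le>J. if i \<le> i0 then 0 else R powr (p/\<rho>)
          * 2 powr g * r * S (i - i0))"
        by (rule sum_mono) (rule al)
      also have "\<dots> = (\<Sum>i\<in>{..J} - {..i0}. R powr (p/\<rho>) * 2 powr g * r * S (i - i0))"
        by (rule sum.mono_neutral_cong_right) auto
      also have "\<dots> = R powr (p/\<rho>) * 2 powr g * r * (\<Sum>d\<in>(\<lambda>i. i - i0) ` ({..J} - {..i0}). S d)"
        by (subst sum.reindex) (auto simp: inj_on_def sum_distrib_left)
      also have "\<dots> \<le> R powr (p/\<rho>) * 2 powr g * r * suminf S"
        by (intro mult_left_mono sum_le_suminf[OF Ss]) (auto simp: r_def S0)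
      finally have 1: "(\<Sum>i\<le>J. signal_bound \<rho> p s \<nu> x i0 b i) \<le> R powr (p/\<rho>) * 2 powr g * suminf S
          * r" by (simp add: mult_ac)
      have "2 powr ((\<nu> + 1/2) * real i0) \<le> x powr ((\<nu> + 1/2) / \<tau>)" using db(1)[of "\<nu> + 1/2"] nu
          by (simp add: mult.commute)
      then have "x powr (-1/2) * 2 powr ((\<nu> + 1/2) * real i0) \<le> x powr (-1/2) * x powr ((\<nu>
          + 1/2) / \<tau>)" by (intro mult_left_mono) auto
      also have "\<dots> = r" unfolding r_def e2[symmetric] by (simp add: powr_add[symmetric])
      finally have 2: "(\<Sum>i\<le>J. noise_bound \<nu> x i0 i) \<le> G * r"
        using G(2)[of x i0 J] x G(1) by (intro order_trans[OF G(2)]) (auto intro: mult_left_mono)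
      have "1 / x = x powr (-1)" using x by (simp add: powr_minus_divide)
      also have "\<dots> \<le> r" unfolding r_def using x st by (intro powr_mono) auto
      finally have 3: "1 / x \<le> r" .
      show "(\<Sum>i\<le>J. signal_bound \<rho> p s \<nu> (real n) i0 b i + noise_bound \<nu> (real n) i0 i) + 1 / real n
          \<le> C * (1 / real n) powr (s / \<tau>)"
        using 1 2 3 unfolding r[folded x_def] x_def[symmetric] sum.distrib C_def
            by (simp add: distrib_right)
    qed
  qed
  then show ?thesis using C unfolding \<tau>_def by blast
qed

text \<open>The source of the logarithmic factor: \<open>A\<close> will consist of order log n
  levels, with e = p / \<rho>. For e < q Hoelder's inequality costs a power of the number of levels;
  for e \<ge> q the boundedness of \<open>b\<close> reduces e to q.\<close>

lemma critical_power_sum: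
  fixes b :: "nat \<Rightarrow> real"
  assumes e: "e > 0" and q: "q > 0" and R: "R > 0" and A: "finite A"
    and b: "\<And>i. 0 \<le> b i \<and> b i \<le> R" and bq: "(\<Sum>i\<in>A. b i powr q) \<le> R powr q"
  shows "(\<Sum>i\<in>A. b i powr e) \<le> R powr e * real (card A) powr (max (1 - e/q) 0) + R powr e
      * (if e \<ge> q then 1 else 0)"
proof (cases "e \<ge> q")
  case True
  have "(\<Sum>i\<in>A. b i powr e) \<le> (\<Sum>i\<in>A. R powr (e - q) * b i powr q)"
  proof (rule sum_mono)
    fix i
    have "b i powr e = b i powr (e - q) * b i powr q" by (simp add: powr_add[symmetric])
    also have "\<dots> \<le> R powr (e - q) * b i powr q" using b[of i] True
        by (intro mult_right_mono powr_mono2) auto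
    finally show "b i powr e \<le> R powr (e - q) * b i powr q" .
  qed
  also have "\<dots> \<le> R powr (e - q) * R powr q" unfolding sum_distrib_left[symmetric]
      by (intro mult_left_mono bq) auto
  also have "\<dots> = R powr e" by (simp add: powr_add[symmetric])
  finally show ?thesis using True by (simp add: add_increasing)
next
  case False
  have m: "max (1 - e/q) 0 = 1 - e/q" using False q by (simp add: max_def field_simps)
  define T where "T = (\<Sum>i\<in>A. b i powr e)"
  have T: "T \<ge> 0" unfolding T_def by (rule sum_nonneg) simp
  have "(\<Sum>i\<in>A. 1 * b i powr e) powr (q/e) \<le> (\<Sum>i\<in>A. 1) powr (q/e - 1) * (\<Sum>i\<in>A. 1
      * (b i powr e) powr (q/e))"
    by (rule powr_sum_jensen[OF A]) (use False e in auto)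
  then have "T powr (q/e) \<le> real (card A) powr (q/e - 1) * (\<Sum>i\<in>A. b i powr q)"
    using e by (simp add: T_def powr_powr)
  also have "\<dots> \<le> real (card A) powr (q/e - 1) * R powr q" by (intro mult_left_mono bq) auto
  finally have "(T powr (q/e)) powr (e/q) \<le> (real (card A) powr (q/e - 1) * R powr q) powr (e/q)"
    using e q by (intro powr_mono2) auto
  moreover have "(T powr (q/e)) powr (e/q) = T" using e q T by (simp add: powr_powr)
  moreover have "(real (card A) powr (q/e - 1) * R powr q) powr (e/q) = real (card A) powr (1 - e/q)
      * R powr e"
  proof -
    have "(q/e - 1) * (e/q) = 1 - e/q" using e q by (simp add: field_simps)
    then show ?thesis using e q by (simp add: powr_mult powr_powr)
  qed
  ultimately show ?thesis using False unfolding m T_def by (simp add: mult.commute)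
qed

text \<open>Levels beyond \<open>m\<close> use the embedding bound, which decays geometrically,
  those up to \<open>m\<close> the thresholding bound; \<open>m\<close> balances the two and is of
  order log n, which turns the factor (i / n)^\<eta> into (log n / n)^\<eta>. If \<gamma> > 0, level
  \<open>m\<close> dominates the lower ones; if \<gamma> = 0, they contribute alike and
  \<open>critical_power_sum\<close> applies.\<close>

lemma sparse_sum:
  assumes rho: "\<rho> > 1" and p: "p > 1" "p < \<rho>" and s: "s > 1/p" and nu: "\<nu> \<ge> 0" and R: "R > 0"
      and q: "q > 1"
    and g: "p/\<rho> * (s + \<nu> + 1/2) - (\<nu> + 1/2) \<le> 0"
  defines "rate \<equiv> \<lambda>n::nat. (ln (real n) / real n) powr ((s - 1/p + 1/\<rho>) / (2 * s + 2 * \<nu> + 1 - 2/p)) *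
     (if p/\<rho> * (s + \<nu> + 1/2) - (\<nu> + 1/2) = 0 then ln (real n) powr (max (1 - p/(\<rho>*q)) 0) else 1)"
  shows "\<exists>C>0. \<forall>n::nat\<ge>2. \<forall>b J. (\<forall>i. 0 \<le> b i \<and> b i \<le> R) \<longrightarrow> (\<forall>J. (\<Sum>i\<le>J. b i powr q) \<le> R powr q) \<longrightarrow>
    (\<Sum>i\<le>J. signal_bound \<rho> p s \<nu> (real n) 0 b i + noise_bound \<nu> (real n) 0 i) + 1 / real n \<le> C * rate n"
proof -
  define g where "g = p/\<rho> * (s + \<nu> + 1/2) - (\<nu> + 1/2)"
  define \<tau> where "\<tau> = 2 * s + 2 * \<nu> + 1 - 2/p"
  define \<eta> where "\<eta> = (1 - p/\<rho>)/2"
  define \<delta> where "\<delta> = s - 1/p + 1/\<rho>"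
  define e where "e = p/\<rho>"
  define \<gamma> where "\<gamma> = - g"
  have e0: "e > 0" "e < 1" using p rho by (auto simp: e_def)
  have \<tau>: "\<tau> > 0" using s nu by (simp add: \<tau>_def field_simps)
  have \<eta>: "\<eta> > 0" using e0 by (simp add: \<eta>_def e_def)
  have \<delta>: "\<delta> > 0" using s rho by (simp add: \<delta>_def add_pos_pos)
  have \<gamma>: "\<gamma> \<ge> 0" using g by (simp add: \<gamma>_def g_def)
  \<comment> \<open>Both entries of the minimum have the same power of n / log n at level
    \<open>m\<close>, because \<gamma> + \<delta> = \<eta> \<tau>.\<close>
  have id: "\<gamma> / \<tau> - \<eta> = - \<delta> / \<tau>"
  proof -
    have "\<gamma> + \<delta> = \<eta> * \<tau>" using p rho by (simp add: \<gamma>_def g_def \<delta>_def \<eta>_def \<tau>_def field_simps)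
    then have "(\<gamma> + \<delta>) / \<tau> = \<eta>" using \<tau> by simp
    then show ?thesis by (simp add: add_divide_distrib)
  qed
  \<comment> \<open>With i0 = 0 the noise is of order n^(-1/2); it stays below the rate because g
    \<le> 0 and s > 1 / p.\<close>
  have half: "\<delta> / \<tau> \<le> 1/2"
  proof -
    have "1/\<rho> \<le> e * (s + \<nu> + 1/2)"
    proof -
      have "1 \<le> p * s" using s p by (simp add: field_simps)
      then have "1/\<rho> \<le> p * s / \<rho>" using rho by (simp add: divide_right_mono)
      also have "\<dots> = e * s" by (simp add: e_def)
      also have "\<dots> \<le> e * (s + \<nu> + 1/2)" using e0 nu by (intro mult_left_mono) auto
      finally show ?thesis .
    qed
    also have "\<dots> \<le> \<nu> + 1/2" using g by (simp add: e_def)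
    finally show ?thesis using \<tau> by (simp add: \<delta>_def \<tau>_def field_simps)
  qed
  obtain G where G: "G > 0" "\<And>x i0 J. x > 0 \<Longrightarrow> (\<Sum>i\<le>J. noise_bound \<nu> x i0 i) \<le> G * (x powr (-1/2)
      * 2 powr ((\<nu> + 1/2) * real i0))"
    using nzlev_sum[OF nu] by blast
  define Gd where "Gd = (\<Sum>k. 2 powr (- \<delta> * real k))"
  define Gg where "Gg = (\<Sum>k. 2 powr (- \<gamma> * real k))"
  have Gd: "Gd \<ge> 0" unfolding Gd_def by (rule suminf_nonneg[OF sum_powr_le(1)[OF \<delta>]]) simp
  have Gg: "Gg \<ge> 0" if "\<gamma> > 0" unfolding Gg_def by (rule suminf_nonneg[OF sum_powr_le(1)[OF that]]) simp
  \<comment> \<open>From m \<le> log2 x / \<tau> and ln x \<le> 2 ln n.\<close>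
  define K where "K = 2 / (\<tau> * ln 2)"
  have K: "K > 0" using \<tau> by (simp add: K_def)
  define mx where "mx = max (1 - e/q) 0"
  have mx: "mx \<ge> 0" "mx = max (1 - p/(\<rho>*q)) 0" by (auto simp: mx_def e_def)
  define L2 where "L2 = (ln 2 :: real)"
  have L2: "L2 > 0" by (simp add: L2_def)
  \<comment> \<open>\<open>Ch\<close> belongs to the levels up to \<open>m\<close>,
    \<open>Ct\<close> to those beyond, and \<open>Cn\<close> to the noise together with the
    remainder 1 / n.\<close>
  define Ch where "Ch = (if \<gamma> = 0 then K powr \<eta> * (R powr e * K powr mx + R powr e) else R powr e
      * K powr \<eta> * Gg)"
  define Ct where "Ct = R * 2 powr \<delta> * Gd"
  define Cn where "Cn = (G + 1) * L2 powr (- \<delta>/\<tau>)"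
  \<comment> \<open>Since ln 2 < 1, the logarithmic factor of the rate can be below 1 at n = 2;
    \<open>xf\<close> compensates, so that terms of size \<open>r\<close> alone also fit under the
    rate.\<close>
  define xf where "xf = (if \<gamma> = 0 then L2 powr (- mx) else 1)"
  have nn: "Ch \<ge> 0" "Ct \<ge> 0" "Cn > 0" "xf > 0"
    using K R Gd Gg G \<gamma> L2 by (auto simp: Ch_def Ct_def Cn_def xf_def)
  define C where "C = Ch + (Ct + Cn) * xf"
  have C: "C > 0" using nn by (auto simp: C_def intro!: add_nonneg_pos mult_pos_pos)
  have "(\<Sum>i\<le>J. signal_bound \<rho> p s \<nu> (real n) 0 b i + noise_bound \<nu> (real n) 0 i) + 1 / real n \<le> C
      * rate n"
    if n: "n \<ge> 2" and b: "\<And>i. 0 \<le> b i \<and> b i \<le> R" and bq: "\<And>J. (\<Sum>i\<le>J. b i powr q) \<le> R powr q"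
        for n :: nat and b J
  proof -
    define N where "N = real n"
    define l where "l = ln N"
    define x where "x = N / l"
    have N: "N \<ge> 2" using n by (simp add: N_def)
    have l: "l \<ge> L2" "l > 0" using N L2 by (auto simp: l_def L2_def)
    have lN: "l \<le> N - 1" using ln_le_minus_one[of N] N by (simp add: l_def)
    have x: "x \<ge> 1" using l lN by (simp add: x_def)
    define m where "m = nat \<lfloor>log 2 x / \<tau>\<rfloor>"
    note ds = dyadic_scale[OF \<tau> x, folded m_def]
    note db = dyadic_powr_bounds[OF \<tau> x ds]
    have mK: "real m \<le> K * l"
    proof -
      have "exp 1 * (1 / exp (1::real)) = 1" by simp
      have L: "L2 \<ge> 1/2" unfolding L2_def using ln2_ge_two_thirds by simp
      \<comment> \<open>At n = 2 the divisor \<open>l\<close> is below 1 and \<open>x\<close>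
        exceeds \<open>N\<close>; the bound by \<open>N * N\<close> covers this case too.\<close>
      have "x \<le> N / L2" unfolding x_def using l N L2 by (intro divide_left_mono) auto
      also have "\<dots> \<le> N * 2" using L N L2 by (simp add: field_simps)
      also have "\<dots> \<le> N * N" using N by simp
      finally have "ln x \<le> ln (N * N)" using x N by simp
      then have "ln x \<le> 2 * l" using N by (simp add: l_def ln_mult)
      have "real m \<le> log 2 x / \<tau>" using x \<tau> unfolding m_def by (simp add: zero_le_log_cancel_iff)
      also have "\<dots> = ln x / (\<tau> * ln 2)" by (simp add: log_def)
      also have "\<dots> \<le> 2 * l / (\<tau> * ln 2)" using \<open>ln x \<le> 2 * l\<close> \<tau> by (intro divide_right_mono) auto
      finally show ?thesis by (simp add: K_def)
    qed
    define r where "r = x powr (- \<delta>/\<tau>)"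
    have r0: "r > 0" using x by (simp add: r_def)
    define lf where "lf = (if \<gamma> = 0 then l powr mx else 1)"
    have lf0: "lf > 0" using l by (simp add: lf_def)
    have rate: "rate n = r * lf"
    proof -
      have "(l / N) powr (\<delta>/\<tau>) = r" unfolding r_def x_def using l N
          by (simp add: powr_minus_divide powr_divide)
      moreover have "(p/\<rho> * (s + \<nu> + 1/2) - (\<nu> + 1/2) = 0) \<longleftrightarrow> \<gamma> = 0"
          by (simp add: \<gamma>_def g_def eq_commute[of "\<nu> + 1/2"])
      ultimately show ?thesis unfolding rate_def lf_def mx(2) l_def N_def \<delta>_def \<tau>_def by simp
    qed
    have xflf: "1 \<le> xf * lf"
    proof (cases "\<gamma> = 0")
      case True
      have "1 = L2 powr (- mx) * L2 powr mx" using L2 by (simp add: powr_add[symmetric])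
      also have "\<dots> \<le> L2 powr (- mx) * l powr mx" using l L2 mx by (intro mult_left_mono powr_mono2) auto
      finally show ?thesis using True by (simp add: xf_def lf_def)
    qed (simp add: xf_def lf_def)
    have tail: "(\<Sum>i\<in>{..J} - {..m}. signal_bound \<rho> p s \<nu> N 0 b i) \<le> Ct * r"
    proof -
      have "(\<Sum>i\<in>{..J} - {..m}. signal_bound \<rho> p s \<nu> N 0 b i) \<le> (\<Sum>i\<in>{..J} - {..m}. R
          * 2 powr (- real m * \<delta>) * 2 powr (- \<delta> * real (i - m)))"
      proof (rule sum_mono)
        fix i assume i: "i \<in> {..J} - {..m}"
        have "signal_bound \<rho> p s \<nu> N 0 b i \<le> b i * 2 powr (- real i * \<delta>)" using i
            by (simp add: signal_bound_def \<delta>_def)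
        also have "\<dots> \<le> R * 2 powr (- real i * \<delta>)" using b[of i] by (intro mult_right_mono) auto
        also have "2 powr (- real i * \<delta>) = 2 powr (- real m * \<delta>) * 2 powr (- \<delta> * real (i - m))"
          using i by (simp add: powr_add[symmetric] of_nat_diff algebra_simps)
        finally show "signal_bound \<rho> p s \<nu> N 0 b i \<le> R * 2 powr (- real m * \<delta>) * 2 powr (- \<delta>
            * real (i - m))" by simp
      qed
      also have "\<dots> = R * 2 powr (- real m * \<delta>) * (\<Sum>k\<in>(\<lambda>i. i - m) ` ({..J} - {..m}). 2 powr (- \<delta>
          * real k))"
        by (subst sum.reindex) (auto simp: inj_on_def sum_distrib_left)
      also have "\<dots> \<le> R * (2 powr \<delta> * x powr (- \<delta>/\<tau>)) * Gd"
        using db(2)[of \<delta>] \<delta> R unfolding Gd_def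
        by (intro mult_mono mult_left_mono sum_powr_le[OF \<delta>]) (auto intro!: sum_nonneg)
      finally show ?thesis by (simp add: Ct_def r_def mult_ac)
    qed
    have headb: "signal_bound \<rho> p s \<nu> N 0 b i \<le> b i powr e * 2 powr (real i * \<gamma>)
        * (real m / N) powr \<eta>" if "i \<in> {1..m}" for i
    proof -
      have "signal_bound \<rho> p s \<nu> N 0 b i \<le> b i powr e * 2 powr (- real i * g) * (real i / N) powr \<eta>"
        using that by (simp add: signal_bound_def g_def \<eta>_def e_def)
      also have "\<dots> \<le> b i powr e * 2 powr (- real i * g) * (real m / N) powr \<eta>"
        using that N \<eta> by (intro mult_left_mono powr_mono2 divide_right_mono) auto
      finally show ?thesis by (simp add: \<gamma>_def)
    qed
    have mN: "(real m / N) powr \<eta> \<le> K powr \<eta> * x powr (- \<eta>)"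
    proof -
      have "real m / N \<le> K * (1 / x)" using mK N l by (simp add: x_def field_simps)
      then have "(real m / N) powr \<eta> \<le> (K * (1 / x)) powr \<eta>" using \<eta> N by (intro powr_mono2) auto
      also have "\<dots> = K powr \<eta> * x powr (- \<eta>)" using K x by (simp add: powr_divide powr_minus_divide)
      finally show ?thesis .
    qed
    have head: "(\<Sum>i\<in>{1..m}. signal_bound \<rho> p s \<nu> N 0 b i) \<le> Ch * (r * lf)"
    proof (cases "\<gamma> = 0")
      case True
      have "(\<Sum>i\<in>{1..m}. signal_bound \<rho> p s \<nu> N 0 b i) \<le> (\<Sum>i\<in>{1..m}. b i powr e * (real m / N) powr \<eta>)"
        using headb True by (intro sum_mono) auto
      also have "\<dots> = (\<Sum>i\<in>{1..m}. b i powr e) * (real m / N) powr \<eta>" by (simp add: sum_distrib_right)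
      also have "\<dots> \<le> ((R powr e * K powr mx + R powr e) * l powr mx) * (K powr \<eta> * x powr (- \<eta>))"
      proof (intro mult_mono mN)
        have "(\<Sum>i\<in>{1..m}. b i powr q) \<le> (\<Sum>i\<le>m. b i powr q)" by (intro sum_mono2) auto
        then have "(\<Sum>i\<in>{1..m}. b i powr q) \<le> R powr q" using bq[of m] by simp
        then have "(\<Sum>i\<in>{1..m}. b i powr e) \<le> R powr e * real (card {1..m}) powr mx + R powr e
            * (if e \<ge> q then 1 else 0)"
          unfolding mx_def using e0 q R b by (intro critical_power_sum) auto
        also have "\<dots> \<le> R powr e * (K * l) powr mx + R powr e * l powr mx"
        proof (intro add_mono mult_left_mono)
          show "real (card {1..m}) powr mx \<le> (K * l) powr mx" using mK mx by (intro powr_mono2) auto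
          show "(if e \<ge> q then 1 else 0) \<le> l powr mx" using q e0 by auto
        qed auto
        also have "\<dots> = (R powr e * K powr mx + R powr e) * l powr mx" using K l
            by (simp add: powr_mult algebra_simps)
        finally show "(\<Sum>i\<in>{1..m}. b i powr e) \<le> (R powr e * K powr mx + R powr e) * l powr mx" .
      qed auto
      also have "\<dots> = Ch * (x powr (- \<eta>) * l powr mx)" using True by (simp add: Ch_def mult_ac)
      also have "x powr (- \<eta>) = r" unfolding r_def id[symmetric] using True by simp
      finally show ?thesis using True by (simp add: lf_def)
    next
      case False
      then have \<gamma>0: "\<gamma> > 0" using \<gamma> by simp
      have "(\<Sum>i\<in>{1..m}. signal_bound \<rho> p s \<nu> N 0 b i) \<le> (\<Sum>i\<in>{1..m}. R powr e * (2 powr (real m * \<gamma>)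
          * 2 powr (- \<gamma> * real (m - i))) * (K powr \<eta> * x powr (- \<eta>)))"
      proof (rule sum_mono)
        fix i assume i: "i \<in> {1..m}"
        have A: "b i powr e * 2 powr (real i * \<gamma>) * (real m / N) powr \<eta> \<le> R powr e * 2 powr (real i
            * \<gamma>) * (K powr \<eta> * x powr (- \<eta>))"
        proof (rule mult_mono[OF mult_right_mono mN])
          show "b i powr e \<le> R powr e" using b[of i] e0 by (intro powr_mono2) auto
        qed auto
        have E: "2 powr (real i * \<gamma>) = 2 powr (real m * \<gamma>) * 2 powr (- \<gamma> * real (m - i))"
          using i by (simp add: powr_add[symmetric] of_nat_diff algebra_simps)
        show "signal_bound \<rho> p s \<nu> N 0 b i \<le> R powr e * (2 powr (real m * \<gamma>) * 2 powr (- \<gamma>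
            * real (m - i))) * (K powr \<eta> * x powr (- \<eta>))"
          using order_trans[OF headb[OF i] A] by (simp only: E)
      qed
      also have "\<dots> = R powr e * 2 powr (real m * \<gamma>) * (K powr \<eta> * x powr (- \<eta>))
          * (\<Sum>k\<in>(\<lambda>i. m - i) ` {1..m}. 2 powr (- \<gamma> * real k))"
        by (subst sum.reindex) (auto simp: inj_on_def sum_distrib_left mult_ac)
      also have "\<dots> \<le> R powr e * x powr (\<gamma>/\<tau>) * (K powr \<eta> * x powr (- \<eta>)) * Gg"
        using db(1)[of \<gamma>] \<gamma> unfolding Gg_def by (intro mult_mono mult_left_mono mult_right_mono
            sum_powr_le[OF \<gamma>0]) (auto intro!: sum_nonneg)
      also have "\<dots> = Ch * (x powr (\<gamma>/\<tau>) * x powr (- \<eta>))" using False by (simp add: Ch_def mult_ac)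
      also have "x powr (\<gamma>/\<tau>) * x powr (- \<eta>) = r" unfolding r_def id[symmetric]
          by (simp add: powr_add[symmetric])
      finally show ?thesis using False by (simp add: lf_def)
    qed
    have rn: "N powr (-1/2) \<le> L2 powr (- \<delta>/\<tau>) * r"
    proof -
      have "N powr (-1/2) \<le> N powr (- \<delta>/\<tau>)" using N half by (intro powr_mono) auto
      also have "\<dots> = l powr (- \<delta>/\<tau>) * r" unfolding r_def x_def using N l by (simp add: powr_divide)
      also have "\<dots> \<le> L2 powr (- \<delta>/\<tau>) * r"
        using l L2 \<delta> \<tau> r0 by (intro mult_right_mono powr_mono2') auto
      finally show ?thesis .
    qed
    have noise: "(\<Sum>i\<le>J. noise_bound \<nu> N 0 i) + 1 / N \<le> Cn * r"
    proof -
      have "1 / N = N powr (-1)" using N by (simp add: powr_minus_divide)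
      also have "\<dots> \<le> N powr (-1/2)" using N by (intro powr_mono) auto
      finally have "(\<Sum>i\<le>J. noise_bound \<nu> N 0 i) + 1 / N \<le> (G + 1) * N powr (-1/2)"
          using G(2)[of N 0 J] N by (simp add: algebra_simps)
      also have "\<dots> \<le> (G + 1) * (L2 powr (- \<delta>/\<tau>) * r)" using G(1) by (intro mult_left_mono rn) auto
      finally show ?thesis by (simp add: Cn_def mult_ac)
    qed
    have a0: "signal_bound \<rho> p s \<nu> N 0 b i \<ge> 0" for i using b[of i] by (auto simp: signal_bound_def)
    have "(\<Sum>i\<le>J. signal_bound \<rho> p s \<nu> N 0 b i) \<le> (\<Sum>i\<in>{1..m} \<union> ({..J} - {..m}). signal_bound \<rho> p s \<nu>
        N 0 b i)"
    proof -
      have "(\<Sum>i\<le>J. signal_bound \<rho> p s \<nu> N 0 b i) = (\<Sum>i\<in>{..J} - {0}. signal_bound \<rho> p s \<nu> N 0 b i)"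
        by (rule sum.mono_neutral_right) (auto simp: signal_bound_def)
      also have "\<dots> \<le> (\<Sum>i\<in>{1..m} \<union> ({..J} - {..m}). signal_bound \<rho> p s \<nu> N 0 b i)"
        by (rule sum_mono2) (auto intro: a0)
      finally show ?thesis .
    qed
    also have "\<dots> \<le> (\<Sum>i\<in>{1..m}. signal_bound \<rho> p s \<nu> N 0 b i)
        + (\<Sum>i\<in>{..J} - {..m}. signal_bound \<rho> p s \<nu> N 0 b i)"
      by (subst sum.union_disjoint) auto
    also have "\<dots> \<le> Ch * (r * lf) + Ct * r" by (intro add_mono head tail)
    finally have "(\<Sum>i\<le>J. signal_bound \<rho> p s \<nu> N 0 b i + noise_bound \<nu> N 0 i) + 1 / N \<le> Ch * (r * lf)
        + (Ct + Cn) * r"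
      using noise by (simp add: sum.distrib algebra_simps)
    also have "\<dots> \<le> Ch * (r * lf) + (Ct + Cn) * (r * (xf * lf))"
      using xflf nn r0 by (intro add_left_mono mult_left_mono) auto
    also have "\<dots> = C * rate n" by (simp add: C_def rate algebra_simps)
    finally show ?thesis by (simp add: N_def)
  qed
  then show ?thesis using C by blast
qed

section \<open>Level-wise bounds\<close>

definition hard_threshold :: "real \<Rightarrow> real \<Rightarrow> real" where
  "hard_threshold t b = (if \<bar>b\<bar> > t then b else 0)"

text \<open>Four cases. If |z| \<le> t / 2, a discarded coefficient has |b| \<le> 3 t / 2, and for a
  kept one |z| is at most |b| and at most t. If |z| > t / 2, a kept coefficient has error |z| and a
  discarded one error |b| \<le> t + |z| < 3 |z|. At t = 0 only the noise is left.\<close>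

lemma hard_error:
  assumes "t \<ge> 0"
  shows "\<bar>hard_threshold t (b + z) - b\<bar> \<le> 3/2 * min \<bar>b\<bar> t + 3 * \<bar>z\<bar> * (if \<bar>z\<bar> > t / 2 then 1 else 0)"
  using assms unfolding hard_threshold_def min_def by (auto simp: abs_if split: if_splits)

lemma hard_error_powr:
  assumes t: "t \<ge> 0" and r: "\<rho> > 1"
  shows "\<bar>hard_threshold t (b + z) - b\<bar> powr \<rho> \<le> 6 powr \<rho> * (min \<bar>b\<bar> t powr \<rho> + \<bar>z\<bar> powr \<rho>
      * (if \<bar>z\<bar> > t / 2 then 1 else 0))"
proof -
  define u where "u = min \<bar>b\<bar> t"
  define v where "v = \<bar>z\<bar> * (if \<bar>z\<bar> > t / 2 then 1 else 0 :: real)"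
  have uv: "u \<ge> 0" "v \<ge> 0" using t by (auto simp: u_def v_def)
  have "\<bar>hard_threshold t (b + z) - b\<bar> \<le> 3/2 * u + 3 * v" using hard_error[OF t, of b z]
      by (simp add: u_def v_def)
  also have "\<dots> \<le> 6 * max u v" using uv by (auto simp: max_def)
  finally have "\<bar>hard_threshold t (b + z) - b\<bar> powr \<rho> \<le> (6 * max u v) powr \<rho>" using r
      by (intro powr_mono2) auto
  also have "\<dots> = 6 powr \<rho> * max u v powr \<rho>" using uv by (simp add: powr_mult)
  also have "\<dots> \<le> 6 powr \<rho> * (u powr \<rho> + v powr \<rho>)" by (intro mult_left_mono) (auto simp: max_def)
  also have "v powr \<rho> = \<bar>z\<bar> powr \<rho> * (if \<bar>z\<bar> > t / 2 then 1 else 0)" using r by (simp add: v_def)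
  finally show ?thesis unfolding u_def .
qed

text \<open>The term of the Besov norm up to a constant: the weight is taken at i = j + 1 instead of
  j, which is why the radius \<open>R\<close> becomes \<open>R1\<close> in
  \<open>bseq_bounds\<close>.\<close>

definition besov_level :: "(real \<Rightarrow> real) \<Rightarrow> (real \<Rightarrow> real) \<Rightarrow> real \<Rightarrow> real \<Rightarrow> nat \<Rightarrow> real" where
  "besov_level h f s p i = 2 powr (real i * (s + 1/2 - 1/p))
      * (\<Sum>k\<in>widx i. \<bar>wav_coeff h f i k\<bar> powr p) powr (1/p)"

lemma bseq_nonneg: "besov_level h f s p i \<ge> 0" by (simp add: besov_level_def)

lemma bseq_besov_term:
  assumes "p > 1" "q > 1"
  shows "besov_level h f s p i powr q = 2 powr ((s + 1/2 - 1/p) * q) * besov_term h s p q f (int i - 1)"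
proof -
  have "2 powr (real i * (s + 1/2 - 1/p) * q) = 2 powr ((s + 1/2 - 1/p) * q)
      * 2 powr (of_int (int i - 1) * (s + 1/2 - 1/p) * q)"
  proof -
    define A where "A = (s + 1/2 - 1/p) * q"
    have "real i * A = A + of_int (int i - 1) * A" by (simp add: algebra_simps)
    then show ?thesis unfolding A_def[symmetric] mult.assoc by (simp only: powr_add)
  qed
  then show ?thesis using assms
    by (simp add: besov_level_def besov_term_def powr_mult powr_powr widx_def wav_coeff_def mult.assoc)
qed

lemma bseq_bounds:
  assumes p: "p > 1" and q: "q > 1" and R: "R > 0" and f: "f \<in> besov_ball h s p q R"
  defines "R1 \<equiv> 2 powr (s + 1/2 - 1/p) * R"
  shows "(\<Sum>i\<le>J. besov_level h f s p i powr q) \<le> R1 powr q" "besov_level h f s p i \<le> R1"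
proof -
  define T where "T = besov_term h s p q f"
  have T0: "T j \<ge> 0" for j by (simp add: T_def besov_term_def)
  have Ts: "T summable_on {-1..}" and Tn: "(\<Sum>\<^sub>\<infinity>j\<in>{-1..}. T j) powr (1/q) \<le> R"
    using f by (auto simp: besov_ball_def besov_space_def besov_norm_def T_def)
  have T1: "(\<Sum>\<^sub>\<infinity>j\<in>{-1..}. T j) \<le> R powr q"
  proof -
    have nn: "(\<Sum>\<^sub>\<infinity>j\<in>{-1..}. T j) \<ge> 0" by (rule infsum_nonneg) (rule T0)
    have "((\<Sum>\<^sub>\<infinity>j\<in>{-1..}. T j) powr (1/q)) powr q \<le> R powr q" using Tn q by (intro powr_mono2) auto
    then show ?thesis using nn q by (simp add: powr_powr)
  qed
  show sum: "(\<Sum>i\<le>J. besov_level h f s p i powr q) \<le> R1 powr q" for J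
  proof -
    have "(\<Sum>i\<le>J. besov_level h f s p i powr q) = 2 powr ((s + 1/2 - 1/p) * q) * (\<Sum>i\<le>J. T (int i - 1))"
      using bseq_besov_term[OF p q] by (simp add: T_def sum_distrib_left)
    also have "(\<Sum>i\<le>J. T (int i - 1)) = (\<Sum>j\<in>(\<lambda>i. int i - 1) ` {..J}. T j)"
      by (subst sum.reindex) (auto simp: inj_on_def)
    also have "\<dots> \<le> (\<Sum>\<^sub>\<infinity>j\<in>{-1..}. T j)"
      by (rule finite_sum_le_infsum[OF Ts]) (auto intro: T0)
    also have "\<dots> \<le> R powr q" by (rule T1)
    also have "2 powr ((s + 1/2 - 1/p) * q) * R powr q = R1 powr q" using R
        by (simp add: R1_def powr_mult powr_powr)
    finally show ?thesis by (simp add: mult_left_mono)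
  qed
  have "besov_level h f s p i powr q \<le> (\<Sum>i\<le>i. besov_level h f s p i powr q)" by (rule member_le_sum) auto
  also have "\<dots> \<le> R1 powr q" by (rule sum)
  finally show "besov_level h f s p i \<le> R1"
    using powr_less_mono2[of q R1 "besov_level h f s p i"] q R by (force simp: R1_def)
qed

text \<open>Hoelder's inequality over at most 2^i positions, whose loss 2^(i (1/r - 1/p)) is exactly
  the difference of the weights. It allows p to be lowered to \<rho> when p > \<rho>.\<close>

lemma bseq_mono_p:
  assumes "1 < r" "r \<le> p"
  shows "besov_level h f s r i \<le> besov_level h f s p i"
proof -
  define N where "N = real (card (widx i))"
  have N: "N > 0" "N \<le> 2 powr real i" using card_widx[of i] by (auto simp: N_def powr_realpow)
  define S where "S u = (\<Sum>k\<in>widx i. \<bar>wav_coeff h f i k\<bar> powr u)" for u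
  have S0: "S u \<ge> 0" for u unfolding S_def by (rule sum_nonneg) simp
  have "(\<Sum>k\<in>widx i. 1 * \<bar>wav_coeff h f i k\<bar> powr r) powr (p/r) \<le> (\<Sum>k\<in>widx i. 1) powr (p/r - 1)
      * (\<Sum>k\<in>widx i. 1 * (\<bar>wav_coeff h f i k\<bar> powr r) powr (p/r))"
    by (rule powr_sum_jensen) (use assms in auto)
  then have "S r powr (p/r) \<le> N powr (p/r - 1) * S p" using assms by (simp add: S_def N_def powr_powr)
  then have "(S r powr (p/r)) powr (1/p) \<le> (N powr (p/r - 1) * S p) powr (1/p)" using assms
      by (intro powr_mono2) auto
  moreover have "(S r powr (p/r)) powr (1/p) = S r powr (1/r)" using assms by (simp add: powr_powr)
  moreover have "(N powr (p/r - 1) * S p) powr (1/p) = N powr (1/r - 1/p) * S p powr (1/p)"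
  proof -
    have "(p/r - 1) * (1/p) = 1/r - 1/p" using assms by (simp add: field_simps)
    then show ?thesis using S0 N by (simp add: powr_mult powr_powr)
  qed
  ultimately have "S r powr (1/r) \<le> N powr (1/r - 1/p) * S p powr (1/p)" by simp
  also have "\<dots> \<le> (2 powr real i) powr (1/r - 1/p) * S p powr (1/p)"
    using N assms by (intro mult_right_mono powr_mono2) (auto simp: field_simps)
  finally have "2 powr (real i * (s + 1/2 - 1/r)) * S r powr (1/r) \<le> 2 powr (real i * (s
      + 1/2 - 1/r)) * (2 powr (real i * (1/r - 1/p)) * S p powr (1/p))"
    by (intro mult_left_mono) (auto simp: powr_powr)
  also have "\<dots> = 2 powr (real i * (s + 1/2 - 1/p)) * S p powr (1/p)"
    by (simp add: powr_add[symmetric] mult.assoc[symmetric] algebra_simps)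
  finally show ?thesis by (simp add: besov_level_def S_def)
qed

lemma level_coeff_sum:
  assumes "p > 1"
  shows "(\<Sum>k\<in>widx i. \<bar>wav_coeff h f i k\<bar> powr p) = besov_level h f s p i powr p * 2 powr (- real i
      * p * (s + 1/2 - 1/p))"
proof -
  have nn: "(\<Sum>k\<in>widx i. \<bar>wav_coeff h f i k\<bar> powr p) \<ge> 0" by (rule sum_nonneg) simp
  have "besov_level h f s p i powr p = 2 powr (real i * p * (s + 1/2 - 1/p))
      * (\<Sum>k\<in>widx i. \<bar>wav_coeff h f i k\<bar> powr p)"
    using assms nn by (simp add: besov_level_def powr_mult powr_powr mult_ac)
  then show ?thesis by (simp add: powr_minus)
qed

text \<open>Inclusion of sequence spaces: the p-th power of each term is kept, and the surplus power
  is bounded by that of the total.\<close>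

lemma powr_sum_le_sum_powr:
  fixes x :: "'a \<Rightarrow> real"
  assumes "finite A" "\<And>a. a \<in> A \<Longrightarrow> x a \<ge> 0" "0 < p" "p \<le> r"
  shows "(\<Sum>a\<in>A. x a powr r) \<le> (\<Sum>a\<in>A. x a powr p) powr (r/p)"
proof -
  define S where "S = (\<Sum>a\<in>A. x a powr p)"
  have S: "S \<ge> 0" unfolding S_def by (rule sum_nonneg) simp
  have "x a powr r \<le> x a powr p * S powr (r/p - 1)" if a: "a \<in> A" for a
  proof -
    have "x a powr p \<le> S" unfolding S_def using assms a by (intro member_le_sum) auto
    then have "(x a powr p) powr (r/p - 1) \<le> S powr (r/p - 1)" using assms by (intro powr_mono2) auto
    then have "x a powr p * (x a powr p) powr (r/p - 1) \<le> x a powr p * S powr (r/p - 1)"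
        by (intro mult_left_mono) auto
    moreover have "x a powr p * (x a powr p) powr (r/p - 1) = x a powr r"
      using assms by (simp add: powr_powr powr_add[symmetric] field_simps)
    ultimately show ?thesis by simp
  qed
  then have "(\<Sum>a\<in>A. x a powr r) \<le> (\<Sum>a\<in>A. x a powr p * S powr (r/p - 1))" by (rule sum_mono)
  also have "\<dots> = S * S powr (r/p - 1)" by (simp add: S_def sum_distrib_right)
  also have "\<dots> = S powr (r/p)" using S powr_mult_base[of S "r/p - 1"] by simp
  finally show ?thesis unfolding S_def .
qed

text \<open>Jensen's inequality with the absolute values of the wavelets as weights: their sum
  contributes 2^(i (\<rho> - 1) / 2), and their integrals, after exchanging sum and integral, 2^(-i
  / 2).\<close>

lemma level_norm_bound:
  assumes h: "meyer_aux h" and r: "\<rho> > 1"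
    and C: "C \<ge> 1" "\<And>i x. (\<Sum>k\<in>widx i. \<bar>wav h i k x\<bar>) \<le> C * 2 powr (real i / 2)"
  shows "(LINT x|I01. \<bar>\<Sum>k\<in>widx i. c k * wav h i k x\<bar> powr \<rho>) \<le>
    2 * C powr \<rho> * 2 powr (real i * (\<rho> / 2 - 1)) * (\<Sum>k\<in>widx i. \<bar>c k\<bar> powr \<rho>)"
proof -
  have wi: "integrable I01 (\<lambda>x. \<bar>wav h i k x\<bar> * c)" if "k \<in> widx i" for k c
    by (intro integrable_I01_continuous continuous_intros wav_continuous[OF h that])
  have pw: "\<bar>\<Sum>k\<in>widx i. c k * wav h i k x\<bar> powr \<rho> \<le> (C * 2 powr (real i / 2)) powr (\<rho> - 1)
      * (\<Sum>k\<in>widx i. \<bar>wav h i k x\<bar> * \<bar>c k\<bar> powr \<rho>)" for x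
  proof -
    have "\<bar>\<Sum>k\<in>widx i. c k * wav h i k x\<bar> \<le> (\<Sum>k\<in>widx i. \<bar>wav h i k x\<bar> * \<bar>c k\<bar>)"
      by (rule order_trans[OF sum_abs]) (simp add: abs_mult mult.commute)
    then have "\<bar>\<Sum>k\<in>widx i. c k * wav h i k x\<bar> powr \<rho> \<le> (\<Sum>k\<in>widx i. \<bar>wav h i k x\<bar> * \<bar>c k\<bar>) powr \<rho>"
      using r by (intro powr_mono2) auto
    also have "\<dots> \<le> (\<Sum>k\<in>widx i. \<bar>wav h i k x\<bar>) powr (\<rho> - 1) * (\<Sum>k\<in>widx i. \<bar>wav h i k x\<bar> * \<bar>c k\<bar> powr \<rho>)"
      using r by (intro powr_sum_jensen) auto
    also have "\<dots> \<le> (C * 2 powr (real i / 2)) powr (\<rho> - 1) * (\<Sum>k\<in>widx i. \<bar>wav h i k x\<bar> * \<bar>c k\<bar> powr \<rho>)"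
      using r C(2) by (intro mult_right_mono powr_mono2) (auto intro!: sum_nonneg)
    finally show ?thesis .
  qed
  have cont: "continuous_on {0..1} (\<lambda>x. \<bar>\<Sum>k\<in>widx i. c k * wav h i k x\<bar> powr \<rho>)"
    using r by (intro continuous_on_powr' continuous_intros wav_continuous[OF h]) auto
  have "(LINT x|I01. \<bar>\<Sum>k\<in>widx i. c k * wav h i k x\<bar> powr \<rho>) \<le>
    (LINT x|I01. (C * 2 powr (real i / 2)) powr (\<rho> - 1) * (\<Sum>k\<in>widx i. \<bar>wav h i k x\<bar> * \<bar>c k\<bar> powr \<rho>))"
    using pw wi by (intro integral_mono integrable_I01_continuous[OF cont] integrable_mult_right
        Bochner_Integration.integrable_sum) auto
  also have "\<dots> = (C * 2 powr (real i / 2)) powr (\<rho> - 1) * (\<Sum>k\<in>widx i. (LINT x|I01. \<bar>wav h i k x\<bar>)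
      * \<bar>c k\<bar> powr \<rho>)"
    using wi by (subst integral_mult_right_zero, subst Bochner_Integration.integral_sum) auto
  also have "\<dots> \<le> (C * 2 powr (real i / 2)) powr (\<rho> - 1) * (\<Sum>k\<in>widx i. (2 * C
      * 2 powr (- real i / 2)) * \<bar>c k\<bar> powr \<rho>)"
    by (intro mult_left_mono sum_mono mult_right_mono wav_integral_bound[OF h C]) auto
  also have "\<dots> = (C * 2 powr (real i / 2)) powr (\<rho> - 1) * (2 * C * 2 powr (- real i / 2))
      * (\<Sum>k\<in>widx i. \<bar>c k\<bar> powr \<rho>)"
    by (simp add: sum_distrib_left mult.assoc)
  also have "(C * 2 powr (real i / 2)) powr (\<rho> - 1) * (2 * C * 2 powr (- real i / 2)) = 2 * C powr \<rho>
      * 2 powr (real i * (\<rho> / 2 - 1))"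
  proof -
    have "C powr (\<rho> - 1) * C = C powr \<rho>" using C(1) powr_mult_base[of C "\<rho> - 1"]
        by (simp add: mult.commute)
    moreover have "(2 powr (real i / 2)) powr (\<rho> - 1) * 2 powr (- real i / 2) = 2 powr (real i
        * (\<rho> / 2 - 1))"
    proof -
      have "real i / 2 * (\<rho> - 1) + - real i / 2 = real i * (\<rho> / 2 - 1)" by (simp add: field_simps)
      then show ?thesis by (simp only: powr_powr powr_add[symmetric])
    qed
    ultimately show ?thesis using C(1) by (simp add: powr_mult) (metis mult.assoc mult.left_commute)
  qed
  finally show ?thesis .
qed

text \<open>A bound for the conditional variance of every coefficient of the level, computable from
  the observed filter, so that it may enter the threshold. The factor
  \<open>2 * 2 powr (- real i)\<close> is the bound of \<open>norm_wc\<close>.\<close>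

definition noise_variance :: "real \<Rightarrow> (nat \<Rightarrow> real) \<Rightarrow> nat \<Rightarrow> (real \<Rightarrow> real) \<Rightarrow> real" where
  "noise_variance c u i y = 2 * c\<^sup>2 * 2 powr (- real i)
      * (\<Sum>l\<in>freqs i. 1 / (norm (sampled_coeff u y l))\<^sup>2)"

definition coeff_noise :: "(real \<Rightarrow> real) \<Rightarrow> real \<Rightarrow> (nat \<Rightarrow> real) \<Rightarrow> nat \<Rightarrow> nat \<Rightarrow> (real \<Rightarrow> real) \<Rightarrow> (real \<Rightarrow>
    real) \<Rightarrow> real" where
  "coeff_noise h c u i k w y = Re (\<Sum>l\<in>freqs i. of_real c
      * cnj (wav_ft h i k l) / sampled_coeff u y l * stieltjes_lim w l)"

lemma square_powr_half: "x > 0 \<Longrightarrow> (x\<^sup>2) powr (a/2) = x powr (a::real)"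
proof -
  assume "x > 0"
  then have "x\<^sup>2 = x powr 2" by simp
  then show ?thesis by (simp only: powr_powr) simp
qed

lemma vlev_nonneg: "noise_variance c u i y \<ge> 0"
  unfolding noise_variance_def by (intro mult_nonneg_nonneg sum_nonneg) auto

lemma yhat_measurable:
  assumes "\<And>i. (\<lambda>z. Y z (u i)) \<in> borel_measurable M"
  shows "(\<lambda>z. sampled_coeff u (Y z) l) \<in> borel_measurable M"
proof -
  have "(\<lambda>z. complex_of_real (Y z (u i))) \<in> borel_measurable M" for i
    by (rule measurable_compose[OF assms measurable_of_real])
  then show ?thesis unfolding sampled_coeff_def
    by (intro borel_measurable_lim_metric borel_measurable_divide borel_measurable_sum
        borel_measurable_times borel_measurable_const)
qed

lemma slim_cong: "(\<And>t. t \<in> {0..1} \<Longrightarrow> x t = y t) \<Longrightarrow> stieltjes_lim x l = stieltjes_lim y l"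
proof -
  assume *: "\<And>t. t \<in> {0..1} \<Longrightarrow> x t = y t"
  have "stieltjes_sum x l n = stieltjes_sum y l n" for n
    unfolding stieltjes_sum_def by (intro sum.cong refl) (subst (1 2) *, auto simp: divide_le_eq)
  then have "stieltjes_sum x l = stieltjes_sum y l" by (rule ext)
  then show ?thesis by (simp add: stieltjes_lim_def)
qed

text \<open>The variant for path spaces, where only coordinates in the unit interval are at
  hand.\<close>

lemma slim_measurable01:
  assumes "\<And>t. t \<in> {0..1} \<Longrightarrow> (\<lambda>z. x z t) \<in> borel_measurable M"
  shows "(\<lambda>z. stieltjes_lim (x z) l) \<in> borel_measurable M"
  unfolding stieltjes_lim_def
proof (rule borel_measurable_lim_metric)
  fix n
  have m: "(\<lambda>z. complex_of_real (x z (real (Suc i) / real n) - x z (real i / real n))) \<in>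
      borel_measurable M" if "i < n" for i
    by (rule measurable_compose[OF borel_measurable_diff measurable_of_real]) (use that
        in \<open>auto intro!: assms simp: divide_le_eq\<close>)
  show "(\<lambda>z. stieltjes_sum (x z) l n) \<in> borel_measurable M"
    unfolding stieltjes_sum_def by (intro borel_measurable_sum borel_measurable_times
        borel_measurable_const m) auto
qed

text \<open>The filter is real, so its coefficients at l and -l have the same modulus, and the sum
  over \<open>freqs i\<close> is at most twice that over nonnegative frequencies, all of which occur
  in \<open>U_filter y i\<close>.\<close>

lemma vlev_bound:
  assumes y: "\<And>l. l \<in> freqs i \<Longrightarrow> sampled_coeff u y l = fourier_coeff y l"
  shows "noise_variance c u i y \<le> 4 * c\<^sup>2 * U_filter y i"
proof -
  define F where "F l = 1 / (norm (fourier_coeff y l))\<^sup>2" for l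
  have F0: "F l \<ge> 0" for l by (simp add: F_def)
  have Fm: "F (-l) = F l" for l
  proof -
    have "fourier_coeff y (-l) = cnj (fourier_coeff y l)"
      unfolding fourier_coeff_I01 by (subst Bochner_Integration.integral_cnj[symmetric]) (simp add:
          cnj_ee)
    then show ?thesis by (simp add: F_def)
  qed
  have "(\<Sum>l\<in>freqs i. 1 / (norm (sampled_coeff u y l))\<^sup>2) = (\<Sum>l\<in>freqs i. F l)" using y
      by (simp add: F_def)
  also have "\<dots> \<le> (\<Sum>l\<in>int ` {..<2^i} \<union> (\<lambda>n. - int n) ` {..<2^i}. F l)"
  proof (rule sum_mono2)
    show "freqs i \<subseteq> int ` {..<2^i} \<union> (\<lambda>n. - int n) ` {..<2^i}"
    proof
      fix l assume "l \<in> freqs i"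
      then have "nat \<bar>l\<bar> < 2 ^ i" by (simp add: freqs_def nat_less_iff)
      then show "l \<in> int ` {..<2^i} \<union> (\<lambda>n. - int n) ` {..<2^i}"
        by (cases "l \<ge> 0") (auto intro!: image_eqI[of _ _ "nat \<bar>l\<bar>"])
    qed
  qed (use F0 in auto)
  also have "\<dots> \<le> (\<Sum>l\<in>int ` {..<2^i}. F l) + (\<Sum>l\<in>(\<lambda>n. - int n) ` {..<2^i}. F l)"
    by (subst sum.union_inter[symmetric]) (auto intro!: sum_nonneg F0)
  also have "\<dots> = 2 * (\<Sum>n<2^i. F (int n))"
    by (subst (1 2) sum.reindex) (auto simp: inj_on_def Fm)
  also have "\<dots> \<le> 2 * (\<Sum>n<2^(i+1). F (int n))" by (intro mult_left_mono sum_mono2) (auto simp: F0)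
  also have "\<dots> = 2 * (2 powr real i * U_filter y i)" by (simp add: U_filter_def F_def powr_realpow)
  finally have "noise_variance c u i y \<le> 2 * c\<^sup>2 * 2 powr (- real i) * (2 * (2 powr real i
      * U_filter y i))"
    unfolding noise_variance_def by (intro mult_left_mono) auto
  also have "\<dots> = 4 * c\<^sup>2 * U_filter y i" by (simp add: powr_minus)
  finally show ?thesis .
qed

lemma vlev_pos:
  assumes "c > 0" "\<And>l. l \<in> freqs i \<Longrightarrow> sampled_coeff u y l \<noteq> 0"
  shows "noise_variance c u i y > 0"
proof -
  have "0 \<in> freqs i" by (simp add: freqs_def)
  then have "0 < (\<Sum>l\<in>freqs i. 1 / (norm (sampled_coeff u y l))\<^sup>2)"
    using assms by (intro sum_pos2[of _ 0]) auto
  then show ?thesis using assms by (simp add: noise_variance_def)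
qed

lemma Re_of_real_mult: "Re (of_real t * z) = t * Re z"
  by simp

text \<open>With the filter frozen the noise is a finite combination of limits of the Wiener path,
  and \<open>norm_wc\<close> bounds its coefficients uniformly in \<open>k\<close>.\<close>

lemma znoise_subgauss:
  assumes h: "meyer_aux h" and W: "wiener_process M W"
  shows "(\<integral>\<^sup>+\<omega>. ennreal (exp (t * coeff_noise h c u i k (\<lambda>x. W x \<omega>) y)) \<partial>M) \<le> ennreal (exp (t\<^sup>2
      * noise_variance c u i y / 2))"
proof -
  define a where "a l = of_real (t * c) * cnj (wav_ft h i k l) / sampled_coeff u y l" for l
  have "t * coeff_noise h c u i k w y = Re (\<Sum>l\<in>freqs i. a l * stieltjes_lim w l)" for w
  proof -
    have "t * Re (of_real c * cnj (wav_ft h i k l) / sampled_coeff u y l * stieltjes_lim w l)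
        = Re (a l * stieltjes_lim w l)" for l
    proof -
      have "a l * stieltjes_lim w l = of_real t * (of_real c
          * cnj (wav_ft h i k l) / sampled_coeff u y l * stieltjes_lim w l)" by (simp add: a_def)
      then show ?thesis by (simp only: Re_of_real_mult)
    qed
    then show ?thesis unfolding coeff_noise_def Re_sum sum_distrib_left by (simp only:)
  qed
  then have "(\<integral>\<^sup>+\<omega>. ennreal (exp (t * coeff_noise h c u i k (\<lambda>x. W x \<omega>) y)) \<partial>M)
      \<le> ennreal (exp ((\<Sum>l\<in>freqs i. (norm (a l))\<^sup>2) / 2))"
    by (simp only:) (rule wiener_subgauss[OF W finite_freqs])
  also have "\<dots> \<le> ennreal (exp (t\<^sup>2 * noise_variance c u i y / 2))"
  proof (intro ennreal_leI, simp)
    have "(\<Sum>l\<in>freqs i. (norm (a l))\<^sup>2) \<le> (\<Sum>l\<in>freqs i. t\<^sup>2 * c\<^sup>2 * (2 * 2 powr (- real i))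
        * (1 / (norm (sampled_coeff u y l))\<^sup>2))"
    proof (rule sum_mono)
      fix l
      have "(norm (a l))\<^sup>2 = t\<^sup>2 * c\<^sup>2 * (norm (wav_ft h i k l))\<^sup>2
          * (1 / (norm (sampled_coeff u y l))\<^sup>2)"
        by (simp add: a_def norm_mult norm_divide power_mult_distrib power_divide)
      also have "\<dots> \<le> t\<^sup>2 * c\<^sup>2 * (2 * 2 powr (- real i)) * (1 / (norm (sampled_coeff u y l))\<^sup>2)"
        by (intro mult_right_mono mult_left_mono norm_wc[OF h]) auto
      finally show "(norm (a l))\<^sup>2 \<le> t\<^sup>2 * c\<^sup>2 * (2 * 2 powr (- real i))
          * (1 / (norm (sampled_coeff u y l))\<^sup>2)" .
    qed
    also have "\<dots> = t\<^sup>2 * noise_variance c u i y" by (simp add: noise_variance_def sum_distrib_left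
        mult_ac)
    finally show "(\<Sum>l\<in>freqs i. (norm (a l))\<^sup>2) \<le> t\<^sup>2 * noise_variance c u i y" .
  qed
  finally show ?thesis .
qed

text \<open>Conditionally on the filter the noise of a coefficient is sub-Gaussian with the variance that
  enters the threshold, so exceeding the threshold costs a factor exponentially small in \<open>d\<close>.\<close>

lemma znoise_tail:
  assumes M: "prob_space M" and W: "wiener_process M W" and Y: "L2_process M Y"
      and ind: "indep_processes M W Y"
    and h: "meyer_aux h" and r: "\<rho> > 1" and c: "c > 0" and u: "\<And>j. u j \<in> {0..1}"
    and good: "AE \<omega> in M. \<forall>l\<in>freqs i. sampled_coeff u (\<lambda>t. Y t \<omega>) l
        = fourier_coeff (\<lambda>t. Y t \<omega>) l \<and> fourier_coeff (\<lambda>t. Y t \<omega>) l \<noteq> 0"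
    and B: "(\<integral>\<^sup>+\<omega>. ennreal (U_filter (\<lambda>t. Y t \<omega>) i powr (\<rho>/2)) \<partial>M) \<le> ennreal (B * 2 powr (2 * \<nu>
        * (\<rho>/2) * real i))" "B > 0"
    and d: "d \<ge> 0" and thr_const: "\<kappa> \<ge> 0"
  shows "(\<integral>\<^sup>+\<omega>. ennreal (\<bar>coeff_noise h c u i k (\<lambda>t. W t \<omega>) (\<lambda>t. Y t \<omega>)\<bar> powr \<rho> *
       (if \<bar>coeff_noise h c u i k (\<lambda>t. W t \<omega>) (\<lambda>t. Y t \<omega>)\<bar> > \<kappa>
           * sqrt (noise_variance c u i (\<lambda>t. Y t \<omega>) * d) / 2 then 1 else 0)) \<partial>M)
    \<le> ennreal (2 * \<rho> powr \<rho> * exp 1 * B * (2 * c * 2 powr (\<nu> * real i)) powr \<rho> * exp (- (\<kappa> / 2 - 1)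
        * d))"
proof -
  let ?S = "Pi\<^sub>M {0..} (\<lambda>_. borel) :: (real \<Rightarrow> real) measure"
  let ?T = "Pi\<^sub>M {0..1} (\<lambda>_. borel) :: (real \<Rightarrow> real) measure"
  define G where "G w y = ennreal (\<bar>coeff_noise h c u i k w y\<bar> powr \<rho> *
       (if \<bar>coeff_noise h c u i k w y\<bar> > \<kappa> * sqrt (noise_variance c u i y * d) / 2 then 1 else 0))"
           for w y
  have [measurable]: "(\<lambda>p. stieltjes_lim (fst p) l) \<in> borel_measurable (?S \<Otimes>\<^sub>M ?T)" for l
  proof (rule slim_measurable01)
    fix t :: real assume "t \<in> {0..1}"
    then have "(\<lambda>w. w t) \<in> borel_measurable ?S" by (intro measurable_component_singleton) auto
    then show "(\<lambda>p. fst p t) \<in> borel_measurable (?S \<Otimes>\<^sub>M ?T)"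
        by (rule measurable_compose[OF measurable_fst])
  qed
  have [measurable]: "(\<lambda>p. sampled_coeff u (snd p) l) \<in> borel_measurable (?S \<Otimes>\<^sub>M ?T)" for l
  proof (rule yhat_measurable)
    fix j
    have "(\<lambda>w. w (u j)) \<in> borel_measurable ?T" by (intro measurable_component_singleton u)
    then show "(\<lambda>p. snd p (u j)) \<in> borel_measurable (?S \<Otimes>\<^sub>M ?T)"
        by (rule measurable_compose[OF measurable_snd])
  qed
  have Gm: "(\<lambda>p. G (fst p) (snd p)) \<in> borel_measurable (?S \<Otimes>\<^sub>M ?T)"
    unfolding G_def coeff_noise_def noise_variance_def by measurable
  \<comment> \<open>Independence is stated for paths restricted to their index sets;
    \<open>G\<close> reads both paths only at times in the unit interval, so the restriction changes
    nothing.\<close>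
  have slr: "stieltjes_lim (\<lambda>t\<in>{0..}. w t) l = stieltjes_lim w l" for w l by (rule slim_cong) auto
  have yhr: "sampled_coeff u (\<lambda>t\<in>{0..1}. y t) l = sampled_coeff u y l" for y l using u
      by (simp add: sampled_coeff_def)
  have Gr: "G (\<lambda>t\<in>{0..}. w t) (\<lambda>t\<in>{0..1}. y t) = G w y" for w y
    unfolding G_def coeff_noise_def noise_variance_def slr yhr ..
  have "(\<integral>\<^sup>+\<omega>. G (\<lambda>t. W t \<omega>) (\<lambda>t. Y t \<omega>) \<partial>M) = (\<integral>\<^sup>+\<omega>'. (\<integral>\<^sup>+\<omega>. G (\<lambda>t. W t \<omega>) (\<lambda>t. Y t \<omega>') \<partial>M) \<partial>M)"
    using indep_processes_nn_integral[OF M ind Gm] by (simp add: Gr)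
  also have "\<dots> \<le> (\<integral>\<^sup>+\<omega>'. ennreal (2 * \<rho> powr \<rho> * exp 1 * (2 * c) powr \<rho> * exp (- (\<kappa> / 2 - 1) * d))
      * ennreal (U_filter (\<lambda>t. Y t \<omega>') i powr (\<rho>/2)) \<partial>M)"
  proof (rule nn_integral_mono_AE)
    show "AE \<omega>' in M. (\<integral>\<^sup>+\<omega>. G (\<lambda>t. W t \<omega>) (\<lambda>t. Y t \<omega>') \<partial>M)
       \<le> ennreal (2 * \<rho> powr \<rho> * exp 1 * (2 * c) powr \<rho> * exp (- (\<kappa> / 2 - 1) * d))
           * ennreal (U_filter (\<lambda>t. Y t \<omega>') i powr (\<rho>/2))"
      using good
    proof eventually_elim
      case (elim \<omega>')
      define y where "y t = Y t \<omega>'" for t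
      have y: "\<And>l. l \<in> freqs i \<Longrightarrow> sampled_coeff u y l = fourier_coeff y l" "\<And>l. l \<in> freqs i
          \<Longrightarrow> sampled_coeff u y l \<noteq> 0"
        using elim by (auto simp: y_def[abs_def])
      \<comment> \<open>Positivity makes the variance eligible as the \<open>V\<close> of
        \<open>subgauss_tail\<close>. The threshold contains the same \<open>V\<close>, so the
        comparison is free of the filter; only afterwards is the variance replaced by
        \<open>U_filter\<close>.\<close>
      have V: "noise_variance c u i y > 0" by (rule vlev_pos[OF c y(2)])
      have sm: "(\<lambda>\<omega>. stieltjes_lim (\<lambda>t. W t \<omega>) l) \<in> borel_measurable M" for l
        by (rule slim_measurable) (rule wiener_measurable[OF W])
      have Zm: "(\<lambda>\<omega>. coeff_noise h c u i k (\<lambda>t. W t \<omega>) y) \<in> borel_measurable M"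
        unfolding coeff_noise_def by (intro measurable_compose[OF _ borel_measurable_Re]
            borel_measurable_sum borel_measurable_times borel_measurable_const sm)
      have "(\<integral>\<^sup>+\<omega>. G (\<lambda>t. W t \<omega>) y \<partial>M) \<le> ennreal (2 * \<rho> powr \<rho> * exp 1
          * noise_variance c u i y powr (\<rho> / 2) * exp (- (\<kappa> / 2 - 1) * d))"
        unfolding G_def by (rule subgauss_tail[OF Zm V znoise_subgauss[OF h W]]) (use r d thr_const
            in auto)
      also have "\<dots> \<le> ennreal (2 * \<rho> powr \<rho> * exp 1 * ((2 * c) powr \<rho> * U_filter y i powr (\<rho>/2))
          * exp (- (\<kappa> / 2 - 1) * d))"
      proof (intro ennreal_leI mult_right_mono mult_left_mono)
        have "noise_variance c u i y powr (\<rho>/2) \<le> ((2 * c)\<^sup>2 * U_filter y i) powr (\<rho>/2)"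
          using vlev_bound[of i u y c, OF y(1)] r vlev_nonneg
              by (intro powr_mono2) (auto simp: power_mult_distrib)
        also have "\<dots> = ((2 * c)\<^sup>2) powr (\<rho>/2) * U_filter y i powr (\<rho>/2)" by (rule powr_mult)
        also have "((2 * c)\<^sup>2) powr (\<rho>/2) = (2 * c) powr \<rho>" using c by (intro square_powr_half) simp
        finally show "noise_variance c u i y powr (\<rho>/2) \<le> (2 * c) powr \<rho> * U_filter y i powr (\<rho>/2)" .
      qed auto
      also have "\<dots> = ennreal (2 * \<rho> powr \<rho> * exp 1 * (2 * c) powr \<rho> * exp (- (\<kappa> / 2 - 1) * d))
          * ennreal (U_filter y i powr (\<rho>/2))"
        by (subst ennreal_mult'[symmetric]) (auto simp: mult_ac)
      finally show ?case unfolding y_def .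
    qed
  qed
  also have "\<dots> = ennreal (2 * \<rho> powr \<rho> * exp 1 * (2 * c) powr \<rho> * exp (- (\<kappa> / 2 - 1) * d))
      * (\<integral>\<^sup>+\<omega>'. ennreal (U_filter (\<lambda>t. Y t \<omega>') i powr (\<rho>/2)) \<partial>M)"
  proof (rule nn_integral_cmult)
    note [measurable] = U_filter_measurable[OF Y, of i]
    show "(\<lambda>\<omega>. ennreal (U_filter (\<lambda>t. Y t \<omega>) i powr (\<rho>/2))) \<in> borel_measurable M" by measurable
  qed
  also have "\<dots> \<le> ennreal (2 * \<rho> powr \<rho> * exp 1 * (2 * c) powr \<rho> * exp (- (\<kappa> / 2 - 1) * d))
      * ennreal (B * 2 powr (2 * \<nu> * (\<rho>/2) * real i))"
    by (intro mult_left_mono B) auto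
  also have "\<dots> = ennreal (2 * \<rho> powr \<rho> * exp 1 * B * (2 * c * 2 powr (\<nu> * real i)) powr \<rho>
      * exp (- (\<kappa> / 2 - 1) * d))"
    using c B(2) by (subst ennreal_mult'[symmetric]) (auto simp: powr_mult powr_powr mult_ac)
  finally show ?thesis unfolding G_def .
qed

lemma vlev_moment:
  assumes Y: "L2_process M Y" and c: "c > 0" and r: "r \<ge> 0"
    and good: "AE \<omega> in M. \<forall>l\<in>freqs i. sampled_coeff u (\<lambda>t. Y t \<omega>) l = fourier_coeff (\<lambda>t. Y t \<omega>) l"
    and B: "(\<integral>\<^sup>+\<omega>. ennreal (U_filter (\<lambda>t. Y t \<omega>) i powr (r/2)) \<partial>M) \<le> ennreal (B * 2 powr (2 * \<nu>
        * (r/2) * real i))" "B > 0"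
  shows "(\<integral>\<^sup>+\<omega>. ennreal (noise_variance c u i (\<lambda>t. Y t \<omega>) powr (r/2)) \<partial>M) \<le> ennreal (B * (2 * c
      * 2 powr (\<nu> * real i)) powr r)"
proof -
  have "(\<integral>\<^sup>+\<omega>. ennreal (noise_variance c u i (\<lambda>t. Y t \<omega>) powr (r/2)) \<partial>M) \<le> (\<integral>\<^sup>+\<omega>. ennreal ((2
      * c) powr r) * ennreal (U_filter (\<lambda>t. Y t \<omega>) i powr (r/2)) \<partial>M)"
  proof (rule nn_integral_mono_AE)
    show "AE \<omega> in M. ennreal (noise_variance c u i (\<lambda>t. Y t \<omega>) powr (r/2)) \<le> ennreal ((2
        * c) powr r) * ennreal (U_filter (\<lambda>t. Y t \<omega>) i powr (r/2))"
      using good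
    proof eventually_elim
      case (elim \<omega>)
      define y where "y t = Y t \<omega>" for t
      have "noise_variance c u i y powr (r/2) \<le> ((2 * c)\<^sup>2 * U_filter y i) powr (r/2)"
        using vlev_bound[of i u y c] elim r vlev_nonneg
            by (intro powr_mono2) (auto simp: power_mult_distrib y_def[abs_def])
      also have "\<dots> = ((2 * c)\<^sup>2) powr (r/2) * U_filter y i powr (r/2)" by (rule powr_mult)
      also have "((2 * c)\<^sup>2) powr (r/2) = (2 * c) powr r" using c by (intro square_powr_half) simp
      finally have "ennreal (noise_variance c u i y powr (r/2)) \<le> ennreal ((2 * c) powr r
          * U_filter y i powr (r/2))" by (rule ennreal_leI)
      then show ?case unfolding y_def by (simp add: ennreal_mult')
    qed
  qed
  also have "\<dots> = ennreal ((2 * c) powr r) * (\<integral>\<^sup>+\<omega>. ennreal (U_filter (\<lambda>t. Y t \<omega>) i powr (r/2)) \<partial>M)"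
  proof (rule nn_integral_cmult)
    note [measurable] = U_filter_measurable[OF Y, of i]
    show "(\<lambda>\<omega>. ennreal (U_filter (\<lambda>t. Y t \<omega>) i powr (r/2))) \<in> borel_measurable M" by measurable
  qed
  also have "\<dots> \<le> ennreal ((2 * c) powr r) * ennreal (B * 2 powr (2 * \<nu> * (r/2) * real i))"
    by (intro mult_left_mono B) auto
  also have "\<dots> = ennreal (B * (2 * c * 2 powr (\<nu> * real i)) powr r)"
    using c B(2) by (subst ennreal_mult'[symmetric]) (auto simp: powr_mult powr_powr mult_ac)
  finally show ?thesis .
qed

section \<open>The thresholding estimator\<close>

lemma besov_ball_measurable:
  assumes "f \<in> besov_ball h s p q R" "p > 1"
  shows "f \<in> borel_measurable borel" "\<And>x. f (x + 1) = f x" "integrable I01 f"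
proof -
  show m: "f \<in> borel_measurable borel" and "\<And>x. f (x + 1) = f x"
    using assms by (auto simp: besov_ball_def besov_space_def Lper_def)
  have "integrable I01 (\<lambda>x. \<bar>f x\<bar> powr p)"
    using assms by (auto simp: besov_ball_def besov_space_def Lper_def Lnorm_def set_integrable_I01
        split: if_splits)
  then show "integrable I01 f"
  proof (rule Bochner_Integration.integrable_bound[OF Bochner_Integration.integrable_add[OF
      I01.integrable_const[of 1]]])
    show "f \<in> borel_measurable I01" by (rule measurable_I01[OF m])
    have "\<bar>a\<bar> \<le> 1 + \<bar>a\<bar> powr p" for a :: real
    proof (cases "\<bar>a\<bar> \<le> 1")
      case False
      then have "\<bar>a\<bar> powr 1 \<le> \<bar>a\<bar> powr p" using assms(2) by (intro powr_mono) auto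
      then show ?thesis using False by simp
    qed (simp add: add_increasing2)
    then show "AE x in I01. norm (f x) \<le> norm (1 + \<bar>f x\<bar> powr p)"
        by (intro AE_I2) (simp add: abs_of_nonneg)
  qed
qed

text \<open>A single coefficient is at most the p-norm of its level, and \<open>C\<close> bounds the
  sum of the wavelets. The exponent s - 1/p is positive in the application, which makes the bounds
  summable.\<close>

lemma dlev_bound:
  assumes p: "p > 1" and C: "C \<ge> 1" "\<And>i x. (\<Sum>k\<in>widx i. \<bar>wav h i k x\<bar>) \<le> C * 2 powr (real i / 2)"
    and b: "besov_level h f s p i \<le> R1"
  shows "\<bar>level_sum h f i x\<bar> \<le> C * R1 * 2 powr (- (s - 1/p) * real i)"
proof -
  define T where "T = (\<Sum>k\<in>widx i. \<bar>wav_coeff h f i k\<bar> powr p) powr (1/p)"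
  have Tb: "T = besov_level h f s p i * 2 powr (- real i * (s + 1/2 - 1/p))"
    by (simp add: besov_level_def T_def powr_minus)
  have "\<bar>wav_coeff h f i k\<bar> \<le> T" if k: "k \<in> widx i" for k
  proof -
    have "\<bar>wav_coeff h f i k\<bar> powr p \<le> (\<Sum>k\<in>widx i. \<bar>wav_coeff h f i k\<bar> powr p)"
      by (rule member_le_sum) (use k in auto)
    then have "(\<bar>wav_coeff h f i k\<bar> powr p) powr (1/p) \<le> T" unfolding T_def using p
        by (intro powr_mono2) auto
    then show ?thesis using p by (simp add: powr_powr)
  qed
  then have "\<bar>level_sum h f i x\<bar> \<le> (\<Sum>k\<in>widx i. T * \<bar>wav h i k x\<bar>)"
    unfolding level_sum_def by (intro order_trans[OF sum_abs] sum_mono) (auto simp: abs_mult intro!: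
        mult_right_mono)
  also have "\<dots> \<le> T * (C * 2 powr (real i / 2))" unfolding sum_distrib_left[symmetric]
    by (intro mult_left_mono C(2)) (simp add: T_def)
  also have "\<dots> = C * besov_level h f s p i * (2 powr (- real i * (s + 1/2 - 1/p))
      * 2 powr (real i / 2))" by (simp add: Tb)
  also have "2 powr (- real i * (s + 1/2 - 1/p)) * 2 powr (real i / 2) = 2 powr (- (s - 1/p) * real i)"
  proof -
    have "- real i * (s + 1/2 - 1/p) + real i / 2 = - (s - 1/p) * real i" by (simp add: algebra_simps)
    then show ?thesis by (simp only: powr_add[symmetric])
  qed
  also have "C * besov_level h f s p i * 2 powr (- (s - 1/p) * real i) \<le> C * R1
      * 2 powr (- (s - 1/p) * real i)"
    using b C(1) by (intro mult_right_mono mult_left_mono) auto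
  finally show ?thesis .
qed

text \<open>\<open>g\<close> will serve as the continuous representative of the target; the last
  bound is the bias from truncating the expansion at level \<open>J\<close>.\<close>

lemma wavelet_sum_properties:
  assumes h: "meyer_aux h" and B: "\<And>i x. \<bar>level_sum h f i x\<bar> \<le> B i" "summable B"
  defines "g \<equiv> \<lambda>x. \<Sum>i. level_sum h f i x"
  shows "continuous_on UNIV g" "g (x + 1) = g x" "\<bar>g x\<bar> \<le> suminf B"
    "\<bar>g x - (\<Sum>i\<le>J. level_sum h f i x)\<bar> \<le> (\<Sum>i. B (i + Suc J))"
proof -
  have u: "uniform_limit UNIV (\<lambda>n x. \<Sum>i<n. level_sum h f i x) g sequentially"
    unfolding g_def using B by (intro Weierstrass_m_test) auto
  show "continuous_on UNIV g"
    by (rule uniform_limit_theorem[OF _ u]) (auto intro!: always_eventually continuous_intros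
        dlev_continuous[OF h])
  have "level_sum h f i (x + 1) = level_sum h f i x" for i
    unfolding level_sum_def using wav_periodic[OF h, of _ i x 1] by (intro sum.cong) auto
  then show "g (x + 1) = g x" by (simp add: g_def)
  have sa: "summable (\<lambda>i. \<bar>level_sum h f i x\<bar>)" for x
    by (rule summable_comparison_test'[OF B(2)]) (use B(1) in auto)
  then have s: "summable (\<lambda>i. level_sum h f i x)" for x by (rule summable_rabs_cancel)
  have "\<bar>g x\<bar> \<le> (\<Sum>i. \<bar>level_sum h f i x\<bar>)" unfolding g_def by (rule summable_rabs[OF sa])
  also have "\<dots> \<le> suminf B" by (rule suminf_le[OF B(1) sa B(2)])
  finally show "\<bar>g x\<bar> \<le> suminf B" .
  have Bs: "summable (\<lambda>i. B (i + Suc J))" using B(2) by (simp only: summable_iff_shift)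
  have sas: "summable (\<lambda>i. \<bar>level_sum h f (i + Suc J) x\<bar>)"
    by (rule summable_comparison_test'[OF Bs]) (use B(1) in auto)
  have "g x - (\<Sum>i\<le>J. level_sum h f i x) = (\<Sum>i. level_sum h f (i + Suc J) x)"
    unfolding g_def using suminf_split_initial_segment[OF s, of x "Suc J"]
        by (simp add: lessThan_Suc_atMost)
  also have "\<bar>\<dots>\<bar> \<le> (\<Sum>i. \<bar>level_sum h f (i + Suc J) x\<bar>)" by (rule summable_rabs[OF sas])
  also have "\<dots> \<le> (\<Sum>i. B (i + Suc J))" by (rule suminf_le[OF B(1) sas Bs])
  finally show "\<bar>g x - (\<Sum>i\<le>J. level_sum h f i x)\<bar> \<le> (\<Sum>i. B (i + Suc J))" .
qed

text \<open>Trades the norm for an expression linear in the \<open>Q i\<close>, so that expectations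
  can be taken level by level. With \<open>T\<close> the sum of the weights and \<open>Z\<close> the
  weighted sum of the \<open>Q i\<close>, Jensen's inequality gives I \<le> T^(\<rho> - 1) Z, and
  y^(1/\<rho>) \<le> 1 + y at y = I / T^\<rho> gives T + Z. If the \<rho>-th power of
  \<open>w i\<close> bounds the mean of \<open>Q i\<close>, then the mean of \<open>Z\<close> is at
  most \<open>T\<close>.\<close>

lemma Lnorm_combination:
  fixes x :: "nat \<Rightarrow> real \<Rightarrow> real" and w Q :: "nat \<Rightarrow> real" and J :: nat
  assumes r: "\<rho> > 1" and x: "\<And>i. i \<le> J \<Longrightarrow> continuous_on {0..1} (x i)"
    and w: "\<And>i. i \<le> J \<Longrightarrow> w i > 0" and v: "v > 0"
    and g: "g \<in> borel_measurable I01" "AE t in I01. \<bar>g t\<bar> \<le> (\<Sum>i\<le>J. \<bar>x i t\<bar>) + v"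
    and Q: "\<And>i. i \<le> J \<Longrightarrow> (LINT t|I01. \<bar>x i t\<bar> powr \<rho>) \<le> Q i"
  shows "Lnorm \<rho> g \<le> ennreal (((\<Sum>i\<le>J. w i) + v) + ((\<Sum>i\<le>J. w i powr (1 - \<rho>) * Q i) + v))"
proof -
  define T where "T = (\<Sum>i\<le>J. w i) + v"
  have T: "T > 0" using w v unfolding T_def by (intro add_nonneg_pos sum_nonneg) (auto intro:
      less_imp_le)
  have xi: "integrable I01 (\<lambda>t. \<bar>x i t\<bar> powr \<rho>)" if "i \<le> J" for i
    using r x[OF that] by (intro integrable_I01_continuous continuous_on_powr' continuous_intros) auto
  define H where "H t = T powr (\<rho> - 1) * ((\<Sum>i\<le>J. w i powr (1 - \<rho>) * \<bar>x i t\<bar> powr \<rho>) + v)" for t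
  have Hi: "integrable I01 H" unfolding H_def
    by (intro integrable_mult_right Bochner_Integration.integrable_add
        Bochner_Integration.integrable_sum xi) auto
  have pw: "((\<Sum>i\<le>J. \<bar>x i t\<bar>) + v) powr \<rho> \<le> H t" for t
  proof -
    \<comment> \<open>The constant \<open>v\<close> joins the sum under the extra index
      \<open>Suc J\<close>, with weight \<open>v\<close> and value 1.\<close>
    define w' where "w' i = (if i \<le> J then w i else v)" for i
    define t' where "t' i = (if i \<le> J then \<bar>x i t\<bar> / w i else 1)" for i
    have w'0: "w' i > 0" for i using w v by (simp add: w'_def)
    have t'0: "t' i \<ge> 0" for i using w less_imp_le[OF w] by (simp add: t'_def)
    have s1: "(\<Sum>i\<le>J. \<bar>x i t\<bar>) + v = (\<Sum>i\<le>Suc J. w' i * t' i)"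
    proof -
      have "w i \<noteq> 0" if "i \<le> J" for i using w[OF that] by simp
      then have "(\<Sum>i\<le>J. \<bar>x i t\<bar>) = (\<Sum>i\<le>J. w' i * t' i)" by (intro sum.cong) (auto simp: w'_def t'_def)
      then show ?thesis by (simp add: w'_def t'_def)
    qed
    have s2: "(\<Sum>i\<le>Suc J. w' i) = T"
    proof -
      have "(\<Sum>i\<le>J. w' i) = (\<Sum>i\<le>J. w i)" by (intro sum.cong) (auto simp: w'_def)
      then show ?thesis by (simp add: T_def w'_def)
    qed
    have s3: "(\<Sum>i\<le>Suc J. w' i * t' i powr \<rho>) = (\<Sum>i\<le>J. w i powr (1 - \<rho>) * \<bar>x i t\<bar> powr \<rho>) + v"
    proof -
      have "w' i * t' i powr \<rho> = w i powr (1 - \<rho>) * \<bar>x i t\<bar> powr \<rho>" if "i \<le> J" for i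
      proof -
        have "w i powr (1 - \<rho>) = w i * w i powr (- \<rho>)" using w[OF that] powr_mult_base[of "w i" "-
            \<rho>"] by simp
        then show ?thesis using that w[OF that] by (simp add: w'_def t'_def powr_divide
            powr_minus_divide)
      qed
      then have "(\<Sum>i\<le>J. w' i * t' i powr \<rho>) = (\<Sum>i\<le>J. w i powr (1 - \<rho>) * \<bar>x i t\<bar> powr \<rho>)"
          by (intro sum.cong) auto
      then show ?thesis by (simp add: w'_def t'_def)
    qed
    have "(\<Sum>i\<le>Suc J. w' i * t' i) powr \<rho> \<le> (\<Sum>i\<le>Suc J. w' i) powr (\<rho> - 1) * (\<Sum>i\<le>Suc J. w' i
        * t' i powr \<rho>)"
      by (rule powr_sum_jensen) (use r w'0 t'0 less_imp_le in auto)
    then show ?thesis unfolding H_def s1 s2 s3 .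
  qed
  have ae: "AE t in I01. \<bar>g t\<bar> powr \<rho> \<le> H t"
    using g(2)
  proof eventually_elim
    case (elim t)
    then have "\<bar>g t\<bar> powr \<rho> \<le> ((\<Sum>i\<le>J. \<bar>x i t\<bar>) + v) powr \<rho>" using r by (intro powr_mono2) auto
    then show ?case using pw[of t] by linarith
  qed
  have gm: "(\<lambda>t. \<bar>g t\<bar> powr \<rho>) \<in> borel_measurable I01" using g(1) by measurable
  have gi: "integrable I01 (\<lambda>t. \<bar>g t\<bar> powr \<rho>)"
    by (rule Bochner_Integration.integrable_bound[OF Hi gm]) (use ae in \<open>auto elim!: eventually_mono\<close>)
  define I where "I = (LINT t|I01. \<bar>g t\<bar> powr \<rho>)"
  have I0: "I \<ge> 0" by (simp add: I_def)
  define Z where "Z = (\<Sum>i\<le>J. w i powr (1 - \<rho>) * Q i) + v"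
  have "I \<le> (LINT t|I01. H t)" unfolding I_def by (rule integral_mono_AE[OF gi Hi ae])
  also have "\<dots> = T powr (\<rho> - 1) * ((\<Sum>i\<le>J. w i powr (1 - \<rho>) * (LINT t|I01. \<bar>x i t\<bar> powr \<rho>)) + v)"
  proof -
    have si: "integrable I01 (\<lambda>t. \<Sum>i\<le>J. w i powr (1 - \<rho>) * \<bar>x i t\<bar> powr \<rho>)"
      by (intro Bochner_Integration.integrable_sum integrable_mult_right xi) auto
    have "(LINT t|I01. (\<Sum>i\<le>J. w i powr (1 - \<rho>) * \<bar>x i t\<bar> powr \<rho>) + v)
        = (LINT t|I01. (\<Sum>i\<le>J. w i powr (1 - \<rho>) * \<bar>x i t\<bar> powr \<rho>)) + (LINT t|I01. v)"
      by (rule Bochner_Integration.integral_add[OF si]) simp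
    also have "(LINT t|I01. (\<Sum>i\<le>J. w i powr (1 - \<rho>) * \<bar>x i t\<bar> powr \<rho>)) = (\<Sum>i\<le>J. w i powr (1 - \<rho>)
        * (LINT t|I01. \<bar>x i t\<bar> powr \<rho>))"
      using xi by (subst Bochner_Integration.integral_sum) auto
    finally show ?thesis unfolding H_def by simp
  qed
  also have "\<dots> \<le> T powr (\<rho> - 1) * Z" unfolding Z_def
    by (intro mult_left_mono add_right_mono sum_mono Q) auto
  finally have IZ: "I \<le> T powr (\<rho> - 1) * Z" .
  have "I powr (1/\<rho>) \<le> T + Z"
  proof -
    define y where "y = I / T powr \<rho>"
    have y0: "y \<ge> 0" using I0 by (simp add: y_def)
    have "y powr (1/\<rho>) \<le> 1 + y"
    proof (cases "y \<le> 1")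
      case True
      then have "y powr (1/\<rho>) \<le> 1" using y0 r powr_mono2[of "1/\<rho>" y 1] by simp
      then show ?thesis using y0 by simp
    next
      case False
      then have "y powr (1/\<rho>) \<le> y powr 1" using r by (intro powr_mono) auto
      then show ?thesis using False by simp
    qed
    moreover have "I powr (1/\<rho>) = T * y powr (1/\<rho>)"
      using T I0 r by (simp add: y_def powr_divide powr_powr)
    ultimately have "I powr (1/\<rho>) \<le> T * (1 + y)" using T by simp
    also have "T * y \<le> Z"
    proof -
      have "T powr \<rho> = T powr (\<rho> - 1) * T" using T powr_mult_base[of T "\<rho> - 1"]
          by (simp add: mult.commute)
      then have "T * y = I / T powr (\<rho> - 1)" using T by (simp add: y_def)
      also have "\<dots> \<le> Z" using IZ T by (simp add: divide_le_eq mult.commute)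
      finally show ?thesis .
    qed
    then have "T * (1 + y) \<le> T + Z" by (simp add: algebra_simps)
    finally show ?thesis .
  qed
  then show ?thesis using gi unfolding Lnorm_def set_integral_I01 set_integrable_I01
    by (simp add: I_def[symmetric] T_def[symmetric] Z_def[symmetric] ennreal_leI)
qed

text \<open>\<open>i - i0\<close> is truncated subtraction: up to level \<open>i0\<close> the
  threshold is 0 and every estimated coefficient is kept. Only the path \<open>z\<close>, known
  constants and the sampling points enter.\<close>

definition threshold_estimator :: "(real \<Rightarrow> real) \<Rightarrow> real \<Rightarrow> (nat \<Rightarrow> real) \<Rightarrow> real \<Rightarrow> nat \<Rightarrow> nat \<Rightarrow> (real \<Rightarrow>
    real \<times> real) \<Rightarrow> real \<Rightarrow> real" where
  "threshold_estimator h c u \<kappa> i0 J z x = (\<Sum>i\<le>J. \<Sum>k\<in>widx i.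
     hard_threshold (\<kappa> * sqrt (noise_variance c u i (\<lambda>t. snd (z t)) * real (i - i0)))
       (Re (\<Sum>l\<in>freqs i. cnj (wav_ft h i k l) * (stieltjes_lim (\<lambda>t. fst (z t)) l / sampled_coeff u
           (\<lambda>t. snd (z t)) l))) * wav h i k x)"

text \<open>All ingredients are built from limits of functions of finitely many coordinates of the
  path, at rational times and at the sampling points; in \<open>x\<close> the estimator is a finite
  sum of continuous wavelets.\<close>

lemma est_estimator:
  assumes h: "meyer_aux h" and u: "\<And>j. u j \<in> {0..1}"
  shows "threshold_estimator h c u \<kappa> i0 J \<in> estimators"
proof -
  let ?P = "Pi\<^sub>M {0..1} (\<lambda>_. borel) :: (real \<Rightarrow> real \<times> real) measure"
  have comp: "(\<lambda>z. fst (z t)) \<in> borel_measurable ?P" "(\<lambda>z. snd (z t)) \<in> borel_measurable ?P"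
      if "t \<in> {0..1}" for t
  proof -
    have c: "(\<lambda>z. z t) \<in> measurable ?P borel" by (rule measurable_component_singleton[OF that])
    have f: "fst \<in> borel_measurable (borel :: (real \<times> real) measure)" "snd \<in> borel_measurable (borel
        :: (real \<times> real) measure)"
      by (rule borel_measurable_continuous_onI, intro continuous_intros)+
    show "(\<lambda>z. fst (z t)) \<in> borel_measurable ?P" "(\<lambda>z. snd (z t)) \<in> borel_measurable ?P"
      using measurable_compose[OF c f(1)] measurable_compose[OF c f(2)] .
  qed
  have s[measurable]: "(\<lambda>z. stieltjes_lim (\<lambda>t. fst (z t)) l) \<in> borel_measurable ?P" for l
    by (rule slim_measurable01) (rule comp)
  have y[measurable]: "(\<lambda>z. sampled_coeff u (\<lambda>t. snd (z t)) l) \<in> borel_measurable ?P" for l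
    by (rule yhat_measurable) (rule comp[OF u])
  have hm[measurable]: "(\<lambda>z. hard_threshold (\<kappa> * sqrt (noise_variance c u i (\<lambda>t. snd (z t))
      * real (i - i0)))
       (Re (\<Sum>l\<in>freqs i. cnj (wav_ft h i k l) * (stieltjes_lim (\<lambda>t. fst (z t)) l / sampled_coeff u
           (\<lambda>t. snd (z t)) l)))) \<in> borel_measurable ?P" for i k
    unfolding hard_threshold_def noise_variance_def by measurable
  have wm: "wav h i k \<in> borel_measurable (restrict_space borel {0..1})" if "k \<in> widx i" for i k
    by (intro measurable_restrict_space1 borel_measurable_continuous_onI wav_continuous[OF h that])
  have "(\<lambda>p. threshold_estimator h c u \<kappa> i0 J (fst p) (snd p)) \<in> borel_measurable (?P \<Otimes>\<^sub>M
      restrict_space borel {0..1})"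
    unfolding threshold_estimator_def
    by (intro borel_measurable_sum borel_measurable_times measurable_compose[OF measurable_fst hm]
        measurable_compose[OF measurable_snd wm])
  then show ?thesis unfolding estimators_def by (simp add: case_prod_beta')
qed

text \<open>Convolution multiplies Fourier coefficients, so division by those of the filter returns
  the ones of \<open>f\<close> plus noise. The function \<open>g\<close> stands in for
  \<open>f\<close> because \<open>conv01_fourier\<close> asks for continuity and
  boundedness.\<close>

lemma observation_coefficient:
  assumes h: "meyer_aux h" and f: "f \<in> borel_measurable borel" "\<And>x. f (x + 1) = f x" "integrable I01 f"
    and g: "continuous_on UNIV g" "\<And>x. g (x + 1) = g x" "\<And>x. \<bar>g x\<bar> \<le> Bg" "AE x in I01. f x = g x"
    and y: "integrable I01 y" and w: "continuous_on {0..1} w"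
    and x: "\<And>t. t \<in> {0..1} \<Longrightarrow> x t = x0 + set_lebesgue_integral lborel {0..t} (conv01 f y) + c * w t"
    and yh: "\<And>l. l \<in> freqs i \<Longrightarrow> sampled_coeff u y l = fourier_coeff y l \<and> fourier_coeff y l \<noteq> 0"
    and k: "k \<in> widx i"
  shows "Re (\<Sum>l\<in>freqs i. cnj (wav_ft h i k l) * (stieltjes_lim x l / sampled_coeff u y l))
      = wav_coeff h f i k + coeff_noise h c u i k w y"
proof -
  have ym: "y \<in> borel_measurable I01" by (rule borel_measurable_integrable[OF y])
  have gm: "g \<in> borel_measurable borel" by (rule borel_measurable_continuous_onI[OF g(1)])
  have cc: "conv01 f y = conv01 g y" by (rule ext, rule conv01_cong[OF f(2) g(2) g(4) f(1) gm ym])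
  note cf = conv01_fourier[OF g(1,2,3) y]
  have fg: "fourier_coeff f l = fourier_coeff g l" for l
  proof -
    note [measurable] = f(1) gm
    have "(\<lambda>x. complex_of_real (f x) * fexp (-l) x) \<in> borel_measurable I01"
      by (rule measurable_I01) measurable
    moreover have "(\<lambda>x. complex_of_real (g x) * fexp (-l) x) \<in> borel_measurable I01"
      by (rule measurable_I01) measurable
    ultimately show ?thesis unfolding fourier_coeff_I01
      by (rule integral_cong_AE) (use g(4) in \<open>auto elim: eventually_mono\<close>)
  qed
  have sl: "stieltjes_lim x l = fourier_coeff f l * fourier_coeff y l + of_real c
      * stieltjes_lim w l" for l
    using slim_observation[OF w cf(1) cf(2) x[unfolded cc], where l=l] by (simp add: cf(3) fg)
  have "(\<Sum>l\<in>freqs i. cnj (wav_ft h i k l) * (stieltjes_lim x l / sampled_coeff u y l)) =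
     (\<Sum>l\<in>freqs i. cnj (wav_ft h i k l) * fourier_coeff f l) + (\<Sum>l\<in>freqs i. of_real c
         * cnj (wav_ft h i k l) / sampled_coeff u y l * stieltjes_lim w l)"
    unfolding sum.distrib[symmetric]
    by (intro sum.cong refl) (use yh in \<open>simp add: sl field_simps\<close>)
  then show ?thesis by (simp add: coeff_noise_def wcoef_fourier[OF h f(3) k, symmetric])
qed

lemma powr_add_le:
  assumes "a \<ge> 0" "b \<ge> 0" "\<rho> \<ge> 1"
  shows "a powr \<rho> + b powr \<rho> \<le> (a + b) powr (\<rho>::real)"
proof -
  have "a powr (\<rho> - 1) \<le> (a + b) powr (\<rho> - 1)" "b powr (\<rho> - 1) \<le> (a + b) powr (\<rho> - 1)"
    using assms by (auto intro!: powr_mono2)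
  then have "a * a powr (\<rho> - 1) + b * b powr (\<rho> - 1) \<le> (a + b) * (a + b) powr (\<rho> - 1)"
    unfolding distrib_right using assms by (intro add_mono mult_left_mono) auto
  then show ?thesis using assms powr_mult_base[of a "\<rho> - 1"] powr_mult_base[of b "\<rho> - 1"]
      powr_mult_base[of "a + b" "\<rho> - 1"]
    by simp
qed

lemma ennreal_mult_add:
  "0 \<le> k \<Longrightarrow> 0 \<le> a \<Longrightarrow> 0 \<le> b \<Longrightarrow> ennreal (k * (a + b)) = ennreal k * (ennreal a + ennreal b)"
  by (simp add: ennreal_mult' flip: ennreal_plus)

section \<open>Risk of the estimator with the constants of the model fixed\<close>

context
  fixes M :: "'a measure" and W Y :: "real \<Rightarrow> 'a \<Rightarrow> real"
    and h :: "real \<Rightarrow> real" and x0 \<sigma> \<rho> R p pm q s \<nu> C B1 B2 :: real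
  assumes M: "prob_space M" and W: "wiener_process M W" and Y: "L2_process M Y"
      and ind: "indep_processes M W Y"
    and sig: "\<sigma> > 0" and h: "meyer_aux h" and rho: "\<rho> > 1" and R: "R > 0" and p: "p > 1"
        and q: "q > 1" and s: "s > 1/p"
    and nu: "\<nu> \<ge> 0" and Y0: "\<And>l. AE \<omega> in M. fourier_coeff (\<lambda>t. Y t \<omega>) l \<noteq> 0"
    and pm: "1 < pm" "pm \<le> \<rho>" "pm \<le> p"
    and C: "C \<ge> 1" "\<And>i x. (\<Sum>k\<in>widx i. \<bar>wav h i k x\<bar>) \<le> C * 2 powr (real i / 2)"
    and B1: "B1 > 0" "\<And>i. (\<integral>\<^sup>+\<omega>. ennreal (U_filter (\<lambda>t. Y t \<omega>) i powr (\<rho>/2)) \<partial>M) \<le> ennreal (B1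
        * 2 powr (2 * \<nu> * (\<rho>/2) * real i))"
    and B2: "B2 > 0" "\<And>i. (\<integral>\<^sup>+\<omega>. ennreal (U_filter (\<lambda>t. Y t \<omega>) i powr ((\<rho> - pm)/2)) \<partial>M)
        \<le> ennreal (B2 * 2 powr (2 * \<nu> * ((\<rho> - pm)/2) * real i))"
begin

text \<open>The threshold constant is chosen so that the exceedance probability beats the growth of the
  noise from level to level.\<close>

definition thr_const :: real where "thr_const = 2 + 2 * \<rho> * (2 * \<nu> + 1) * ln 2"

text \<open>\<open>thr_const / 2 - 1\<close> equals \<open>\<rho> * (2 * \<nu> + 1) * ln 2\<close>:
  the \<rho>-th root of the exceedance factor then removes twice the growth 2^(\<nu> + 1/2) per
  level, as recorded in \<open>noise_bound\<close>.\<close>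

lemma thr_const: "thr_const \<ge> 2" "exp (- (thr_const / 2 - 1) * d) = (2 powr (- 2 * (\<nu> + 1/2)
    * d)) powr \<rho>"
proof -
  have "0 \<le> 2 * \<rho> * (2 * \<nu> + 1) * ln 2" using rho nu by (intro mult_nonneg_nonneg) auto
  then show "thr_const \<ge> 2" by (simp add: thr_const_def)
  have "- (thr_const / 2 - 1) * d = (- 2 * (\<nu> + 1/2) * d * \<rho>) * ln 2"
      by (simp add: thr_const_def field_simps)
  then show "exp (- (thr_const / 2 - 1) * d) = (2 powr (- 2 * (\<nu> + 1/2) * d)) powr \<rho>"
    by (simp add: powr_powr) (simp add: powr_def)
qed

definition noise_const :: real where "noise_const = 2 * \<rho> powr \<rho> * exp 1 * B1 * (2 * \<sigma>) powr \<rho>"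
definition coeff_const :: real where "coeff_const = 1 + B2 * (2 * \<sigma> * thr_const) powr (\<rho> - pm)"

lemma A_pos: "noise_const > 0" "coeff_const \<ge> 1"
  using rho B1(1) B2(1) sig by (auto simp: noise_const_def coeff_const_def)

definition level_const :: real where "level_const = 2 * C powr \<rho> * 6 powr \<rho>"
definition risk_const :: real where "risk_const = (level_const * (noise_const + coeff_const)) powr (1/\<rho>)"

lemma const_pos: "level_const > 0" "risk_const > 0"
  using C(1) A_pos by (auto simp: level_const_def risk_const_def)

lemma Y_sample_measurable: "t \<in> {0..1} \<Longrightarrow> Y t \<in> borel_measurable M"
proof -
  assume t: "t \<in> {0..1}"
  then have "t \<in> space I01" by simp
  from measurable_compose[OF measurable_Pair2'[OF this] L2_process_measurable[OF Y]] show ?thesis by simp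
qed

context
  fixes n :: nat and i0 J :: nat and u :: "nat \<Rightarrow> real" and c :: real and f :: "real \<Rightarrow> real"
  assumes n: "n \<ge> 1" and c: "c = \<sigma> * real n powr (-1/2)" and u: "\<And>j. u j \<in> {0..1}"
    and good: "AE \<omega> in M. \<forall>l\<in>freqs J. sampled_coeff u (\<lambda>t. Y t \<omega>) l = fourier_coeff (\<lambda>t. Y t \<omega>) l"
    and f: "f \<in> besov_ball h s p q R"
begin

lemma c_pos: "c > 0" using sig n by (simp add: c)

lemma freqs_mono: "i \<le> J \<Longrightarrow> freqs i \<subseteq> freqs J"
proof
  fix l assume "i \<le> J" "l \<in> freqs i"
  then have "\<bar>l\<bar> < 2 ^ i" by (simp add: freqs_def)
  also have "(2::int) ^ i \<le> 2 ^ J" using \<open>i \<le> J\<close> by (intro power_increasing) auto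
  finally show "l \<in> freqs J" by (simp add: freqs_def)
qed

lemma sampled_coeff_AE: "AE \<omega> in M. \<forall>i\<le>J. \<forall>l\<in>freqs i. sampled_coeff u (\<lambda>t. Y t \<omega>) l
    = fourier_coeff (\<lambda>t. Y t \<omega>) l \<and> fourier_coeff (\<lambda>t. Y t \<omega>) l \<noteq> 0"
proof -
  have "AE \<omega> in M. \<forall>l\<in>freqs J. fourier_coeff (\<lambda>t. Y t \<omega>) l \<noteq> 0"
    by (rule AE_finite_allI) (use Y0 in auto)
  with good show ?thesis
    by eventually_elim (use freqs_mono in blast)
qed

definition cond_var :: "nat \<Rightarrow> 'a \<Rightarrow> real" where "cond_var i \<omega> = noise_variance c u i (\<lambda>t. Y t \<omega>)"
definition threshold :: "nat \<Rightarrow> 'a \<Rightarrow> real" where "threshold i \<omega> = thr_const * sqrt (cond_var i \<omega>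
    * real (i - i0))"
definition noise :: "nat \<Rightarrow> nat \<Rightarrow> 'a \<Rightarrow> real" where "noise i k \<omega>
    = coeff_noise h c u i k (\<lambda>t. W t \<omega>) (\<lambda>t. Y t \<omega>)"
definition noise_exceed :: "nat \<Rightarrow> nat \<Rightarrow> 'a \<Rightarrow> real" where
  "noise_exceed i k \<omega> = \<bar>noise i k \<omega>\<bar> powr \<rho> * (if \<bar>noise i k \<omega>\<bar> > threshold i \<omega> / 2 then 1 else 0)"
definition trunc_coeff :: "nat \<Rightarrow> nat \<Rightarrow> 'a \<Rightarrow> real" where "trunc_coeff i k \<omega>
    = min \<bar>wav_coeff h f i k\<bar> (threshold i \<omega>) powr \<rho>"

lemma cond_var_measurable [measurable]: "cond_var i \<in> borel_measurable M"
proof -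
  have [measurable]: "(\<lambda>\<omega>. sampled_coeff u (\<lambda>t. Y t \<omega>) l) \<in> borel_measurable M" for l
    by (rule yhat_measurable) (rule Y_sample_measurable[OF u])
  show ?thesis unfolding cond_var_def noise_variance_def by measurable
qed

lemma threshold_measurable [measurable]: "threshold i \<in> borel_measurable M"
  unfolding threshold_def by measurable

lemma noise_measurable [measurable]: "noise i k \<in> borel_measurable M"
proof -
  have y: "(\<lambda>\<omega>. sampled_coeff u (\<lambda>t. Y t \<omega>) l) \<in> borel_measurable M" for l
    by (rule yhat_measurable) (rule Y_sample_measurable[OF u])
  have sm: "(\<lambda>\<omega>. stieltjes_lim (\<lambda>t. W t \<omega>) l) \<in> borel_measurable M" for l
    by (rule slim_measurable) (rule wiener_measurable[OF W])
  show ?thesis unfolding noise_def coeff_noise_def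
    by (intro measurable_compose[OF _ borel_measurable_Re] borel_measurable_sum
        borel_measurable_times borel_measurable_divide borel_measurable_const sm y)
qed

lemma noise_exceed_measurable [measurable]: "noise_exceed i k \<in> borel_measurable M"
  unfolding noise_exceed_def by measurable

lemma trunc_coeff_measurable [measurable]: "trunc_coeff i k \<in> borel_measurable M"
  unfolding trunc_coeff_def by measurable

lemma threshold_nonneg: "threshold i \<omega> \<ge> 0"
  using thr_const(1) vlev_nonneg by (simp add: threshold_def cond_var_def)

definition signal_level :: "nat \<Rightarrow> real" where "signal_level i
    = signal_bound \<rho> pm s \<nu> (real n) i0 (besov_level h f s pm) i"
definition noise_level :: "nat \<Rightarrow> real" where "noise_level i = noise_bound \<nu> (real n) i0 i"

lemma signal_level_nonneg: "signal_level i \<ge> 0" by (simp add: signal_level_def signal_bound_def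
    bseq_nonneg)
lemma noise_level_pos: "noise_level i > 0" using n by (simp add: noise_level_def noise_bound_def)

text \<open>At most 2^i coefficients and the factor 2^(i (\<rho>/2 - 1)) from
  \<open>level_norm_bound\<close> give 2^(i \<rho> / 2); with 2^(\<nu> i \<rho>) from the filter
  this is the \<rho>-th power of the growth in \<open>noise_bound\<close>.\<close>

lemma noise_moment:
  assumes i: "i \<le> J"
  shows "(\<integral>\<^sup>+\<omega>. ennreal (2 powr (real i * (\<rho>/2 - 1)) * (\<Sum>k\<in>widx i. noise_exceed i k \<omega>)) \<partial>M)
      \<le> ennreal (noise_const * noise_level i powr \<rho>)"
proof -
  define d where "d = real (i - i0)"
  define E where "E = 2 * \<rho> powr \<rho> * exp 1 * B1 * (2 * c * 2 powr (\<nu> * real i)) powr \<rho>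
      * exp (- (thr_const / 2 - 1) * d)"
  have E0: "E \<ge> 0" using B1(1) by (simp add: E_def)
  have zk: "(\<integral>\<^sup>+\<omega>. ennreal (noise_exceed i k \<omega>) \<partial>M) \<le> ennreal E" for k
    unfolding noise_exceed_def noise_def threshold_def cond_var_def E_def d_def
    by (rule znoise_tail[OF M W Y ind h rho c_pos u _ B1(2) B1(1)])
        (use sampled_coeff_AE i thr_const(1) in \<open>auto elim!: eventually_mono\<close>)
  have "(\<integral>\<^sup>+\<omega>. ennreal (2 powr (real i * (\<rho>/2 - 1)) * (\<Sum>k\<in>widx i. noise_exceed i k \<omega>)) \<partial>M) =
     (\<integral>\<^sup>+\<omega>. ennreal (2 powr (real i * (\<rho>/2 - 1))) * (\<Sum>k\<in>widx i. ennreal (noise_exceed i k \<omega>)) \<partial>M)"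
  proof -
    have "ennreal (2 powr (real i * (\<rho>/2 - 1)) * (\<Sum>k\<in>widx i. noise_exceed i k \<omega>))
        = ennreal (2 powr (real i * (\<rho>/2 - 1))) * (\<Sum>k\<in>widx i. ennreal (noise_exceed i k \<omega>))" for \<omega>
    proof -
      have "(\<Sum>k\<in>widx i. ennreal (noise_exceed i k \<omega>)) = ennreal (\<Sum>k\<in>widx i. noise_exceed i k \<omega>)"
        by (rule sum_ennreal) (simp add: noise_exceed_def)
      then show ?thesis by (simp add: ennreal_mult')
    qed
    then show ?thesis by simp
  qed
  also have "\<dots> = ennreal (2 powr (real i * (\<rho>/2 - 1))) * (\<Sum>k\<in>widx i. \<integral>\<^sup>+\<omega>. ennreal (noise_exceed i k
      \<omega>) \<partial>M)"
    by (subst nn_integral_cmult, measurable) (subst nn_integral_sum, auto)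
  also have "\<dots> \<le> ennreal (2 powr (real i * (\<rho>/2 - 1))) * (\<Sum>k\<in>widx i. ennreal E)"
    by (intro mult_left_mono sum_mono zk) auto
  also have "\<dots> = ennreal (2 powr (real i * (\<rho>/2 - 1)) * (real (card (widx i)) * E))"
    using E0 by (simp add: sum_ennreal ennreal_mult' flip: ennreal_of_nat_eq_real_of_nat)
  also have "\<dots> \<le> ennreal (2 powr (real i * (\<rho>/2 - 1)) * (2 powr real i * E))"
  proof (intro ennreal_leI mult_left_mono mult_right_mono E0)
    have "real (card (widx i)) \<le> real (2 ^ i)" using card_widx(1)[of i] by (simp only: of_nat_le_iff)
    then show "real (card (widx i)) \<le> 2 powr real i" by (simp add: powr_realpow)
  qed auto
  also have "2 powr (real i * (\<rho>/2 - 1)) * (2 powr real i * E) = noise_const * noise_level i powr \<rho>"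
  proof -
    have nzp: "noise_level i powr \<rho> = (real n powr (-1/2)) powr \<rho> * (2 powr (\<nu> * real i)) powr \<rho>
        * 2 powr (real i * \<rho>/2) * (2 powr (- 2 * (\<nu> + 1/2) * d)) powr \<rho>"
    proof -
      have "2 powr ((\<nu> + 1/2) * (real i - 2 * d)) = 2 powr (\<nu> * real i) * 2 powr (real i / 2)
          * 2 powr (- 2 * (\<nu> + 1/2) * d)"
      proof -
        have "(\<nu> + 1/2) * (real i - 2 * d) = \<nu> * real i + real i / 2 + - 2 * (\<nu> + 1/2) * d"
            by (simp add: algebra_simps)
        then show ?thesis by (simp only: powr_add)
      qed
      then show ?thesis by (simp add: noise_level_def noise_bound_def d_def[symmetric] powr_mult
          powr_powr)
    qed
    have two: "2 powr (real i * (\<rho>/2 - 1)) * 2 powr real i = 2 powr (real i * \<rho>/2)"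
    proof -
      have "real i * (\<rho>/2 - 1) + real i = real i * \<rho>/2" by (simp add: algebra_simps)
      then show ?thesis by (simp only: powr_add[symmetric])
    qed
    have "(2 * c * 2 powr (\<nu> * real i)) powr \<rho> = (2 * \<sigma>) powr \<rho> * (real n powr (-1/2)) powr \<rho>
        * (2 powr (\<nu> * real i)) powr \<rho>"
      unfolding c by (simp only: powr_mult mult.assoc)
    then have "2 powr (real i * (\<rho>/2 - 1)) * (2 powr real i * E) = (2 powr (real i * (\<rho>/2 - 1))
        * 2 powr real i) *
      (2 * \<rho> powr \<rho> * exp 1 * B1 * ((2 * \<sigma>) powr \<rho> * (real n powr (-1/2)) powr \<rho> * (2 powr (\<nu>
          * real i)) powr \<rho>) * (2 powr (- 2 * (\<nu> + 1/2) * d)) powr \<rho>)"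
      unfolding E_def thr_const(2) by (simp only: mult.assoc)
    also have "\<dots> = noise_const * noise_level i powr \<rho>" unfolding two nzp noise_const_def
        by (simp only: mult_ac)
    finally show ?thesis .
  qed
  finally show ?thesis .
qed

text \<open>The two entries of \<open>signal_bound\<close> are shown separately. Without the
  threshold, the inclusion of sequence spaces applies, as \<open>pm\<close> \<le> \<rho>. Splitting
  the power \<rho> into \<open>pm\<close> and \<open>\<rho> - pm\<close> leaves a moment of the
  variance of order (\<rho> - pm) / 2, which \<open>B2\<close> controls.\<close>

lemma min_moment:
  assumes i: "i \<le> J"
  shows "(\<integral>\<^sup>+\<omega>. ennreal (2 powr (real i * (\<rho>/2 - 1)) * (\<Sum>k\<in>widx i. trunc_coeff i k \<omega>)) \<partial>M)
      \<le> ennreal (coeff_const * signal_level i powr \<rho>)"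
proof (cases "i \<le> i0")
  case True
  then have "threshold i \<omega> = 0" for \<omega> by (simp add: threshold_def)
  then have "trunc_coeff i k \<omega> = 0" for k \<omega> using rho by (simp add: trunc_coeff_def min_def)
  then show ?thesis by simp
next
  case False
  interpret prob_space M by (rule M)
  define b where "b = besov_level h f s pm i"
  have b0: "b \<ge> 0" by (simp add: b_def bseq_nonneg)
  define d where "d = real (i - i0)"
  have d: "d > 0" using False by (simp add: d_def)
  define t where "t = 2 powr (real i * (\<rho>/2 - 1))"
  have t0: "t > 0" by (simp add: t_def)
  define S where "S r = (\<Sum>k\<in>widx i. \<bar>wav_coeff h f i k\<bar> powr r)" for r
  have S0: "S r \<ge> 0" for r unfolding S_def by (rule sum_nonneg) simp
  have Spm: "S pm = b powr pm * 2 powr (- real i * pm * (s + 1/2 - 1/pm))"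
    unfolding S_def b_def by (rule level_coeff_sum[OF pm(1)])
  define X1 where "X1 = b * 2 powr (- real i * (s - 1/pm + 1/\<rho>))"
  define X2 where "X2 = b powr (pm/\<rho>) * 2 powr (- real i * (pm/\<rho> * (s + \<nu> + 1/2) - (\<nu> + 1/2)))
      * (d / real n) powr ((1 - pm/\<rho>)/2)"
  have signal_level: "signal_level i = min X1 X2" using False
      by (simp add: signal_level_def signal_bound_def X1_def X2_def b_def d_def)
  have X0: "X1 \<ge> 0" "X2 \<ge> 0" using b0 by (auto simp: X1_def X2_def)
  have Mb: "trunc_coeff i k \<omega> \<le> \<bar>wav_coeff h f i k\<bar> powr \<rho>" for k \<omega>
    unfolding trunc_coeff_def using rho threshold_nonneg by (intro powr_mono2) auto
  have first: "t * S \<rho> \<le> X1 powr \<rho>"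
  proof -
    have "S \<rho> \<le> S pm powr (\<rho>/pm)" unfolding S_def by (rule powr_sum_le_sum_powr) (use pm in auto)
    then have "t * S \<rho> \<le> t * S pm powr (\<rho>/pm)" using t0 by (intro mult_left_mono) auto
    also have "S pm powr (\<rho>/pm) = b powr \<rho> * 2 powr (- real i * \<rho> * (s + 1/2 - 1/pm))"
    proof -
      have "pm * (\<rho>/pm) = \<rho>" "- real i * pm * (s + 1/2 - 1/pm) * (\<rho>/pm) = - real i * \<rho> * (s
          + 1/2 - 1/pm)" using pm by auto
      then show ?thesis unfolding Spm powr_mult powr_powr by (simp only:)
    qed
    also have "t * (b powr \<rho> * 2 powr (- real i * \<rho> * (s + 1/2 - 1/pm))) = b powr \<rho> * (t
        * 2 powr (- real i * \<rho> * (s + 1/2 - 1/pm)))" by simp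
    also have "t * 2 powr (- real i * \<rho> * (s + 1/2 - 1/pm)) = 2 powr (- real i * (s - 1/pm + 1/\<rho>) * \<rho>)"
    proof -
      have "real i * (\<rho>/2 - 1) + - real i * \<rho> * (s + 1/2 - 1/pm) = - real i * (s - 1/pm + 1/\<rho>) * \<rho>"
        using rho by (simp add: algebra_simps)
      then show ?thesis unfolding t_def by (simp only: powr_add[symmetric])
    qed
    also have "b powr \<rho> * 2 powr (- real i * (s - 1/pm + 1/\<rho>) * \<rho>) = X1 powr \<rho>"
        by (simp add: X1_def powr_mult powr_powr)
    finally show ?thesis .
  qed
  have e1: "(\<integral>\<^sup>+\<omega>. ennreal (t * (\<Sum>k\<in>widx i. trunc_coeff i k \<omega>)) \<partial>M) \<le> ennreal (X1 powr \<rho>)"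
  proof -
    have "(\<integral>\<^sup>+\<omega>. ennreal (t * (\<Sum>k\<in>widx i. trunc_coeff i k \<omega>)) \<partial>M) \<le> (\<integral>\<^sup>+\<omega>. ennreal (X1 powr \<rho>) \<partial>M)"
    proof (intro nn_integral_mono ennreal_leI)
      fix \<omega>
      have "t * (\<Sum>k\<in>widx i. trunc_coeff i k \<omega>) \<le> t * S \<rho>" unfolding S_def using t0 Mb
          by (intro mult_left_mono sum_mono) auto
      then show "t * (\<Sum>k\<in>widx i. trunc_coeff i k \<omega>) \<le> X1 powr \<rho>" using first by linarith
    qed
    then show ?thesis by (simp add: emeasure_space_1)
  qed
  have e2: "(\<integral>\<^sup>+\<omega>. ennreal (t * (\<Sum>k\<in>widx i. trunc_coeff i k \<omega>)) \<partial>M) \<le> ennreal (coeff_const * X2 powr \<rho>)"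
  proof -
    define K where "K = thr_const powr (\<rho> - pm) * d powr ((\<rho> - pm)/2)"
    have level_const: "K \<ge> 0" by (simp add: K_def)
    have "(\<integral>\<^sup>+\<omega>. ennreal (t * (\<Sum>k\<in>widx i. trunc_coeff i k \<omega>)) \<partial>M) \<le> (\<integral>\<^sup>+\<omega>. ennreal (t * S pm * K)
        * ennreal (cond_var i \<omega> powr ((\<rho> - pm)/2)) \<partial>M)"
    proof (rule nn_integral_mono_AE)
      show "AE \<omega> in M. ennreal (t * (\<Sum>k\<in>widx i. trunc_coeff i k \<omega>)) \<le> ennreal (t * S pm * K)
          * ennreal (cond_var i \<omega> powr ((\<rho> - pm)/2))"
        using sampled_coeff_AE
      proof eventually_elim
        case (elim \<omega>)
        have cond_var: "cond_var i \<omega> > 0" unfolding cond_var_def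
          by (rule vlev_pos[OF c_pos]) (use elim i in auto)
        have L: "threshold i \<omega> > 0" using cond_var d thr_const(1) by (simp add: threshold_def d_def)
        have lp: "threshold i \<omega> powr (\<rho> - pm) = K * cond_var i \<omega> powr ((\<rho> - pm)/2)"
        proof -
          have "sqrt (cond_var i \<omega> * d) = (cond_var i \<omega> * d) powr (1/2)" using cond_var d
              by (simp add: powr_half_sqrt)
          then have "threshold i \<omega> = thr_const * (cond_var i \<omega> powr (1/2) * d powr (1/2))"
              by (simp add: threshold_def d_def powr_mult)
          then show ?thesis unfolding K_def by (simp add: powr_mult powr_powr)
        qed
        have "trunc_coeff i k \<omega> \<le> \<bar>wav_coeff h f i k\<bar> powr pm * threshold i \<omega> powr (\<rho> - pm)" for k
        proof -
          define m where "m = min \<bar>wav_coeff h f i k\<bar> (threshold i \<omega>)"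
          have m: "m \<ge> 0" "m \<le> \<bar>wav_coeff h f i k\<bar>" "m \<le> threshold i \<omega>" using L by (auto simp: m_def)
          have "m powr \<rho> = m powr pm * m powr (\<rho> - pm)" by (simp add: powr_add[symmetric])
          also have "\<dots> \<le> \<bar>wav_coeff h f i k\<bar> powr pm * threshold i \<omega> powr (\<rho> - pm)"
            using m pm by (intro mult_mono powr_mono2) auto
          finally show ?thesis by (simp add: trunc_coeff_def m_def)
        qed
        then have "(\<Sum>k\<in>widx i. trunc_coeff i k \<omega>) \<le> S pm * threshold i \<omega> powr (\<rho> - pm)"
          unfolding S_def sum_distrib_right by (rule sum_mono)
        then have "t * (\<Sum>k\<in>widx i. trunc_coeff i k \<omega>) \<le> t * (S pm * threshold i \<omega> powr (\<rho> - pm))"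
            using t0 by (intro mult_left_mono) auto
        also have "\<dots> = (t * S pm * K) * cond_var i \<omega> powr ((\<rho> - pm)/2)" by (simp add: lp)
        finally have "ennreal (t * (\<Sum>k\<in>widx i. trunc_coeff i k \<omega>)) \<le> ennreal ((t * S pm * K)
            * cond_var i \<omega> powr ((\<rho> - pm)/2))" by (rule ennreal_leI)
        then show ?case by (simp add: ennreal_mult'')
      qed
    qed
    also have "\<dots> = ennreal (t * S pm * K) * (\<integral>\<^sup>+\<omega>. ennreal (cond_var i \<omega> powr ((\<rho> - pm)/2)) \<partial>M)"
      by (rule nn_integral_cmult) measurable
    also have "\<dots> \<le> ennreal (t * S pm * K) * ennreal (B2 * (2 * c * 2 powr (\<nu> * real i)) powr (\<rho> - pm))"
      unfolding cond_var_def
      by (intro mult_left_mono vlev_moment[OF Y c_pos _ _ B2(2) B2(1)]) (use sampled_coeff_AE i pm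
          in \<open>auto elim!: eventually_mono\<close>)
    also have "\<dots> = ennreal (t * S pm * K * (B2 * (2 * c * 2 powr (\<nu> * real i)) powr (\<rho> - pm)))"
      using B2(1) by (intro ennreal_mult''[symmetric]) auto
    also have "\<dots> \<le> ennreal (coeff_const * X2 powr \<rho>)"
    proof (rule ennreal_leI)
      define G where "G = \<rho> - pm"
      have r0: "\<rho> \<noteq> 0" using rho by simp
      have x2: "X2 powr \<rho> = b powr pm * 2 powr (- real i * (pm * (s + \<nu> + 1/2) - \<rho> * (\<nu> + 1/2)))
          * (d powr (G/2) * (real n powr (-1/2)) powr G)"
      proof -
        have "pm/\<rho> * \<rho> = pm" "- real i * (pm/\<rho> * (s + \<nu> + 1/2) - (\<nu> + 1/2)) * \<rho> = - real i * (pm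
            * (s + \<nu> + 1/2) - \<rho> * (\<nu> + 1/2))"
          "(1 - pm/\<rho>)/2 * \<rho> = G/2" using r0 by (auto simp: G_def field_simps)
        then have "X2 powr \<rho> = b powr pm * 2 powr (- real i * (pm * (s + \<nu> + 1/2) - \<rho> * (\<nu> + 1/2)))
            * (d / real n) powr (G/2)"
          unfolding X2_def powr_mult powr_powr by (simp only:)
        also have "(d / real n) powr (G/2) = d powr (G/2) * (real n powr (-1/2)) powr G"
          using n d by (simp add: powr_divide powr_powr powr_minus_divide)
        finally show ?thesis .
      qed
      have two: "t * 2 powr (- real i * pm * (s + 1/2 - 1/pm)) * 2 powr (\<nu> * real i * G)
          = 2 powr (- real i * (pm * (s + \<nu> + 1/2) - \<rho> * (\<nu> + 1/2)))"
      proof -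
        have "real i * (\<rho>/2 - 1) + - real i * pm * (s + 1/2 - 1/pm) + \<nu> * real i * G = - real i
            * (pm * (s + \<nu> + 1/2) - \<rho> * (\<nu> + 1/2))"
          using pm by (simp add: G_def algebra_simps)
        then show ?thesis unfolding t_def by (simp only: powr_add[symmetric])
      qed
      have cc: "(2 * c * 2 powr (\<nu> * real i)) powr G = (2 * \<sigma>) powr G * (real n powr (-1/2)) powr G
          * 2 powr (\<nu> * real i * G)"
        unfolding c by (simp only: powr_mult mult.assoc powr_powr)
      have kp: "(2 * \<sigma> * thr_const) powr G = (2 * \<sigma>) powr G * thr_const powr G" by (rule powr_mult)
      have "t * S pm * K * (B2 * (2 * c * 2 powr (\<nu> * real i)) powr G) =
        B2 * ((2 * \<sigma>) powr G * thr_const powr G) * (b powr pm * (t * 2 powr (- real i * pm * (s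
            + 1/2 - 1/pm)) * 2 powr (\<nu> * real i * G)) * (d powr (G/2) * (real n powr (-1/2)) powr G))"
        unfolding Spm K_def cc G_def[symmetric] by (simp only: mult_ac)
      also have "\<dots> = B2 * (2 * \<sigma> * thr_const) powr G * X2 powr \<rho>" unfolding two x2 kp ..
      also have "\<dots> \<le> coeff_const * X2 powr \<rho>" unfolding coeff_const_def G_def
          by (intro mult_right_mono) auto
      finally show "t * S pm * K * (B2 * (2 * c * 2 powr (\<nu> * real i)) powr (\<rho> - pm)) \<le> coeff_const
          * X2 powr \<rho>" unfolding G_def .
    qed
    finally show ?thesis .
  qed
  show ?thesis
  proof (cases "X1 \<le> X2")
    case True
    then have "signal_level i = X1" by (simp add: signal_level)
    moreover have "X1 powr \<rho> \<le> coeff_const * X1 powr \<rho>" using A_pos(2)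
        by (simp add: mult_le_cancel_right1)
    ultimately show ?thesis using e1 unfolding t_def by (auto intro: order_trans ennreal_leI)
  next
    case False
    then have "signal_level i = X2" by (simp add: signal_level)
    then show ?thesis using e2 unfolding t_def by simp
  qed
qed

text \<open>A deterministic bound for the \<rho>-th root of the mean of \<open>level_loss i\<close>;
  it becomes the weight of the level in \<open>Lnorm_combination\<close>.\<close>

definition level_weight :: "nat \<Rightarrow> real" where "level_weight i = risk_const * (signal_level i
    + noise_level i)"
definition level_loss :: "nat \<Rightarrow> 'a \<Rightarrow> real" where
  "level_loss i \<omega> = level_const * (2 powr (real i * (\<rho>/2 - 1)) * (\<Sum>k\<in>widx i. trunc_coeff i k \<omega>)
      + 2 powr (real i * (\<rho>/2 - 1)) * (\<Sum>k\<in>widx i. noise_exceed i k \<omega>))"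

lemma level_weight_pos: "level_weight i > 0"
  using const_pos signal_level_nonneg[of i] noise_level_pos[of i]
      by (simp add: level_weight_def add_nonneg_pos)

lemma level_loss_nonneg: "level_loss i \<omega> \<ge> 0"
  unfolding level_loss_def trunc_coeff_def noise_exceed_def using const_pos
      by (intro mult_nonneg_nonneg add_nonneg_nonneg sum_nonneg) auto

lemma level_loss_measurable [measurable]: "level_loss i \<in> borel_measurable M"
  unfolding level_loss_def by measurable

lemma level_loss_moment:
  assumes i: "i \<le> J"
  shows "(\<integral>\<^sup>+\<omega>. ennreal (level_loss i \<omega>) \<partial>M) \<le> ennreal (level_weight i powr \<rho>)"
proof -
  have nn: "0 \<le> 2 powr (real i * (\<rho>/2 - 1)) * (\<Sum>k\<in>widx i. trunc_coeff i k \<omega>)" "0 \<le> 2 powr (real i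
      * (\<rho>/2 - 1)) * (\<Sum>k\<in>widx i. noise_exceed i k \<omega>)" for \<omega>
    unfolding trunc_coeff_def noise_exceed_def by (auto intro!: mult_nonneg_nonneg sum_nonneg)
  have "(\<integral>\<^sup>+\<omega>. ennreal (level_loss i \<omega>) \<partial>M) = (\<integral>\<^sup>+\<omega>. ennreal level_const * (ennreal (2 powr (real i
      * (\<rho>/2 - 1)) * (\<Sum>k\<in>widx i. trunc_coeff i k \<omega>))
      + ennreal (2 powr (real i * (\<rho>/2 - 1)) * (\<Sum>k\<in>widx i. noise_exceed i k \<omega>))) \<partial>M)"
    unfolding level_loss_def using const_pos nn by (intro nn_integral_cong ennreal_mult_add) auto
  also have "\<dots> = ennreal level_const * ((\<integral>\<^sup>+\<omega>. ennreal (2 powr (real i * (\<rho>/2 - 1))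
      * (\<Sum>k\<in>widx i. trunc_coeff i k \<omega>)) \<partial>M)
      + (\<integral>\<^sup>+\<omega>. ennreal (2 powr (real i * (\<rho>/2 - 1)) * (\<Sum>k\<in>widx i. noise_exceed i k \<omega>)) \<partial>M))"
    by (subst nn_integral_cmult, measurable) (subst nn_integral_add, auto)
  also have "\<dots> \<le> ennreal level_const * (ennreal (coeff_const * signal_level i powr \<rho>)
      + ennreal (noise_const * noise_level i powr \<rho>))"
    by (intro mult_left_mono add_mono min_moment noise_moment i) auto
  also have "\<dots> = ennreal (level_const * (coeff_const * signal_level i powr \<rho> + noise_const
      * noise_level i powr \<rho>))"
    using A_pos const_pos by (intro ennreal_mult_add[symmetric]) auto
  also have "\<dots> \<le> ennreal (level_weight i powr \<rho>)"
  proof (rule ennreal_leI)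
    have "coeff_const * signal_level i powr \<rho> + noise_const * noise_level i powr \<rho> \<le> (noise_const
        + coeff_const) * signal_level i powr \<rho> + (noise_const + coeff_const) * noise_level i powr \<rho>"
      using A_pos by (intro add_mono mult_right_mono) auto
    also have "\<dots> = (noise_const + coeff_const) * (signal_level i powr \<rho> + noise_level i powr \<rho>)"
        by (simp add: distrib_left)
    also have "\<dots> \<le> (noise_const + coeff_const) * (signal_level i + noise_level i) powr \<rho>"
      using A_pos rho signal_level_nonneg[of i] noise_level_pos[of i]
          by (intro mult_left_mono powr_add_le) auto
    finally have "level_const * (coeff_const * signal_level i powr \<rho> + noise_const
        * noise_level i powr \<rho>) \<le> level_const * ((noise_const + coeff_const) * (signal_level i
        + noise_level i) powr \<rho>)"
      using const_pos by (intro mult_left_mono) auto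
    also have "\<dots> = risk_const powr \<rho> * (signal_level i + noise_level i) powr \<rho>"
      unfolding risk_const_def using rho A_pos const_pos by (simp add: powr_powr)
    also have "\<dots> = level_weight i powr \<rho>" unfolding level_weight_def by (rule powr_mult[symmetric])
    finally show "level_const * (coeff_const * signal_level i powr \<rho> + noise_const
        * noise_level i powr \<rho>) \<le> level_weight i powr \<rho>" .
  qed
  finally show ?thesis .
qed

text \<open>The error splits into the errors of the coefficients up to level \<open>J\<close> and
  the tail of the expansion, at most 1 / n. Exceptional \<omega> are those with a discontinuous
  Wiener path, or where sampled and true coefficients of the filter differ or vanish.\<close>

lemma pathwise_error:
  assumes tail: "(\<Sum>i. C * (2 powr (s + 1/2 - 1/p) * R) * 2 powr (- (s - 1/p) * real (i + Suc J)))
      \<le> 1 / real n"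
  shows "AE \<omega> in M. Lnorm \<rho> (\<lambda>x. threshold_estimator h c u thr_const i0 J (obs_path W Y x0 \<sigma> n f \<omega>)
      x - f x)
     \<le> ennreal (((\<Sum>i\<le>J. level_weight i) + 1 / real n) + ((\<Sum>i\<le>J. level_weight i powr (1 - \<rho>)
         * level_loss i \<omega>) + 1 / real n))"
proof -
  interpret prob_space M by (rule M)
  note fm = besov_ball_measurable[OF f p]
  define R1 where "R1 = 2 powr (s + 1/2 - 1/p) * R"
  define Bd where "Bd i = C * R1 * 2 powr (- (s - 1/p) * real i)" for i
  have db: "\<bar>level_sum h f i x\<bar> \<le> Bd i" for i x
    unfolding Bd_def by (rule dlev_bound[OF p C]) (simp add: R1_def bseq_bounds(2)[OF p q R f])
  have Bs: "summable Bd" unfolding Bd_def using sum_powr_le(1)[of "s - 1/p"] s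
      by (intro summable_mult) auto
  define g where "g x = (\<Sum>i. level_sum h f i x)" for x
  note gp = wavelet_sum_properties[OF h db Bs, folded g_def]
  have fg: "AE x in I01. f x = g x" unfolding g_def by (rule wavelet_expansion[OF h fm(3) db Bs])
  have "AE \<omega> in M. continuous_on {0..} (\<lambda>t. W t \<omega>)" using W by (simp add: wiener_process_def)
  moreover have "AE \<omega> in M. \<omega> \<in> space M" by (rule AE_space)
  ultimately show ?thesis using sampled_coeff_AE
  proof eventually_elim
    case (elim \<omega>)
    define y where "y t = Y t \<omega>" for t
    have yi: "integrable I01 y" using L2_process_section(3)[OF Y elim(2)] by (simp add: y_def[abs_def])
    have wav_ft: "continuous_on {0..1} (\<lambda>t. W t \<omega>)" using elim(1) by (rule continuous_on_subset) auto
    define z where "z = obs_path W Y x0 \<sigma> n f \<omega>"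
    have z1: "fst (z t) = x0 + set_lebesgue_integral lborel {0..t} (conv01 f y) + c
        * W t \<omega>" "snd (z t) = y t" if "t \<in> {0..1}" for t
      using that by (simp_all add: z_def obs_path_def obs_X_def y_def[abs_def] c)
    have yz: "sampled_coeff u (\<lambda>t. snd (z t)) l = sampled_coeff u y l" for l using z1(2)[OF u]
        by (simp add: sampled_coeff_def)
    define err where "err i k = hard_threshold (threshold i \<omega>) (wav_coeff h f i k
        + noise i k \<omega>) - wav_coeff h f i k" for i k
    have beta: "Re (\<Sum>l\<in>freqs i. cnj (wav_ft h i k l) * (stieltjes_lim (\<lambda>t. fst (z t)) l /
        sampled_coeff u (\<lambda>t. snd (z t)) l)) = wav_coeff h f i k + noise i k \<omega>"
      if i: "i \<le> J" and k: "k \<in> widx i" for i k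
      unfolding yz noise_def y_def[abs_def, symmetric]
      by (rule observation_coefficient[OF h fm gp(1,2,3) fg yi wav_ft z1(1) _ k]) (use elim(3) i
          in \<open>auto simp: y_def[abs_def]\<close>)
    have lm: "thr_const * sqrt (noise_variance c u i (\<lambda>t. snd (z t)) * real (i - i0))
        = threshold i \<omega>" for i
      by (simp add: threshold_def cond_var_def noise_variance_def yz y_def[abs_def])
    define X where "X i x = (\<Sum>k\<in>widx i. err i k * wav h i k x)" for i x
    have threshold_estimator: "threshold_estimator h c u thr_const i0 J z x = (\<Sum>i\<le>J. X i x)
        + (\<Sum>i\<le>J. level_sum h f i x)" for x
    proof -
      have "threshold_estimator h c u thr_const i0 J z x = (\<Sum>i\<le>J. \<Sum>k\<in>widx i. (err i k
          + wav_coeff h f i k) * wav h i k x)"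
        unfolding threshold_estimator_def lm
      proof (intro sum.cong refl)
        fix i k assume i: "i \<in> {..J}" and k: "k \<in> widx i"
        then show "hard_threshold (threshold i \<omega>) (Re (\<Sum>l\<in>freqs i. cnj (wav_ft h i k l)
            * (stieltjes_lim (\<lambda>t. fst (z t)) l / sampled_coeff u (\<lambda>t. snd (z t)) l))) * wav h i k x =
          (err i k + wav_coeff h f i k) * wav h i k x"
          by (subst beta) (auto simp: err_def)
      qed
      then show ?thesis by (simp add: X_def level_sum_def distrib_right sum.distrib)
    qed
    have ecm: "(\<lambda>x. threshold_estimator h c u thr_const i0 J z x - f x) \<in> borel_measurable I01"
    proof (rule borel_measurable_diff[OF _ measurable_I01[OF fm(1)]])
      have "continuous_on UNIV (\<lambda>x. threshold_estimator h c u thr_const i0 J z x)"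
          unfolding threshold_estimator_def
        by (intro continuous_intros wav_continuous[OF h])
      then show "(\<lambda>x. threshold_estimator h c u thr_const i0 J z x) \<in> borel_measurable I01"
        by (intro measurable_I01 borel_measurable_continuous_onI)
    qed
    have "Lnorm \<rho> (\<lambda>x. threshold_estimator h c u thr_const i0 J z x - f x)
      \<le> ennreal (((\<Sum>i\<le>J. level_weight i) + 1 / real n) + ((\<Sum>i\<le>J. level_weight i powr (1 - \<rho>)
          * level_loss i \<omega>) + 1 / real n))"
    proof (rule Lnorm_combination[OF rho _ _ _ ecm])
      show "continuous_on {0..1} (X i)" for i unfolding X_def[abs_def]
        by (intro continuous_intros wav_continuous[OF h])
      show "level_weight i > 0" for i by (rule level_weight_pos)
      show "1 / real n > 0" using n by simp
      show "AE x in I01. \<bar>threshold_estimator h c u thr_const i0 J z x - f x\<bar> \<le> (\<Sum>i\<le>J. \<bar>X i x\<bar>)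
          + 1 / real n"
        using fg
      proof eventually_elim
        case (elim x)
        have "threshold_estimator h c u thr_const i0 J z x - f x
            = (\<Sum>i\<le>J. X i x) - (g x - (\<Sum>i\<le>J. level_sum h f i x))"
          using elim by (simp add: threshold_estimator)
        also have "\<bar>\<dots>\<bar> \<le> (\<Sum>i\<le>J. \<bar>X i x\<bar>) + \<bar>g x - (\<Sum>i\<le>J. level_sum h f i x)\<bar>"
          using sum_abs[of "\<lambda>i. X i x" "{..J}"] by linarith
        also have "\<bar>g x - (\<Sum>i\<le>J. level_sum h f i x)\<bar> \<le> 1 / real n"
          using gp(4)[of x J] tail unfolding Bd_def R1_def by linarith
        finally show ?case by simp
      qed
      show "(LINT x|I01. \<bar>X i x\<bar> powr \<rho>) \<le> level_loss i \<omega>" for i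
      proof -
        have "(LINT x|I01. \<bar>X i x\<bar> powr \<rho>) \<le> 2 * C powr \<rho> * 2 powr (real i * (\<rho> / 2 - 1))
            * (\<Sum>k\<in>widx i. \<bar>err i k\<bar> powr \<rho>)"
          unfolding X_def by (rule level_norm_bound[OF h rho C])
        also have "\<dots> \<le> 2 * C powr \<rho> * 2 powr (real i * (\<rho> / 2 - 1)) * (\<Sum>k\<in>widx i. 6 powr \<rho>
            * (trunc_coeff i k \<omega> + noise_exceed i k \<omega>))"
          unfolding err_def trunc_coeff_def noise_exceed_def
          by (intro mult_left_mono sum_mono hard_error_powr threshold_nonneg rho) auto
        also have "\<dots> = level_loss i \<omega>"
          unfolding level_loss_def level_const_def sum_distrib_left[symmetric] sum.distrib
              by (simp add: algebra_simps)
        finally show ?thesis .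
      qed
    qed
    then show ?case unfolding z_def .
  qed
qed

text \<open>The mean of \<open>level_loss i\<close> is at most
  \<open>level_weight i powr \<rho>\<close>, which multiplied by
  \<open>level_weight i powr (1 - \<rho>)\<close> is the weight itself: in the mean the random half
  of the pathwise bound contributes no more than the deterministic half.\<close>

lemma estimator_risk:
  assumes tail: "(\<Sum>i. C * (2 powr (s + 1/2 - 1/p) * R) * 2 powr (- (s - 1/p) * real (i + Suc J)))
      \<le> 1 / real n"
  shows "risk M W Y x0 \<sigma> \<rho> n (threshold_estimator h c u thr_const i0 J) f \<le>
    ennreal (2 * (risk_const + 1) * ((\<Sum>i\<le>J. signal_bound \<rho> pm s \<nu> (real n) i0 (besov_level h f s pm)
        i + noise_bound \<nu> (real n) i0 i) + 1 / real n))"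
proof -
  interpret prob_space M by (rule M)
  define T where "T = (\<Sum>i\<le>J. level_weight i) + 1 / real n"
  have T0: "T \<ge> 0" unfolding T_def using level_weight_pos
      by (intro add_nonneg_nonneg sum_nonneg) (auto intro: less_imp_le)
  have sn: "(\<Sum>i\<le>J. level_weight i powr (1 - \<rho>) * level_loss i \<omega>) \<ge> 0" for \<omega>
    using level_loss_nonneg by (intro sum_nonneg mult_nonneg_nonneg) auto
  have "risk M W Y x0 \<sigma> \<rho> n (threshold_estimator h c u thr_const i0 J) f \<le>
     (\<integral>\<^sup>+\<omega>. ennreal (T + ((\<Sum>i\<le>J. level_weight i powr (1 - \<rho>) * level_loss i \<omega>) + 1 / real n)) \<partial>M)"
    unfolding risk_def T_def by (rule nn_integral_mono_AE[OF pathwise_error[OF tail]])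
  also have "\<dots> = (\<integral>\<^sup>+\<omega>. ennreal (T + 1 / real n) + (\<Sum>i\<le>J. ennreal (level_weight i powr (1 - \<rho>))
      * ennreal (level_loss i \<omega>)) \<partial>M)"
  proof (intro nn_integral_cong)
    fix \<omega>
    have "(\<Sum>i\<le>J. ennreal (level_weight i powr (1 - \<rho>)) * ennreal (level_loss i \<omega>))
        = ennreal (\<Sum>i\<le>J. level_weight i powr (1 - \<rho>) * level_loss i \<omega>)"
      using level_loss_nonneg by (subst sum_ennreal[symmetric]) (auto simp: ennreal_mult)
    then show "ennreal (T + ((\<Sum>i\<le>J. level_weight i powr (1 - \<rho>) * level_loss i \<omega>) + 1 / real n)) =
        ennreal (T + 1 / real n) + (\<Sum>i\<le>J. ennreal (level_weight i powr (1 - \<rho>))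
            * ennreal (level_loss i \<omega>))"
      using T0 sn[of \<omega>] by (simp add: algebra_simps flip: ennreal_plus)
  qed
  also have "\<dots> = ennreal (T + 1 / real n) + (\<Sum>i\<le>J. ennreal (level_weight i powr (1 - \<rho>))
      * (\<integral>\<^sup>+\<omega>. ennreal (level_loss i \<omega>) \<partial>M))"
  proof -
    have "(\<integral>\<^sup>+\<omega>. (\<Sum>i\<le>J. ennreal (level_weight i powr (1 - \<rho>)) * ennreal (level_loss i \<omega>)) \<partial>M)
        = (\<Sum>i\<le>J. ennreal (level_weight i powr (1 - \<rho>)) * (\<integral>\<^sup>+\<omega>. ennreal (level_loss i \<omega>) \<partial>M))"
      by (subst nn_integral_sum) (auto intro!: sum.cong nn_integral_cmult)
    then show ?thesis by (subst nn_integral_add) (auto simp: emeasure_space_1)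
  qed
  also have "\<dots> \<le> ennreal (T + 1 / real n) + (\<Sum>i\<le>J. ennreal (level_weight i powr (1 - \<rho>))
      * ennreal (level_weight i powr \<rho>))"
    by (intro add_left_mono sum_mono mult_left_mono level_loss_moment) auto
  also have "(\<Sum>i\<le>J. ennreal (level_weight i powr (1 - \<rho>)) * ennreal (level_weight i powr \<rho>))
      = (\<Sum>i\<le>J. ennreal (level_weight i))"
  proof (intro sum.cong refl)
    fix i
    have "level_weight i powr (1 - \<rho>) * level_weight i powr \<rho> = level_weight i"
        using level_weight_pos[of i] by (simp add: powr_add[symmetric])
    then show "ennreal (level_weight i powr (1 - \<rho>)) * ennreal (level_weight i powr \<rho>)
        = ennreal (level_weight i)" by (simp flip: ennreal_mult)
  qed
  also have "(\<Sum>i\<le>J. ennreal (level_weight i)) = ennreal (\<Sum>i\<le>J. level_weight i)"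
      using level_weight_pos by (intro sum_ennreal) (auto intro: less_imp_le)
  also have "ennreal (T + 1 / real n) + ennreal (\<Sum>i\<le>J. level_weight i) = ennreal (2 * T)"
  proof -
    have S: "(\<Sum>i\<le>J. level_weight i) \<ge> 0" using level_weight_pos
        by (intro sum_nonneg) (auto intro: less_imp_le)
    have "ennreal (T + 1 / real n) + ennreal (\<Sum>i\<le>J. level_weight i) = ennreal ((T + 1 / real n)
        + (\<Sum>i\<le>J. level_weight i))"
      by (rule ennreal_plus[symmetric]) (use T0 S in auto)
    also have "(T + 1 / real n) + (\<Sum>i\<le>J. level_weight i) = 2 * T" by (simp add: T_def)
    finally show ?thesis .
  qed
  also have "\<dots> \<le> ennreal (2 * (risk_const + 1) * ((\<Sum>i\<le>J. signal_level i + noise_level i) + 1 / real n))"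
  proof (rule ennreal_leI)
    have a: "(\<Sum>i\<le>J. signal_level i + noise_level i) \<ge> 0" using signal_level_nonneg noise_level_pos
        by (intro sum_nonneg add_nonneg_nonneg) (auto intro: less_imp_le)
    have "T = risk_const * (\<Sum>i\<le>J. signal_level i + noise_level i) + 1 / real n"
        by (simp add: T_def level_weight_def sum_distrib_left)
    also have "\<dots> \<le> (risk_const + 1) * (\<Sum>i\<le>J. signal_level i + noise_level i) + (risk_const + 1)
        * (1 / real n)"
      using a const_pos(2) n by (intro add_mono mult_right_mono) (auto simp: field_simps)
    finally have "2 * T \<le> 2 * ((risk_const + 1) * (\<Sum>i\<le>J. signal_level i + noise_level i)
        + (risk_const + 1) * (1 / real n))" by (intro mult_left_mono) auto
    also have "\<dots> = 2 * (risk_const + 1) * ((\<Sum>i\<le>J. signal_level i + noise_level i) + 1 / real n)"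
        by (simp only: mult.assoc[of 2 "risk_const + 1"] distrib_left[of "risk_const + 1"])
    finally show "2 * T \<le> 2 * (risk_const + 1) * ((\<Sum>i\<le>J. signal_level i + noise_level i) + 1 / real n)" .
  qed
  finally show ?thesis unfolding signal_level_def noise_level_def .
qed

end

text \<open>Separates probability from calculus: the hypothesis concerns all sequences
  \<open>b\<close> within the bounds of the level norms, hence the whole ball at once.
  \<open>J\<close> and the sampling points may depend on n and the model, but are chosen before the
  target.\<close>

lemma minimax_bound:
  "\<exists>K>0. \<forall>n\<ge>1. \<forall>i0 D. (\<forall>b J. (\<forall>i. 0 \<le> b i \<and> b i \<le> 2 powr (s + 1/2 - 1/p) * R) \<longrightarrow>
     (\<forall>J. (\<Sum>i\<le>J. b i powr q) \<le> (2 powr (s + 1/2 - 1/p) * R) powr q) \<longrightarrow>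
     (\<Sum>i\<le>J. signal_bound \<rho> pm s \<nu> (real n) i0 b i + noise_bound \<nu> (real n) i0 i) + 1 / real n \<le> D) \<longrightarrow>
   minimax_risk M W Y x0 \<sigma> \<rho> (besov_ball h s p q R) n \<le> ennreal (K * D)"
proof (intro exI[of _ "2 * (risk_const + 1)"] conjI allI impI)
  show "0 < 2 * (risk_const + 1)" using const_pos by simp
  fix n :: nat and i0 :: nat and D :: real
  assume n: "n \<ge> 1"
  assume D: "\<forall>b J. (\<forall>i. 0 \<le> b i \<and> b i \<le> 2 powr (s + 1/2 - 1/p) * R) \<longrightarrow>
     (\<forall>J. (\<Sum>i\<le>J. b i powr q) \<le> (2 powr (s + 1/2 - 1/p) * R) powr q) \<longrightarrow>
     (\<Sum>i\<le>J. signal_bound \<rho> pm s \<nu> (real n) i0 b i + noise_bound \<nu> (real n) i0 i) + 1 / real n \<le> D"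
  define Bd where "Bd i = C * (2 powr (s + 1/2 - 1/p) * R) * 2 powr (- (s - 1/p) * real i)" for i
  have Bs: "summable Bd" unfolding Bd_def using sum_powr_le(1)[of "s - 1/p"] s
      by (intro summable_mult) auto
  \<comment> \<open>The tail only has to be below 1 / n. The level bounds hold for any number of
    levels, so \<open>J\<close> may be as large as this takes.\<close>
  obtain N where N: "\<And>m. m \<ge> N \<Longrightarrow> norm (\<Sum>i. Bd (i + m)) < 1 / real n"
    using suminf_exist_split[OF _ Bs, of "1 / real n"] n by auto
  define J where "J = N"
  have tail: "(\<Sum>i. C * (2 powr (s + 1/2 - 1/p) * R) * 2 powr (- (s - 1/p) * real (i + Suc J)))
      \<le> 1 / real n"
    using N[of "Suc J"] unfolding J_def Bd_def by simp
  obtain u where u: "\<And>j. u j \<in> {0..1}"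
    and good: "AE \<omega> in M. \<forall>l\<in>freqs J. sampled_coeff u (\<lambda>t. Y t \<omega>) l = fourier_coeff (\<lambda>t. Y t \<omega>) l"
    using sampling_points[OF M Y finite_freqs[of J]] by blast
  define c where "c = \<sigma> * real n powr (-1/2)"
  have "minimax_risk M W Y x0 \<sigma> \<rho> (besov_ball h s p q R) n \<le>
     (SUP f\<in>besov_ball h s p q R. risk M W Y x0 \<sigma> \<rho> n (threshold_estimator h c u thr_const i0 J) f)"
    unfolding minimax_risk_def by (rule INF_lower[OF est_estimator[OF h u]])
  also have "\<dots> \<le> ennreal (2 * (risk_const + 1) * D)"
  proof (rule SUP_least)
    fix f assume f: "f \<in> besov_ball h s p q R"
    have b: "0 \<le> besov_level h f s pm i \<and> besov_level h f s pm i \<le> 2 powr (s + 1/2 - 1/p) * R" for i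
      using bseq_nonneg bseq_mono_p[OF pm(1,3)] bseq_bounds(2)[OF p q R f, of i] by (meson order_trans)
    have bq: "(\<Sum>i\<le>J. besov_level h f s pm i powr q) \<le> (2 powr (s + 1/2 - 1/p) * R) powr q" for J
    proof -
      have "(\<Sum>i\<le>J. besov_level h f s pm i powr q) \<le> (\<Sum>i\<le>J. besov_level h f s p i powr q)"
        using q bseq_nonneg bseq_mono_p[OF pm(1,3)] by (intro sum_mono powr_mono2) auto
      then show ?thesis using bseq_bounds(1)[OF p q R f, of J] by linarith
    qed
    have "risk M W Y x0 \<sigma> \<rho> n (threshold_estimator h c u thr_const i0 J) f \<le>
       ennreal (2 * (risk_const + 1) * ((\<Sum>i\<le>J. signal_bound \<rho> pm s \<nu> (real n) i0 (besov_level h f s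
           pm) i + noise_bound \<nu> (real n) i0 i) + 1 / real n))"
      by (rule estimator_risk[OF n c_def u good f tail])
    also have "\<dots> \<le> ennreal (2 * (risk_const + 1) * D)"
    proof (intro ennreal_leI mult_left_mono)
      show "(\<Sum>i\<le>J. signal_bound \<rho> pm s \<nu> (real n) i0 (besov_level h f s pm) i
          + noise_bound \<nu> (real n) i0 i) + 1 / real n \<le> D"
        using D b bq by blast
    qed (use const_pos in simp)
    finally show "risk M W Y x0 \<sigma> \<rho> n (threshold_estimator h c u thr_const i0 J) f \<le> ennreal (2
        * (risk_const + 1) * D)" .
  qed
  finally show "minimax_risk M W Y x0 \<sigma> \<rho> (besov_ball h s p q R) n \<le> ennreal (2 * (risk_const + 1)
      * D)" .
qed

end

theorem theorem2:
  fixes M :: "'a measure" and W Y :: "real \<Rightarrow> 'a \<Rightarrow> real"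
    and h :: "real \<Rightarrow> real" and x0 \<sigma> \<rho> R p q s \<nu> \<epsilon> :: real
  assumes "prob_space M"
    and "wiener_process M W"
    and "L2_process M Y"
    and "indep_processes M W Y"
    and "\<sigma> > 0"
    and "meyer_aux h"
    and "\<rho> > 1" and "R > 0" and "p > 1" and "q > 1" and "s > 1 / p"
    and "cond_Cup M Y \<nu>"
    and "\<epsilon> = (2 * s + 2 * \<nu> + 1) / \<rho> - (2 * \<nu> + 1) / p"
  shows "\<exists>C0>0. \<forall>n::nat. n \<ge> 2 \<longrightarrow>
    (\<epsilon> > 0 \<longrightarrow>
       minimax_risk M W Y x0 \<sigma> \<rho> (besov_ball h s p q R) n
         \<le> ennreal (C0 * (1 / real n) powr (s / (2 * s + 2 * \<nu> + 1)))) \<and>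
    (\<epsilon> < 0 \<longrightarrow>
       minimax_risk M W Y x0 \<sigma> \<rho> (besov_ball h s p q R) n
         \<le> ennreal (C0 * (ln (real n) / real n)
                powr ((s - 1 / p + 1 / \<rho>) / (2 * s + 2 * \<nu> + 1 - 2 / p)))) \<and>
    (\<epsilon> = 0 \<longrightarrow>
       minimax_risk M W Y x0 \<sigma> \<rho> (besov_ball h s p q R) n
         \<le> ennreal (C0 * (ln (real n) / real n)
                powr ((s - 1 / p + 1 / \<rho>) / (2 * s + 2 * \<nu> + 1 - 2 / p))
              * ln (real n) powr (max (1 - p / (\<rho> * q)) 0)))"
proof -
  note M = assms(1) and Y = assms(3) and h = assms(6) and rho = assms(7) and R = assms(8) and p
      = assms(9)
    and q = assms(10) and s = assms(11) and Cup = assms(12) and eps = assms(13)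
  \<comment> \<open>For p > \<rho> the thresholding bound would contain a negative power of the
    threshold; lowering p to \<rho> makes the level norms only smaller.\<close>
  define pm where "pm = min p \<rho>"
  have pm: "1 < pm" "pm \<le> \<rho>" "pm \<le> p" using rho p by (auto simp: pm_def)
  have nu: "\<nu> \<ge> 0" and Y0: "\<And>l. AE \<omega> in M. fourier_coeff (\<lambda>t. Y t \<omega>) l \<noteq> 0"
    using Cup unfolding cond_Cup_def by auto
  have s0: "s > 0" using s p by (meson less_trans zero_less_divide_1_iff zero_less_one)
  define R1 where "R1 = 2 powr (s + 1/2 - 1/p) * R"
  have R1: "R1 > 0" using R by (simp add: R1_def)
  obtain C where C: "C \<ge> 1" "\<And>i x. (\<Sum>k\<in>widx i. \<bar>wav h i k x\<bar>) \<le> C * 2 powr (real i / 2)"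
    using wav_sum_bound[OF h] by blast
  obtain B1 where B1: "B1 > 0" "\<And>i. (\<integral>\<^sup>+\<omega>. ennreal (U_filter (\<lambda>t. Y t \<omega>) i powr (\<rho>/2)) \<partial>M)
      \<le> ennreal (B1 * 2 powr (2 * \<nu> * (\<rho>/2) * real i))"
    using U_filter_moment[OF M Y Cup, of "\<rho>/2"] rho by auto
  obtain B2 where B2: "B2 > 0" "\<And>i. (\<integral>\<^sup>+\<omega>. ennreal (U_filter (\<lambda>t. Y t \<omega>) i powr ((\<rho> - pm)/2)) \<partial>M)
      \<le> ennreal (B2 * 2 powr (2 * \<nu> * ((\<rho> - pm)/2) * real i))"
    using U_filter_moment[OF M Y Cup, of "(\<rho> - pm)/2"] pm by auto
  obtain K where K: "K > 0" and mm: "\<And>n i0 D. n \<ge> 1 \<Longrightarrow> (\<And>b J. (\<forall>i. 0 \<le> b i \<and> b i \<le> R1) \<Longrightarrow>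
     (\<forall>J. (\<Sum>i\<le>J. b i powr q) \<le> R1 powr q) \<Longrightarrow>
     (\<Sum>i\<le>J. signal_bound \<rho> pm s \<nu> (real n) i0 b i + noise_bound \<nu> (real n) i0 i) + 1 / real n \<le> D) \<Longrightarrow>
     minimax_risk M W Y x0 \<sigma> \<rho> (besov_ball h s p q R) n \<le> ennreal (K * D)"
    using minimax_bound[OF assms(1-5) h rho R p q s nu Y0 pm C B1 B2, of x0] unfolding R1_def by blast
  \<comment> \<open>The decay exponent per level in the thresholding bound. It has the sign of
    \<epsilon>: for p \<le> \<rho> by \<open>g_p\<close>, and for p > \<rho> both are
    positive.\<close>
  define g where "g = pm/\<rho> * (s + \<nu> + 1/2) - (\<nu> + 1/2)"
  have g_p: "g = p/2 * \<epsilon>" if "p \<le> \<rho>"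
    using that p rho by (simp add: g_def pm_def eps field_simps)
  have big: "\<epsilon> > 0" if "p \<ge> \<rho>"
  proof -
    have "(2 * \<nu> + 1) / p < (2 * s + 2 * \<nu> + 1) / p" using s0 p by (simp add: divide_strict_right_mono)
    also have "\<dots> \<le> (2 * s + 2 * \<nu> + 1) / \<rho>" using that rho s0 nu by (intro divide_left_mono) auto
    finally show ?thesis by (simp add: eps)
  qed
  show ?thesis
  proof (cases "\<epsilon> > 0")
    case True
    have "g > 0"
    proof (cases "p \<le> \<rho>")
      case True
      then show ?thesis unfolding g_p[OF True] using \<open>\<epsilon> > 0\<close> p by (intro mult_pos_pos) auto
    next
      case False
      then show ?thesis using s0 rho by (simp add: g_def pm_def)
    qed
    then obtain C1 where C1: "C1 > 0" "\<And>n. n \<ge> 1 \<Longrightarrow> \<exists>i0. \<forall>b J. (\<forall>i. 0 \<le> b i \<and> b i \<le> R1) \<longrightarrow>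
      (\<Sum>i\<le>J. signal_bound \<rho> pm s \<nu> (real n) i0 b i + noise_bound \<nu> (real n) i0 i) + 1 / real n \<le> C1
          * (1 / real n) powr (s / (2 * s + 2 * \<nu> + 1))"
      using regular_sum[OF rho pm(1,2) s0 nu R1] unfolding g_def by blast
    show ?thesis
    proof (intro exI[of _ "K * C1"] conjI allI impI)
      fix n :: nat assume "n \<ge> 2"
      then have n: "n \<ge> 1" by simp
      obtain i0 where i0: "\<And>b J. (\<forall>i. 0 \<le> b i \<and> b i \<le> R1) \<Longrightarrow>
        (\<Sum>i\<le>J. signal_bound \<rho> pm s \<nu> (real n) i0 b i + noise_bound \<nu> (real n) i0 i) + 1 / real n
            \<le> C1 * (1 / real n) powr (s / (2 * s + 2 * \<nu> + 1))"
        using C1(2)[OF n] by blast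
      show "minimax_risk M W Y x0 \<sigma> \<rho> (besov_ball h s p q R) n \<le> ennreal (K * C1
          * (1 / real n) powr (s / (2 * s + 2 * \<nu> + 1)))"
        using mm[OF n, of i0 "C1 * (1 / real n) powr (s / (2 * s + 2 * \<nu> + 1))"] i0
            by (simp add: mult.assoc)
    qed (use True K C1 in auto)
  next
    case False
    then have lt: "p < \<rho>" using big by force
    then have pmp: "pm = p" by (simp add: pm_def)
    have g0: "g = 0 \<longleftrightarrow> \<epsilon> = 0" "g \<le> 0" using g_p lt p False mult_nonneg_nonpos[of "p/2" \<epsilon>] by auto
    \<comment> \<open>The sparse and the critical case in one expression, in the form delivered by
      \<open>sparse_sum\<close>.\<close>
    define rate where "rate n = (ln (real n) / real n) powr ((s - 1 / p + 1 / \<rho>) / (2 * s + 2 * \<nu>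
        + 1 - 2 / p)) *
      (if g = 0 then ln (real n) powr (max (1 - p / (\<rho> * q)) 0) else 1)" for n
    obtain C1 where C1: "C1 > 0" "\<And>n b J. n \<ge> 2 \<Longrightarrow> (\<forall>i. 0 \<le> b i \<and> b i \<le> R1) \<Longrightarrow> (\<forall>J. (\<Sum>i\<le>J. b i powr q)
        \<le> R1 powr q) \<Longrightarrow>
      (\<Sum>i\<le>J. signal_bound \<rho> p s \<nu> (real n) 0 b i + noise_bound \<nu> (real n) 0 i) + 1 / real n \<le> C1
          * rate n"
      using sparse_sum[OF rho p lt s nu R1 q] g0(2) unfolding g_def pmp rate_def by blast
    have main: "minimax_risk M W Y x0 \<sigma> \<rho> (besov_ball h s p q R) n \<le> ennreal (K * (C1 * rate n))"
        if "n \<ge> 2" for n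
      using that C1(2)[OF that] by (intro mm[of n 0]) (auto simp: pmp)
    show ?thesis
    proof (intro exI[of _ "K * C1"] conjI allI impI)
      fix n :: nat assume n: "n \<ge> 2"
      show "minimax_risk M W Y x0 \<sigma> \<rho> (besov_ball h s p q R) n
         \<le> ennreal (K * C1 * (ln (real n) / real n) powr ((s - 1 / p + 1 / \<rho>) / (2 * s + 2 * \<nu>
             + 1 - 2 / p)))" if "\<epsilon> < 0"
        using main[OF n] that g0(1) by (simp add: rate_def mult.assoc)
      show "minimax_risk M W Y x0 \<sigma> \<rho> (besov_ball h s p q R) n
         \<le> ennreal (K * C1 * (ln (real n) / real n) powr ((s - 1 / p + 1 / \<rho>) / (2 * s + 2 * \<nu>
             + 1 - 2 / p))
              * ln (real n) powr (max (1 - p / (\<rho> * q)) 0))" if "\<epsilon> = 0"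
        using main[OF n] that g0(1) by (simp add: rate_def mult.assoc)
    qed (use False K C1 in auto)
  qed
qed

end
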